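(* Let $p\in(1,+\infty)$ and let $\{w^\varepsilon\}$ with $w^\varepsilon\in L^p(\Gamma^\varepsilon)$ satisfy $\varepsilon\|w^\varepsilon\|^p_{L^p(\Gamma^\varepsilon)}\le C$ with $C$ independent of $\varepsilon$. Then there exist a subsequence (denoted again by $\{w^\varepsilon\}$) and $w\in L^p(\Omega;L^p(\Gamma_x))$ such that $w^\varepsilon\to w$ locally periodic two-scale (l-t-s) on $\Gamma^\varepsilon$ as $\varepsilon\to0$.
   Context: Setting. $\Omega\subset\mathbb R^d$ is a bounded Lipschitz domain, $Y=(0,1)^d$. $D:\mathbb R^d\to\mathbb R^{d\times d}$ takes invertible matrix values, $D,D^{-1}\in\mathrm{Lip}(\mathbb R^d;\mathbb R^{d\times d})$, and $0<D_1\le|\det D(x)|\le D_2<\infty$ for all $x\in\overline\Omega$. Write $D_x=D(x)$, $D_x^{-1}=D^{-1}(x)$ (inverse matrix), $Y_x=D_xY$. Fix $0<r<1$. For every $\varepsilon>0$, $\{\Omega^\varepsilon_n\}_{1\le n\le N_\varepsilon}$ is a family of open pairwise disjoint cubes of side $\varepsilon^r$ with $\Omega\subset\bigcup_{n}\overline{\Omega^\varepsilon_n}$ and $\Omega^\varepsilon_n\cap\Omega\ne\emptyset$; $x_n^\varepsilon\in\Omega_n^\varepsilon\cap\Omega$ are arbitrary fixed points. $\Xi_n^\varepsilon=\{\xi\in\mathbb Z^d:\varepsilon D_{x_n^\varepsilon}(Y+\xi)\cap\Omega_n^\varepsilon\neq\emptyset\}$, $\Xi_n^{\ast,\varepsilon}=\{\xi\in\Xi_n^\varepsilon:\varepsilon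 D_{x_n^\varepsilon}(Y+\xi)\subset\Omega_n^\varepsilon\}$. Perforations: $Y_0\subset Y$ has Lipschitz boundary $\Gamma=\partial Y_0$; $K:\mathbb R^d\to\mathbb R^{d\times d}$ satisfies $K,K^{-1}\in\mathrm{Lip}(\mathbb R^d;\mathbb R^{d\times d})$, $0<K_1\le|\det K(x)|\le K_2<\infty$, $K_xY_0\subset Y$ (with $K_x=K(x)$), and $Y\setminus\overline{Y_0}$, $Y\setminus K_x\overline{Y_0}$ are connected, for all $x\in\overline\Omega$. $\Gamma_x=D_xK_x\Gamma$, and $$\Gamma^\varepsilon=\bigcup_{n=1}^{N_\varepsilon}\Gamma_n^\varepsilon,\qquad\Gamma_n^\varepsilon=\bigcup_{\xi\in\Xi_n^{\ast,\varepsilon}}\varepsilon D_{x_n^\varepsilon}(K_{x_n^\varepsilon}\Gamma+\xi)\cap\Omega.$$ Spaces and l-p approximation: $\psi\in C(\overline\Omega;C_{\rm per}(Y_x))$ means $\psi(x,y)=\widetilde\psi(x,D_x^{-1}y)$ with $\widetilde\psi\in C(\overline\Omega;C_{\rm per}(Y))$, and then $$(\mathcal L^\varepsilon\psi)(x)=\sum_{n=1}^{N_\varepsilon}\widetilde\psi\big(x,D^{-1}_{x_n^\varepsilon}x/\varepsilon\big)\chi_{\Omega_n^\varepsilon}(x).$$ $w\in L^p(\Omega;L^p(\Gamma_x))$ means that $(x,y)\mapsto w(x,D_xK_xy)$ belongs to $L^p(\Omega;L^p(\Gamma))$. l-t-s convergence on $\Gamma^\varepsilon$: a sequence $u^\varepsilon\in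 L^p(\Gamma^\varepsilon)$ converges l-t-s to $u\in L^p(\Omega;L^p(\Gamma_x))$ if $\varepsilon\|u^\varepsilon\|^p_{L^p(\Gamma^\varepsilon)}\le C$ and for every $\psi\in C(\overline\Omega;C_{\rm per}(Y_x))$ $$\lim_{\varepsilon\to0}\varepsilon\int_{\Gamma^\varepsilon}u^\varepsilon(x)\,\mathcal L^\varepsilon\psi(x)\,d\sigma_x=\int_\Omega\frac1{|Y_x|}\int_{\Gamma_x}u(x,y)\psi(x,y)\,d\sigma_y\,dx.$$ *)

theory Defs
  imports "HOL-Analysis.Analysis"
begin

section \<open>Hausdorff measure and surface measure\<close>

text \<open>
  Normalised so that the measure of dimension \<open>s = DIM('a) - 1\<close> is the usual surface
  measure on Lipschitz hypersurfaces. The exponent is a natural number, hence \<open>0 ^ 0 = 1\<close>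
  and \<open>s = 0\<close> gives the counting measure; the empty set has to be treated separately.
\<close>

definition hausdorff_gauge :: "nat \<Rightarrow> 'a::metric_space set \<Rightarrow> ennreal" where
  "hausdorff_gauge s U =
     (if U = {} then 0 else ennreal (unit_ball_vol (real s) * (diameter U / 2) ^ s))"

definition hausdorff_pre :: "nat \<Rightarrow> real \<Rightarrow> 'a::metric_space set \<Rightarrow> ennreal" where
  "hausdorff_pre s \<delta> A =
     (INF C \<in> {C :: nat \<Rightarrow> 'a set. A \<subseteq> (\<Union>i. C i) \<and> (\<forall>i. bounded (C i) \<and> diameter (C i) \<le> \<delta>)}.
        (\<Sum>i. hausdorff_gauge s (C i)))"

definition hausdorff_outer :: "nat \<Rightarrow> 'a::metric_space set \<Rightarrow> ennreal" where
  "hausdorff_outer s A = (SUP \<delta> \<in> {0<..}. hausdorff_pre s \<delta> A)"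

text \<open>Its sets are the Caratheodory measurable sets of the outer measure.\<close>

definition hausdorff_measure :: "nat \<Rightarrow> 'a::metric_space measure" where
  "hausdorff_measure s =
     measure_of UNIV (lambda_system UNIV UNIV (hausdorff_outer s)) (hausdorff_outer s)"

definition surface_measure :: "'a::euclidean_space set \<Rightarrow> 'a measure" where
  "surface_measure S = restrict_space (hausdorff_measure (DIM('a) - 1)) S"


section \<open>Lebesgue and Bochner spaces\<close>

text \<open>Elements are functions, not classes of functions that agree almost everywhere.\<close>

definition Lp_space :: "real \<Rightarrow> 'a measure \<Rightarrow> ('a \<Rightarrow> real) set" where
  "Lp_space p M = {f \<in> borel_measurable M. integrable M (\<lambda>x. \<bar>f x\<bar> powr p)}"

definition Lp_norm :: "real \<Rightarrow> 'a measure \<Rightarrow> ('a \<Rightarrow> real) \<Rightarrow> real" where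
  "Lp_norm p M f = (\<integral>x. \<bar>f x\<bar> powr p \<partial>M) powr (1 / p)"

text \<open>
  The Bochner space of strongly measurable functions on \<open>M\<close> with values in the \<open>p\<close>-integrable
  functions on \<open>N\<close>: a.e. limits, in the norm of the target space, of simple functions.
\<close>

definition Bochner_Lp :: "real \<Rightarrow> 'a measure \<Rightarrow> 'b measure \<Rightarrow> ('a \<Rightarrow> 'b \<Rightarrow> real) set" where
  "Bochner_Lp p M N = {f.
     (\<forall>x \<in> space M. f x \<in> Lp_space p N) \<and>
     (\<exists>s. (\<forall>k::nat. simple_function M (s k) \<and> (\<forall>x \<in> space M. s k x \<in> Lp_space p N)) \<and>
          (AE x in M. (\<lambda>k. Lp_norm p N (\<lambda>y. s k x y - f x y)) \<longlonglongrightarrow> 0)) \<and>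
     (\<lambda>x. Lp_norm p N (f x)) \<in> Lp_space p M}"


section \<open>Geometry\<close>

text \<open>
  Near each boundary point, and after the choice of a unit vector \<open>e\<close> as vertical direction,
  \<open>S\<close> lies above the graph of a Lipschitz function of the component orthogonal to \<open>e\<close>.
  The two inclusions leave open which points of the graph belong to \<open>S\<close>; if \<open>S\<close> is open, the
  first one is an equality.
\<close>

definition lipschitz_boundary :: "'a::euclidean_space set \<Rightarrow> bool" where
  "lipschitz_boundary S \<longleftrightarrow>
     (\<forall>z \<in> frontier S. \<exists>\<rho> > 0. \<exists>e \<gamma> L. norm e = 1 \<and> L-lipschitz_on {y. y \<bullet> e = 0} (\<gamma> :: 'a \<Rightarrow> real) \<and>
        {y \<in> ball z \<rho>. \<gamma> (y - (y \<bullet> e) *\<^sub>R e) < y \<bullet> e} \<subseteq> S \<inter> ball z \<rho> \<and>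
        S \<inter> ball z \<rho> \<subseteq> {y \<in> ball z \<rho>. \<gamma> (y - (y \<bullet> e) *\<^sub>R e) \<le> y \<bullet> e})"

definition bounded_lipschitz_domain :: "'a::euclidean_space set \<Rightarrow> bool" where
  "bounded_lipschitz_domain S \<longleftrightarrow>
     S \<noteq> {} \<and> open S \<and> connected S \<and> bounded S \<and> lipschitz_boundary S"

text \<open>Cubes need not be parallel to the axes.\<close>

definition open_cube :: "real \<Rightarrow> (real ^ 'n) set \<Rightarrow> bool" where
  "open_cube s Q \<longleftrightarrow>
     (\<exists>a T. orthogonal_transformation T \<and>
        Q = (\<lambda>y. a + T y) ` {y :: real ^ 'n. \<forall>i. 0 < y $ i \<and> y $ i < s})"

definition unit_cell :: "(real ^ 'n) set" where
  "unit_cell = {y. \<forall>i. 0 < y $ i \<and> y $ i < 1}"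

definition int_lattice :: "(real ^ 'n) set" where
  "int_lattice = {\<xi>. \<forall>i. \<xi> $ i \<in> \<int>}"

definition inverse_lipschitz_pair :: "(real ^ 'n \<Rightarrow> real ^ 'n ^ 'n) \<Rightarrow> bool" where
  "inverse_lipschitz_pair A \<longleftrightarrow>
     (\<forall>x. invertible (A x)) \<and>
     (\<exists>L. L-lipschitz_on UNIV A) \<and> (\<exists>L. L-lipschitz_on UNIV (\<lambda>x. matrix_inv (A x)))"

text \<open>\<open>\<epsilon> A (S + \<xi>)\<close>\<close>

definition scaled_cell ::
  "real \<Rightarrow> real ^ 'n ^ 'n \<Rightarrow> real ^ 'n \<Rightarrow> (real ^ 'n) set \<Rightarrow> (real ^ 'n) set" where
  "scaled_cell \<epsilon> A \<xi> S = (\<lambda>y. \<epsilon> *\<^sub>R (A *v (y + \<xi>))) ` S"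

definition Xi :: "real \<Rightarrow> real ^ 'n ^ 'n \<Rightarrow> (real ^ 'n) set \<Rightarrow> (real ^ 'n) set" where
  "Xi \<epsilon> A Q = {\<xi> \<in> int_lattice. scaled_cell \<epsilon> A \<xi> unit_cell \<inter> Q \<noteq> {}}"

definition Xi_star :: "real \<Rightarrow> real ^ 'n ^ 'n \<Rightarrow> (real ^ 'n) set \<Rightarrow> (real ^ 'n) set" where
  "Xi_star \<epsilon> A Q = {\<xi> \<in> Xi \<epsilon> A Q. scaled_cell \<epsilon> A \<xi> unit_cell \<subseteq> Q}"

text \<open>
  A partition family assigns to each \<open>\<epsilon> > 0\<close> the cubes \<open>Q \<epsilon> n\<close> and the points \<open>xs \<epsilon> n\<close>,
  \<open>1 \<le> n \<le> N \<epsilon>\<close>.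
\<close>

definition cube_partition ::
  "(real ^ 'n) set \<Rightarrow> real \<Rightarrow> (real \<Rightarrow> nat) \<Rightarrow> (real \<Rightarrow> nat \<Rightarrow> (real ^ 'n) set) \<Rightarrow>
   (real \<Rightarrow> nat \<Rightarrow> real ^ 'n) \<Rightarrow> bool" where
  "cube_partition \<Omega> r N Q xs \<longleftrightarrow>
     (\<forall>\<epsilon> > 0.
        (\<forall>n \<in> {1..N \<epsilon>}. open_cube (\<epsilon> powr r) (Q \<epsilon> n)) \<and>
        disjoint_family_on (Q \<epsilon>) {1..N \<epsilon>} \<and>
        \<Omega> \<subseteq> (\<Union>n \<in> {1..N \<epsilon>}. closure (Q \<epsilon> n)) \<and>
        (\<forall>n \<in> {1..N \<epsilon>}. Q \<epsilon> n \<inter> \<Omega> \<noteq> {}) \<and>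
        (\<forall>n \<in> {1..N \<epsilon>}. xs \<epsilon> n \<in> Q \<epsilon> n \<inter> \<Omega>))"

definition Gamma_eps ::
  "(real ^ 'n) set \<Rightarrow> (real ^ 'n \<Rightarrow> real ^ 'n ^ 'n) \<Rightarrow> (real ^ 'n \<Rightarrow> real ^ 'n ^ 'n) \<Rightarrow>
   (real ^ 'n) set \<Rightarrow> (real \<Rightarrow> nat) \<Rightarrow> (real \<Rightarrow> nat \<Rightarrow> (real ^ 'n) set) \<Rightarrow>
   (real \<Rightarrow> nat \<Rightarrow> real ^ 'n) \<Rightarrow> real \<Rightarrow> (real ^ 'n) set" where
  "Gamma_eps \<Omega> D K \<Gamma> N Q xs \<epsilon> =
     (\<Union>n \<in> {1..N \<epsilon>}. \<Union>\<xi> \<in> Xi_star \<epsilon> (D (xs \<epsilon> n)) (Q \<epsilon> n).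
        scaled_cell \<epsilon> (D (xs \<epsilon> n)) \<xi> ((*v) (K (xs \<epsilon> n)) ` \<Gamma>) \<inter> \<Omega>)"


section \<open>Locally periodic two-scale convergence\<close>

definition C_per :: "((real ^ 'n) \<Rightarrow>\<^sub>C real) set" where
  "C_per = {g. \<forall>y. \<forall>\<xi> \<in> int_lattice. apply_bcontfun g (y + \<xi>) = apply_bcontfun g y}"

text \<open>
  Continuous maps from the closure of \<open>\<Omega>\<close> to the periodic functions with the supremum norm.
  A member \<open>\<psi>\<close> is the function written with a tilde in the literature; it determines and is
  determined by the locally periodic function \<open>locally_periodic D \<psi>\<close>.
\<close>

definition C_C_per :: "(real ^ 'n) set \<Rightarrow> (real ^ 'n \<Rightarrow> ((real ^ 'n) \<Rightarrow>\<^sub>C real)) set" where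
  "C_C_per \<Omega> = {\<psi>. continuous_on (closure \<Omega>) \<psi> \<and> (\<forall>x \<in> closure \<Omega>. \<psi> x \<in> C_per)}"

definition locally_periodic ::
  "(real ^ 'n \<Rightarrow> real ^ 'n ^ 'n) \<Rightarrow> (real ^ 'n \<Rightarrow> ((real ^ 'n) \<Rightarrow>\<^sub>C real)) \<Rightarrow>
   real ^ 'n \<Rightarrow> real ^ 'n \<Rightarrow> real" where
  "locally_periodic D \<psi> x y = apply_bcontfun (\<psi> x) (matrix_inv (D x) *v y)"

definition lp_approx ::
  "(real ^ 'n \<Rightarrow> real ^ 'n ^ 'n) \<Rightarrow> (real \<Rightarrow> nat) \<Rightarrow> (real \<Rightarrow> nat \<Rightarrow> (real ^ 'n) set) \<Rightarrow>
   (real \<Rightarrow> nat \<Rightarrow> real ^ 'n) \<Rightarrow> real \<Rightarrow> (real ^ 'n \<Rightarrow> ((real ^ 'n) \<Rightarrow>\<^sub>C real)) \<Rightarrow>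
   real ^ 'n \<Rightarrow> real" where
  "lp_approx D N Q xs \<epsilon> \<psi> x =
     (\<Sum>n \<in> {1..N \<epsilon>}.
        apply_bcontfun (\<psi> x) (matrix_inv (D (xs \<epsilon> n)) *v (x /\<^sub>R \<epsilon>)) * indicator (Q \<epsilon> n) x)"

definition Gamma_at ::
  "(real ^ 'n \<Rightarrow> real ^ 'n ^ 'n) \<Rightarrow> (real ^ 'n \<Rightarrow> real ^ 'n ^ 'n) \<Rightarrow>
   (real ^ 'n) set \<Rightarrow> real ^ 'n \<Rightarrow> (real ^ 'n) set" where
  "Gamma_at D K \<Gamma> x = (\<lambda>y. D x *v (K x *v y)) ` \<Gamma>"

definition Lp_Gamma_x ::
  "real \<Rightarrow> (real ^ 'n) set \<Rightarrow> (real ^ 'n \<Rightarrow> real ^ 'n ^ 'n) \<Rightarrow> (real ^ 'n \<Rightarrow> real ^ 'n ^ 'n) \<Rightarrow>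
   (real ^ 'n) set \<Rightarrow> (real ^ 'n \<Rightarrow> real ^ 'n \<Rightarrow> real) set" where
  "Lp_Gamma_x p \<Omega> D K \<Gamma> =
     {w. (\<lambda>x y. w x (D x *v (K x *v y))) \<in> Bochner_Lp p (lebesgue_on \<Omega>) (surface_measure \<Gamma>)}"

definition lts_converges ::
  "real \<Rightarrow> (real ^ 'n) set \<Rightarrow> (real ^ 'n \<Rightarrow> real ^ 'n ^ 'n) \<Rightarrow> (real ^ 'n \<Rightarrow> real ^ 'n ^ 'n) \<Rightarrow>
   (real ^ 'n) set \<Rightarrow> (real \<Rightarrow> nat) \<Rightarrow> (real \<Rightarrow> nat \<Rightarrow> (real ^ 'n) set) \<Rightarrow>
   (real \<Rightarrow> nat \<Rightarrow> real ^ 'n) \<Rightarrow> (nat \<Rightarrow> real) \<Rightarrow> (nat \<Rightarrow> real ^ 'n \<Rightarrow> real) \<Rightarrow>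
   (real ^ 'n \<Rightarrow> real ^ 'n \<Rightarrow> real) \<Rightarrow> bool" where
  "lts_converges p \<Omega> D K \<Gamma> N Q xs \<epsilon> u u0 \<longleftrightarrow>
     (\<forall>k. u k \<in> Lp_space p (surface_measure (Gamma_eps \<Omega> D K \<Gamma> N Q xs (\<epsilon> k)))) \<and>
     u0 \<in> Lp_Gamma_x p \<Omega> D K \<Gamma> \<and>
     (\<exists>C. \<forall>k. \<epsilon> k * Lp_norm p (surface_measure (Gamma_eps \<Omega> D K \<Gamma> N Q xs (\<epsilon> k))) (u k) powr p \<le> C) \<and>
     (\<forall>\<psi> \<in> C_C_per \<Omega>.
        (\<lambda>k. \<epsilon> k * (\<integral>x. u k x * lp_approx D N Q xs (\<epsilon> k) \<psi> x
                       \<partial>surface_measure (Gamma_eps \<Omega> D K \<Gamma> N Q xs (\<epsilon> k))))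
        \<longlonglongrightarrow>
        (\<integral>x. 1 / measure lebesgue ((*v) (D x) ` unit_cell) *
               (\<integral>y. u0 x y * locally_periodic D \<psi> x y \<partial>surface_measure (Gamma_at D K \<Gamma> x))
           \<partial>lebesgue_on \<Omega>))"

end

theory Submission
  imports Defs "HOL-Probability.Probability" "HOL-Complex_Analysis.Great_Picard"
begin

text \<open>
  The functionals \<open>\<psi> \<mapsto> \<epsilon> \<integral> w\<^sup>\<epsilon> \<L>\<^sup>\<epsilon>\<psi> d\<sigma>\<close> on \<open>\<Gamma>\<^sup>\<epsilon>\<close> are, by Young's inequality and a bound for
  \<open>\<epsilon> \<integral> \<bar>\<L>\<^sup>\<epsilon>\<psi>\<bar> powr q d\<sigma>\<close>, equicontinuous on the separable space of test functions, so a
  subsequence converges pointwise to a functional that is bounded by an affine function of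
  \<open>\<integral> \<bar>\<psi>\<bar> powr q d\<nu>\<close>. Here \<open>\<nu>\<close> is the measure \<open>d\<sigma>\<^sub>x dx / \<bar>Y\<^sub>x\<bar>\<close>, transported to \<open>\<Omega> \<times> \<Gamma>\<close>. Such a
  functional is the integral against a \<open>p\<close>-integrable density with respect to \<open>\<nu>\<close>, which is
  the limit. The test functions need not be dense in the \<open>q\<close>-integrable functions, since
  \<open>\<Gamma>\<close> may contain points that are identified by periodicity; the density is found by
  minimising a strictly convex functional.
\<close>


section \<open>Hausdorff measure\<close>

text \<open>Multiplicative constants may be lost in the bound for the oscillating surface integrals,
  because it only has to make the limit functional bounded. A cell carries surface of order
  \<open>\<epsilon> ^ s\<close> and volume of order \<open>\<epsilon> ^ CARD('n)\<close> with
  \<open>CARD('n) = s + 1\<close>, so the prefactor \<open>\<epsilon>\<close> is exactly what turns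
  a sum over cells into a Riemann sum over the cubes. Young's inequality leaves an affine bound,
  which suffices: \<open>A * I f - a\<close> is coercive once \<open>A\<close> exceeds the
  coefficient of the integral. Two measure-theoretic obstacles shape the rest. The Caratheodory sets
  of moving surfaces give no common sigma-algebra over which a kernel in \<open>x\<close> could be
  formed, so surface measures are moved to the Borel sets. And the spaces consist of functions: the
  density is known only almost everywhere with respect to \<open>\<nu>\<close>, while
  \<open>Lp_Gamma_x\<close> asks every section to be \<open>p\<close>-integrable over
  \<open>\<Gamma>\<close>. It is therefore corrected on a null set of points \<open>x\<close>, after
  \<open>\<nu>\<close> has been compared with the product of Lebesgue measure and the fixed surface
  measure of \<open>\<Gamma>\<close>.\<close>

lemma hausdorff_pre_antimono: "\<delta> \<le> \<delta>' \<Longrightarrow> hausdorff_pre s \<delta>' A \<le> hausdorff_pre s \<delta> A"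
  unfolding hausdorff_pre_def by (rule INF_superset_mono) (auto intro: order_trans)

lemma hausdorff_pre_mono: "A \<subseteq> B \<Longrightarrow> hausdorff_pre s \<delta> A \<le> hausdorff_pre s \<delta> B"
  unfolding hausdorff_pre_def by (rule INF_superset_mono) auto

lemma hausdorff_pre_le:
  assumes "A \<subseteq> (\<Union>i. C i)" "\<And>i::nat. bounded (C i)" "\<And>i. diameter (C i) \<le> \<delta>"
  shows "hausdorff_pre s \<delta> A \<le> (\<Sum>i. hausdorff_gauge s (C i))"
  unfolding hausdorff_pre_def by (rule INF_lower) (use assms in auto)

lemma hausdorff_pre_close:
  assumes "hausdorff_pre s \<delta> A < e"
  obtains C :: "nat \<Rightarrow> 'a::metric_space set" where "A \<subseteq> (\<Union>i. C i)" "\<And>i. bounded (C i)" "\<And>i. diameter (C i) \<le> \<delta>"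
    "(\<Sum>i. hausdorff_gauge s (C i)) < e"
  using assms unfolding hausdorff_pre_def INF_less_iff by auto

lemma hausdorff_pre_le_outer: "0 < \<delta> \<Longrightarrow> hausdorff_pre s \<delta> A \<le> hausdorff_outer s A"
  unfolding hausdorff_outer_def by (rule SUP_upper) simp

lemma hausdorff_outer_least:
  "(\<And>\<delta>. 0 < \<delta> \<Longrightarrow> hausdorff_pre s \<delta> A \<le> x) \<Longrightarrow> hausdorff_outer s A \<le> x"
  unfolding hausdorff_outer_def by (rule SUP_least) simp

lemma hausdorff_outer_mono: "A \<subseteq> B \<Longrightarrow> hausdorff_outer s A \<le> hausdorff_outer s B"
  unfolding hausdorff_outer_def by (intro SUP_mono) (auto intro: hausdorff_pre_mono)

lemma hausdorff_outer_empty [simp]: "hausdorff_outer s {} = 0"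
proof -
  have "hausdorff_pre s \<delta> ({}::'a set) \<le> 0" if "\<delta> > 0" for \<delta>
    using hausdorff_pre_le[of "{}" "\<lambda>i. {}::'a set" \<delta> s] that by (simp add: hausdorff_gauge_def)
  then show ?thesis
    using hausdorff_outer_least[of s "{}::'a set" 0] by simp
qed

text \<open>Covers of the sets \<open>A n\<close> that are optimal up to
  \<open>e / 2 ^ (n + 1)\<close> are merged into one sequence along \<open>prod_decode\<close>; the
  errors add up to \<open>e\<close>.\<close>

lemma hausdorff_pre_subadditive:
  fixes A :: "nat \<Rightarrow> 'a::metric_space set"
  shows "hausdorff_pre s \<delta> (\<Union>i. A i) \<le> (\<Sum>i. hausdorff_pre s \<delta> (A i))"
proof (rule ennreal_le_epsilon)
  let ?P = "hausdorff_pre s \<delta>"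
  fix e :: real assume "0 < e" "(\<Sum>n. ?P (A n)) < top"
  then have *: "\<And>n. ?P (A n) < ?P (A n) + e * (1/2)^Suc n"
    by (auto simp add: less_top dest!: ennreal_suminf_lessD)
  have "\<forall>n. \<exists>C. A n \<subseteq> (\<Union>i::nat. C i) \<and> (\<forall>i. bounded (C i) \<and> diameter (C i) \<le> \<delta>) \<and>
      (\<Sum>i. hausdorff_gauge s (C i)) \<le> ?P (A n) + e * (1/2)^Suc n"
  proof
    fix n
    obtain C where "A n \<subseteq> (\<Union>i::nat. C i)" "\<And>i. bounded (C i)" "\<And>i. diameter (C i) \<le> \<delta>"
      "(\<Sum>i. hausdorff_gauge s (C i)) < ?P (A n) + e * (1/2)^Suc n"
      using hausdorff_pre_close[OF *[of n]] by blast
    then show "\<exists>C. A n \<subseteq> (\<Union>i::nat. C i) \<and> (\<forall>i. bounded (C i) \<and> diameter (C i) \<le> \<delta>) \<and>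
      (\<Sum>i. hausdorff_gauge s (C i)) \<le> ?P (A n) + e * (1/2)^Suc n"
      by (intro exI[of _ C]) auto
  qed
  then obtain B where B: "\<And>n. A n \<subseteq> (\<Union>i::nat. B n i)" "\<And>n i. bounded (B n i)"
      "\<And>n i. diameter (B n i) \<le> \<delta>"
      "\<And>n. (\<Sum>i. hausdorff_gauge s (B n i)) \<le> ?P (A n) + e * (1/2)^Suc n"
    by metis
  define C where "C = case_prod B o prod_decode"
  have "(\<Union>i. A i) \<subseteq> (\<Union>i. C i)"
    using B(1) by (auto simp add: C_def subset_eq) (metis prod.case prod_encode_inverse)
  then have "?P (\<Union>i. A i) \<le> (\<Sum>i. hausdorff_gauge s (C i))"
    by (rule hausdorff_pre_le) (auto simp: C_def split_def B)
  also have "\<dots> = (\<Sum>n. \<Sum>i. hausdorff_gauge s (B n i))"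
    unfolding C_def comp_def
    using suminf_ennreal_2dimen[of "\<lambda>n. \<Sum>i. hausdorff_gauge s (B n i)" "\<lambda>(n,i). hausdorff_gauge s (B n i)"]
    by (simp add: split_def)
  also have "\<dots> \<le> (\<Sum>n. ?P (A n) + e * (1/2) ^ Suc n)"
    by (intro suminf_le suminf_nonneg allI B) auto
  also have "... = (\<Sum>n. ?P (A n)) + (\<Sum>n. ennreal e * ennreal ((1/2) ^ Suc n))"
    using \<open>0 < e\<close> by (subst suminf_add[symmetric])
                     (auto simp del: ennreal_suminf_cmult simp add: ennreal_mult[symmetric])
  also have "\<dots> = (\<Sum>n. ?P (A n)) + e"
    unfolding ennreal_suminf_cmult
    by (subst suminf_ennreal_eq[OF zero_le_power power_half_series]) auto
  finally show "?P (\<Union>i. A i) \<le> (\<Sum>n. ?P (A n)) + e" .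
qed

lemma hausdorff_outer_subadditive:
  "hausdorff_outer s (\<Union>i::nat. A i) \<le> (\<Sum>i. hausdorff_outer s (A i))"
  by (rule hausdorff_outer_least, rule order_trans[OF hausdorff_pre_subadditive])
     (intro suminf_le hausdorff_pre_le_outer, auto)

lemma hausdorff_outer_Un: "hausdorff_outer s (A \<union> B) \<le> hausdorff_outer s A + hausdorff_outer s B"
proof -
  let ?A = "\<lambda>i::nat. if i = 0 then A else if i = 1 then B else {}"
  have "A \<union> B = (\<Union>i. ?A i)"
    by (auto split: if_splits)
  then have "hausdorff_outer s (A \<union> B) \<le> (\<Sum>i. hausdorff_outer s (?A i))"
    using hausdorff_outer_subadditive by metis
  also have "\<dots> = (\<Sum>i\<in>{0,1}. hausdorff_outer s (?A i))"
    by (rule suminf_finite) auto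
  finally show ?thesis by simp
qed

lemma outer_measure_space_hausdorff: "outer_measure_space UNIV (hausdorff_outer s)"
  unfolding outer_measure_space_def positive_def increasing_def countably_subadditive_def
  by (auto intro: hausdorff_outer_mono hausdorff_outer_subadditive)

lemma measure_space_hausdorff:
  "measure_space UNIV (lambda_system UNIV UNIV (hausdorff_outer s)) (hausdorff_outer s)"
proof -
  interpret sigma_algebra "UNIV::'a set" UNIV
    by (metis Pow_UNIV sigma_algebra_Pow)
  show ?thesis
    by (rule caratheodory_lemma[OF outer_measure_space_hausdorff])
qed

text \<open>A covering set of diameter below \<open>d\<close> cannot meet both \<open>A\<close> and
  \<open>B\<close>, so a fine cover of the union splits into two families without common members.
  Additivity on sets at positive distance is the input of Caratheodory's criterion.\<close>

lemma hausdorff_outer_separated: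
  fixes A B :: "'a::metric_space set"
  assumes d: "0 < d" "\<And>a b. a \<in> A \<Longrightarrow> b \<in> B \<Longrightarrow> d \<le> dist a b"
  shows "hausdorff_outer s A + hausdorff_outer s B \<le> hausdorff_outer s (A \<union> B)"
proof -
  have pre: "hausdorff_pre s \<delta> A + hausdorff_pre s \<delta> B \<le> hausdorff_pre s \<delta> (A \<union> B)"
    if \<delta>: "0 < \<delta>" "\<delta> < d" for \<delta>
  proof -
    have "hausdorff_pre s \<delta> A + hausdorff_pre s \<delta> B \<le> (\<Sum>i. hausdorff_gauge s (C i))"
      if C: "A \<union> B \<subseteq> (\<Union>i. C i)" "\<And>i. bounded (C i)" "\<And>i. diameter (C i) \<le> \<delta>" for C :: "nat \<Rightarrow> 'a set"
    proof -
      \<comment> \<open>Covering sets that miss the given set are replaced by \<open>{}\<close>: its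
        gauge is 0 even for \<open>s = 0\<close>, where the formula for nonempty sets would give
        1.\<close>
      let ?r = "\<lambda>A i. if C i \<inter> A = {} then {} else C i"
      have "hausdorff_pre s \<delta> A + hausdorff_pre s \<delta> B \<le>
          (\<Sum>i. hausdorff_gauge s (?r A i)) + (\<Sum>i. hausdorff_gauge s (?r B i))"
        by (intro add_mono hausdorff_pre_le; insert C \<delta>; fastforce)
      also have "\<dots> = (\<Sum>i. hausdorff_gauge s (?r A i) + hausdorff_gauge s (?r B i))"
        by (rule suminf_add) auto
      also have "\<dots> \<le> (\<Sum>i. hausdorff_gauge s (C i))"
      proof (intro suminf_le allI)
        fix i
        have "\<not> (C i \<inter> A \<noteq> {} \<and> C i \<inter> B \<noteq> {})"
        proof (rule notI, elim conjE)
          assume "C i \<inter> A \<noteq> {}" "C i \<inter> B \<noteq> {}"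
          then obtain a b where "a \<in> C i" "b \<in> C i" "a \<in> A" "b \<in> B" by auto
          with d(2)[of a b] diameter_bounded_bound[OF C(2)[of i], of a b] C(3)[of i] \<delta> show False
            by linarith
        qed
        then show "hausdorff_gauge s (?r A i) + hausdorff_gauge s (?r B i) \<le> hausdorff_gauge s (C i)"
          by (auto simp: hausdorff_gauge_def)
      qed auto
      finally show ?thesis .
    qed
    then show ?thesis
      unfolding hausdorff_pre_def[of s \<delta> "A \<union> B"] by (intro INF_greatest) auto
  qed
  have "hausdorff_pre s \<delta> A + hausdorff_pre s \<delta>' B \<le> hausdorff_outer s (A \<union> B)"
    if "0 < \<delta>" "0 < \<delta>'" for \<delta> \<delta>'
  proof -
    define \<eta> where "\<eta> = min (min \<delta> \<delta>') (d/2)"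
    have \<eta>: "0 < \<eta>" "\<eta> < d" "\<eta> \<le> \<delta>" "\<eta> \<le> \<delta>'"
      using that d(1) by (auto simp: \<eta>_def)
    have "hausdorff_pre s \<delta> A + hausdorff_pre s \<delta>' B \<le> hausdorff_pre s \<eta> A + hausdorff_pre s \<eta> B"
      by (intro add_mono hausdorff_pre_antimono \<eta>)
    also have "\<dots> \<le> hausdorff_outer s (A \<union> B)"
      using pre[OF \<eta>(1,2)] hausdorff_pre_le_outer[OF \<eta>(1)] order_trans by blast
    finally show ?thesis .
  qed
  then have *: "(SUP \<delta>'\<in>{0<..}. hausdorff_pre s \<delta> A + hausdorff_pre s \<delta>' B) \<le> hausdorff_outer s (A \<union> B)"
    if "0 < \<delta>" for \<delta>
    using that by (intro SUP_least) auto
  have "hausdorff_pre s \<delta> A + hausdorff_outer s B \<le> hausdorff_outer s (A \<union> B)" if "0 < \<delta>" for \<delta>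
    using *[OF that] ennreal_SUP_add_right[of "{0<..}" "hausdorff_pre s \<delta> A" "\<lambda>\<delta>. hausdorff_pre s \<delta> B"]
    unfolding hausdorff_outer_def[of s B] by auto
  then have "(SUP \<delta>\<in>{0<..}. hausdorff_pre s \<delta> A + hausdorff_outer s B) \<le> hausdorff_outer s (A \<union> B)"
    by (intro SUP_least) auto
  then show ?thesis
    using ennreal_SUP_add_left[of "{0<..}" "\<lambda>\<delta>. hausdorff_pre s \<delta> A" "hausdorff_outer s B"]
    unfolding hausdorff_outer_def[of s A] by auto
qed

text \<open>Layers whose indices have the same parity are at positive distance from each other, so
  their measures add up to at most that of \<open>T\<close>; the factor 2 accounts for the two
  parities. If \<open>T\<close> has finite measure, the layers close to \<open>F\<close> therefore
  have small total measure.\<close>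

lemma hausdorff_outer_distance_layers:
  fixes T F :: "'a::metric_space set"
  defines "R \<equiv> \<lambda>k::nat. {x \<in> T. 1 / real (k+2) \<le> infdist x F \<and> infdist x F < 1 / real (k+1)}"
  shows "(\<Sum>j. hausdorff_outer s (R j)) \<le> 2 * hausdorff_outer s T"
proof -
  have parity: "(\<Sum>j<m. hausdorff_outer s (R (2*j+b))) \<le> hausdorff_outer s (\<Union>j<m. R (2*j+b))" for m b
  proof (induction m)
    case (Suc m)
    \<comment> \<open>The layers with \<open>j < m\<close> stay at distance at least
      \<open>1 / (2 * m + b)\<close> from \<open>F\<close>. The summand 1/2 weakens this to keep the
      denominator positive for \<open>m = b = 0\<close>, where \<open>1 / 0 = 0\<close> would make
      the gap negative.\<close>
    have sep: "1 / (real (2*m+b)+1/2) - 1 / (real (2*m+b)+1) \<le> dist x y"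
      if x: "x \<in> (\<Union>j<m. R (2*j+b))" and y: "y \<in> R (2*m+b)" for x y
    proof -
      obtain j where j: "j < m" "x \<in> R (2*j+b)" using x by blast
      have "1 / (real (2*m+b)+1/2) \<le> 1 / real (2*j+b+2)"
        using j(1) by (intro divide_left_mono) auto
      also have "\<dots> \<le> infdist x F" using j by (simp add: R_def)
      also have "\<dots> \<le> infdist y F + dist x y" by (rule infdist_triangle)
      also have "infdist y F < 1 / real (2*m+b+1)" using y by (simp add: R_def)
      finally show ?thesis by (simp add: algebra_simps)
    qed
    have "0 < 1 / (real (2*m+b)+1/2) - 1 / (real (2*m+b)+1)"
      by (simp, rule divide_strict_left_mono) auto
    then have "hausdorff_outer s (\<Union>j<m. R (2*j+b)) + hausdorff_outer s (R (2*m+b))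
      \<le> hausdorff_outer s ((\<Union>j<m. R (2*j+b)) \<union> R (2*m+b))"
      by (rule hausdorff_outer_separated) (rule sep)
    also have "(\<Union>j<m. R (2*j+b)) \<union> R (2*m+b) = (\<Union>j<Suc m. R (2*j+b))"
      by (auto simp: lessThan_Suc)
    finally show ?case
      unfolding sum.lessThan_Suc
      using add_right_mono[OF Suc, of "hausdorff_outer s (R (2*m+b))"] order_trans by blast
  qed simp
  have le: "(\<Sum>j<m. hausdorff_outer s (R (2*j+b))) \<le> hausdorff_outer s T" for m b
    by (rule order_trans[OF parity hausdorff_outer_mono]) (auto simp: R_def)
  have "(\<Sum>j<n. hausdorff_outer s (R j)) \<le> 2 * hausdorff_outer s T" for n
  proof -
    have "(\<Sum>j<n. hausdorff_outer s (R j)) \<le> (\<Sum>j<2*n. hausdorff_outer s (R j))"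
      by (rule sum_mono2) auto
    also have "\<dots> = (\<Sum>j<n. hausdorff_outer s (R (2*j+0))) + (\<Sum>j<n. hausdorff_outer s (R (2*j+1)))"
      by (induction n) (auto simp: algebra_simps)
    also have "\<dots> \<le> hausdorff_outer s T + hausdorff_outer s T"
      by (intro add_mono le)
    finally show ?thesis by (simp add: mult_2)
  qed
  then show ?thesis
    by (intro suminf_le_const) auto
qed

text \<open>Caratheodory's criterion. The part of \<open>T\<close> outside \<open>F\<close> consists
  of the set \<open>Tn\<close> at distance at least \<open>1 / (n + 1)\<close>, which is separated
  from \<open>F\<close>, and of the layers with index at least \<open>n\<close>. If \<open>T\<close>
  has finite measure, these layers contribute the tail of a convergent series.\<close>

lemma closed_in_lambda_system:
  fixes F :: "'a::metric_space set"
  assumes "closed F"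
  shows "F \<in> lambda_system UNIV UNIV (hausdorff_outer s)"
proof (cases "F = {}")
  case True
  then show ?thesis by (simp add: lambda_system_def)
next
  case False
  have "hausdorff_outer s (F \<inter> T) + hausdorff_outer s ((UNIV - F) \<inter> T) \<le> hausdorff_outer s T" for T
  proof (cases "hausdorff_outer s T = top")
    case fin: False
    define f where "f = (\<lambda>k::nat. hausdorff_outer s {x \<in> T. 1 / real (k+2) \<le> infdist x F \<and> infdist x F < 1 / real (k+1)})"
    have sumf: "suminf f < top"
      using hausdorff_outer_distance_layers[where s=s and T=T and F=F] fin
      unfolding f_def by (elim order_le_less_trans) (simp add: ennreal_mult_less_top less_top)
    have le: "hausdorff_outer s (F \<inter> T) + hausdorff_outer s ((UNIV - F) \<inter> T)
        \<le> hausdorff_outer s T + suminf (\<lambda>k. f (k + n))" for n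
    proof -
      define Tn where "Tn = {x \<in> T. 1 / real (n+1) \<le> infdist x F}"
      define R where "R = (\<lambda>k::nat. {x \<in> T. 1 / real (k+n+2) \<le> infdist x F \<and> infdist x F < 1 / real (k+n+1)})"
      have "(UNIV - F) \<inter> T \<subseteq> Tn \<union> (\<Union>k. R k)"
      proof
        fix x assume x: "x \<in> (UNIV - F) \<inter> T"
        then have pos: "0 < infdist x F"
          using infdist_pos_not_in_closed[OF assms False] by auto
        show "x \<in> Tn \<union> (\<Union>k. R k)"
        proof (cases "1 / real (n+1) \<le> infdist x F")
          case False
          obtain m where m: "1 / real (m+1) < infdist x F"
            using nat_approx_posE[OF pos] by (metis Suc_eq_plus1)
          \<comment> \<open>The layer of \<open>x\<close> is the one before the first threshold that
            \<open>infdist x F\<close> reaches; \<open>k = 0\<close> would put \<open>x\<close> into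
            \<open>Tn\<close>.\<close>
          define k where "k = (LEAST k. 1 / real (k+n+1) \<le> infdist x F)"
          have ex: "1 / real (m+n+1) \<le> infdist x F"
          proof -
            have "1 / real (m+n+1) \<le> 1 / real (m+1)" by (intro divide_left_mono) auto
            with m show ?thesis by simp
          qed
          have k1: "1 / real (k+n+1) \<le> infdist x F"
            unfolding k_def by (rule LeastI[of _ m]) (rule ex)
          have "k \<noteq> 0" using False k1 by (cases k) auto
          then obtain j where j: "k = Suc j" using not0_implies_Suc by blast
          have "\<not> 1 / real (j+n+1) \<le> infdist x F"
            using not_less_Least[of j "\<lambda>k. 1 / real (k+n+1) \<le> infdist x F"] j unfolding k_def by simp
          with k1 j x have "x \<in> R j" by (simp add: R_def algebra_simps)
          then show ?thesis by auto
        qed (use x in \<open>auto simp: Tn_def\<close>)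
      qed
      then have "hausdorff_outer s ((UNIV - F) \<inter> T) \<le> hausdorff_outer s Tn + hausdorff_outer s (\<Union>k. R k)"
        using hausdorff_outer_mono hausdorff_outer_Un order_trans by meson
      also have "\<dots> \<le> hausdorff_outer s Tn + (\<Sum>k. hausdorff_outer s (R k))"
        by (intro add_left_mono hausdorff_outer_subadditive)
      also have "(\<Sum>k. hausdorff_outer s (R k)) = suminf (\<lambda>k. f (k + n))"
        by (simp add: R_def f_def algebra_simps)
      finally have 1: "hausdorff_outer s ((UNIV - F) \<inter> T) \<le> hausdorff_outer s Tn + suminf (\<lambda>k. f (k + n))" .
      have "hausdorff_outer s (F \<inter> T) + hausdorff_outer s Tn \<le> hausdorff_outer s ((F \<inter> T) \<union> Tn)"
      proof (rule hausdorff_outer_separated)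
        show "0 < 1 / real (n+1)" by simp
        fix a b assume "a \<in> F \<inter> T" "b \<in> Tn"
        then show "1 / real (n+1) \<le> dist a b"
          using infdist_le[of a F b] by (auto simp: Tn_def dist_commute intro: order_trans)
      qed
      also have "\<dots> \<le> hausdorff_outer s T"
        by (rule hausdorff_outer_mono) (auto simp: Tn_def)
      finally have 2: "hausdorff_outer s (F \<inter> T) + hausdorff_outer s Tn \<le> hausdorff_outer s T" .
      have "hausdorff_outer s (F \<inter> T) + hausdorff_outer s ((UNIV - F) \<inter> T)
        \<le> hausdorff_outer s (F \<inter> T) + hausdorff_outer s Tn + suminf (\<lambda>k. f (k + n))"
        using 1 by (simp add: add.assoc add_left_mono)
      also have "\<dots> \<le> hausdorff_outer s T + suminf (\<lambda>k. f (k + n))"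
        using 2 by (rule add_right_mono)
      finally show ?thesis .
    qed
    show ?thesis
    proof (rule ennreal_le_epsilon)
      fix e :: real assume "e > 0"
      have "(\<lambda>n. sum f {..<n}) \<longlonglongrightarrow> suminf f"
        by (rule summable_LIMSEQ) simp
      moreover have "suminf f < suminf f + ennreal e"
        using sumf \<open>e > 0\<close> by auto
      ultimately have "\<forall>\<^sub>F n in sequentially. suminf f < sum f {..<n} + ennreal e"
        by (intro order_tendstoD(1)[of _ "suminf f + ennreal e"] tendsto_add tendsto_const) auto
      then obtain n where n: "suminf f < sum f {..<n} + ennreal e"
        using eventually_happens' sequentially_bot by blast
      have "suminf f = suminf (\<lambda>k. f (k + n)) + sum f {..<n}"
        by (rule suminf_offset) simp
      then have "sum f {..<n} + suminf (\<lambda>k. f (k + n)) < sum f {..<n} + ennreal e"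
        using n by (simp add: add.commute)
      then have "suminf (\<lambda>k. f (k + n)) < ennreal e"
        unfolding ennreal_add_left_cancel_less by (rule conjunct2)
      then have "suminf (\<lambda>k. f (k + n)) \<le> ennreal e" by (rule less_imp_le)
      then show "hausdorff_outer s (F \<inter> T) + hausdorff_outer s ((UNIV - F) \<inter> T) \<le> hausdorff_outer s T + e"
        using le[of n] by (meson add_left_mono order_trans)
    qed
  qed simp
  moreover have "hausdorff_outer s T \<le> hausdorff_outer s (F \<inter> T) + hausdorff_outer s ((UNIV - F) \<inter> T)" for T
    using hausdorff_outer_Un[of s "F \<inter> T" "(UNIV - F) \<inter> T"]
    by (metis Compl_eq_Diff_UNIV Int_Un_distrib2 Compl_partition inf_top_left)
  ultimately show ?thesis
    by (auto simp: lambda_system_def intro!: antisym)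
qed

section \<open>The Hausdorff measure and its Borel sets\<close>

lemma space_hausdorff_measure [simp]: "space (hausdorff_measure s) = UNIV"
  by (simp add: hausdorff_measure_def space_measure_of_conv)

lemma sets_hausdorff_measure: "sets (hausdorff_measure s) = lambda_system UNIV UNIV (hausdorff_outer s)"
proof -
  interpret sigma_algebra "UNIV::'a set" "lambda_system UNIV UNIV (hausdorff_outer s)"
    using measure_space_hausdorff by (auto simp: measure_space_def)
  show ?thesis
    unfolding hausdorff_measure_def by (rule sets_measure_of_eq)
qed

lemma emeasure_hausdorff_measure:
  "A \<in> sets (hausdorff_measure s) \<Longrightarrow> emeasure (hausdorff_measure s) A = hausdorff_outer s A"
  unfolding hausdorff_measure_def
  using measure_space_hausdorff[of s]
  by (intro emeasure_measure_of_sigma)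
     (auto simp: measure_space_def sets_hausdorff_measure hausdorff_measure_def[symmetric])

lemma borel_subset_hausdorff: "sets borel \<subseteq> sets (hausdorff_measure s)"
proof -
  interpret sigma_algebra "UNIV::'a set" "lambda_system UNIV UNIV (hausdorff_outer s)"
    using measure_space_hausdorff by (auto simp: measure_space_def)
  show ?thesis
    unfolding sets_hausdorff_measure borel_eq_closed
    by (subst sets_measure_of) (auto intro!: sigma_sets_subset closed_in_lambda_system)
qed

section \<open>Lipschitz images\<close>

lemma diameter_le_dist:
  assumes "S \<noteq> {}" "\<And>x y. x \<in> S \<Longrightarrow> y \<in> S \<Longrightarrow> dist x y \<le> d"
  shows "diameter S \<le> d"
  unfolding diameter_def using assms by (auto intro!: cSUP_least)

text \<open>Covers of \<open>A\<close> with diameters at most \<open>\<delta> / L\<close> go to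
  covers with diameters at most \<open>\<delta>\<close>, each gauge growing at most by
  \<open>L ^ s\<close>. The covering sets are first intersected with \<open>A\<close>, since
  \<open>f\<close> is controlled only there. All later comparisons of surface measures rest on this
  scaling.\<close>

lemma hausdorff_outer_lipschitz_image:
  fixes f :: "'a::metric_space \<Rightarrow> 'b::metric_space"
  assumes L: "0 < L" and f: "\<And>x y. x \<in> A \<Longrightarrow> y \<in> A \<Longrightarrow> dist (f x) (f y) \<le> L * dist x y"
  shows "hausdorff_outer s (f ` A) \<le> ennreal (L ^ s) * hausdorff_outer s A"
proof (rule hausdorff_outer_least)
  fix \<delta> :: real assume \<delta>: "0 < \<delta>"
  have le: "hausdorff_pre s \<delta> (f ` A) \<le> ennreal (L ^ s) * (\<Sum>i. hausdorff_gauge s (C i))"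
    if C: "A \<subseteq> (\<Union>i. C i)" "\<And>i. bounded (C i)" "\<And>i. diameter (C i) \<le> \<delta> / L" for C :: "nat \<Rightarrow> 'a set"
  proof -
    have dm: "bounded (f ` (C i \<inter> A)) \<and> diameter (f ` (C i \<inter> A)) \<le> L * diameter (C i)" for i
    proof -
      have d: "dist (f x) (f y) \<le> L * diameter (C i)" if "x \<in> C i \<inter> A" "y \<in> C i \<inter> A" for x y
        using f[of x y] that diameter_bounded_bound[OF C(2)[of i], of x y] L
        by (meson IntD1 IntD2 mult_left_mono less_imp_le order_trans)
      have "bounded (f ` (C i \<inter> A))"
        unfolding bounded_two_points using d by (intro exI[of _ "L * diameter (C i)"]) auto
      moreover have "diameter (f ` (C i \<inter> A)) \<le> L * diameter (C i)"
      proof (cases "C i \<inter> A = {}")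
        case True
        then show ?thesis using L diameter_ge_0[OF C(2)] by simp
      next
        case False
        then show ?thesis
          using d by (intro diameter_le_dist) auto
      qed
      ultimately show ?thesis by blast
    qed
    have "hausdorff_pre s \<delta> (f ` A) \<le> (\<Sum>i. hausdorff_gauge s (f ` (C i \<inter> A)))"
    proof (rule hausdorff_pre_le)
      show "f ` A \<subseteq> (\<Union>i. f ` (C i \<inter> A))" using C(1) by (auto simp: image_iff subset_eq) blast
      fix i
      show "bounded (f ` (C i \<inter> A))" using dm by blast
      have "L * diameter (C i) \<le> \<delta>" using C(3)[of i] L by (simp add: field_simps)
      then show "diameter (f ` (C i \<inter> A)) \<le> \<delta>" using dm[of i] by linarith
    qed
    also have "\<dots> \<le> (\<Sum>i. ennreal (L ^ s) * hausdorff_gauge s (C i))"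
    proof (intro suminf_le allI)
      fix i
      show "hausdorff_gauge s (f ` (C i \<inter> A)) \<le> ennreal (L ^ s) * hausdorff_gauge s (C i)"
      proof (cases "C i \<inter> A = {}")
        case False
        have "(diameter (f ` (C i \<inter> A)) / 2) ^ s \<le> (L * (diameter (C i) / 2)) ^ s"
          using dm[of i] diameter_ge_0 by (intro power_mono) auto
        then have "unit_ball_vol (real s) * (diameter (f ` (C i \<inter> A)) / 2) ^ s
          \<le> L ^ s * (unit_ball_vol (real s) * (diameter (C i) / 2) ^ s)"
          unfolding power_mult_distrib[of L]
          using mult_left_mono[of "(diameter (f ` (C i \<inter> A)) / 2) ^ s" "L ^ s * (diameter (C i) / 2) ^ s" "unit_ball_vol (real s)"]
          by (simp only: ac_simps unit_ball_vol_nonneg)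
        then show ?thesis
          using False L by (auto simp: hausdorff_gauge_def ennreal_mult'[symmetric] ennreal_leI)
      qed (simp add: hausdorff_gauge_def)
    qed auto
    finally show ?thesis by simp
  qed
  have "hausdorff_pre s \<delta> (f ` A) \<le> (INF C \<in> {C :: nat \<Rightarrow> 'a set. A \<subseteq> (\<Union>i. C i) \<and> (\<forall>i. bounded (C i) \<and> diameter (C i) \<le> \<delta>/L)}.
        ennreal (L ^ s) * (\<Sum>i. hausdorff_gauge s (C i)))"
    by (intro INF_greatest) (use le in auto)
  \<comment> \<open>The factor is taken out of the infimum by multiplying with its inverse
    \<open>1 / L ^ s\<close>; products with a finite positive constant cancel in
    \<open>ennreal\<close>.\<close>
  also have "\<dots> \<le> ennreal (L ^ s) * hausdorff_pre s (\<delta>/L) A"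
  proof (rule ccontr)
    assume "\<not> ?thesis"
    then have lt: "ennreal (L ^ s) * hausdorff_pre s (\<delta>/L) A < (INF C \<in> {C :: nat \<Rightarrow> 'a set. A \<subseteq> (\<Union>i. C i) \<and> (\<forall>i. bounded (C i) \<and> diameter (C i) \<le> \<delta>/L)}.
        ennreal (L ^ s) * (\<Sum>i. hausdorff_gauge s (C i)))" (is "_ < ?I") by simp
    have c: "ennreal (1 / L^s) * (ennreal (L ^ s) * x) = x" for x
      using L by (simp add: mult.assoc[symmetric] ennreal_mult'[symmetric])
    have c': "ennreal (L^s) * (ennreal (1 / L ^ s) * x) = x" for x
      using L by (simp add: mult.assoc[symmetric] ennreal_mult'[symmetric])
    have "hausdorff_pre s (\<delta>/L) A < ennreal (1 / L^s) * ?I"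
    proof (rule ccontr)
      assume "\<not> ?thesis"
      then have "ennreal (1 / L^s) * ?I \<le> hausdorff_pre s (\<delta>/L) A" by simp
      from mult_left_mono[OF this, of "ennreal (L^s)"] lt show False unfolding c' by simp
    qed
    then obtain C :: "nat \<Rightarrow> 'a set" where C: "A \<subseteq> (\<Union>i. C i)" "\<And>i. bounded (C i)" "\<And>i. diameter (C i) \<le> \<delta>/L"
      "(\<Sum>i. hausdorff_gauge s (C i)) < ennreal (1 / L^s) * ?I"
      by (rule hausdorff_pre_close) blast
    have "?I \<le> ennreal (L ^ s) * (\<Sum>i. hausdorff_gauge s (C i))"
      by (rule INF_lower) (use C in auto)
    from mult_left_mono[OF this, of "ennreal (1 / L^s)"] C(4) show False unfolding c by simp
  qed
  also have "\<dots> \<le> ennreal (L ^ s) * hausdorff_outer s A"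
    using \<delta> L by (intro mult_left_mono hausdorff_pre_le_outer) auto
  finally show "hausdorff_pre s \<delta> (f ` A) \<le> ennreal (L ^ s) * hausdorff_outer s A" .
qed


section \<open>Linear functionals bounded by an integral\<close>

lemma powr_midpoint_less:
  fixes x y q :: real
  assumes "1 < q" "0 \<le> x" "x < y"
  shows "((x + y) / 2) powr q < (x powr q + y powr q) / 2"
proof -
  define m where "m = (x + y) / 2"
  have m: "x < m" "m < y" "y - m = m - x" "0 < m" using assms by (auto simp: m_def field_simps)
  have cont: "continuous_on {a..b} (\<lambda>t. t powr q)" if "0 \<le> a" for a b :: real
    using assms(1) that by (intro continuous_on_powr' continuous_intros) auto
  have der: "((\<lambda>t. t powr q) has_real_derivative q * t powr (q - 1)) (at t)" if "0 < t" for t :: real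
    using that by (auto intro!: derivative_eq_intros)
  have diff: "(\<lambda>t. t powr q) differentiable (at t)" if "0 < t" for t :: real
    using der[OF that] real_differentiable_def by blast
  \<comment> \<open>The mean value theorem on the two halves of the interval: the slope
    \<open>q * t powr (q - 1)\<close> is strictly larger at the intermediate point of the right
    half.\<close>
  obtain l u where u: "x < u" "u < m" "(DERIV (\<lambda>t. t powr q) u :> l)" "m powr q - x powr q = (m - x) * l"
    using MVT[OF m(1) cont[OF assms(2)] diff] assms(2) by auto
  obtain k v where v: "m < v" "v < y" "(DERIV (\<lambda>t. t powr q) v :> k)" "y powr q - m powr q = (y - m) * k"
    using MVT[OF m(2) cont diff] m(4) by auto
  have "l = q * u powr (q-1)" "k = q * v powr (q-1)"
    using u(1,3) v(1,3) m(4) assms(2) der[of u] der[of v] by (auto intro: DERIV_unique)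
  then have "l < k"
    using assms u v m by (auto intro!: powr_less_mono2)
  then have "(m - x) * l < (y - m) * k" using m by simp
  then show ?thesis using u v by (simp add: m_def)
qed

lemma abs_powr_midpoint_less:
  fixes a b q :: real
  assumes "1 < q" "a \<noteq> b"
  shows "\<bar>(a + b) / 2\<bar> powr q < (\<bar>a\<bar> powr q + \<bar>b\<bar> powr q) / 2"
proof (cases "\<bar>a\<bar> = \<bar>b\<bar>")
  case True
  with assms(2) have "b = - a" "a \<noteq> 0" by auto
  then show ?thesis using assms by simp
next
  case False
  have "\<bar>(a + b) / 2\<bar> powr q \<le> ((\<bar>a\<bar> + \<bar>b\<bar>) / 2) powr q"
    using assms by (intro powr_mono2) auto
  also have "\<dots> < (\<bar>a\<bar> powr q + \<bar>b\<bar> powr q) / 2"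
    using powr_midpoint_less[OF assms(1), of "\<bar>a\<bar>" "\<bar>b\<bar>"] powr_midpoint_less[OF assms(1), of "\<bar>b\<bar>" "\<bar>a\<bar>"] False
    by (cases "\<bar>a\<bar> < \<bar>b\<bar>") (auto simp: add.commute)
  finally show ?thesis .
qed

lemma abs_powr_midpoint_le:
  fixes a b q :: real
  assumes "1 < q"
  shows "\<bar>(a + b) / 2\<bar> powr q \<le> (\<bar>a\<bar> powr q + \<bar>b\<bar> powr q) / 2"
  using abs_powr_midpoint_less[OF assms, of a b] by (cases "a = b") auto

lemma abs_add_powr_le:
  fixes a b q :: real
  assumes "1 < q"
  shows "(\<bar>a\<bar> + \<bar>b\<bar>) powr q \<le> 2 powr q * (\<bar>a\<bar> powr q + \<bar>b\<bar> powr q)"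
proof -
  define m where "m = (\<bar>a\<bar> + \<bar>b\<bar>) / 2"
  have "(2 * m) powr q = 2 powr q * \<bar>m\<bar> powr q"
    by (subst powr_mult) (simp_all add: m_def)
  then have "(\<bar>a\<bar> + \<bar>b\<bar>) powr q = 2 powr q * \<bar>(\<bar>a\<bar> + \<bar>b\<bar>) / 2\<bar> powr q"
    by (simp only: m_def mult_2 field_sum_of_halves)
  also have "\<dots> \<le> 2 powr q * ((\<bar>a\<bar> powr q + \<bar>b\<bar> powr q) / 2)"
    using abs_powr_midpoint_le[OF assms, of "\<bar>a\<bar>" "\<bar>b\<bar>"] by (intro mult_left_mono) auto
  also have "\<dots> \<le> 2 powr q * (\<bar>a\<bar> powr q + \<bar>b\<bar> powr q)"
    by (intro mult_left_mono) auto
  finally show ?thesis .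
qed

lemma abs_plus_powr_le:
  fixes a b q :: real
  assumes "1 < q"
  shows "\<bar>a + b\<bar> powr q \<le> 2 powr q * (\<bar>a\<bar> powr q + \<bar>b\<bar> powr q)"
  by (rule order_trans[OF powr_mono2 abs_add_powr_le[OF assms]]) (use assms in auto)

text \<open>The gap in the midpoint inequality is homogeneous of degree \<open>q\<close>, so compactness of the
  unit sphere replaces the Clarkson inequalities.\<close>

lemma abs_powr_midpoint_gap:
  fixes q \<eta> :: real
  assumes q: "1 < q" and \<eta>: "0 < \<eta>"
  obtains c where "0 < c" "\<And>a b. \<bar>a - b\<bar> powr q \<le> \<eta> * (\<bar>a\<bar> powr q + \<bar>b\<bar> powr q)
     + c * ((\<bar>a\<bar> powr q + \<bar>b\<bar> powr q) / 2 - \<bar>(a + b) / 2\<bar> powr q)"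
proof -
  define gap where "gap = (\<lambda>a b. (\<bar>a\<bar> powr q + \<bar>b\<bar> powr q) / 2 - \<bar>(a + b) / 2\<bar> powr q)"
  \<comment> \<open>With this value \<open>\<tau> powr q * 2 powr q = \<eta>\<close>, so that pairs
    with \<open>\<bar>a - b\<bar> \<le> \<tau> * (\<bar>a\<bar> + \<bar>b\<bar>)\<close> are covered
    by the \<open>\<eta>\<close>-term alone. \<open>S\<close> collects the remaining pairs,
    normalised to \<open>\<bar>a\<bar> + \<bar>b\<bar> = 1\<close>.\<close>
  define \<tau> where "\<tau> = (\<eta> / 2 powr q) powr (1/q)"
  have \<tau>: "0 < \<tau>" using \<eta> by (simp add: \<tau>_def)
  have \<tau>q: "\<tau> powr q * 2 powr q = \<eta>" using \<eta> q by (simp add: \<tau>_def powr_powr)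
  define S where "S = {z::real\<times>real. \<bar>fst z\<bar> + \<bar>snd z\<bar> = 1 \<and> \<tau> \<le> \<bar>fst z - snd z\<bar>}"
  have gap_nonneg: "0 \<le> gap a b" for a b
    using abs_powr_midpoint_le[OF q, of a b] by (simp add: gap_def)
  have "compact S"
  proof -
    have "closed S"
      unfolding S_def by (intro closed_Collect_conj closed_Collect_eq closed_Collect_le continuous_intros)
    moreover have "bounded S"
      unfolding bounded_iff
    proof (intro exI[of _ 1] ballI)
      fix z assume "z \<in> S"
      then show "norm z \<le> 1"
        using norm_Pair_le[of "fst z" "snd z"] by (auto simp: S_def)
    qed
    ultimately show ?thesis by (simp add: compact_eq_bounded_closed)
  qed
  note cS = this
  have cg: "continuous_on S (\<lambda>z. gap (fst z) (snd z))"
    unfolding gap_def using q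
    by (intro continuous_intros continuous_on_powr') auto
  have pg: "0 < gap (fst z) (snd z)" if "z \<in> S" for z
    using abs_powr_midpoint_less[OF q, of "fst z" "snd z"] that \<tau> by (auto simp: gap_def S_def)
  have "\<exists>c>0. \<forall>z\<in>S. c \<le> gap (fst z) (snd z)"
  \<comment> \<open>\<open>S\<close> is empty for \<open>\<tau> > 1\<close>, because
    \<open>\<bar>a - b\<bar> \<le> \<bar>a\<bar> + \<bar>b\<bar> = 1\<close> on the normalised
    pairs; any positive \<open>c\<close> then serves.\<close>
  proof (cases "S = {}")
    case False
    then show ?thesis
      using continuous_attains_inf[OF cS False cg] pg by blast
  qed (auto intro: exI[of _ 1])
  then obtain c where c: "0 < c" "\<And>z. z \<in> S \<Longrightarrow> c \<le> gap (fst z) (snd z)"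
    by blast
  have main: "\<bar>a - b\<bar> powr q \<le> \<eta> * (\<bar>a\<bar> powr q + \<bar>b\<bar> powr q) + (1/c) * gap a b" for a b
  proof (cases "\<bar>a - b\<bar> \<le> \<tau> * (\<bar>a\<bar> + \<bar>b\<bar>)")
    case True
    then have "\<bar>a - b\<bar> powr q \<le> (\<tau> * (\<bar>a\<bar> + \<bar>b\<bar>)) powr q"
      using q by (intro powr_mono2) auto
    also have "\<dots> = \<tau> powr q * (\<bar>a\<bar> + \<bar>b\<bar>) powr q" using \<tau> by (simp add: powr_mult)
    also have "\<dots> \<le> \<tau> powr q * (2 powr q * (\<bar>a\<bar> powr q + \<bar>b\<bar> powr q))"
      by (intro mult_left_mono abs_add_powr_le q) auto
    also have "\<dots> = \<eta> * (\<bar>a\<bar> powr q + \<bar>b\<bar> powr q)" using \<tau>q by (simp add: mult.assoc[symmetric])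
    finally show ?thesis using gap_nonneg[of a b] c(1) by (simp add: add_increasing2)
  next
    case False
    define s where "s = \<bar>a\<bar> + \<bar>b\<bar>"
    have "a \<noteq> 0 \<or> b \<noteq> 0" using False by auto
    then have s: "0 < s" by (auto simp: s_def)
    have hom: "gap a b = s powr q * gap (a/s) (b/s)"
    proof -
      have e: "\<bar>t / s\<bar> powr q * s powr q = \<bar>t\<bar> powr q" for t
        using s by (simp add: powr_mult[symmetric] abs_divide)
      have "(a/s + b/s)/2 = ((a+b)/2)/s" by (simp add: add_divide_distrib)
      then have "gap (a/s) (b/s) = (\<bar>a / s\<bar> powr q + \<bar>b / s\<bar> powr q) / 2 - \<bar>((a+b)/2)/s\<bar> powr q"
        by (simp only: gap_def)
      then have "gap (a/s) (b/s) * s powr q = (\<bar>a / s\<bar> powr q * s powr q + \<bar>b / s\<bar> powr q * s powr q) / 2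
          - \<bar>((a+b)/2)/s\<bar> powr q * s powr q"
        by (simp only: left_diff_distrib distrib_right times_divide_eq_left)
      then show ?thesis unfolding e by (simp only: gap_def mult.commute)
    qed
    have "(a/s, b/s) \<in> S"
      using False s by (auto simp: S_def s_def field_simps add_divide_distrib[symmetric] diff_divide_distrib[symmetric])
    then have "c \<le> gap (a/s) (b/s)" using c(2)[of "(a/s, b/s)"] by simp
    then have "s powr q * c \<le> gap a b" unfolding hom by (intro mult_left_mono) auto
    moreover have "\<bar>a - b\<bar> powr q \<le> s powr q" using q by (intro powr_mono2) (auto simp: s_def)
    ultimately have "c * \<bar>a - b\<bar> powr q \<le> gap a b"
      using c(1) mult_left_mono[of "\<bar>a - b\<bar> powr q" "s powr q" c] mult.commute[of c "s powr q"] by linarith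
    then have "\<bar>a - b\<bar> powr q \<le> (1/c) * gap a b" using c(1) by (simp add: field_simps)
    then show ?thesis using \<eta> by (simp add: add_increasing)
  qed
  show ?thesis
    by (rule that[of "1/c"]) (use c(1) main in \<open>auto simp: gap_def\<close>)
qed

text \<open>A \<open>b\<close> that is small compared with \<open>a\<close> is absorbed by the
  factor \<open>1 + \<eta>\<close>; otherwise \<open>a\<close> is at most
  \<open>\<bar>b\<bar> / \<tau>\<close>. This takes the place of Minkowski's inequality when the
  \<open>q\<close>-integrals of a convergent sequence are exchanged for those of its limit.\<close>

lemma abs_add_powr_le_perturb:
  fixes q \<eta> :: real
  assumes q: "1 < q" and \<eta>: "0 < \<eta>"
  obtains c where "0 \<le> c" "\<And>a b. \<bar>a + b\<bar> powr q \<le> (1 + \<eta>) * \<bar>a\<bar> powr q + c * \<bar>b\<bar> powr q"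
proof -
  define \<tau> where "\<tau> = (1 + \<eta>) powr (1/q) - 1"
  have "1 powr (1/q) < (1 + \<eta>) powr (1/q)" using q \<eta> by (intro powr_less_mono2) auto
  then have \<tau>: "0 < \<tau>" by (simp add: \<tau>_def)
  have \<tau>q: "(1 + \<tau>) powr q = 1 + \<eta>" using q \<eta> by (simp add: \<tau>_def powr_powr)
  have "\<bar>a + b\<bar> powr q \<le> (1 + \<eta>) * \<bar>a\<bar> powr q + (1 + 1/\<tau>) powr q * \<bar>b\<bar> powr q" for a b
  proof (cases "\<bar>b\<bar> \<le> \<tau> * \<bar>a\<bar>")
    case True
    then have "\<bar>a + b\<bar> powr q \<le> ((1 + \<tau>) * \<bar>a\<bar>) powr q"
      using q by (intro powr_mono2) (auto simp: algebra_simps)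
    also have "\<dots> = (1 + \<eta>) * \<bar>a\<bar> powr q" using \<tau> \<tau>q by (simp add: powr_mult)
    finally show ?thesis by (simp add: add_increasing2)
  next
    case False
    then have "\<bar>a\<bar> \<le> (1/\<tau>) * \<bar>b\<bar>" using \<tau> by (simp add: field_simps)
    then have "\<bar>a + b\<bar> powr q \<le> ((1 + 1/\<tau>) * \<bar>b\<bar>) powr q"
      using q by (intro powr_mono2) (auto simp: algebra_simps)
    also have "\<dots> = (1 + 1/\<tau>) powr q * \<bar>b\<bar> powr q" using \<tau> by (simp add: powr_mult)
    finally show ?thesis using \<eta> by (simp add: add_increasing)
  qed
  then show ?thesis by (intro that[of "(1 + 1/\<tau>) powr q"]) auto
qed

text \<open>For \<open>a = q - 1\<close> and \<open>q > 1\<close> this is the derivative of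
  \<open>\<bar>t\<bar> powr q / q\<close>, continuous also at 0.\<close>

definition signed_powr :: "real \<Rightarrow> real \<Rightarrow> real" where
  "signed_powr a t = sgn t * \<bar>t\<bar> powr a"

lemma abs_signed_powr: "\<bar>signed_powr a t\<bar> = \<bar>t\<bar> powr a"
  by (cases "t = 0") (auto simp: signed_powr_def abs_mult abs_sgn_eq)

lemma continuous_signed_powr:
  assumes "0 < a"
  shows "isCont (signed_powr a) t"
proof (cases "t = 0")
  case True
  have "((\<lambda>t. \<bar>t\<bar> powr a) \<longlongrightarrow> \<bar>0::real\<bar> powr a) (at 0)"
    using assms by (intro tendsto_powr' tendsto_intros) auto
  then have "((\<lambda>t. \<bar>signed_powr a t\<bar>) \<longlongrightarrow> 0) (at 0)"
    by (simp add: abs_signed_powr)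
  then show ?thesis
    unfolding True isCont_def tendsto_rabs_zero_iff by (simp add: signed_powr_def[of a 0])
next
  case False
  have "((\<lambda>t. sgn t * \<bar>t\<bar> powr a) \<longlongrightarrow> sgn t * \<bar>t\<bar> powr a) (at t)"
    using False by (intro tendsto_intros) auto
  then show ?thesis by (simp add: isCont_def signed_powr_def[abs_def])
qed

lemma borel_measurable_signed_powr [measurable]: "signed_powr a \<in> borel_measurable borel"
  unfolding signed_powr_def[abs_def] by measurable

text \<open>Convexity, with the tangent taken at \<open>b\<close>. It comes from Young's inequality
  for \<open>\<bar>b\<bar> powr (q - 1)\<close> and \<open>\<bar>a\<bar>\<close> with exponents
  \<open>q / (q - 1)\<close> and \<open>q\<close>. Difference quotients of
  \<open>q\<close>-integrals can thus be bounded without differentiating under the integral.\<close>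

lemma abs_powr_tangent:
  fixes a b q :: real
  assumes q: "1 < q"
  shows "\<bar>b\<bar> powr q - \<bar>a\<bar> powr q \<le> q * (b - a) * signed_powr (q - 1) b"
proof -
  have "\<bar>b\<bar> powr (q-1) * \<bar>a\<bar> \<le> (\<bar>b\<bar> powr (q-1)) powr (q/(q-1)) / (q/(q-1)) + \<bar>a\<bar> powr q / q"
    using q by (intro Youngs_inequality) (auto simp: field_simps)
  also have "(\<bar>b\<bar> powr (q-1)) powr (q/(q-1)) = \<bar>b\<bar> powr q" using q by (simp add: powr_powr)
  finally have 1: "q * (\<bar>b\<bar> powr (q-1) * \<bar>a\<bar>) \<le> (q - 1) * \<bar>b\<bar> powr q + \<bar>a\<bar> powr q"
    using q by (simp add: field_simps)
  have 2: "b * signed_powr (q - 1) b = \<bar>b\<bar> powr q"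
  proof (cases "b = 0")
    case False
    then have "\<bar>b\<bar> powr q = \<bar>b\<bar> * \<bar>b\<bar> powr (q-1)" by (simp add: powr_mult_base)
    moreover have "b * sgn b = \<bar>b\<bar>" by (simp add: abs_sgn)
    ultimately show ?thesis by (simp add: signed_powr_def mult.assoc[symmetric])
  qed simp
  have 3: "a * signed_powr (q - 1) b \<le> \<bar>b\<bar> powr (q-1) * \<bar>a\<bar>"
    using abs_ge_self[of "a * signed_powr (q - 1) b"] by (simp add: abs_mult abs_signed_powr mult.commute)
  have "q * (a * signed_powr (q - 1) b) \<le> q * (\<bar>b\<bar> powr (q-1) * \<bar>a\<bar>)" using 3 q by simp
  then have X: "q * (a * signed_powr (q - 1) b) \<le> (q - 1) * \<bar>b\<bar> powr q + \<bar>a\<bar> powr q" using 1 by linarith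
  have "q * (b - a) * signed_powr (q - 1) b = q * \<bar>b\<bar> powr q - q * (a * signed_powr (q - 1) b)"
    unfolding 2[symmetric] by (simp add: algebra_simps)
  then show ?thesis using X unfolding left_diff_distrib by linarith
qed


section \<open>Completeness of the \<open>q\<close>-integrable functions and representation of
  functionals\<close>

lemma integrable_abs_powr_add:
  fixes f g :: "'a \<Rightarrow> real"
  assumes "1 < q" and [measurable]: "f \<in> borel_measurable M" "g \<in> borel_measurable M"
    and "integrable M (\<lambda>x. \<bar>f x\<bar> powr q)" "integrable M (\<lambda>x. \<bar>g x\<bar> powr q)"
  shows "integrable M (\<lambda>x. \<bar>f x + g x\<bar> powr q)"
proof (rule Bochner_Integration.integrable_bound)
  show "integrable M (\<lambda>x. 2 powr q * (\<bar>f x\<bar> powr q + \<bar>g x\<bar> powr q))"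
    using assms by simp
  show "AE x in M. norm (\<bar>f x + g x\<bar> powr q) \<le> norm (2 powr q * (\<bar>f x\<bar> powr q + \<bar>g x\<bar> powr q))"
    using abs_plus_powr_le[OF assms(1)] by (intro AE_I2) simp
qed measurable

lemma integrable_abs_powr_cmult:
  fixes f :: "'a \<Rightarrow> real"
  assumes "integrable M (\<lambda>x. \<bar>f x\<bar> powr q)"
  shows "integrable M (\<lambda>x. \<bar>c * f x\<bar> powr q)"
  using assms by (simp add: abs_mult powr_mult)

text \<open>Reduction to convergence in mean: since \<open>\<bar>t\<bar> \<le> \<tau> + \<tau> powr
  (1 - q) * \<bar>t\<bar> powr q\<close>, the sequence is Cauchy in L1 as the measure is finite,
  hence almost everywhere Cauchy along a subsequence. Fatou's lemma along that subsequence carries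
  the \<open>q\<close>-estimates over to the limit.\<close>

lemma Lq_Cauchy_limit:
  fixes f :: "nat \<Rightarrow> 'a \<Rightarrow> real"
  assumes "finite_measure M" "1 < q" and meas [measurable]: "\<And>k. f k \<in> borel_measurable M"
    and int: "\<And>k. integrable M (\<lambda>x. \<bar>f k x\<bar> powr q)"
    and cauchy: "\<And>e. 0 < e \<Longrightarrow> \<exists>n. \<forall>j\<ge>n. \<forall>k\<ge>n. (\<integral>x. \<bar>f j x - f k x\<bar> powr q \<partial>M) < e"
  obtains g where "g \<in> borel_measurable M" "integrable M (\<lambda>x. \<bar>g x\<bar> powr q)"
    "(\<lambda>k. \<integral>x. \<bar>f k x - g x\<bar> powr q \<partial>M) \<longlonglongrightarrow> 0"
proof -
  interpret finite_measure M by fact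
  have intd: "integrable M (\<lambda>x. \<bar>f j x - f k x\<bar> powr q)" for j k
    using integrable_abs_powr_add[OF assms(2) meas[of j], of "\<lambda>x. (-1) * f k x"] int
      integrable_abs_powr_cmult[OF int[of k], of "-1"] by simp
  have le: "\<bar>t\<bar> \<le> \<tau> + \<tau> powr (1 - q) * \<bar>t\<bar> powr q" if "0 < \<tau>" for t \<tau> :: real
  proof (cases "\<bar>t\<bar> \<le> \<tau>")
    case False
    then have "\<tau> powr (q - 1) \<le> \<bar>t\<bar> powr (q - 1)" using assms(2) that by (intro powr_mono2) auto
    then have "\<tau> powr (1 - q) * \<tau> powr (q - 1) \<le> \<tau> powr (1 - q) * \<bar>t\<bar> powr (q - 1)"
      by (intro mult_left_mono) auto
    then have "1 \<le> \<tau> powr (1 - q) * \<bar>t\<bar> powr (q - 1)"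
      using that by (simp add: powr_add[symmetric])
    then have "\<bar>t\<bar> * 1 \<le> \<bar>t\<bar> * (\<tau> powr (1 - q) * \<bar>t\<bar> powr (q - 1))"
      by (intro mult_left_mono) auto
    also have "\<dots> = \<tau> powr (1 - q) * \<bar>t\<bar> powr q"
      using False that powr_mult_base[of "\<bar>t\<bar>" "q - 1"] by (simp add: mult.left_commute)
    finally show ?thesis using that by simp
  qed (simp add: add_increasing2)
  have int1: "integrable M (f k)" for k
  proof (rule Bochner_Integration.integrable_bound)
    show "integrable M (\<lambda>x. 1 + 1 powr (1 - q) * \<bar>f k x\<bar> powr q)"
      using int by simp
    show "AE x in M. norm (f k x) \<le> norm (1 + 1 powr (1 - q) * \<bar>f k x\<bar> powr q)"
      using le[of 1] by (intro AE_I2) simp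
  qed measurable
  have L1: "(\<integral>x. norm (f j x - f k x) \<partial>M)
      \<le> \<tau> * measure M (space M) + \<tau> powr (1 - q) * (\<integral>x. \<bar>f j x - f k x\<bar> powr q \<partial>M)"
    if "0 < \<tau>" for \<tau> j k
  proof -
    have "(\<integral>x. norm (f j x - f k x) \<partial>M) \<le> (\<integral>x. \<tau> + \<tau> powr (1 - q) * \<bar>f j x - f k x\<bar> powr q \<partial>M)"
      using le[OF that] intd int1 by (intro integral_mono) auto
    then show ?thesis using intd by (simp add: mult.commute)
  qed
  have "\<exists>n. \<forall>i\<ge>n. \<forall>j\<ge>n. (\<integral>x. norm (f i x - f j x) \<partial>M) < e" if "0 < e" for e
  proof -
    \<comment> \<open>This keeps the first term of \<open>L1\<close> below \<open>e / 2\<close>; the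
      added 1 covers the case of total mass 0.\<close>
    define \<tau> where "\<tau> = e / (2 * (measure M (space M) + 1))"
    have \<tau>: "0 < \<tau>" using that by (simp add: \<tau>_def add_nonneg_pos)
    have "0 < measure M (space M) + 1" by (simp add: add_nonneg_pos)
    then have "\<tau> * (measure M (space M) + 1) = e / 2" unfolding \<tau>_def by (metis mult.commute nonzero_eq_divide_eq divide_divide_eq_left less_numeral_extra(3))
    then have "\<tau> * measure M (space M) + \<tau> = e / 2" by (simp add: algebra_simps)
    then have small: "\<tau> * measure M (space M) < e / 2" using \<tau> by linarith
    have pos: "0 < e / 2 / \<tau> powr (1 - q)" using that \<tau> by simp
    obtain n where n: "\<forall>j\<ge>n. \<forall>k\<ge>n. (\<integral>x. \<bar>f j x - f k x\<bar> powr q \<partial>M) < e / 2 / \<tau> powr (1 - q)"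
      using cauchy[OF pos] by blast
    have "(\<integral>x. norm (f i x - f j x) \<partial>M) < e" if "i \<ge> n" "j \<ge> n" for i j
    proof -
      have "\<tau> powr (1 - q) * (\<integral>x. \<bar>f i x - f j x\<bar> powr q \<partial>M) < e / 2"
        using n[rule_format, OF that] \<tau> by (simp add: field_simps)
      then show ?thesis using L1[OF \<tau>, of i j] small by linarith
    qed
    then show ?thesis by blast
  qed
  then obtain r where r: "strict_mono r" "AE x in M. Cauchy (\<lambda>i. f (r i) x)"
    by (rule cauchy_L1_AE_cauchy_subseq[OF int1])
  define g where "g = (\<lambda>x. lim (\<lambda>i. f (r i) x))"
  have g [measurable]: "g \<in> borel_measurable M"
    unfolding g_def by measurable
  have conv: "AE x in M. (\<lambda>i. f (r i) x) \<longlonglongrightarrow> g x"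
    using r(2) by eventually_elim (simp add: g_def Cauchy_convergent_iff convergent_LIMSEQ_iff)
  have bd: "(\<integral>\<^sup>+x. \<bar>f k x - g x\<bar> powr q \<partial>M) \<le> ennreal e"
    if n: "0 < e" "\<forall>j\<ge>n. \<forall>k\<ge>n. (\<integral>x. \<bar>f j x - f k x\<bar> powr q \<partial>M) < e" "k \<ge> n" for e k n
  proof -
    have "(\<integral>\<^sup>+x. \<bar>f k x - g x\<bar> powr q \<partial>M) = (\<integral>\<^sup>+x. liminf (\<lambda>i. ennreal (\<bar>f k x - f (r i) x\<bar> powr q)) \<partial>M)"
    proof (rule nn_integral_cong_AE)
      show "AE x in M. ennreal (\<bar>f k x - g x\<bar> powr q) = liminf (\<lambda>i. ennreal (\<bar>f k x - f (r i) x\<bar> powr q))"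
        using conv
      proof eventually_elim
        fix x assume "(\<lambda>i. f (r i) x) \<longlonglongrightarrow> g x"
        then have "(\<lambda>i. ennreal (\<bar>f k x - f (r i) x\<bar> powr q)) \<longlonglongrightarrow> ennreal (\<bar>f k x - g x\<bar> powr q)"
          using assms(2) by (intro tendsto_ennrealI tendsto_powr' tendsto_intros) auto
        then show "ennreal (\<bar>f k x - g x\<bar> powr q) = liminf (\<lambda>i. ennreal (\<bar>f k x - f (r i) x\<bar> powr q))"
          by (rule lim_imp_Liminf[OF sequentially_bot, symmetric])
      qed
    qed
    also have "\<dots> \<le> liminf (\<lambda>i. \<integral>\<^sup>+x. ennreal (\<bar>f k x - f (r i) x\<bar> powr q) \<partial>M)"
      by (rule nn_integral_liminf) measurable
    also have "\<dots> \<le> limsup (\<lambda>i. \<integral>\<^sup>+x. ennreal (\<bar>f k x - f (r i) x\<bar> powr q) \<partial>M)"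
      by (rule Liminf_le_Limsup) simp
    also have "\<dots> \<le> ennreal e"
    proof (rule Limsup_bounded)
      have "\<forall>\<^sub>F i in sequentially. n \<le> i" by (rule eventually_ge_at_top)
      then show "\<forall>\<^sub>F i in sequentially. (\<integral>\<^sup>+x. ennreal (\<bar>f k x - f (r i) x\<bar> powr q) \<partial>M) \<le> ennreal e"
      proof eventually_elim
        fix i assume "n \<le> i"
        then have "n \<le> r i" using seq_suble[OF r(1), of i] by linarith
        then have "(\<integral>x. \<bar>f k x - f (r i) x\<bar> powr q \<partial>M) \<le> e" using n(2,3) by (meson less_imp_le)
        then show "(\<integral>\<^sup>+x. ennreal (\<bar>f k x - f (r i) x\<bar> powr q) \<partial>M) \<le> ennreal e"
          using intd by (subst nn_integral_eq_integral) (auto intro: ennreal_leI)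
      qed
    qed
    finally show ?thesis .
  qed
  have intg: "integrable M (\<lambda>x. \<bar>f k x - g x\<bar> powr q) \<and> (\<integral>x. \<bar>f k x - g x\<bar> powr q \<partial>M) \<le> e"
    if n: "0 < e" "\<forall>j\<ge>n. \<forall>k\<ge>n. (\<integral>x. \<bar>f j x - f k x\<bar> powr q \<partial>M) < e" "k \<ge> n" for e k n
  proof -
    have i: "integrable M (\<lambda>x. \<bar>f k x - g x\<bar> powr q)"
      using bd[OF n] by (intro integrableI_bounded) (auto simp: order_le_less_trans)
    moreover have "ennreal (\<integral>x. \<bar>f k x - g x\<bar> powr q \<partial>M) \<le> ennreal e"
      using bd[OF n] nn_integral_eq_integral[OF i] by simp
    ultimately show ?thesis using n(1) by simp
  qed
  obtain n where "\<forall>j\<ge>n. \<forall>k\<ge>n. (\<integral>x. \<bar>f j x - f k x\<bar> powr q \<partial>M) < 1" using cauchy[of 1] by auto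
  then have "integrable M (\<lambda>x. \<bar>f n x - g x\<bar> powr q)" using intg[of 1 n n] by simp
  from integrable_abs_powr_cmult[OF this, of "-1"]
  have "integrable M (\<lambda>x. \<bar>g x - f n x\<bar> powr q)" by simp
  from integrable_abs_powr_add[OF assms(2) _ _ this int[of n]]
  have "integrable M (\<lambda>x. \<bar>g x\<bar> powr q)" by simp
  moreover have "(\<lambda>k. \<integral>x. \<bar>f k x - g x\<bar> powr q \<partial>M) \<longlonglongrightarrow> 0"
  proof (rule LIMSEQ_I)
    fix e :: real assume "0 < e"
    then obtain n where n: "\<forall>j\<ge>n. \<forall>k\<ge>n. (\<integral>x. \<bar>f j x - f k x\<bar> powr q \<partial>M) < e/2"
      using cauchy[of "e/2"] by auto
    have "norm ((\<integral>x. \<bar>f k x - g x\<bar> powr q \<partial>M) - 0) < e" if "k \<ge> n" for k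
    proof -
      have "0 \<le> (\<integral>x. \<bar>f k x - g x\<bar> powr q \<partial>M)" by (rule integral_nonneg_AE) simp
      then show ?thesis using intg[OF _ n that] \<open>0 < e\<close> by simp
    qed
    then show "\<exists>n. \<forall>k\<ge>n. norm ((\<integral>x. \<bar>f k x - g x\<bar> powr q \<partial>M) - 0) < e" by blast
  qed
  ultimately show ?thesis using that g by blast
qed

text \<open>\<open>G\<close> is the graph of a linear functional. The functional is represented by
  \<open>\<alpha> q \<bar>g\<bar> powr (q - 1) sgn g\<close>, where \<open>g\<close> minimises
  \<open>f \<mapsto> \<alpha> \<integral>\<bar>f\<bar> powr q - a\<close> over the closure of the domain; this replaces the
  Hahn--Banach theorem and the duality of the \<open>L\<^sup>p\<close> spaces.\<close>

lemma Lq_functional_representation: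
  fixes M :: "'a measure" and G :: "(('a \<Rightarrow> real) \<times> real) set"
  assumes fin: "finite_measure M" and q: "1 < q" and ne: "G \<noteq> {}"
    and meas: "\<And>f a. (f, a) \<in> G \<Longrightarrow> f \<in> borel_measurable M"
    and int: "\<And>f a. (f, a) \<in> G \<Longrightarrow> integrable M (\<lambda>x. \<bar>f x\<bar> powr q)"
    and lin: "\<And>f a g b c. (f, a) \<in> G \<Longrightarrow> (g, b) \<in> G \<Longrightarrow> (\<lambda>x. f x + c * g x, a + c * b) \<in> G"
    and bound: "\<And>f a. (f, a) \<in> G \<Longrightarrow> a \<le> C + B * (\<integral>x. \<bar>f x\<bar> powr q \<partial>M)"
  obtains v where "v \<in> borel_measurable M" "integrable M (\<lambda>x. \<bar>v x\<bar> powr (q / (q - 1)))"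
    "\<And>f a. (f, a) \<in> G \<Longrightarrow> integrable M (\<lambda>x. v x * f x) \<and> a = (\<integral>x. v x * f x \<partial>M)"
proof -
  \<comment> \<open>Larger than the constant in \<open>bound\<close>, so that
    \<open>J (f, a) \<ge> I f - C\<close>: the functional is bounded below and its minimising
    sequences have bounded \<open>q\<close>-integrals.\<close>
  define A where "A = \<bar>B\<bar> + 1"
  have A: "0 < A" by (simp add: A_def)
  define I where "I = (\<lambda>f. \<integral>x. \<bar>f x\<bar> powr q \<partial>M)"
  define J where "J = (\<lambda>(f, a). A * I f - a)"
  have I_nonneg: "0 \<le> I f" for f unfolding I_def by (rule integral_nonneg_AE) simp
  have J_ge: "I f - C \<le> J (f, a)" if "(f, a) \<in> G" for f a
  proof -
    have "a \<le> C + \<bar>B\<bar> * I f"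
      using bound[OF that] mult_right_mono[OF abs_ge_self[of B] I_nonneg[of f]] by (simp add: I_def)
    then show ?thesis by (simp add: J_def A_def algebra_simps)
  qed
  define m where "m = Inf (J ` G)"
  have bdd: "bdd_below (J ` G)"
  proof (rule bdd_belowI[of _ "- C"])
    fix y assume "y \<in> J ` G"
    then obtain f a where "(f, a) \<in> G" "y = J (f, a)" by auto
    then show "- C \<le> y" using J_ge[of f a] I_nonneg[of f] by simp
  qed
  have m_le: "m \<le> J z" if "z \<in> G" for z
    unfolding m_def using that bdd by (intro cInf_lower) auto
  define \<delta> where "\<delta> = (\<lambda>k::nat. 1 / (real k + 1))"
  have \<delta>: "0 < \<delta> k" for k by (simp add: \<delta>_def add_nonneg_pos)
  have \<delta>0: "\<delta> \<longlonglongrightarrow> 0" unfolding \<delta>_def using LIMSEQ_inverse_real_of_nat by (simp add: inverse_eq_divide add.commute)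
  have "\<exists>z\<in>G. J z < m + \<delta> k" for k
    using cInf_lessD[of "J ` G" "m + \<delta> k"] ne \<delta>[of k] by (auto simp: m_def)
  then obtain z where z: "\<And>k. z k \<in> G" "\<And>k. J (z k) < m + \<delta> k" by metis
  define f where "f = (\<lambda>k. fst (z k))"
  define a where "a = (\<lambda>k. snd (z k))"
  have fG: "(f k, a k) \<in> G" for k using z by (simp add: f_def a_def)
  have fJ: "A * I (f k) - a k < m + \<delta> k" for k using z(2)[of k] by (simp add: f_def a_def J_def split_def)
  note [measurable] = meas[OF fG]
  define R where "R = m + 1 + C"
  have IR: "I (f k) \<le> R" for k
  proof -
    have "\<delta> k \<le> 1" by (simp add: \<delta>_def)
    then show ?thesis using J_ge[OF fG[of k]] fJ[of k] by (simp add: J_def R_def)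
  qed
  have midG: "(\<lambda>x. (f j x + f k x) / 2, (a j + a k) / 2) \<in> G" for j k
  proof -
    \<comment> \<open>\<open>lin\<close> offers only combinations \<open>f + c * g\<close>, so a
      function is halved by adding \<open>-1/2\<close> times itself.\<close>
    have "(\<lambda>x. f j x + (-1/2) * f j x, a j + (-1/2) * a j) \<in> G" by (rule lin[OF fG fG])
    from lin[OF this fG[of k], of "1/2"]
    have "(\<lambda>x. (f j x + (-1/2) * f j x) + (1/2) * f k x, (a j + (-1/2) * a j) + (1/2) * a k) \<in> G" .
    moreover have "(\<lambda>x. (f j x + (-1/2) * f j x) + (1/2) * f k x) = (\<lambda>x. (f j x + f k x) / 2)"
      by (rule ext) (simp add: field_simps)
    moreover have "(a j + (-1/2) * a j) + (1/2) * a k = (a j + a k) / 2" by (simp add: field_simps)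
    ultimately show ?thesis by metis
  qed
  \<comment> \<open>The midpoint has value at least \<open>m\<close>, and the linear parts
    \<open>a\<close> cancel, so near-minimality bounds the convexity gap of \<open>I\<close>
    alone.\<close>
  have gap: "A * ((I (f j) + I (f k)) / 2 - I (\<lambda>x. (f j x + f k x) / 2)) \<le> (\<delta> j + \<delta> k) / 2" for j k
    using m_le[OF midG[of j k]] fJ[of j] fJ[of k] by (simp add: J_def algebra_simps add_divide_distrib)
  have cauchy: "\<exists>n. \<forall>j\<ge>n. \<forall>k\<ge>n. (\<integral>x. \<bar>f j x - f k x\<bar> powr q \<partial>M) < e" if e: "0 < e" for e
  proof -
    have R0: "0 \<le> R" using IR[of 0] I_nonneg[of "f 0"] by linarith
    define \<eta> where "\<eta> = e / (4 * (R + 1))"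
    have \<eta>: "0 < \<eta>" using e R0 by (simp add: \<eta>_def)
    have "\<eta> * (2 * R) \<le> e / 2" using e R0 by (simp add: \<eta>_def field_simps)
    obtain c where c: "0 < c" "\<And>s t. \<bar>s - t\<bar> powr q \<le> \<eta> * (\<bar>s\<bar> powr q + \<bar>t\<bar> powr q)
     + c * ((\<bar>s\<bar> powr q + \<bar>t\<bar> powr q) / 2 - \<bar>(s + t) / 2\<bar> powr q)"
      by (rule abs_powr_midpoint_gap[OF q \<eta>]) blast
    have le: "(\<integral>x. \<bar>f j x - f k x\<bar> powr q \<partial>M) \<le> e / 2 + c * ((\<delta> j + \<delta> k) / 2 / A)" for j k
    proof -
      note ints = int[OF fG[of j]] int[OF fG[of k]] int[OF midG[of j k]]
      have intd: "integrable M (\<lambda>x. \<bar>f j x - f k x\<bar> powr q)"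
        using int[OF lin[OF fG[of j] fG[of k], of "-1"]] by simp
      have "(\<integral>x. \<bar>f j x - f k x\<bar> powr q \<partial>M) \<le> (\<integral>x. \<eta> * (\<bar>f j x\<bar> powr q + \<bar>f k x\<bar> powr q)
         + c * ((\<bar>f j x\<bar> powr q + \<bar>f k x\<bar> powr q) / 2 - \<bar>(f j x + f k x) / 2\<bar> powr q) \<partial>M)"
        using ints intd c(2) by (intro integral_mono) auto
      also have "\<dots> = \<eta> * (I (f j) + I (f k)) + c * ((I (f j) + I (f k)) / 2 - I (\<lambda>x. (f j x + f k x) / 2))"
        using ints by (simp add: I_def)
      also have "\<dots> \<le> \<eta> * (2 * R) + c * ((\<delta> j + \<delta> k) / 2 / A)"
      proof (intro add_mono mult_left_mono)
        show "I (f j) + I (f k) \<le> 2 * R" using IR[of j] IR[of k] by simp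
        show "(I (f j) + I (f k)) / 2 - I (\<lambda>x. (f j x + f k x) / 2) \<le> (\<delta> j + \<delta> k) / 2 / A"
          using gap[of j k] A by (simp add: pos_le_divide_eq mult.commute)
      qed (use \<eta> c in auto)
      finally show ?thesis using \<open>\<eta> * (2 * R) \<le> e / 2\<close> by linarith
    qed
    have "0 < e * A / (2 * c)" using e A c(1) by simp
    then have "\<forall>\<^sub>F k in sequentially. \<delta> k < e * A / (2 * c)"
      using \<delta>0 by (intro order_tendstoD(2))
    then obtain n where n: "\<And>k. n \<le> k \<Longrightarrow> \<delta> k < e * A / (2 * c)"
      by (auto simp: eventually_sequentially)
    have avg: "(s + t) / 2 < X" if "s < X" "t < X" for s t X :: real using that by simp
    have "(\<integral>x. \<bar>f j x - f k x\<bar> powr q \<partial>M) < e" if "j \<ge> n" "k \<ge> n" for j k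
    proof -
      have "(\<delta> j + \<delta> k) / 2 < e * A / (2 * c)" using n[OF that(1)] n[OF that(2)] by (rule avg)
      then have "c * ((\<delta> j + \<delta> k) / 2 / A) < e / 2" using A c(1) by (simp add: field_simps)
      then show ?thesis using le[of j k] by linarith
    qed
    then show ?thesis by blast
  qed
  obtain g where g [measurable]: "g \<in> borel_measurable M" and gint: "integrable M (\<lambda>x. \<bar>g x\<bar> powr q)"
    and glim: "(\<lambda>k. \<integral>x. \<bar>f k x - g x\<bar> powr q \<partial>M) \<longlonglongrightarrow> 0"
    by (rule Lq_Cauchy_limit[OF fin q meas[OF fG] int[OF fG] cauchy])
  have dint: "integrable M (\<lambda>x. \<bar>f k x - g x\<bar> powr q)" for k
    using integrable_abs_powr_add[OF q meas[OF fG[of k]] _ int[OF fG[of k]] integrable_abs_powr_cmult[OF gint, of "-1"]] by simp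
  define v where "v = (\<lambda>x. A * q * signed_powr (q - 1) (g x))"
  \<comment> \<open>The limit \<open>g\<close> need not come from an element of \<open>G\<close>, so
    minimality is tested with \<open>f k + t * h\<close>. Its \<open>q\<close>-integral and that of
    \<open>f k\<close> are exchanged for those of \<open>g + t * h\<close> and \<open>g\<close> at
    the cost of factors \<open>1 + \<eta>\<close> and of multiples of \<open>E k\<close>. The limit
    in \<open>k\<close> is taken first, then \<open>\<eta>\<close> runs through the null sequence
    \<open>\<delta>\<close>.\<close>
  have step: "t * b \<le> A * (I (\<lambda>x. g x + t * h x) - I g)" if hb: "(h, b) \<in> G" for h b t
  proof -
    note [measurable] = meas[OF hb]
    have gth: "integrable M (\<lambda>x. \<bar>g x + t * h x\<bar> powr q)"
      by (intro integrable_abs_powr_add q gint integrable_abs_powr_cmult int[OF hb]) measurable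
    have ineq: "0 \<le> A * (1 + \<eta>) * I (\<lambda>x. g x + t * h x) - A * I g / (1 + \<eta>) - t * b" if \<eta>: "0 < \<eta>" for \<eta>
    proof -
      obtain c where c: "0 \<le> c" "\<And>s t. \<bar>s + t\<bar> powr q \<le> (1 + \<eta>) * \<bar>s\<bar> powr q + c * \<bar>t\<bar> powr q"
        by (rule abs_add_powr_le_perturb[OF q \<eta>]) blast
      define E where "E = (\<lambda>k. \<integral>x. \<bar>f k x - g x\<bar> powr q \<partial>M)"
      have k: "0 \<le> A * ((1 + \<eta>) * I (\<lambda>x. g x + t * h x) + c * E k) + \<delta> k - A * ((I g - c * E k) / (1 + \<eta>)) - t * b" for k
      proof -
        have G: "(\<lambda>x. f k x + t * h x, a k + t * b) \<in> G" by (rule lin[OF fG hb])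
        have "I (\<lambda>x. f k x + t * h x) \<le> (\<integral>x. (1 + \<eta>) * \<bar>g x + t * h x\<bar> powr q + c * \<bar>f k x - g x\<bar> powr q \<partial>M)"
          unfolding I_def
        proof (intro integral_mono int[OF G])
          fix x show "\<bar>f k x + t * h x\<bar> powr q \<le> (1 + \<eta>) * \<bar>g x + t * h x\<bar> powr q + c * \<bar>f k x - g x\<bar> powr q"
            using c(2)[of "g x + t * h x" "f k x - g x"] by (simp add: algebra_simps)
        qed (use gth dint in simp)
        also have "\<dots> = (1 + \<eta>) * I (\<lambda>x. g x + t * h x) + c * E k"
          using gth dint by (simp add: I_def E_def)
        finally have 1: "A * I (\<lambda>x. f k x + t * h x) \<le> A * ((1 + \<eta>) * I (\<lambda>x. g x + t * h x) + c * E k)"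
          using A by (intro mult_left_mono) auto
        have "I g \<le> (\<integral>x. (1 + \<eta>) * \<bar>f k x\<bar> powr q + c * \<bar>f k x - g x\<bar> powr q \<partial>M)"
          unfolding I_def
        proof (intro integral_mono gint)
          fix x show "\<bar>g x\<bar> powr q \<le> (1 + \<eta>) * \<bar>f k x\<bar> powr q + c * \<bar>f k x - g x\<bar> powr q"
            using c(2)[of "f k x" "g x - f k x"] by (simp add: abs_minus_commute)
        qed (use int[OF fG] dint in simp)
        also have "\<dots> = (1 + \<eta>) * I (f k) + c * E k"
          using int[OF fG] dint by (simp add: I_def E_def)
        finally have "(I g - c * E k) / (1 + \<eta>) \<le> I (f k)" using \<eta> by (simp add: field_simps)
        then have 2: "A * ((I g - c * E k) / (1 + \<eta>)) \<le> A * I (f k)" using A by (intro mult_left_mono) auto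
        have "m \<le> A * I (\<lambda>x. f k x + t * h x) - (a k + t * b)" using m_le[OF G] by (simp add: J_def)
        then show ?thesis using 1 2 fJ[of k] by linarith
      qed
      have "(\<lambda>k. A * ((1 + \<eta>) * I (\<lambda>x. g x + t * h x) + c * E k) + \<delta> k - A * ((I g - c * E k) / (1 + \<eta>)) - t * b)
         \<longlonglongrightarrow> A * ((1 + \<eta>) * I (\<lambda>x. g x + t * h x) + c * 0) + 0 - A * ((I g - c * 0) / (1 + \<eta>)) - t * b"
        using glim \<delta>0 \<eta> unfolding E_def by (intro tendsto_intros) auto
      from LIMSEQ_le_const[OF this, of 0] k
      have "0 \<le> A * ((1 + \<eta>) * I (\<lambda>x. g x + t * h x) + c * 0) + 0 - A * ((I g - c * 0) / (1 + \<eta>)) - t * b"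
        by blast
      then show ?thesis by (simp add: mult.assoc)
    qed
    have "(\<lambda>k. A * (1 + \<delta> k) * I (\<lambda>x. g x + t * h x) - A * I g / (1 + \<delta> k) - t * b)
       \<longlonglongrightarrow> A * (1 + 0) * I (\<lambda>x. g x + t * h x) - A * I g / (1 + 0) - t * b"
      using \<delta>0 by (intro tendsto_intros) auto
    from LIMSEQ_le_const[OF this, of 0] ineq[OF \<delta>]
    have "0 \<le> A * (1 + 0) * I (\<lambda>x. g x + t * h x) - A * I g / (1 + 0) - t * b" by blast
    then show ?thesis by (simp add: algebra_simps)
  qed
  have upper: "integrable M (\<lambda>x. v x * h x) \<and> b \<le> (\<integral>x. v x * h x \<partial>M)" if hb: "(h, b) \<in> G" for h b
  proof -
    note [measurable] = meas[OF hb]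
    \<comment> \<open>\<open>F t\<close> is the derivative of
      \<open>A * \<bar>g x + u * h x\<bar> powr q\<close> with respect to \<open>u\<close> at
      \<open>u = t\<close>, and \<open>D\<close> dominates it for \<open>0 \<le> t \<le> 1\<close>.
      Dividing \<open>step\<close> by \<open>t\<close> and letting \<open>t\<close> tend to 0 yields
      the inequality at \<open>F 0\<close>.\<close>
    define F where "F = (\<lambda>t x. A * q * (h x * signed_powr (q - 1) (g x + t * h x)))"
    define D where "D = (\<lambda>x. A * q * (2 powr q * (\<bar>g x\<bar> powr q + \<bar>h x\<bar> powr q)))"
    have D: "integrable M D" unfolding D_def using gint int[OF hb] by simp
    have FD: "norm (F t x) \<le> D x" if "0 \<le> t" "t \<le> 1" for t x
    proof -
      have th: "\<bar>t * h x\<bar> \<le> \<bar>h x\<bar>" using that by (simp add: abs_mult mult_left_le_one_le)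
      have "\<bar>h x\<bar> * \<bar>g x + t * h x\<bar> powr (q - 1) \<le> (\<bar>g x\<bar> + \<bar>h x\<bar>) * (\<bar>g x\<bar> + \<bar>h x\<bar>) powr (q - 1)"
        using q th by (intro mult_mono powr_mono2) auto
      also have "\<dots> = (\<bar>g x\<bar> + \<bar>h x\<bar>) powr q"
        using powr_mult_base[of "\<bar>g x\<bar> + \<bar>h x\<bar>" "q - 1"] by simp
      also have "\<dots> \<le> 2 powr q * (\<bar>g x\<bar> powr q + \<bar>h x\<bar> powr q)" by (rule abs_add_powr_le[OF q])
      finally show ?thesis
        using A q by (simp add: F_def D_def abs_mult abs_signed_powr)
    qed
    have Fint: "integrable M (F t)" if "0 \<le> t" "t \<le> 1" for t
    proof (rule Bochner_Integration.integrable_bound[OF D])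
      show "F t \<in> borel_measurable M" unfolding F_def by measurable
      show "AE x in M. norm (F t x) \<le> norm (D x)"
        using FD[OF that] abs_ge_self[of "D _"] order_trans by (intro AE_I2) (simp, blast)
    qed
    have le: "b \<le> (\<integral>x. F t x \<partial>M)" if t: "0 < t" "t \<le> 1" for t
    proof -
      have gth: "integrable M (\<lambda>x. \<bar>g x + t * h x\<bar> powr q)"
        by (intro integrable_abs_powr_add q gint integrable_abs_powr_cmult int[OF hb]) measurable
      have "t * b \<le> A * (I (\<lambda>x. g x + t * h x) - I g)" by (rule step[OF hb])
      also have "\<dots> = (\<integral>x. A * (\<bar>g x + t * h x\<bar> powr q - \<bar>g x\<bar> powr q) \<partial>M)"
        using gth gint by (simp add: I_def)
      also have "\<dots> \<le> (\<integral>x. t * F t x \<partial>M)"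
      proof (intro integral_mono)
        show "integrable M (\<lambda>x. t * F t x)" using Fint[of t] t by simp
        fix x
        have "\<bar>g x + t * h x\<bar> powr q - \<bar>g x\<bar> powr q \<le> q * (t * h x) * signed_powr (q - 1) (g x + t * h x)"
          using abs_powr_tangent[OF q, of "g x + t * h x" "g x"] by simp
        then have "A * (\<bar>g x + t * h x\<bar> powr q - \<bar>g x\<bar> powr q) \<le> A * (q * (t * h x) * signed_powr (q - 1) (g x + t * h x))"
          using A by (intro mult_left_mono) auto
        then show "A * (\<bar>g x + t * h x\<bar> powr q - \<bar>g x\<bar> powr q) \<le> t * F t x"
          by (simp add: F_def mult_ac)
      qed (use gth gint in simp)
      finally show ?thesis using t by simp
    qed
    have "(\<lambda>k. \<integral>x. F (\<delta> k) x \<partial>M) \<longlonglongrightarrow> (\<integral>x. F 0 x \<partial>M)"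
    proof (rule integral_dominated_convergence[where w=D])
      show "AE x in M. (\<lambda>k. F (\<delta> k) x) \<longlonglongrightarrow> F 0 x"
      proof (intro AE_I2)
        fix x
        have "(\<lambda>k. g x + \<delta> k * h x) \<longlonglongrightarrow> g x + 0 * h x" by (intro tendsto_intros \<delta>0)
        then have "(\<lambda>k. signed_powr (q - 1) (g x + \<delta> k * h x)) \<longlonglongrightarrow> signed_powr (q - 1) (g x + 0 * h x)"
          using q by (intro isCont_tendsto_compose[OF continuous_signed_powr, rotated]) auto
        then show "(\<lambda>k. F (\<delta> k) x) \<longlonglongrightarrow> F 0 x" unfolding F_def by (intro tendsto_intros)
      qed
      show "AE x in M. norm (F (\<delta> k) x) \<le> D x" for k
        using \<delta>[of k] by (intro AE_I2 FD) (auto simp: \<delta>_def)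
    qed (use D in \<open>auto simp: F_def\<close>)
    then have "b \<le> (\<integral>x. F 0 x \<partial>M)"
    proof (rule LIMSEQ_le_const)
      show "\<exists>n. \<forall>k\<ge>n. b \<le> (\<integral>x. F (\<delta> k) x \<partial>M)"
        using \<delta> by (intro exI[of _ 0] allI impI le) (auto simp: \<delta>_def)
    qed
    moreover have "F 0 = (\<lambda>x. v x * h x)" by (auto simp: F_def v_def)
    ultimately show ?thesis using Fint[of 0] by simp
  qed
  have "integrable M (\<lambda>x. v x * h x) \<and> b = (\<integral>x. v x * h x \<partial>M)" if hb: "(h, b) \<in> G" for h b
  proof -
    \<comment> \<open>This is the element \<open>(- h, - b)\<close> of \<open>G\<close>; its upper
      bound is the lower bound for \<open>(h, b)\<close>.\<close>
    have "(\<lambda>x. h x + (-2) * h x, b + (-2) * b) \<in> G" by (rule lin[OF hb hb])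
    moreover have "(\<lambda>x. h x + (-2) * h x) = (\<lambda>x. - h x)" by auto
    ultimately have "(\<lambda>x. - h x, - b) \<in> G" by simp
    from upper[OF this] upper[OF hb] show ?thesis by simp
  qed
  moreover have "v \<in> borel_measurable M" unfolding v_def by measurable
  moreover have "integrable M (\<lambda>x. \<bar>v x\<bar> powr (q / (q - 1)))"
  proof -
    have "\<bar>v x\<bar> powr (q / (q - 1)) = (A * q) powr (q / (q - 1)) * \<bar>g x\<bar> powr q" for x
      using A q by (simp add: v_def abs_mult abs_signed_powr powr_mult powr_powr)
    then show ?thesis using gint by simp
  qed
  ultimately show ?thesis using that by blast
qed


section \<open>Surface measure of Lipschitz boundaries\<close>

text \<open>Padding a finite cover with \<open>{}\<close> is free, the gauge of \<open>{}\<close>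
  being 0 for every \<open>s\<close>.\<close>

lemma hausdorff_pre_le_finite:
  assumes P: "finite P" and A: "A \<subseteq> (\<Union>p\<in>P. C p)"
    and b: "\<And>p. p \<in> P \<Longrightarrow> bounded (C p) \<and> diameter (C p) \<le> \<delta>" and \<delta>: "0 \<le> \<delta>"
  shows "hausdorff_pre s \<delta> A \<le> (\<Sum>p\<in>P. hausdorff_gauge s (C p))"
proof -
  obtain h where h: "bij_betw h {0..<card P} P"
    using ex_bij_betw_nat_finite[OF P] by blast
  define E where "E = (\<lambda>i. if i < card P then C (h i) else {})"
  have hP: "h i \<in> P" if "i < card P" for i
    using h that by (auto simp: bij_betw_def)
  have "A \<subseteq> (\<Union>i. E i)"
  proof
    fix x assume "x \<in> A"
    then obtain p where "p \<in> P" "x \<in> C p" using A by blast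
    moreover have "p \<in> h ` {0..<card P}" using h \<open>p \<in> P\<close> by (simp add: bij_betw_imp_surj_on)
    then obtain i where "i < card P" "p = h i" by auto
    ultimately show "x \<in> (\<Union>i. E i)" by (auto simp: E_def intro!: exI[of _ i])
  qed
  then have "hausdorff_pre s \<delta> A \<le> (\<Sum>i. hausdorff_gauge s (E i))"
    by (rule hausdorff_pre_le) (use b hP \<delta> in \<open>auto simp: E_def\<close>)
  also have "\<dots> = (\<Sum>i\<in>{0..<card P}. hausdorff_gauge s (E i))"
    by (rule suminf_finite) (auto simp: E_def hausdorff_gauge_def)
  also have "\<dots> = (\<Sum>i\<in>{0..<card P}. hausdorff_gauge s (C (h i)))"
    by (rule sum.cong) (auto simp: E_def)
  also have "\<dots> = (\<Sum>p\<in>P. hausdorff_gauge s (C p))"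
    by (rule sum.reindex_bij_betw[OF h])
  finally show ?thesis .
qed

text \<open>A grid of \<open>k ^ s\<close> cubes of side \<open>h = 2 * R / k\<close> covers the
  set. The sum of the gauges is at most a constant times
  \<open>k ^ s * (d * h / 2) ^ s = (d * R) ^ s\<close>, which depends neither on \<open>k\<close>
  nor on \<open>\<delta>\<close>.\<close>

lemma hausdorff_outer_coordinate_hyperplane:
  fixes j :: "'n::finite"
  shows "hausdorff_outer (CARD('n) - 1) {x :: real ^ 'n. x $ j = 0 \<and> norm x < R} < top"
proof (cases "0 < R")
  case False
  have *: "{x :: real ^ 'n. x $ j = 0 \<and> norm x < R} = {}"
    using False norm_ge_zero by (smt (verit, best) Collect_empty_eq)
  show ?thesis unfolding * by simp
next
  case R: True
  define s where "s = CARD('n) - 1"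
  define d where "d = real CARD('n)"
  have d: "1 \<le> d" by (simp add: d_def Suc_le_eq)
  let ?A = "{x :: real ^ 'n. x $ j = 0 \<and> norm x < R}"
  have "hausdorff_outer s ?A \<le> ennreal (unit_ball_vol (real s) * (d * R) ^ s)"
  proof (rule hausdorff_outer_least)
    fix \<delta> :: real assume \<delta>: "0 < \<delta>"
    \<comment> \<open>Fine enough for \<open>d * h \<le> \<delta>\<close>; here \<open>d * h\<close>
      bounds the diameter of a grid cube through the 1-norm.\<close>
    obtain k :: nat where k: "2 * R * d / \<delta> < real k" using reals_Archimedean2 by blast
    have k0: "0 < real k" using k R d \<delta> by (smt (verit, best) divide_nonneg_pos mult_nonneg_nonneg)
    define h where "h = 2 * R / real k"
    have h: "0 < h" using R k0 by (simp add: h_def)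
    have kh: "real k * h = 2 * R" using k0 by (simp add: h_def)
    have dh: "d * h \<le> \<delta>" using k k0 \<delta> by (simp add: h_def field_simps)
    define P where "P = PiE (UNIV - {j}) (\<lambda>_. {..<k})"
    have P: "finite P" "card P = k ^ s"
      by (auto simp: P_def s_def card_PiE card_Diff_singleton intro!: finite_PiE)
    define C where "C = (\<lambda>p. {x :: real ^ 'n. x $ j = 0 \<and> (\<forall>i. i \<noteq> j \<longrightarrow> - R + real (p i) * h \<le> x $ i \<and> x $ i \<le> - R + real (p i) * h + h)})"
    have cover: "?A \<subseteq> (\<Union>p\<in>P. C p)"
    proof
      fix x assume x: "x \<in> ?A"
      \<comment> \<open>The index of the grid cube that contains \<open>x\<close>. The value at
        \<open>j\<close> has to be \<open>undefined\<close>, as for every member of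
        \<open>PiE\<close> outside its domain.\<close>
      define p where "p = (\<lambda>i. if i = j then undefined else nat \<lfloor>(x $ i + R) / h\<rfloor>)"
      have pi: "real (p i) \<le> (x $ i + R) / h \<and> (x $ i + R) / h < real (p i) + 1 \<and> p i < k" if "i \<noteq> j" for i
      proof -
        have xi: "\<bar>x $ i\<bar> < R" using x component_le_norm_cart[of x i] by auto
        then have pos: "0 \<le> (x $ i + R) / h" using h by simp
        have lt: "(x $ i + R) / h < real k" using xi h kh by (simp add: divide_less_eq)
        have e: "p i = nat \<lfloor>(x $ i + R) / h\<rfloor>" using that by (simp add: p_def)
        have "real (p i) = of_int \<lfloor>(x $ i + R) / h\<rfloor>" using pos unfolding e by simp
        then have "real (p i) \<le> (x $ i + R) / h" "(x $ i + R) / h < real (p i) + 1" by linarith+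
        moreover have "p i < k" using calculation(1) lt by linarith
        ultimately show ?thesis by blast
      qed
      have "p \<in> P" unfolding P_def using pi by (intro PiE_I) (auto simp: p_def)
      moreover have "x \<in> C p"
      proof -
        have "- R + real (p i) * h \<le> x $ i \<and> x $ i \<le> - R + real (p i) * h + h" if "i \<noteq> j" for i
        proof -
          have "real (p i) * h \<le> x $ i + R" using pi[OF that] h by (simp add: pos_le_divide_eq)
          moreover have "x $ i + R < (real (p i) + 1) * h" using pi[OF that] h by (simp add: pos_divide_less_eq)
          ultimately show ?thesis by (simp add: algebra_simps)
        qed
        then show ?thesis using x by (auto simp: C_def)
      qed
      ultimately show "x \<in> (\<Union>p\<in>P. C p)" by blast
    qed
    have dist: "dist x y \<le> d * h" if "x \<in> C p" "y \<in> C p" for x y p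
    proof -
      have "\<bar>(x - y) $ i\<bar> \<le> h" for i
        using that h by (cases "i = j") (auto simp: C_def abs_le_iff, (smt (verit))+)
      then have "(\<Sum>i\<in>UNIV. \<bar>(x - y) $ i\<bar>) \<le> (\<Sum>i\<in>(UNIV::'n set). h)" by (intro sum_mono) auto
      then show ?thesis using norm_le_l1_cart[of "x - y"] by (simp add: dist_norm d_def)
    qed
    have bd: "bounded (C p)" for p
      unfolding bounded_two_points using dist by blast
    have diam: "diameter (C p) \<le> d * h" for p
      using dist[of _ p] d h diameter_le_dist[of "C p" "d * h"] by (cases "C p = {}") auto
    have "hausdorff_pre s \<delta> ?A \<le> (\<Sum>p\<in>P. hausdorff_gauge s (C p))"
    proof (rule hausdorff_pre_le_finite[OF P(1) cover _ less_imp_le[OF \<delta>]])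
      show "bounded (C p) \<and> diameter (C p) \<le> \<delta>" for p using diam[of p] dh bd[of p] by linarith
    qed
    also have "\<dots> \<le> (\<Sum>p\<in>P. ennreal (unit_ball_vol (real s) * (d * h / 2) ^ s))"
    proof (rule sum_mono)
      fix p
      have "(diameter (C p) / 2) ^ s \<le> (d * h / 2) ^ s"
        using diam[of p] diameter_ge_0[OF bd[of p]] by (intro power_mono) auto
      then show "hausdorff_gauge s (C p) \<le> ennreal (unit_ball_vol (real s) * (d * h / 2) ^ s)"
        by (auto simp: hausdorff_gauge_def intro!: ennreal_leI mult_left_mono)
    qed
    also have "\<dots> = ennreal (real (k ^ s) * (unit_ball_vol (real s) * (d * h / 2) ^ s))"
      by (simp add: P ennreal_of_nat_eq_real_of_nat ennreal_mult'[symmetric])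
    also have "real (k ^ s) * (unit_ball_vol (real s) * (d * h / 2) ^ s) = unit_ball_vol (real s) * (d * R) ^ s"
    proof -
      have "d * R = real k * (d * h / 2)" using kh by (simp add: algebra_simps)
      then have "(d * R) ^ s = real k ^ s * (d * h / 2) ^ s" by (simp only: power_mult_distrib[of "real k"])
      then show ?thesis by (simp only: of_nat_power mult.left_commute)
    qed
    finally show "hausdorff_pre s \<delta> ?A \<le> ennreal (unit_ball_vol (real s) * (d * R) ^ s)" .
  qed
  then show ?thesis unfolding s_def using ennreal_less_top order_le_less_trans by blast
qed

text \<open>Inside the ball, the points strictly above the graph form an open subset of
  \<open>S\<close>, and those strictly below form an open set that misses \<open>S\<close>, hence
  also its closure. Neither set contains a frontier point, whichever points of the graph belong to
  \<open>S\<close>.\<close>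

lemma frontier_subset_graph:
  fixes S :: "'a::euclidean_space set" and \<gamma> :: "'a \<Rightarrow> real"
  assumes L: "L-lipschitz_on {y. y \<bullet> e = 0} \<gamma>" and e: "norm e = 1"
    and lo: "{y \<in> ball z \<rho>. \<gamma> (y - (y \<bullet> e) *\<^sub>R e) < y \<bullet> e} \<subseteq> S \<inter> ball z \<rho>"
    and up: "S \<inter> ball z \<rho> \<subseteq> {y \<in> ball z \<rho>. \<gamma> (y - (y \<bullet> e) *\<^sub>R e) \<le> y \<bullet> e}"
  shows "frontier S \<inter> ball z \<rho> \<subseteq> {y \<in> ball z \<rho>. y \<bullet> e = \<gamma> (y - (y \<bullet> e) *\<^sub>R e)}"
proof
  have ee: "e \<bullet> e = 1" using e by (simp add: dot_square_norm)
  have cont: "continuous_on UNIV (\<lambda>y. \<gamma> (y - (y \<bullet> e) *\<^sub>R e))"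
    by (rule continuous_on_compose2[OF lipschitz_on_continuous_on[OF L]])
       (auto intro!: continuous_intros simp: inner_diff_left ee)
  fix y assume y: "y \<in> frontier S \<inter> ball z \<rho>"
  have "\<not> \<gamma> (y - (y \<bullet> e) *\<^sub>R e) < y \<bullet> e"
  proof
    assume less: "\<gamma> (y - (y \<bullet> e) *\<^sub>R e) < y \<bullet> e"
    have "open ({y. \<gamma> (y - (y \<bullet> e) *\<^sub>R e) < y \<bullet> e} \<inter> ball z \<rho>)"
      by (intro open_Int open_Collect_less cont open_ball continuous_intros)
    then have "y \<in> interior S"
      using less y lo by (intro interiorI) auto
    then show False using y by (simp add: frontier_def)
  qed
  moreover have "\<not> y \<bullet> e < \<gamma> (y - (y \<bullet> e) *\<^sub>R e)"
  proof
    assume less: "y \<bullet> e < \<gamma> (y - (y \<bullet> e) *\<^sub>R e)"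
    have op: "open ({y. y \<bullet> e < \<gamma> (y - (y \<bullet> e) *\<^sub>R e)} \<inter> ball z \<rho>)"
      by (intro open_Int open_Collect_less cont open_ball continuous_intros)
    have "({y. y \<bullet> e < \<gamma> (y - (y \<bullet> e) *\<^sub>R e)} \<inter> ball z \<rho>) \<inter> S = {}"
      using up by fastforce
    then have "({y. y \<bullet> e < \<gamma> (y - (y \<bullet> e) *\<^sub>R e)} \<inter> ball z \<rho>) \<inter> closure S = {}"
      using open_Int_closure_eq_empty[OF op] by blast
    then show False using less y by (auto simp: frontier_def)
  qed
  ultimately show "y \<in> {y \<in> ball z \<rho>. y \<bullet> e = \<gamma> (y - (y \<bullet> e) *\<^sub>R e)}" using y by auto
qed

text \<open>An orthogonal map that sends a coordinate axis to \<open>e\<close> brings the hyperplane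
  orthogonal to \<open>e\<close> into the form for which the grid covering is available. Adding
  \<open>\<gamma>\<close> in direction \<open>e\<close> then gives a map with Lipschitz constant
  \<open>1 + L\<close>.\<close>

lemma lipschitz_graph_parametrisation:
  fixes e z :: "real ^ 'n" and \<gamma> :: "real ^ 'n \<Rightarrow> real"
  assumes L: "L-lipschitz_on {y. y \<bullet> e = 0} \<gamma>" and e: "norm e = 1"
  obtains j :: 'n and G :: "real ^ 'n \<Rightarrow> real ^ 'n" and R B :: real where "0 < B"
    "{y \<in> ball z \<rho>. y \<bullet> e = \<gamma> (y - (y \<bullet> e) *\<^sub>R e)} \<subseteq> G ` {x. x $ j = 0 \<and> norm x < R}"
    "\<And>x y. x $ j = 0 \<Longrightarrow> y $ j = 0 \<Longrightarrow> dist (G x) (G y) \<le> B * dist x y"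
proof -
  have ee: "e \<bullet> e = 1" using e by (simp add: dot_square_norm)
  \<comment> \<open>Any coordinate will do; this only names an element of the type
    \<open>'n\<close>.\<close>
  obtain j :: 'n where True by simp
  obtain f :: "real ^ 'n \<Rightarrow> real ^ 'n" where f: "orthogonal_transformation f" "f (axis j 1) = e"
    by (rule orthogonal_transformation_exists_1[OF norm_axis_1[of j] e]) blast
  have fn: "norm (f x) = norm x" for x using f(1) by (simp add: orthogonal_transformation_norm)
  have fl: "linear f" using f(1) by (simp add: orthogonal_transformation_linear)
  have fj: "f x \<bullet> e = x $ j" for x
    using f by (metis cart_eq_inner_axis orthogonal_transformation_def)
  define G where "G = (\<lambda>x. f x + \<gamma> (f x) *\<^sub>R e)"
  have lip: "dist (G x) (G y) \<le> (1 + L) * dist x y" if "x $ j = 0" "y $ j = 0" for x y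
  proof -
    have "dist (\<gamma> (f x)) (\<gamma> (f y)) \<le> L * dist (f x) (f y)"
      using lipschitz_onD[OF L, of "f x" "f y"] that by (simp add: fj)
    moreover have fd: "dist (f x) (f y) = dist x y"
      by (metis dist_norm fl fn linear_diff)
    moreover have "dist (G x) (G y) \<le> dist (f x) (f y) + dist (\<gamma> (f x) *\<^sub>R e) (\<gamma> (f y) *\<^sub>R e)"
      unfolding G_def by (rule dist_triangle_add)
    moreover have "dist (\<gamma> (f x) *\<^sub>R e) (\<gamma> (f y) *\<^sub>R e) = dist (\<gamma> (f x)) (\<gamma> (f y))"
      by (simp add: dist_norm e scaleR_diff_left[symmetric])
    ultimately show ?thesis by (simp add: algebra_simps)
  qed
  have sub: "{y \<in> ball z \<rho>. y \<bullet> e = \<gamma> (y - (y \<bullet> e) *\<^sub>R e)} \<subseteq> G ` {x. x $ j = 0 \<and> norm x < norm z + \<rho>}"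
  proof
    fix y assume y: "y \<in> {y \<in> ball z \<rho>. y \<bullet> e = \<gamma> (y - (y \<bullet> e) *\<^sub>R e)}"
    define u where "u = y - (y \<bullet> e) *\<^sub>R e"
    have ue: "u \<bullet> e = 0" by (simp add: u_def inner_diff_left ee)
    obtain x where x: "f x = u" using orthogonal_transformation_surj[OF f(1)] by (metis surjD)
    have "x $ j = 0" using fj[of x] x ue by simp
    moreover have "norm x < norm z + \<rho>"
    proof -
      have "u \<bullet> u \<le> y \<bullet> y"
        by (simp add: u_def inner_diff_left inner_diff_right ee inner_commute)
      then have "norm u \<le> norm y" by (simp add: norm_le)
      moreover have "norm y < norm z + \<rho>"
        using y norm_triangle_ineq2[of y z] by (simp add: dist_norm norm_minus_commute)
      ultimately show ?thesis using fn[of x] x by simp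
    qed
    moreover have "y = G x" using y by (simp add: G_def x) (simp add: u_def)
    ultimately show "y \<in> G ` {x. x $ j = 0 \<and> norm x < norm z + \<rho>}" by blast
  qed
  have "0 < 1 + L" using lipschitz_on_nonneg[OF L] by simp
  then show ?thesis using that[OF _ sub lip] by blast
qed

text \<open>Near each of its points the frontier is contained in a Lipschitz image of a bounded
  piece of a hyperplane; compactness leaves finitely many pieces. The same pieces serve twice:
  finite surface measure is wanted for \<open>\<Gamma>\<close>, Lebesgue measure zero for the
  boundary of \<open>\<Omega>\<close>.\<close>

lemma lipschitz_frontier_pieces:
  fixes S :: "(real ^ 'n) set"
  assumes S: "lipschitz_boundary S" "bounded S"
  obtains F where "finite F" "frontier S \<subseteq> \<Union>F"
    "\<And>T. T \<in> F \<Longrightarrow> hausdorff_outer (CARD('n) - 1) T < top \<and> negligible T"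
proof -
  have piece: "\<exists>\<rho>>0. hausdorff_outer (CARD('n) - 1) (frontier S \<inter> ball z \<rho>) < top \<and> negligible (frontier S \<inter> ball z \<rho>)"
    if z: "z \<in> frontier S" for z
  proof -
    obtain \<rho> e \<gamma> L where *: "\<rho> > 0" "norm e = 1" "L-lipschitz_on {y. y \<bullet> e = 0} (\<gamma> :: real^'n \<Rightarrow> real)"
        "{y \<in> ball z \<rho>. \<gamma> (y - (y \<bullet> e) *\<^sub>R e) < y \<bullet> e} \<subseteq> S \<inter> ball z \<rho>"
        "S \<inter> ball z \<rho> \<subseteq> {y \<in> ball z \<rho>. \<gamma> (y - (y \<bullet> e) *\<^sub>R e) \<le> y \<bullet> e}"
      using S(1) z unfolding lipschitz_boundary_def by blast
    obtain j :: 'n and G R B where G: "0 < B"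
      "{y \<in> ball z \<rho>. y \<bullet> e = \<gamma> (y - (y \<bullet> e) *\<^sub>R e)} \<subseteq> G ` {x. x $ j = 0 \<and> norm x < R}"
      "\<And>x y :: real^'n. x $ j = 0 \<Longrightarrow> y $ j = 0 \<Longrightarrow> dist (G x) (G y :: real^'n) \<le> B * dist x y"
      by (rule lipschitz_graph_parametrisation[OF *(3,2)]) blast
    let ?T = "{x :: real^'n. x $ j = 0 \<and> norm x < R}"
    have sub: "frontier S \<inter> ball z \<rho> \<subseteq> G ` ?T"
      using frontier_subset_graph[OF *(3,2,4,5)] G(2) by blast
    have "hausdorff_outer (CARD('n) - 1) (frontier S \<inter> ball z \<rho>) \<le> ennreal (B ^ (CARD('n) - 1)) * hausdorff_outer (CARD('n) - 1) ?T"
      by (rule order_trans[OF hausdorff_outer_mono[OF sub] hausdorff_outer_lipschitz_image]) (use G in auto)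
    also have "\<dots> < top"
      using hausdorff_outer_coordinate_hyperplane[of j R] by (simp add: ennreal_mult_less_top)
    finally have 1: "hausdorff_outer (CARD('n) - 1) (frontier S \<inter> ball z \<rho>) < top" .
    have "negligible ?T"
      by (rule negligible_subset[OF negligible_standard_hyperplane_cart[of j]]) auto
    then have "negligible (G ` ?T)"
    proof (rule negligible_locally_Lipschitz_image[rotated])
      fix x assume "x \<in> ?T"
      then show "\<exists>T B. open T \<and> x \<in> T \<and> (\<forall>y \<in> ?T \<inter> T. norm(G y - G x) \<le> B * norm(y - x))"
        using G(3)[of _ x] by (intro exI[of _ UNIV] exI[of _ B]) (auto simp: dist_norm)
    qed simp
    then have "negligible (frontier S \<inter> ball z \<rho>)" using sub negligible_subset by blast
    with 1 *(1) show ?thesis by blast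
  qed
  then obtain \<rho> where \<rho>: "\<And>z. z \<in> frontier S \<Longrightarrow> 0 < \<rho> z"
    "\<And>z. z \<in> frontier S \<Longrightarrow> hausdorff_outer (CARD('n) - 1) (frontier S \<inter> ball z (\<rho> z)) < top \<and> negligible (frontier S \<inter> ball z (\<rho> z))"
    by metis
  have "compact (frontier S)"
    using S(2) by (simp add: compact_frontier_bounded)
  then obtain Z where Z: "Z \<subseteq> frontier S" "finite Z" "frontier S \<subseteq> (\<Union>z\<in>Z. ball z (\<rho> z))"
  proof (rule compactE_image)
    show "frontier S \<subseteq> (\<Union>z\<in>frontier S. ball z (\<rho> z))" using \<rho>(1) by force
  qed auto
  show ?thesis
  proof (rule that[of "(\<lambda>z. frontier S \<inter> ball z (\<rho> z)) ` Z"])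
    show "frontier S \<subseteq> \<Union> ((\<lambda>z. frontier S \<inter> ball z (\<rho> z)) ` Z)" using Z(3) by blast
  qed (use Z \<rho> in auto)
qed

lemma hausdorff_outer_Union_finite:
  assumes "finite F"
  shows "hausdorff_outer s (\<Union>i\<in>F. A i) \<le> (\<Sum>i\<in>F. hausdorff_outer s (A i))"
  using assms
proof induction
  case (insert i F)
  have "hausdorff_outer s (\<Union>i\<in>insert i F. A i) \<le> hausdorff_outer s (A i) + hausdorff_outer s (\<Union>i\<in>F. A i)"
    using hausdorff_outer_Un[of s "A i" "\<Union>i\<in>F. A i"] by simp
  also have "\<dots> \<le> hausdorff_outer s (A i) + (\<Sum>i\<in>F. hausdorff_outer s (A i))"
    using insert by (intro add_left_mono)
  finally show ?case using insert by simp
qed simp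

lemma hausdorff_outer_lipschitz_frontier:
  fixes S :: "(real ^ 'n) set"
  assumes "lipschitz_boundary S" "bounded S"
  shows "hausdorff_outer (CARD('n) - 1) (frontier S) < top"
proof -
  obtain F where F: "finite F" "frontier S \<subseteq> \<Union>F"
    "\<And>T. T \<in> F \<Longrightarrow> hausdorff_outer (CARD('n) - 1) T < top \<and> negligible T"
    by (rule lipschitz_frontier_pieces[OF assms]) blast
  have "hausdorff_outer (CARD('n) - 1) (frontier S) \<le> hausdorff_outer (CARD('n) - 1) (\<Union>T\<in>F. T)"
    using F(2) by (intro hausdorff_outer_mono) auto
  also have "\<dots> \<le> (\<Sum>T\<in>F. hausdorff_outer (CARD('n) - 1) T)"
    by (rule hausdorff_outer_Union_finite[OF F(1)])
  also have "\<dots> < top" using F by simp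
  finally show ?thesis .
qed

lemma negligible_lipschitz_frontier:
  fixes S :: "(real ^ 'n) set"
  assumes "lipschitz_boundary S" "bounded S"
  shows "negligible (frontier S)"
proof -
  obtain F where F: "finite F" "frontier S \<subseteq> \<Union>F"
    "\<And>T. T \<in> F \<Longrightarrow> hausdorff_outer (CARD('n) - 1) T < top \<and> negligible T"
    by (rule lipschitz_frontier_pieces[OF assms]) blast
  then show ?thesis using negligible_Union negligible_subset by metis
qed

section \<open>Surface measure on Borel sets\<close>

text \<open>All these measures live on the Borel sets of the whole space, so that the surfaces may
  vary with a parameter and still form a kernel. Integrals of Borel functions are the same as for
  \<open>surface_measure S\<close>.\<close>

definition hausdorff_on :: "'a::euclidean_space set \<Rightarrow> 'a measure" where
  "hausdorff_on S = distr (surface_measure S) borel (\<lambda>x. x)"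

lemma measurable_id_surface [measurable]: "(\<lambda>x. x) \<in> surface_measure S \<rightarrow>\<^sub>M borel"
  unfolding surface_measure_def
  by (rule measurable_restrict_space1) (use borel_subset_hausdorff in \<open>auto simp: measurable_def\<close>)

lemma borel_measurable_surface: "f \<in> borel_measurable borel \<Longrightarrow> f \<in> borel_measurable (surface_measure S)"
  using measurable_compose[OF measurable_id_surface] by blast

lemma space_surface_measure [simp]: "space (surface_measure S) = S"
  by (simp add: surface_measure_def space_restrict_space)

lemma sets_hausdorff_on [simp, measurable_cong]: "sets (hausdorff_on S) = sets borel"
  and space_hausdorff_on [simp]: "space (hausdorff_on S) = UNIV"
  by (simp_all add: hausdorff_on_def)

lemma emeasure_surface_measure:
  fixes S :: "'a::euclidean_space set"
  assumes "S \<in> sets borel" "B \<in> sets borel"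
  shows "emeasure (surface_measure S) (B \<inter> S) = hausdorff_outer (DIM('a) - 1) (B \<inter> S)"
proof -
  have "B \<inter> S \<in> sets (hausdorff_measure (DIM('a) - 1))" "S \<in> sets (hausdorff_measure (DIM('a) - 1))"
    using assms borel_subset_hausdorff by blast+
  then show ?thesis
    unfolding surface_measure_def by (subst emeasure_restrict_space) (auto simp: emeasure_hausdorff_measure)
qed

lemma emeasure_hausdorff_on:
  fixes S :: "'a::euclidean_space set"
  assumes "S \<in> sets borel" "B \<in> sets borel"
  shows "emeasure (hausdorff_on S) B = hausdorff_outer (DIM('a) - 1) (B \<inter> S)"
  unfolding hausdorff_on_def using assms
  by (subst emeasure_distr) (auto simp: emeasure_surface_measure)

lemma nn_integral_hausdorff_on:
  assumes "f \<in> borel_measurable borel"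
  shows "(\<integral>\<^sup>+x. f x \<partial>hausdorff_on S) = (\<integral>\<^sup>+x. f x \<partial>surface_measure S)"
  unfolding hausdorff_on_def using assms by (subst nn_integral_distr) auto

lemma integral_hausdorff_on:
  fixes f :: "'a::euclidean_space \<Rightarrow> real"
  assumes "f \<in> borel_measurable borel"
  shows "(\<integral>x. f x \<partial>hausdorff_on S) = (\<integral>x. f x \<partial>surface_measure S)"
  unfolding hausdorff_on_def using assms by (subst integral_distr) auto

lemma integrable_hausdorff_on:
  fixes f :: "'a::euclidean_space \<Rightarrow> real"
  assumes "f \<in> borel_measurable borel"
  shows "integrable (hausdorff_on S) f \<longleftrightarrow> integrable (surface_measure S) f"
  unfolding hausdorff_on_def using assms by (subst integrable_distr_eq) auto

lemma AE_hausdorff_on: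
  assumes "S \<in> sets borel"
  shows "AE x in hausdorff_on S. x \<in> S"
proof (rule AE_I)
  show "emeasure (hausdorff_on S) (- S) = 0"
    using assms by (subst emeasure_hausdorff_on) auto
qed (use assms in auto)

text \<open>By approximation with simple functions. It turns the setwise Lipschitz estimates for
  Hausdorff measure into inequalities between integrals.\<close>

lemma nn_integral_mono_measures:
  assumes s: "sets M = sets N" and le: "\<And>A. A \<in> sets M \<Longrightarrow> emeasure M A \<le> c * emeasure N A"
    and f: "f \<in> borel_measurable M"
  shows "(\<integral>\<^sup>+x. f x \<partial>M) \<le> c * (\<integral>\<^sup>+x. f x \<partial>N)"
  using f
proof (induction rule: borel_measurable_induct)
  case (cong f g)
  moreover have "(\<integral>\<^sup>+x. f x \<partial>M) = (\<integral>\<^sup>+x. g x \<partial>M)" "(\<integral>\<^sup>+x. f x \<partial>N) = (\<integral>\<^sup>+x. g x \<partial>N)"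
    using cong sets_eq_imp_space_eq[OF s] by (auto intro!: nn_integral_cong)
  ultimately show ?case by simp
next
  case (set A)
  then show ?case using le s by simp
next
  case (mult u a)
  then have "u \<in> borel_measurable N" using s measurable_cong_sets by blast
  then show ?case using mult mult_left_mono[OF mult.IH, of a] by (simp add: nn_integral_cmult mult.left_commute)
next
  case (add u v)
  moreover have "u \<in> borel_measurable N" "v \<in> borel_measurable N" using add s measurable_cong_sets by blast+
  ultimately show ?case by (simp add: nn_integral_add distrib_left add_mono)
next
  case (seq U)
  have m: "U i \<in> borel_measurable N" for i using seq(1) s measurable_cong_sets by blast
  have "(\<integral>\<^sup>+x. (SUP i. U i) x \<partial>M) = (SUP i. \<integral>\<^sup>+x. U i x \<partial>M)"
    using nn_integral_monotone_convergence_SUP[OF seq(3) seq(1)] by (simp add: image_comp)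
  also have "\<dots> \<le> (SUP i. c * \<integral>\<^sup>+x. U i x \<partial>N)"
    by (rule SUP_mono') (rule seq.IH)
  also have "\<dots> = c * (SUP i. \<integral>\<^sup>+x. U i x \<partial>N)" by (rule SUP_mult_left_ennreal[symmetric])
  also have "(SUP i. \<integral>\<^sup>+x. U i x \<partial>N) = (\<integral>\<^sup>+x. (SUP i. U i) x \<partial>N)"
    using nn_integral_monotone_convergence_SUP[OF seq(3) m] by (simp add: image_comp)
  finally show ?case .
qed

lemma hausdorff_on_lipschitz_image:
  fixes f :: "'a::euclidean_space \<Rightarrow> 'a"
  assumes S: "S \<in> sets borel" "f ` S \<in> sets borel" and f [measurable]: "f \<in> borel_measurable borel"
    and L: "0 < L" "\<And>x y. x \<in> S \<Longrightarrow> y \<in> S \<Longrightarrow> dist (f x) (f y) \<le> L * dist x y"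
    and h [measurable]: "h \<in> borel_measurable borel"
  shows "(\<integral>\<^sup>+x. h x \<partial>hausdorff_on (f ` S)) \<le> ennreal (L ^ (DIM('a) - 1)) * (\<integral>\<^sup>+x. h (f x) \<partial>hausdorff_on S)"
proof -
  have "(\<integral>\<^sup>+x. h x \<partial>hausdorff_on (f ` S)) \<le> ennreal (L ^ (DIM('a) - 1)) * (\<integral>\<^sup>+x. h x \<partial>distr (hausdorff_on S) borel f)"
  proof (rule nn_integral_mono_measures)
    fix B assume "B \<in> sets (hausdorff_on (f ` S))"
    then have B [measurable]: "B \<in> sets borel" by simp
    have "emeasure (hausdorff_on (f ` S)) B = hausdorff_outer (DIM('a) - 1) (f ` (f -` B \<inter> S))"
      using S by (subst emeasure_hausdorff_on) (auto intro!: arg_cong[of _ _ "hausdorff_outer _"])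
    also have "\<dots> \<le> ennreal (L ^ (DIM('a) - 1)) * hausdorff_outer (DIM('a) - 1) (f -` B \<inter> S)"
      by (rule hausdorff_outer_lipschitz_image[OF L(1)]) (use L(2) in auto)
    also have "hausdorff_outer (DIM('a) - 1) (f -` B \<inter> S) = emeasure (distr (hausdorff_on S) borel f) B"
    proof -
      have m: "f \<in> hausdorff_on S \<rightarrow>\<^sub>M borel" using f measurable_cong_sets[OF sets_hausdorff_on refl] by blast
      show ?thesis
        using measurable_sets[OF f B] by (simp add: emeasure_distr[OF m B] emeasure_hausdorff_on[OF S(1)])
    qed
    finally show "emeasure (hausdorff_on (f ` S)) B \<le> ennreal (L ^ (DIM('a) - 1)) * emeasure (distr (hausdorff_on S) borel f) B" .
  qed (auto simp: measurable_cong_sets[OF sets_hausdorff_on refl])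
  also have "(\<integral>\<^sup>+x. h x \<partial>distr (hausdorff_on S) borel f) = (\<integral>\<^sup>+x. h (f x) \<partial>hausdorff_on S)"
    by (rule nn_integral_distr) (auto simp: measurable_cong_sets[OF sets_hausdorff_on refl])
  finally show ?thesis .
qed

text \<open>The Cauchy-Schwarz inequality row by row; \<open>norm A\<close> is the Frobenius
  norm.\<close>

lemma norm_matrix_vector_mult_le:
  fixes A :: "real ^ 'n ^ 'm"
  shows "norm (A *v x) \<le> norm A * norm x"
proof -
  have "norm (A *v x) \<le> L2_set (\<lambda>i. norm (A $ i) * norm x) UNIV"
    unfolding norm_vec_def[of "A *v x"]
    by (intro L2_set_mono) (simp_all add: matrix_vector_mul_component Cauchy_Schwarz_ineq2)
  also have "\<dots> = norm A * norm x"
    unfolding norm_vec_def[of A] by (simp add: L2_set_right_distrib[symmetric] L2_set_left_distrib)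
  finally show ?thesis .
qed

lemma matrix_inv_cancel:
  fixes A :: "real ^ 'n ^ 'n"
  assumes "invertible A"
  shows "matrix_inv A ** A = mat 1" "A ** matrix_inv A = mat 1"
    "matrix_inv A *v (A *v x) = x" "A *v (matrix_inv A *v x) = x"
proof -
  have "A ** matrix_inv A = mat 1 \<and> matrix_inv A ** A = mat 1"
    using assms unfolding invertible_def matrix_inv_def by (rule someI_ex)
  then show "matrix_inv A ** A = mat 1" "A ** matrix_inv A = mat 1"
    "matrix_inv A *v (A *v x) = x" "A *v (matrix_inv A *v x) = x"
    by (simp_all add: matrix_vector_mul_assoc)
qed

lemma borel_measurable_matrix_vector_mult [measurable]:
  "(\<lambda>x. (A :: real ^ 'n ^ 'm) *v x) \<in> borel_measurable borel"
  by (intro borel_measurable_continuous_onI) (simp add: linear_continuous_on)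

text \<open>The matrix \<open>A' ** matrix_inv A\<close> is the identity plus
  \<open>(A' - A) ** matrix_inv A\<close>, so its Lipschitz constant tends to 1 as \<open>A'\<close>
  tends to \<open>A\<close>. This is the source of the continuity of the surface measures in
  \<open>x\<close>.\<close>

lemma hausdorff_outer_linear_image_le:
  fixes A A' :: "real ^ 'n ^ 'n"
  assumes "invertible A"
  shows "hausdorff_outer s ((*v) A' ` X) \<le> ennreal ((1 + norm (A' - A) * norm (matrix_inv A)) ^ s) * hausdorff_outer s ((*v) A ` X)"
proof -
  have "(*v) A' ` X = (\<lambda>v. A' *v (matrix_inv A *v v)) ` ((*v) A ` X)"
    by (auto simp: image_image matrix_inv_cancel[OF assms])
  moreover have "hausdorff_outer s ((\<lambda>v. A' *v (matrix_inv A *v v)) ` ((*v) A ` X))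
     \<le> ennreal ((1 + norm (A' - A) * norm (matrix_inv A)) ^ s) * hausdorff_outer s ((*v) A ` X)"
  proof (rule hausdorff_outer_lipschitz_image)
    show "0 < 1 + norm (A' - A) * norm (matrix_inv A)" by (simp add: add_pos_nonneg)
    fix x y :: "real ^ 'n"
    let ?u = "x - y"
    have "dist (A' *v (matrix_inv A *v x)) (A' *v (matrix_inv A *v y)) = norm (A' *v (matrix_inv A *v ?u))"
      by (simp add: dist_norm matrix_vector_mult_diff_distrib)
    also have "A' *v (matrix_inv A *v ?u) = ?u + (A' - A) *v (matrix_inv A *v ?u)"
      by (simp add: matrix_vector_mult_diff_rdistrib matrix_inv_cancel[OF assms])
    also have "norm \<dots> \<le> norm ?u + norm (A' - A) * (norm (matrix_inv A) * norm ?u)"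
      using norm_matrix_vector_mult_le[of "A' - A" "matrix_inv A *v ?u"] norm_matrix_vector_mult_le[of "matrix_inv A" ?u]
      by (intro norm_triangle_le add_left_mono) (meson mult_left_mono norm_ge_zero order_trans)
    finally show "dist (A' *v (matrix_inv A *v x)) (A' *v (matrix_inv A *v y)) \<le> (1 + norm (A' - A) * norm (matrix_inv A)) * dist x y"
      by (simp add: dist_norm algebra_simps)
  qed
  ultimately show ?thesis by simp
qed


section \<open>Integration with respect to a kernel\<close>

text \<open>The semidirect product of \<open>M\<close> with the kernel, formed by
  \<open>bind\<close>: a point \<open>x\<close> is drawn from \<open>M\<close> and then
  \<open>y\<close> from \<open>\<kappa> x\<close>. The lemmas that follow are its Tonelli and Fubini
  theorems.\<close>

definition kernel_product :: "'a measure \<Rightarrow> 'b measure \<Rightarrow> ('a \<Rightarrow> 'b measure) \<Rightarrow> ('a \<times> 'b) measure" where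
  "kernel_product M N \<kappa> = M \<bind> (\<lambda>x. distr (\<kappa> x) (M \<Otimes>\<^sub>M N) (Pair x))"

context
  fixes M :: "'a measure" and N :: "'b measure" and \<kappa> :: "'a \<Rightarrow> 'b measure"
  assumes M: "finite_measure M" "space M \<noteq> {}" and \<kappa>: "\<kappa> \<in> M \<rightarrow>\<^sub>M subprob_algebra N"
begin

lemma kernel_product_kernel:
  "(\<lambda>x. distr (\<kappa> x) (M \<Otimes>\<^sub>M N) (Pair x)) \<in> M \<rightarrow>\<^sub>M subprob_algebra (M \<Otimes>\<^sub>M N)"
  by (rule measurable_distr2[OF _ \<kappa>]) simp

lemma sets_kernel_product: "sets (kernel_product M N \<kappa>) = sets (M \<Otimes>\<^sub>M N)"
  unfolding kernel_product_def by (rule sets_bind_measurable[OF kernel_product_kernel M(2)])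

lemma measurable_kernel_section:
  assumes "x \<in> space M" "f \<in> borel_measurable (M \<Otimes>\<^sub>M N)"
  shows "(\<lambda>y. f (x, y)) \<in> borel_measurable (\<kappa> x)"
  using measurable_Pair2[OF assms(2,1)] measurable_cong_sets[OF sets_kernel[OF \<kappa> assms(1)] refl] by blast

lemma nn_integral_kernel_product:
  assumes f: "f \<in> borel_measurable (M \<Otimes>\<^sub>M N)"
  shows "(\<integral>\<^sup>+z. f z \<partial>kernel_product M N \<kappa>) = (\<integral>\<^sup>+x. \<integral>\<^sup>+y. f (x, y) \<partial>\<kappa> x \<partial>M)"
  unfolding kernel_product_def nn_integral_bind[OF f kernel_product_kernel]
proof (rule nn_integral_cong)
  fix x assume x: "x \<in> space M"
  have "Pair x \<in> \<kappa> x \<rightarrow>\<^sub>M M \<Otimes>\<^sub>M N"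
    using measurable_Pair1'[OF x] measurable_cong_sets[OF sets_kernel[OF \<kappa> x] refl] by blast
  then show "(\<integral>\<^sup>+z. f z \<partial>distr (\<kappa> x) (M \<Otimes>\<^sub>M N) (Pair x)) = (\<integral>\<^sup>+y. f (x, y) \<partial>\<kappa> x)"
    using f by (subst nn_integral_distr) auto
qed

lemma finite_measure_kernel_product: "finite_measure (kernel_product M N \<kappa>)"
proof (rule finite_measureI)
  have "emeasure (kernel_product M N \<kappa>) (space (kernel_product M N \<kappa>)) = (\<integral>\<^sup>+z. 1 \<partial>kernel_product M N \<kappa>)"
    by simp
  also have "\<dots> = (\<integral>\<^sup>+x. \<integral>\<^sup>+y. 1 \<partial>\<kappa> x \<partial>M)"
    by (rule nn_integral_kernel_product) simp
  also have "\<dots> \<le> (\<integral>\<^sup>+x. 1 \<partial>M)"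
  proof (rule nn_integral_mono)
    fix x assume "x \<in> space M"
    then interpret subprob_space "\<kappa> x" by (rule subprob_space_kernel[OF \<kappa>])
    show "(\<integral>\<^sup>+y. 1 \<partial>\<kappa> x) \<le> 1" by (simp add: subprob_emeasure_le_1)
  qed
  finally show "emeasure (kernel_product M N \<kappa>) (space (kernel_product M N \<kappa>)) \<noteq> \<infinity>"
    using finite_measure.finite_emeasure_space[OF M(1)] by (auto simp: top_unique)
qed

text \<open>Positive and negative parts are treated by the nonnegative case. The sections that fail
  to be integrable belong to a null set of \<open>x\<close>, where the Bochner integral has the
  value 0; the resulting case formula \<open>eq1\<close> also gives the measurability of the inner
  integral.\<close>

lemma integral_kernel_product:
  fixes f :: "'a \<times> 'b \<Rightarrow> real"
  assumes int: "integrable (kernel_product M N \<kappa>) f"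
  shows "(\<integral>z. f z \<partial>kernel_product M N \<kappa>) = (\<integral>x. \<integral>y. f (x, y) \<partial>\<kappa> x \<partial>M)"
proof -
  have f [measurable]: "f \<in> borel_measurable (M \<Otimes>\<^sub>M N)"
    using int measurable_cong_sets[OF sets_kernel_product refl] by blast
  define P where "P = (\<lambda>x. \<integral>\<^sup>+y. ennreal (f (x, y)) \<partial>\<kappa> x)"
  define R where "R = (\<lambda>x. \<integral>\<^sup>+y. ennreal (- f (x, y)) \<partial>\<kappa> x)"
  have meas: "(\<lambda>x. \<integral>\<^sup>+y. g (x, y) \<partial>\<kappa> x) \<in> borel_measurable M"
    if "g \<in> borel_measurable (M \<Otimes>\<^sub>M N)" for g :: "'a \<times> 'b \<Rightarrow> ennreal"
    using nn_integral_measurable_subprob_algebra2[OF _ \<kappa>, of "\<lambda>x y. g (x, y)"] that by simp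
  have [measurable]: "P \<in> borel_measurable M" "R \<in> borel_measurable M"
    unfolding P_def R_def by (auto intro!: meas)
  have Pn: "(\<integral>\<^sup>+z. ennreal (f z) \<partial>kernel_product M N \<kappa>) = (\<integral>\<^sup>+x. P x \<partial>M)"
    and Rn: "(\<integral>\<^sup>+z. ennreal (- f z) \<partial>kernel_product M N \<kappa>) = (\<integral>\<^sup>+x. R x \<partial>M)"
    unfolding P_def R_def by (auto intro!: nn_integral_kernel_product)
  have fin: "(\<integral>\<^sup>+x. P x \<partial>M) < \<infinity>" "(\<integral>\<^sup>+x. R x \<partial>M) < \<infinity>"
    using int unfolding real_integrable_def Pn Rn by (auto simp: less_top)
  have aeP: "AE x in M. P x \<noteq> \<infinity>"
    by (rule nn_integral_PInf_AE) (use fin in auto)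
  have aeR: "AE x in M. R x \<noteq> \<infinity>"
    by (rule nn_integral_PInf_AE) (use fin in auto)
  have eq1: "(\<integral>y. f (x, y) \<partial>\<kappa> x) = (if P x \<noteq> \<infinity> \<and> R x \<noteq> \<infinity> then enn2real (P x) - enn2real (R x) else 0)"
    if x: "x \<in> space M" for x
  proof -
    have "integrable (\<kappa> x) (\<lambda>y. f (x, y)) \<longleftrightarrow> P x \<noteq> \<infinity> \<and> R x \<noteq> \<infinity>"
      unfolding real_integrable_def P_def R_def using measurable_kernel_section[OF x f] by simp
    then show ?thesis
      by (auto simp: real_lebesgue_integral_def P_def R_def not_integrable_integral_eq)
  qed
  have eq: "AE x in M. (\<integral>y. f (x, y) \<partial>\<kappa> x) = enn2real (P x) - enn2real (R x)"
    using aeP aeR AE_space by eventually_elim (simp add: eq1)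
  have part: "integrable M (\<lambda>x. enn2real (F x)) \<and> (\<integral>x. enn2real (F x) \<partial>M) = enn2real (\<integral>\<^sup>+x. F x \<partial>M)"
    if [measurable]: "F \<in> borel_measurable M" and F: "AE x in M. F x \<noteq> \<infinity>" "(\<integral>\<^sup>+x. F x \<partial>M) < \<infinity>" for F
  proof -
    have e: "(\<integral>\<^sup>+x. ennreal (enn2real (F x)) \<partial>M) = (\<integral>\<^sup>+x. F x \<partial>M)"
      using F(1) by (intro nn_integral_cong_AE) (auto simp: less_top)
    have "integrable M (\<lambda>x. enn2real (F x))"
      by (rule integrableI_nonneg) (use F e in auto)
    moreover have "(\<integral>x. enn2real (F x) \<partial>M) = enn2real (\<integral>\<^sup>+x. ennreal (enn2real (F x)) \<partial>M)"
      by (rule integral_eq_nn_integral) auto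
    ultimately show ?thesis using e by simp
  qed
  have "(\<integral>z. f z \<partial>kernel_product M N \<kappa>) = enn2real (\<integral>\<^sup>+x. P x \<partial>M) - enn2real (\<integral>\<^sup>+x. R x \<partial>M)"
    using int by (simp add: real_lebesgue_integral_def Pn Rn)
  also have "\<dots> = (\<integral>x. enn2real (P x) - enn2real (R x) \<partial>M)"
    using part[of P] part[of R] aeP aeR fin by simp
  also have "\<dots> = (\<integral>x. \<integral>y. f (x, y) \<partial>\<kappa> x \<partial>M)"
  proof (rule integral_cong_AE)
    have "(\<lambda>x. if P x \<noteq> \<infinity> \<and> R x \<noteq> \<infinity> then enn2real (P x) - enn2real (R x) else 0) \<in> borel_measurable M"
      by measurable
    then show "(\<lambda>x. \<integral>y. f (x, y) \<partial>\<kappa> x) \<in> borel_measurable M"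
      by (rule measurable_cong[THEN iffD2, rotated]) (rule eq1)
  qed (use eq in auto)
  finally show ?thesis .
qed

end

section \<open>Strong measurability of jointly measurable functions\<close>

text \<open>These are simple functions whose finitely many values are functions on \<open>N\<close>,
  the approximants that \<open>Bochner_Lp\<close> asks for. Joint measurability is carried along so
  that differences from a given function can be integrated over the product.\<close>

definition simple_valued :: "'a measure \<Rightarrow> 'b measure \<Rightarrow> ('a \<Rightarrow> 'b \<Rightarrow> real) \<Rightarrow> bool" where
  "simple_valued M N h \<longleftrightarrow> simple_function M h \<and> (\<forall>x\<in>space M. h x \<in> borel_measurable N) \<and>
     (\<lambda>z. h (fst z) (snd z)) \<in> borel_measurable (M \<Otimes>\<^sub>M N)"

lemma simple_valued_const: "simple_valued M N (\<lambda>x y. c)"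
  by (simp add: simple_valued_def)

lemma simple_valued_add:
  assumes "simple_valued M N h" "simple_valued M N k"
  shows "simple_valued M N (\<lambda>x y. h x y + k x y)"
  using assms simple_function_compose2[of M h k "\<lambda>f g y. f y + g y"] by (auto simp: simple_valued_def intro!: borel_measurable_add)

lemma simple_valued_compose:
  assumes "simple_valued M N h" and [measurable]: "\<phi> \<in> borel_measurable borel"
  shows "simple_valued M N (\<lambda>x y. \<phi> (h x y))"
  using assms simple_function_compose1[of M h "\<lambda>f y. \<phi> (f y)"] by (auto simp: simple_valued_def)

lemma simple_valued_rectangle:
  assumes [measurable]: "A \<in> sets M" "B \<in> sets N"
  shows "simple_valued M N (\<lambda>x y. indicator (A \<times> B) (x, y))"
proof -
  have "simple_function M (\<lambda>x. indicator A x :: real)" by simp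
  from simple_function_compose1[OF this, of "\<lambda>a y. a * indicator B y"]
  have "simple_function M (\<lambda>x y. indicator A x * indicator B y :: real)" .
  moreover have "(\<lambda>x y. indicator A x * indicator B y :: real) = (\<lambda>x y. indicator (A \<times> B) (x, y))"
    by (intro ext) (auto simp: indicator_def)
  ultimately have "simple_function M (\<lambda>x y. indicator (A \<times> B) (x, y) :: real)" by simp
  moreover have "(\<lambda>y. indicator (A \<times> B) (x, y) :: real) \<in> borel_measurable N" if "x \<in> space M" for x
    using that by measurable
  ultimately show ?thesis by (simp add: simple_valued_def)
qed

context
  fixes M :: "'a measure" and N :: "'b measure"
  assumes fM: "finite_measure M" and fN: "finite_measure N"
begin

lemma finite_measure_pair: "finite_measure (M \<Otimes>\<^sub>M N)"
  using finite_measure_pair_measure[OF fN fM] .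

text \<open>Approximation is demanded in L1 only, where sums and dominated limits are immediate. The
  passage to the exponent \<open>p\<close> comes after truncation, in
  \<open>Bochner_Lp_jointly_measurable\<close>.\<close>

definition simple_approximable :: "('a \<times> 'b \<Rightarrow> real) \<Rightarrow> bool" where
  "simple_approximable f \<longleftrightarrow> integrable (M \<Otimes>\<^sub>M N) f \<and> (\<forall>e>0. \<exists>h. simple_valued M N h \<and>
     integrable (M \<Otimes>\<^sub>M N) (\<lambda>z. h (fst z) (snd z)) \<and>
     (\<integral>z. \<bar>f z - h (fst z) (snd z)\<bar> \<partial>(M \<Otimes>\<^sub>M N)) < e)"

lemma simple_approximable_simple:
  assumes "simple_valued M N h" "integrable (M \<Otimes>\<^sub>M N) (\<lambda>z. h (fst z) (snd z))"
  shows "simple_approximable (\<lambda>z. h (fst z) (snd z))"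
  unfolding simple_approximable_def using assms by (auto intro!: exI[of _ h])

lemma simple_approximable_cong:
  assumes f: "simple_approximable f" and eq: "\<And>z. z \<in> space (M \<Otimes>\<^sub>M N) \<Longrightarrow> f z = g z"
  shows "simple_approximable g"
proof -
  have "integrable (M \<Otimes>\<^sub>M N) f \<longleftrightarrow> integrable (M \<Otimes>\<^sub>M N) g"
    by (rule Bochner_Integration.integrable_cong) (auto simp: eq)
  then have "integrable (M \<Otimes>\<^sub>M N) g"
    using f by (simp add: simple_approximable_def)
  moreover have "(\<integral>z. \<bar>g z - h (fst z) (snd z)\<bar> \<partial>(M \<Otimes>\<^sub>M N)) = (\<integral>z. \<bar>f z - h (fst z) (snd z)\<bar> \<partial>(M \<Otimes>\<^sub>M N))" for h
    by (rule Bochner_Integration.integral_cong) (auto simp: eq)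
  ultimately show ?thesis using f by (simp add: simple_approximable_def)
qed

lemma simple_approximable_add:
  assumes f: "simple_approximable f" and g: "simple_approximable g"
  shows "simple_approximable (\<lambda>z. f z + g z)"
  unfolding simple_approximable_def
proof (intro conjI allI impI)
  show "integrable (M \<Otimes>\<^sub>M N) (\<lambda>z. f z + g z)" using f g by (simp add: simple_approximable_def)
  fix e :: real assume "0 < e"
  then have "0 < e/2" by simp
  then obtain h k where h: "simple_valued M N h" "integrable (M \<Otimes>\<^sub>M N) (\<lambda>z. h (fst z) (snd z))"
     "(\<integral>z. \<bar>f z - h (fst z) (snd z)\<bar> \<partial>(M \<Otimes>\<^sub>M N)) < e/2"
    and k: "simple_valued M N k" "integrable (M \<Otimes>\<^sub>M N) (\<lambda>z. k (fst z) (snd z))"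
     "(\<integral>z. \<bar>g z - k (fst z) (snd z)\<bar> \<partial>(M \<Otimes>\<^sub>M N)) < e/2"
    using f g unfolding simple_approximable_def by meson
  have fi: "integrable (M \<Otimes>\<^sub>M N) f" "integrable (M \<Otimes>\<^sub>M N) g" using f g by (auto simp: simple_approximable_def)
  have "(\<integral>z. \<bar>f z + g z - (h (fst z) (snd z) + k (fst z) (snd z))\<bar> \<partial>(M \<Otimes>\<^sub>M N))
     \<le> (\<integral>z. \<bar>f z - h (fst z) (snd z)\<bar> + \<bar>g z - k (fst z) (snd z)\<bar> \<partial>(M \<Otimes>\<^sub>M N))"
    using fi h(2) k(2) by (intro integral_mono) auto
  also have "\<dots> = (\<integral>z. \<bar>f z - h (fst z) (snd z)\<bar> \<partial>(M \<Otimes>\<^sub>M N)) + (\<integral>z. \<bar>g z - k (fst z) (snd z)\<bar> \<partial>(M \<Otimes>\<^sub>M N))"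
    using fi h(2) k(2) by (intro Bochner_Integration.integral_add) auto
  also have "\<dots> < e" using h(3) k(3) by simp
  finally show "\<exists>h. simple_valued M N h \<and> integrable (M \<Otimes>\<^sub>M N) (\<lambda>z. h (fst z) (snd z)) \<and>
     (\<integral>z. \<bar>f z + g z - h (fst z) (snd z)\<bar> \<partial>(M \<Otimes>\<^sub>M N)) < e"
    using h k by (intro exI[of _ "\<lambda>x y. h x y + k x y"]) (simp add: simple_valued_add)
qed

lemma simple_approximable_cmult:
  assumes f: "simple_approximable f"
  shows "simple_approximable (\<lambda>z. c * f z)"
  unfolding simple_approximable_def
proof (intro conjI allI impI)
  show "integrable (M \<Otimes>\<^sub>M N) (\<lambda>z. c * f z)" using f by (simp add: simple_approximable_def)
  fix e :: real assume e: "0 < e"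
  have c: "0 < \<bar>c\<bar> + 1" by simp
  then have "0 < e / (\<bar>c\<bar> + 1)" using e by simp
  then obtain h where h: "simple_valued M N h" "integrable (M \<Otimes>\<^sub>M N) (\<lambda>z. h (fst z) (snd z))"
     "(\<integral>z. \<bar>f z - h (fst z) (snd z)\<bar> \<partial>(M \<Otimes>\<^sub>M N)) < e / (\<bar>c\<bar> + 1)"
    using f unfolding simple_approximable_def by meson
  let ?I = "\<integral>z. \<bar>f z - h (fst z) (snd z)\<bar> \<partial>(M \<Otimes>\<^sub>M N)"
  have "(\<integral>z. \<bar>c * f z - c * h (fst z) (snd z)\<bar> \<partial>(M \<Otimes>\<^sub>M N)) = \<bar>c\<bar> * ?I"
    by (simp add: right_diff_distrib[symmetric] abs_mult)
  also have "\<dots> \<le> (\<bar>c\<bar> + 1) * ?I"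
    by (intro mult_right_mono) auto
  also have "\<dots> < e" using h(3) c by (simp add: pos_less_divide_eq mult.commute)
  finally show "\<exists>h. simple_valued M N h \<and> integrable (M \<Otimes>\<^sub>M N) (\<lambda>z. h (fst z) (snd z)) \<and>
     (\<integral>z. \<bar>c * f z - h (fst z) (snd z)\<bar> \<partial>(M \<Otimes>\<^sub>M N)) < e"
    using h simple_valued_compose[OF h(1), of "\<lambda>t. c * t"] by (intro exI[of _ "\<lambda>x y. c * h x y"]) simp
qed

lemma simple_approximable_limit:
  assumes s: "\<And>i::nat. simple_approximable (s i)" and f: "integrable (M \<Otimes>\<^sub>M N) f" and g: "integrable (M \<Otimes>\<^sub>M N) g"
    and lim: "\<And>z. z \<in> space (M \<Otimes>\<^sub>M N) \<Longrightarrow> (\<lambda>i. s i z) \<longlonglongrightarrow> f z"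
    and bd: "\<And>i z. z \<in> space (M \<Otimes>\<^sub>M N) \<Longrightarrow> \<bar>s i z\<bar> \<le> g z"
  shows "simple_approximable f"
  unfolding simple_approximable_def
proof (intro conjI allI impI)
  show "integrable (M \<Otimes>\<^sub>M N) f" by fact
  fix e :: real assume e: "0 < e"
  have si: "integrable (M \<Otimes>\<^sub>M N) (s i)" for i using s by (simp add: simple_approximable_def)
  have "(\<lambda>i. \<integral>z. \<bar>s i z - f z\<bar> \<partial>(M \<Otimes>\<^sub>M N)) \<longlonglongrightarrow> (\<integral>z. 0 \<partial>(M \<Otimes>\<^sub>M N))"
  proof (rule integral_dominated_convergence[where w="\<lambda>z. g z + \<bar>f z\<bar>"])
    show "AE z in M \<Otimes>\<^sub>M N. (\<lambda>i. \<bar>s i z - f z\<bar>) \<longlonglongrightarrow> 0"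
    proof (rule AE_I2)
      fix z assume "z \<in> space (M \<Otimes>\<^sub>M N)"
      from lim[OF this] have "(\<lambda>i. s i z - f z) \<longlonglongrightarrow> 0" by (simp add: LIM_zero)
      then show "(\<lambda>i. \<bar>s i z - f z\<bar>) \<longlonglongrightarrow> 0" by (rule tendsto_rabs_zero)
    qed
    show "AE z in M \<Otimes>\<^sub>M N. norm \<bar>s i z - f z\<bar> \<le> g z + \<bar>f z\<bar>" for i
    proof (rule AE_I2)
      fix z assume "z \<in> space (M \<Otimes>\<^sub>M N)"
      from bd[OF this, of i] show "norm \<bar>s i z - f z\<bar> \<le> g z + \<bar>f z\<bar>" by simp
    qed
  qed (use si f g in auto)
  then have "\<forall>\<^sub>F i in sequentially. (\<integral>z. \<bar>s i z - f z\<bar> \<partial>(M \<Otimes>\<^sub>M N)) < e/2"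
    using e by (intro order_tendstoD(2)) auto
  then obtain i where i: "(\<integral>z. \<bar>s i z - f z\<bar> \<partial>(M \<Otimes>\<^sub>M N)) < e/2"
    using eventually_happens' sequentially_bot by blast
  have "0 < e/2" using e by simp
  then obtain h where h: "simple_valued M N h" "integrable (M \<Otimes>\<^sub>M N) (\<lambda>z. h (fst z) (snd z))"
     "(\<integral>z. \<bar>s i z - h (fst z) (snd z)\<bar> \<partial>(M \<Otimes>\<^sub>M N)) < e/2"
    using s[of i] unfolding simple_approximable_def by meson
  have "(\<integral>z. \<bar>f z - h (fst z) (snd z)\<bar> \<partial>(M \<Otimes>\<^sub>M N))
     \<le> (\<integral>z. \<bar>s i z - f z\<bar> + \<bar>s i z - h (fst z) (snd z)\<bar> \<partial>(M \<Otimes>\<^sub>M N))"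
    using f si[of i] h(2) by (intro integral_mono) auto
  also have "\<dots> = (\<integral>z. \<bar>s i z - f z\<bar> \<partial>(M \<Otimes>\<^sub>M N)) + (\<integral>z. \<bar>s i z - h (fst z) (snd z)\<bar> \<partial>(M \<Otimes>\<^sub>M N))"
    using f si[of i] h(2) by (intro Bochner_Integration.integral_add) auto
  also have "\<dots> < e" using h(3) i by simp
  finally show "\<exists>h. simple_valued M N h \<and> integrable (M \<Otimes>\<^sub>M N) (\<lambda>z. h (fst z) (snd z)) \<and>
     (\<integral>z. \<bar>f z - h (fst z) (snd z)\<bar> \<partial>(M \<Otimes>\<^sub>M N)) < e"
    using h by blast
qed

text \<open>Rectangles are closed under intersection and generate the product sigma-algebra, so
  complements and countable disjoint unions remain; the latter are dominated limits of finite
  sums.\<close>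

lemma simple_approximable_indicator:
  assumes "A \<in> sets (M \<Otimes>\<^sub>M N)"
  shows "simple_approximable (indicator A)"
proof -
  interpret P: finite_measure "M \<Otimes>\<^sub>M N" by (rule finite_measure_pair)
  have rect: "simple_approximable (indicator (a \<times> b))" if ab: "a \<in> sets M" "b \<in> sets N" for a b
  proof -
    have "integrable (M \<Otimes>\<^sub>M N) (\<lambda>z. indicator (a \<times> b) (fst z, snd z) :: real)"
      unfolding prod.collapse
      using ab by (intro integrable_real_indicator) (auto simp: P.emeasure_finite less_top[symmetric])
    from simple_approximable_simple[OF simple_valued_rectangle[OF ab] this] show ?thesis by simp
  qed
  have "A \<in> sigma_sets (space M \<times> space N) {a \<times> b | a b. a \<in> sets M \<and> b \<in> sets N}"
    using assms by (simp add: sets_pair_measure)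
  with Int_stable_pair_measure_generator[of M N] pair_measure_closed[of M N] show ?thesis
  proof (induction rule: sigma_sets_induct_disjoint)
    case (basic A)
    then show ?case using rect by blast
  next
    case empty
    show ?case using simple_approximable_simple[OF simple_valued_const[of _ _ 0]] by simp
  next
    case (compl A)
    have "simple_approximable (\<lambda>z. indicator (space M \<times> space N) z + (-1) * indicator A z)"
      by (intro simple_approximable_add simple_approximable_cmult compl rect) auto
    then show ?case
      by (rule simple_approximable_cong) (auto simp: indicator_def space_pair_measure)
  next
    case (union A)
    have A: "A i \<in> sets (M \<Otimes>\<^sub>M N)" for i using union by (auto simp: sets_pair_measure)
    have part: "simple_approximable (\<lambda>z. \<Sum>i<n. indicator (A i) z)" for n
    proof (induction n)
      case 0
      show ?case using simple_approximable_simple[OF simple_valued_const[of _ _ 0]] by simp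
    next
      case (Suc n)
      then show ?case using simple_approximable_add[OF Suc union(3)[of n]] by simp
    qed
    have sums: "(\<lambda>i. indicator (A i) z :: real) sums indicator (\<Union>i. A i) z" for z
      by (rule indicator_sums) (use union(1) in \<open>auto simp: disjoint_family_on_def\<close>)
    have I: "integrable (M \<Otimes>\<^sub>M N) (indicator (\<Union>i. A i) :: _ \<Rightarrow> real)"
      using A by (intro integrable_real_indicator) (auto simp: P.emeasure_finite less_top[symmetric])
    show ?case
    proof (rule simple_approximable_limit[OF part I I])
      fix n z
      show "(\<lambda>n. \<Sum>i<n. indicator (A i) z :: real) \<longlonglongrightarrow> indicator (\<Union>i. A i) z" using sums[of z] by (simp add: sums_def)
      have "(\<Sum>i<n. indicator (A i) z :: real) \<le> (\<Sum>i. indicator (A i) z)"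
        using sums[of z] by (intro sum_le_suminf) (auto simp: sums_iff)
      then show "\<bar>\<Sum>i<n. indicator (A i) z :: real\<bar> \<le> indicator (\<Union>i. A i) z"
        using sums[of z] by (simp add: sums_iff sum_nonneg)
    qed
  qed
qed

lemma simple_approximable_integrable:
  assumes "integrable (M \<Otimes>\<^sub>M N) f"
  shows "simple_approximable f"
  using assms
proof (induction rule: integrable_induct)
  case (base A c)
  show ?case using simple_approximable_cmult[OF simple_approximable_indicator[OF base(1)], of c] by (simp add: mult.commute)
next
  case (add f g)
  then show ?case using simple_approximable_add by blast
next
  case (lim f s)
  show ?case
    by (rule simple_approximable_limit[OF lim(5) \<open>integrable (M \<Otimes>\<^sub>M N) f\<close>, where g="\<lambda>z. 2 * \<bar>f z\<bar>"])
      (use lim in auto)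
qed

text \<open>Strong measurability from joint measurability. The truncation of \<open>f\<close> at
  level \<open>k\<close> is approximated in L1 so closely that the error of order \<open>p\<close>,
  controlled by means of the bound \<open>k\<close>, is summable in \<open>k\<close>. For almost
  every \<open>x\<close> the sections then converge; what the truncation cuts off tends to 0 by
  dominated convergence.\<close>

lemma Bochner_Lp_jointly_measurable:
  fixes f :: "'a \<Rightarrow> 'b \<Rightarrow> real"
  assumes p: "1 < p" and f: "(\<lambda>z. f (fst z) (snd z)) \<in> borel_measurable (M \<Otimes>\<^sub>M N)"
    and sec: "\<And>x. x \<in> space M \<Longrightarrow> integrable N (\<lambda>y. \<bar>f x y\<bar> powr p)"
    and fin: "(\<integral>\<^sup>+x. \<integral>\<^sup>+y. ennreal (\<bar>f x y\<bar> powr p) \<partial>N \<partial>M) < \<infinity>"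
  shows "f \<in> Bochner_Lp p M N"
proof -
  interpret P: finite_measure "M \<Otimes>\<^sub>M N" by (rule finite_measure_pair)
  interpret M: finite_measure M by (rule fM)
  interpret N: finite_measure N by (rule fN)
  interpret pair_sigma_finite M N ..
  note [measurable] = f
  have fx [measurable]: "f x \<in> borel_measurable N" if "x \<in> space M" for x
    using measurable_Pair2[OF f that] by simp
  have fLp: "f x \<in> Lp_space p N" if "x \<in> space M" for x
    using fx[OF that] sec[OF that] by (simp add: Lp_space_def)
  define cl :: "nat \<Rightarrow> real \<Rightarrow> real" where "cl = (\<lambda>k t. max (- real k) (min (real k) t))"
  have cl [measurable]: "cl k \<in> borel_measurable borel" for k unfolding cl_def by measurable
  have clb: "\<bar>cl k t\<bar> \<le> real k" for k t by (auto simp: cl_def)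
  have cl1: "\<bar>cl k s - cl k t\<bar> \<le> \<bar>s - t\<bar>" for k s t by (auto simp: cl_def)
  have cl2: "\<bar>cl k t\<bar> \<le> \<bar>t\<bar>" for k t by (auto simp: cl_def)
  have clint: "integrable (M \<Otimes>\<^sub>M N) (\<lambda>z. cl k (f (fst z) (snd z)))" for k
    by (rule P.integrable_const_bound[where B="real k"]) (auto simp: clb)
  \<comment> \<open>This bounds \<open>t powr (p - 1)\<close> for
    \<open>0 \<le> t \<le> 2 * k\<close>, which converts an L1 error into one with exponent
    \<open>p\<close>; the added 1 makes it positive at \<open>k = 0\<close>.\<close>
  define c where "c = (\<lambda>k::nat. (2 * real k + 1) powr (p - 1))"
  have c: "0 < c k" for k by (auto simp: c_def)
  have "\<forall>k. \<exists>h. simple_valued M N h \<and> integrable (M \<Otimes>\<^sub>M N) (\<lambda>z. h (fst z) (snd z)) \<and>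
     (\<integral>z. \<bar>cl k (f (fst z) (snd z)) - h (fst z) (snd z)\<bar> \<partial>(M \<Otimes>\<^sub>M N)) < (1/2)^k / c k"
  proof
    fix k
    show "\<exists>h. simple_valued M N h \<and> integrable (M \<Otimes>\<^sub>M N) (\<lambda>z. h (fst z) (snd z)) \<and>
     (\<integral>z. \<bar>cl k (f (fst z) (snd z)) - h (fst z) (snd z)\<bar> \<partial>(M \<Otimes>\<^sub>M N)) < (1/2)^k / c k"
    using simple_approximable_integrable[OF clint[of k]] c[of k] unfolding simple_approximable_def by simp
  qed
  from choice[OF this] obtain h where h: "\<And>k. simple_valued M N (h k)" "\<And>k. integrable (M \<Otimes>\<^sub>M N) (\<lambda>z. h k (fst z) (snd z))"
     "\<And>k. (\<integral>z. \<bar>cl k (f (fst z) (snd z)) - h k (fst z) (snd z)\<bar> \<partial>(M \<Otimes>\<^sub>M N)) < (1/2)^k / c k"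
    by blast
  \<comment> \<open>Truncating the approximant as well makes the difference bounded by
    \<open>2 * k\<close>. The L1 error does not grow, because \<open>cl k\<close> is 1-Lipschitz and
    leaves the truncated \<open>f\<close> fixed.\<close>
  define g where "g = (\<lambda>k x y. cl k (h k x y))"
  have gs: "simple_valued M N (g k)" for k unfolding g_def by (rule simple_valued_compose[OF h(1) cl])
  have [measurable]: "(\<lambda>z. g k (fst z) (snd z)) \<in> borel_measurable (M \<Otimes>\<^sub>M N)" for k
    using gs by (simp add: simple_valued_def)
  have gx [measurable]: "g k x \<in> borel_measurable N" if "x \<in> space M" for k x
    using gs that by (simp add: simple_valued_def)
  have gb: "\<bar>g k x y\<bar> \<le> real k" for k x y by (simp add: g_def clb)
  define u where "u = (\<lambda>k x. \<integral>y. \<bar>cl k (f x y) - g k x y\<bar> powr p \<partial>N)"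
  have db: "\<bar>cl k (f x y) - g k x y\<bar> powr p \<le> c k * \<bar>cl k (f x y) - h k x y\<bar>" for k x y
  proof -
    let ?t = "\<bar>cl k (f x y) - g k x y\<bar>"
    have t: "?t \<le> 2 * real k + 1" using clb[of k "f x y"] gb[of k x y] by linarith
    have "?t powr p = ?t * ?t powr (p - 1)" by (simp add: powr_mult_base)
    also have "\<dots> \<le> ?t * c k" unfolding c_def using t p by (intro mult_left_mono powr_mono2) auto
    also have "\<dots> \<le> \<bar>cl k (f x y) - h k x y\<bar> * c k"
    proof (rule mult_right_mono)
      have "cl k (cl k (f x y)) = cl k (f x y)" by (auto simp: cl_def)
      then show "?t \<le> \<bar>cl k (f x y) - h k x y\<bar>"
        using cl1[of k "cl k (f x y)" "h k x y"] by (simp add: g_def)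
    qed (use c[of k] in simp)
    finally show ?thesis by (simp add: mult.commute)
  qed
  have dbk: "\<bar>cl k (f x y) - g k x y\<bar> powr p \<le> (2 * real k) powr p" for k x y
    using clb[of k "f x y"] gb[of k x y] p by (intro powr_mono2) linarith+
  have uint: "integrable N (\<lambda>y. \<bar>cl k (f x y) - g k x y\<bar> powr p)" if [measurable]: "x \<in> space M" for k x
    by (rule N.integrable_const_bound[where B="(2 * real k) powr p"]) (use dbk in auto)
  have un: "(\<integral>\<^sup>+y. ennreal (\<bar>cl k (f x y) - g k x y\<bar> powr p) \<partial>N) = ennreal (u k x)" if "x \<in> space M" for k x
    unfolding u_def by (rule nn_integral_eq_integral[OF uint[OF that]]) simp
  have u0: "0 \<le> u k x" for k x unfolding u_def by (rule integral_nonneg_AE) simp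
  have [measurable]: "u k \<in> borel_measurable M" for k
  proof -
    have "(\<lambda>z. \<bar>cl k (f (fst z) (snd z)) - g k (fst z) (snd z)\<bar> powr p) \<in> borel_measurable (M \<Otimes>\<^sub>M N)" by measurable
    then show ?thesis
      unfolding u_def by (intro N.borel_measurable_lebesgue_integral) (simp add: split_def)
  qed
  have uk: "(\<integral>\<^sup>+x. ennreal (u k x) \<partial>M) \<le> ennreal ((1/2)^k)" for k
  proof -
    have "(\<integral>\<^sup>+x. ennreal (u k x) \<partial>M) = (\<integral>\<^sup>+x. \<integral>\<^sup>+y. ennreal (\<bar>cl k (f x y) - g k x y\<bar> powr p) \<partial>N \<partial>M)"
      by (rule nn_integral_cong) (simp add: un)
    also have "\<dots> = (\<integral>\<^sup>+z. ennreal (\<bar>cl k (f (fst z) (snd z)) - g k (fst z) (snd z)\<bar> powr p) \<partial>(M \<Otimes>\<^sub>M N))"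
      by (subst N.nn_integral_fst[symmetric]) auto
    also have "\<dots> \<le> (\<integral>\<^sup>+z. ennreal (c k * \<bar>cl k (f (fst z) (snd z)) - h k (fst z) (snd z)\<bar>) \<partial>(M \<Otimes>\<^sub>M N))"
      by (intro nn_integral_mono ennreal_leI db)
    also have "\<dots> = ennreal (c k * (\<integral>z. \<bar>cl k (f (fst z) (snd z)) - h k (fst z) (snd z)\<bar> \<partial>(M \<Otimes>\<^sub>M N)))"
      using clint[of k] h(2)[of k] c[of k] by (subst nn_integral_eq_integral) auto
    also have "\<dots> \<le> ennreal ((1/2)^k)"
      using h(3)[of k] c[of k] by (intro ennreal_leI) (simp add: field_simps)
    finally show ?thesis .
  qed
  have "(\<integral>\<^sup>+x. (\<Sum>k. ennreal (u k x)) \<partial>M) = (\<Sum>k. \<integral>\<^sup>+x. ennreal (u k x) \<partial>M)"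
    by (rule nn_integral_suminf) measurable
  also have "\<dots> \<le> (\<Sum>k. ennreal ((1/2)^k))" by (intro suminf_le uk) auto
  also have "\<dots> = ennreal 2" by (rule suminf_ennreal_eq) (use geometric_sums[of "1/2::real"] in auto)
  finally have "(\<integral>\<^sup>+x. (\<Sum>k. ennreal (u k x)) \<partial>M) \<noteq> \<infinity>" by (auto simp: top_unique)
  then have "AE x in M. (\<Sum>k. ennreal (u k x)) \<noteq> \<infinity>" by (intro nn_integral_PInf_AE) auto
  \<comment> \<open>Summability of the errors gives convergence of the whole sequence for almost
    every \<open>x\<close>, without passing to a subsequence.\<close>
  then have ulim: "AE x in M. (\<lambda>k. u k x) \<longlonglongrightarrow> 0"
  proof eventually_elim
    case (elim x)
    then have "summable (\<lambda>k. u k x)" using u0 by (intro summable_suminf_not_top) auto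
    then show ?case by (rule summable_LIMSEQ_zero)
  qed
  have lim: "AE x in M. (\<lambda>k. Lp_norm p N (\<lambda>y. g k x y - f x y)) \<longlonglongrightarrow> 0"
    using ulim AE_space
  proof eventually_elim
    fix x assume ux: "(\<lambda>k. u k x) \<longlonglongrightarrow> 0" and x [measurable]: "x \<in> space M"
    define v where "v = (\<lambda>k. \<integral>y. \<bar>f x y - cl k (f x y)\<bar> powr p \<partial>N)"
    have vint: "integrable N (\<lambda>y. \<bar>f x y - cl k (f x y)\<bar> powr p)" for k
    proof (rule Bochner_Integration.integrable_bound[OF sec[OF x]])
      show "AE y in N. norm (\<bar>f x y - cl k (f x y)\<bar> powr p) \<le> norm (\<bar>f x y\<bar> powr p)"
        using p by (intro AE_I2) (auto intro!: powr_mono2 simp: cl_def)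
    qed measurable
    have "v \<longlonglongrightarrow> (\<integral>y. 0 \<partial>N)"
      unfolding v_def
    proof (rule integral_dominated_convergence[OF _ _ sec[OF x]])
      show "AE y in N. (\<lambda>k. \<bar>f x y - cl k (f x y)\<bar> powr p) \<longlonglongrightarrow> 0"
      proof (rule AE_I2)
        fix y
        obtain m where m: "\<bar>f x y\<bar> \<le> real m" using real_arch_simple by blast
        have "\<forall>\<^sub>F k in sequentially. \<bar>f x y - cl k (f x y)\<bar> powr p = 0"
          using eventually_ge_at_top[of m] by eventually_elim (use m in \<open>auto simp: cl_def\<close>)
        then show "(\<lambda>k. \<bar>f x y - cl k (f x y)\<bar> powr p) \<longlonglongrightarrow> 0" by (rule tendsto_eventually)
      qed
      show "AE y in N. norm (\<bar>f x y - cl k (f x y)\<bar> powr p) \<le> \<bar>f x y\<bar> powr p" for k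
        using p by (intro AE_I2) (auto intro!: powr_mono2 simp: cl_def)
    qed measurable
    then have v0: "v \<longlonglongrightarrow> 0" by simp
    have gf: "integrable N (\<lambda>y. \<bar>g k x y - f x y\<bar> powr p) \<and>
       (\<integral>y. \<bar>g k x y - f x y\<bar> powr p \<partial>N) \<le> 2 powr p * (u k x + v k)" for k
    proof -
      have le: "\<bar>g k x y - f x y\<bar> powr p \<le> 2 powr p * (\<bar>cl k (f x y) - g k x y\<bar> powr p + \<bar>f x y - cl k (f x y)\<bar> powr p)" for y
        using abs_plus_powr_le[OF p, of "cl k (f x y) - g k x y" "f x y - cl k (f x y)"] by (simp add: abs_minus_commute)
      have i: "integrable N (\<lambda>y. 2 powr p * (\<bar>cl k (f x y) - g k x y\<bar> powr p + \<bar>f x y - cl k (f x y)\<bar> powr p))"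
        using uint[OF x, of k] vint[of k] by simp
      have i2: "integrable N (\<lambda>y. \<bar>g k x y - f x y\<bar> powr p)"
        by (rule Bochner_Integration.integrable_bound[OF i]) (use le in auto)
      have "(\<integral>y. \<bar>g k x y - f x y\<bar> powr p \<partial>N) \<le> (\<integral>y. 2 powr p * (\<bar>cl k (f x y) - g k x y\<bar> powr p + \<bar>f x y - cl k (f x y)\<bar> powr p) \<partial>N)"
        by (rule integral_mono[OF i2 i le])
      also have "\<dots> = 2 powr p * (u k x + v k)" using uint[OF x, of k] vint[of k] by (simp add: u_def v_def)
      finally show ?thesis using i2 by blast
    qed
    have "(\<lambda>k. \<integral>y. \<bar>g k x y - f x y\<bar> powr p \<partial>N) \<longlonglongrightarrow> 0"
    proof (rule tendsto_sandwich[OF _ _ tendsto_const])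
      show "(\<lambda>k. 2 powr p * (u k x + v k)) \<longlonglongrightarrow> 0"
        using tendsto_mult[OF tendsto_const[of "2 powr p"] tendsto_add[OF ux v0]] by simp
    qed (use gf in \<open>auto intro!: always_eventually\<close>)
    then have "(\<lambda>k. (\<integral>y. \<bar>g k x y - f x y\<bar> powr p \<partial>N) powr (1 / p)) \<longlonglongrightarrow> 0 powr (1 / p)"
      using p by (intro tendsto_powr' tendsto_const) (auto intro!: always_eventually integral_nonneg_AE)
    then show "(\<lambda>k. Lp_norm p N (\<lambda>y. g k x y - f x y)) \<longlonglongrightarrow> 0" using p by (simp add: Lp_norm_def)
  qed
  have gLp: "g k x \<in> Lp_space p N" if "x \<in> space M" for k x
  proof -
    have [measurable]: "g k x \<in> borel_measurable N" by (rule gx[OF that])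
    have "integrable N (\<lambda>y. \<bar>g k x y\<bar> powr p)"
    proof (rule N.integrable_const_bound[where B="real k powr p"])
      show "AE y in N. norm (\<bar>g k x y\<bar> powr p) \<le> real k powr p"
        using p gb by (intro AE_I2) (simp add: powr_mono2)
    qed measurable
    then show ?thesis by (simp add: Lp_space_def)
  qed
  have normLp: "(\<lambda>x. Lp_norm p N (f x)) \<in> Lp_space p M"
  proof -
    have [measurable]: "(\<lambda>x. \<integral>y. \<bar>f x y\<bar> powr p \<partial>N) \<in> borel_measurable M"
    proof -
      have "(\<lambda>z. \<bar>f (fst z) (snd z)\<bar> powr p) \<in> borel_measurable (M \<Otimes>\<^sub>M N)" by measurable
      then show ?thesis
        by (intro N.borel_measurable_lebesgue_integral) (simp add: split_def)
    qed
    have pos: "0 \<le> (\<integral>y. \<bar>f x y\<bar> powr p \<partial>N)" for x by (rule integral_nonneg_AE) simp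
    have e: "\<bar>Lp_norm p N (f x)\<bar> powr p = (\<integral>y. \<bar>f x y\<bar> powr p \<partial>N)" for x
      using pos[of x] p by (simp add: Lp_norm_def powr_powr)
    have "(\<integral>\<^sup>+x. ennreal (\<integral>y. \<bar>f x y\<bar> powr p \<partial>N) \<partial>M) = (\<integral>\<^sup>+x. \<integral>\<^sup>+y. ennreal (\<bar>f x y\<bar> powr p) \<partial>N \<partial>M)"
      by (rule nn_integral_cong) (simp add: nn_integral_eq_integral sec)
    then have "integrable M (\<lambda>x. \<integral>y. \<bar>f x y\<bar> powr p \<partial>N)"
      using fin pos by (intro integrableI_nonneg) auto
    then show ?thesis unfolding Lp_space_def e[symmetric] by (simp add: Lp_norm_def e)
  qed
  show ?thesis
    unfolding Bochner_Lp_def using fLp lim gLp gs normLp by (auto simp: simple_valued_def intro!: exI[of _ g])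
qed

end

text \<open>Integrals of Borel functions agree for the two measures, and Borel functions are
  measurable for \<open>surface_measure S\<close>, so the same simple functions serve.\<close>

lemma Bochner_Lp_surface_measure:
  assumes "f \<in> Bochner_Lp p M (hausdorff_on S)" and b: "\<And>x. x \<in> space M \<Longrightarrow> f x \<in> borel_measurable borel"
  shows "f \<in> Bochner_Lp p M (surface_measure S)"
proof -
  have sub: "g \<in> borel_measurable borel \<and> g \<in> Lp_space p (surface_measure S)" if "g \<in> Lp_space p (hausdorff_on S)" for g
  proof -
    have g [measurable]: "g \<in> borel_measurable borel"
      using that measurable_cong_sets[OF sets_hausdorff_on refl] by (auto simp: Lp_space_def)
    then show ?thesis
      using that by (auto simp: Lp_space_def borel_measurable_surface integrable_hausdorff_on)
  qed
  have norm: "Lp_norm p (surface_measure S) g = Lp_norm p (hausdorff_on S) g" if [measurable]: "g \<in> borel_measurable borel" for g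
    unfolding Lp_norm_def by (subst integral_hausdorff_on) auto
  obtain s where f: "\<And>x. x \<in> space M \<Longrightarrow> f x \<in> Lp_space p (hausdorff_on S)"
    and s: "\<And>k::nat. simple_function M (s k)" "\<And>k x. x \<in> space M \<Longrightarrow> s k x \<in> Lp_space p (hausdorff_on S)"
    and lim: "AE x in M. (\<lambda>k. Lp_norm p (hausdorff_on S) (\<lambda>y. s k x y - f x y)) \<longlonglongrightarrow> 0"
    and n: "(\<lambda>x. Lp_norm p (hausdorff_on S) (f x)) \<in> Lp_space p M"
    using assms(1) unfolding Bochner_Lp_def by blast
  have "AE x in M. (\<lambda>k. Lp_norm p (surface_measure S) (\<lambda>y. s k x y - f x y)) \<longlonglongrightarrow> 0"
    using lim AE_space
  proof eventually_elim
    case (elim x)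
    have "(\<lambda>y. s k x y - f x y) \<in> borel_measurable borel" for k
      using sub[OF s(2)[OF elim(2), of k]] b[OF elim(2)] by auto
    then show ?case using elim by (simp add: norm)
  qed
  moreover have "(\<lambda>x. Lp_norm p (surface_measure S) (f x)) \<in> Lp_space p M"
  proof -
    have eq: "Lp_norm p (surface_measure S) (f x) = Lp_norm p (hausdorff_on S) (f x)" if "x \<in> space M" for x
      by (rule norm[OF b[OF that]])
    show ?thesis
      using n unfolding Lp_space_def
      by (simp add: eq cong: measurable_cong Bochner_Integration.integrable_cong)
  qed
  ultimately show ?thesis
    unfolding Bochner_Lp_def using f s sub by blast
qed


section \<open>Separability and extraction of subsequences\<close>

text \<open>A function is coded by a mesh \<open>m\<close> that is fine enough for the accuracy
  \<open>j\<close>, and by rational approximations of its values on a finite net of that mesh. Two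
  functions with the same code differ by less than \<open>4 / (j + 1)\<close>. One member of
  \<open>V\<close> is chosen for each code that occurs, so the countable set lies in
  \<open>V\<close>.\<close>

lemma separable_continuous_family:
  fixes h :: "'i \<Rightarrow> 'a::metric_space \<Rightarrow> real"
  assumes X: "compact X" and h: "\<And>v. v \<in> V \<Longrightarrow> continuous_on X (h v)"
  obtains E where "countable E" "E \<subseteq> V"
    "\<And>v e. v \<in> V \<Longrightarrow> 0 < e \<Longrightarrow> \<exists>d\<in>E. \<forall>x\<in>X. \<bar>h v x - h d x\<bar> \<le> e"
proof -
  have "\<forall>m. \<exists>us. set us \<subseteq> X \<and> X \<subseteq> (\<Union>u\<in>set us. ball u (1 / real (Suc m)))"
  proof
    fix m
    obtain F where F: "F \<subseteq> X" "finite F" "X \<subseteq> (\<Union>u\<in>F. ball u (1 / real (Suc m)))"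
    proof (rule compactE_image[OF X])
      show "X \<subseteq> (\<Union>u\<in>X. ball u (1 / real (Suc m)))" by force
    qed auto
    obtain us where "set us = F" using finite_list[OF F(2)] by blast
    then show "\<exists>us. set us \<subseteq> X \<and> X \<subseteq> (\<Union>u\<in>set us. ball u (1 / real (Suc m)))" using F by blast
  qed
  from choice[OF this] obtain us where us: "\<And>m. set (us m) \<subseteq> X" "\<And>m. X \<subseteq> (\<Union>u\<in>set (us m). ball u (1 / real (Suc m)))"
    by blast
  define R where "R = (\<lambda>(m::nat, j::nat, ts::rat list) v.
     (\<forall>x\<in>X. \<forall>y\<in>X. dist x y < 1 / real (Suc m) \<longrightarrow> \<bar>h v x - h v y\<bar> < 1 / real (Suc j)) \<and>
     length ts = length (us m) \<and> (\<forall>i<length ts. \<bar>h v (us m ! i) - of_rat (ts ! i)\<bar> < 1 / real (Suc j)))"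
  define d where "d = (\<lambda>c. SOME v. v \<in> V \<and> R c v)"
  have d: "d c \<in> V \<and> R c (d c)" if "v \<in> V" "R c v" for c v
    unfolding d_def by (rule someI[of "\<lambda>v. v \<in> V \<and> R c v" v]) (use that in auto)
  have dense: "\<exists>d'\<in>d ` {c. \<exists>v\<in>V. R c v}. \<forall>x\<in>X. \<bar>h v x - h d' x\<bar> \<le> e" if v: "v \<in> V" and e: "0 < e" for v e
  proof -
    obtain j where j: "1 / real (Suc j) < e / 4" using nat_approx_posE[of "e/4"] e by auto
    have "uniformly_continuous_on X (h v)" using compact_uniformly_continuous[OF h[OF v] X] .
    then obtain \<rho> where \<rho>: "0 < \<rho>" "\<And>x y. x \<in> X \<Longrightarrow> y \<in> X \<Longrightarrow> dist x y < \<rho> \<Longrightarrow> \<bar>h v x - h v y\<bar> < 1 / real (Suc j)"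
      unfolding uniformly_continuous_on_def dist_real_def
      by (metis abs_minus_commute dist_commute of_nat_0_less_iff zero_less_Suc zero_less_divide_1_iff)
    obtain m where m: "1 / real (Suc m) < \<rho>" using nat_approx_posE[OF \<rho>(1)] by auto
    have "\<exists>q::rat. \<bar>t - of_rat q\<bar> < 1 / real (Suc j)" for t :: real
    proof -
      have "t < t + 1 / real (Suc j)" by simp
      then obtain q where "t < of_rat q" "of_rat q < t + 1 / real (Suc j)" using of_rat_dense by blast
      then show ?thesis by (intro exI[of _ q]) auto
    qed
    then obtain rt :: "real \<Rightarrow> rat" where rt: "\<And>t. \<bar>t - of_rat (rt t)\<bar> < 1 / real (Suc j)" by metis
    define ts where "ts = map (\<lambda>u. rt (h v u)) (us m)"
    have Rv: "R (m, j, ts) v"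
      using \<rho>(2) m rt by (auto simp: R_def ts_def)
    define d' where "d' = d (m, j, ts)"
    have Rd: "R (m, j, ts) d'" using d[OF v Rv] by (simp add: d'_def)
    have "\<bar>h v x - h d' x\<bar> \<le> e" if x: "x \<in> X" for x
    proof -
      obtain u where u: "u \<in> set (us m)" "dist u x < 1 / real (Suc m)" using us(2)[of m] x by auto
      then obtain i where i: "i < length ts" "us m ! i = u" using Rv by (auto simp: in_set_conv_nth R_def)
      have uX: "u \<in> X" using u(1) us(1) by auto
      have "\<bar>h v x - h v u\<bar> < 1 / real (Suc j)" "\<bar>h d' x - h d' u\<bar> < 1 / real (Suc j)"
        using Rv Rd x uX u(2) by (auto simp: R_def dist_commute)
      moreover have "\<bar>h v u - of_rat (ts ! i)\<bar> < 1 / real (Suc j)" "\<bar>h d' u - of_rat (ts ! i)\<bar> < 1 / real (Suc j)"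
        using Rv Rd i by (auto simp: R_def)
      ultimately show ?thesis using j by linarith
    qed
    then show ?thesis using v Rv unfolding d'_def by blast
  qed
  show ?thesis
    by (rule that[OF _ _ dense]) (use d in auto)
qed

text \<open>A diagonal sequence converges on the countable set; approximation that is uniform for
  large \<open>k\<close> extends this to \<open>V\<close> by Cauchy's criterion. Division by
  \<open>\<bar>b d\<bar> + 1\<close> makes the pointwise bounds into the common bound 1.\<close>

lemma convergent_subsequence_functionals:
  fixes \<mu> :: "nat \<Rightarrow> 'i \<Rightarrow> real"
  assumes E: "countable E" and bdd: "\<And>d. d \<in> E \<Longrightarrow> \<exists>b. \<forall>k. \<bar>\<mu> k d\<bar> \<le> b"
    and dense: "\<And>v e. v \<in> V \<Longrightarrow> 0 < e \<Longrightarrow> \<exists>d\<in>E. \<forall>\<^sub>F k in sequentially. \<bar>\<mu> k v - \<mu> k d\<bar> \<le> e"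
  obtains s :: "nat \<Rightarrow> nat" where "strict_mono s" "\<And>v. v \<in> V \<Longrightarrow> convergent (\<lambda>k. \<mu> (s k) v)"
proof -
  obtain b where b: "\<And>d k. d \<in> E \<Longrightarrow> \<bar>\<mu> k d\<bar> \<le> b d" using bdd by metis
  define f where "f = (\<lambda>k d. \<mu> k d / (\<bar>b d\<bar> + 1))"
  have "norm (f k d) \<le> 1" if "d \<in> E" for k d
    using b[OF that, of k] by (simp add: f_def abs_divide)
  then obtain s where s: "strict_mono (s::nat \<Rightarrow> nat)" "\<And>d. d \<in> E \<Longrightarrow> \<exists>l. (\<lambda>k. f (s k) d) \<longlonglongrightarrow> l"
    using function_convergent_subsequence[OF E, of f 1] by metis
  have conv: "convergent (\<lambda>k. \<mu> (s k) d)" if d: "d \<in> E" for d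
  proof -
    obtain l where "(\<lambda>k. f (s k) d) \<longlonglongrightarrow> l" using s(2)[OF d] by blast
    then have "(\<lambda>k. (\<bar>b d\<bar> + 1) * f (s k) d) \<longlonglongrightarrow> (\<bar>b d\<bar> + 1) * l" by (intro tendsto_intros)
    moreover have "(\<bar>b d\<bar> + 1) * f (s k) d = \<mu> (s k) d" for k by (simp add: f_def)
    ultimately show ?thesis unfolding convergent_def by auto
  qed
  have "convergent (\<lambda>k. \<mu> (s k) v)" if v: "v \<in> V" for v
  proof (subst Cauchy_convergent_iff[symmetric], rule metric_CauchyI)
    fix e :: real assume e: "0 < e"
    then have "0 < e/4" by simp
    then obtain d where d: "d \<in> E" "\<forall>\<^sub>F k in sequentially. \<bar>\<mu> k v - \<mu> k d\<bar> \<le> e/4" using dense[OF v] by blast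
    obtain n where n: "\<And>k. n \<le> k \<Longrightarrow> \<bar>\<mu> k v - \<mu> k d\<bar> \<le> e/4" using d(2) by (auto simp: eventually_sequentially)
    obtain n' where n': "\<And>k l. n' \<le> k \<Longrightarrow> n' \<le> l \<Longrightarrow> dist (\<mu> (s k) d) (\<mu> (s l) d) < e/4"
      using metric_CauchyD[OF convergent_Cauchy[OF conv[OF d(1)]] \<open>0 < e/4\<close>] by blast
    show "\<exists>m. \<forall>k\<ge>m. \<forall>l\<ge>m. dist (\<mu> (s k) v) (\<mu> (s l) v) < e"
    proof (intro exI[of _ "max n n'"] allI impI)
      fix k l assume kl: "max n n' \<le> k" "max n n' \<le> l"
      have "n \<le> s k" "n \<le> s l" using kl seq_suble[OF s(1)] by (meson max.bounded_iff order_trans)+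
      then show "dist (\<mu> (s k) v) (\<mu> (s l) v) < e"
        using n[of "s k"] n[of "s l"] n'[of k l] kl e unfolding dist_real_def by linarith
    qed
  qed
  then show ?thesis using that s(1) by blast
qed

section \<open>The space of test functions\<close>

lemma continuous_on_apply_bcontfun:
  fixes \<psi> :: "'a::metric_space \<Rightarrow> ('b::metric_space \<Rightarrow>\<^sub>C real)"
  assumes \<psi>: "continuous_on S \<psi>"
  shows "continuous_on (S \<times> UNIV) (\<lambda>z. apply_bcontfun (\<psi> (fst z)) (snd z))"
  unfolding continuous_on_iff
proof (intro ballI allI impI)
  fix z :: "'a \<times> 'b" and e :: real assume z: "z \<in> S \<times> UNIV" and e: "0 < e"
  obtain x y where xy: "z = (x, y)" "x \<in> S" using z by auto
  have "0 < e/2" using e by simp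
  obtain d1 where d1: "0 < d1" "\<And>x'. x' \<in> S \<Longrightarrow> dist x' x < d1 \<Longrightarrow> dist (\<psi> x') (\<psi> x) < e/2"
    using \<psi> xy(2) \<open>0 < e/2\<close> unfolding continuous_on_iff by meson
  have "continuous_on UNIV (apply_bcontfun (\<psi> x))" using apply_bcontfun[of "\<psi> x"] by (simp add: bcontfun_def)
  then obtain d2 where d2: "0 < d2" "\<And>y'. dist y' y < d2 \<Longrightarrow> dist (apply_bcontfun (\<psi> x) y') (apply_bcontfun (\<psi> x) y) < e/2"
    using \<open>0 < e/2\<close> unfolding continuous_on_iff by (meson UNIV_I)
  show "\<exists>d>0. \<forall>z'\<in>S \<times> UNIV. dist z' z < d \<longrightarrow> dist (apply_bcontfun (\<psi> (fst z')) (snd z')) (apply_bcontfun (\<psi> (fst z)) (snd z)) < e"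
  proof (intro exI[of _ "min d1 d2"] conjI ballI impI)
    fix z' assume z': "z' \<in> S \<times> (UNIV :: 'b set)" "dist z' z < min d1 d2"
    obtain x' y' where xy': "z' = (x', y')" "x' \<in> S" using z' by auto
    have "dist x' x < d1" "dist y' y < d2"
      using z'(2) dist_fst_le[of z' z] dist_snd_le[of z' z] by (auto simp: xy xy')
    then have "dist (\<psi> x') (\<psi> x) < e/2" "dist (apply_bcontfun (\<psi> x) y') (apply_bcontfun (\<psi> x) y) < e/2"
      using d1(2)[OF xy'(2)] d2(2) by auto
    moreover have "dist (apply_bcontfun (\<psi> x') y') (apply_bcontfun (\<psi> x) y') \<le> dist (\<psi> x') (\<psi> x)"
      by (rule dist_bounded)
    ultimately show "dist (apply_bcontfun (\<psi> (fst z')) (snd z')) (apply_bcontfun (\<psi> (fst z)) (snd z)) < e"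
      using dist_triangle[of "apply_bcontfun (\<psi> x') y'" "apply_bcontfun (\<psi> x) y" "apply_bcontfun (\<psi> x) y'"]
      by (simp add: xy xy')
  qed (use d1 d2 in auto)
qed

lemma continuous_on_apply_bcontfun_compose:
  fixes \<psi> :: "'a::metric_space \<Rightarrow> ('b::metric_space \<Rightarrow>\<^sub>C real)"
  assumes "continuous_on S \<psi>" "continuous_on T f" "continuous_on T g" "f ` T \<subseteq> S"
  shows "continuous_on T (\<lambda>t. apply_bcontfun (\<psi> (f t)) (g t))"
proof -
  have "continuous_on T (\<lambda>t. (f t, g t))" using assms(2,3) by (rule continuous_on_Pair)
  from continuous_on_compose2[OF continuous_on_apply_bcontfun[OF assms(1)] this] show ?thesis
    using assms(4) by auto
qed

lemma int_lattice_reduce: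
  fixes y :: "real ^ 'n"
  obtains \<xi> where "\<xi> \<in> int_lattice" "y + \<xi> \<in> cbox 0 1"
proof (rule that[of "\<chi> i. - of_int \<lfloor>y $ i\<rfloor>"])
  show "y + (\<chi> i. - of_int \<lfloor>y $ i\<rfloor>) \<in> cbox 0 1"
    by (auto simp: mem_box_cart) linarith+
qed (simp add: int_lattice_def)

lemma dist_C_per_le:
  fixes f g :: "(real ^ 'n) \<Rightarrow>\<^sub>C real"
  assumes "f \<in> C_per" "g \<in> C_per" "\<And>y. y \<in> cbox 0 1 \<Longrightarrow> \<bar>apply_bcontfun f y - apply_bcontfun g y\<bar> \<le> e"
  shows "dist f g \<le> e"
proof (rule dist_bound)
  fix y :: "real ^ 'n"
  obtain \<xi> where "\<xi> \<in> int_lattice" "y + \<xi> \<in> cbox 0 1" by (rule int_lattice_reduce)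
  then show "dist (apply_bcontfun f y) (apply_bcontfun g y) \<le> e"
    using assms(1,2) assms(3)[of "y + \<xi>"] by (simp add: C_per_def dist_real_def)
qed

text \<open>By periodicity the supremum distance is determined on the closed unit cell, so the test
  functions may be regarded as continuous functions on the compact set
  \<open>closure \<Omega> \<times> cbox 0 1\<close>.\<close>

lemma C_C_per_separable:
  fixes \<Omega> :: "(real ^ 'n) set"
  assumes "bounded \<Omega>"
  obtains E where "countable E" "E \<subseteq> C_C_per \<Omega>"
    "\<And>\<psi> e. \<psi> \<in> C_C_per \<Omega> \<Longrightarrow> 0 < e \<Longrightarrow> \<exists>\<phi>\<in>E. \<forall>x\<in>closure \<Omega>. dist (\<psi> x) (\<phi> x) \<le> e"
proof -
  let ?X = "closure \<Omega> \<times> cbox (0::real^'n) 1"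
  have X: "compact ?X" using assms by (intro compact_Times) (auto simp: compact_closure)
  have cont: "continuous_on ?X (\<lambda>z. apply_bcontfun (\<psi> (fst z)) (snd z))" if "\<psi> \<in> C_C_per \<Omega>" for \<psi>
    using that by (intro continuous_on_apply_bcontfun_compose[of "closure \<Omega>"] continuous_intros) (auto simp: C_C_per_def)
  obtain E where E: "countable E" "E \<subseteq> C_C_per \<Omega>"
    "\<And>\<psi> e. \<psi> \<in> C_C_per \<Omega> \<Longrightarrow> 0 < e \<Longrightarrow> \<exists>\<phi>\<in>E. \<forall>z\<in>?X. \<bar>apply_bcontfun (\<psi> (fst z)) (snd z) - apply_bcontfun (\<phi> (fst z)) (snd z)\<bar> \<le> e"
    by (rule separable_continuous_family[where h="\<lambda>\<psi> z. apply_bcontfun (\<psi> (fst z)) (snd z)", OF X cont]) blast+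
  have "\<exists>\<phi>\<in>E. \<forall>x\<in>closure \<Omega>. dist (\<psi> x) (\<phi> x) \<le> e" if \<psi>: "\<psi> \<in> C_C_per \<Omega>" and e: "0 < e" for \<psi> e
  proof -
    obtain \<phi> where \<phi>: "\<phi> \<in> E" "\<And>z. z \<in> ?X \<Longrightarrow> \<bar>apply_bcontfun (\<psi> (fst z)) (snd z) - apply_bcontfun (\<phi> (fst z)) (snd z)\<bar> \<le> e"
      using E(3)[OF \<psi> e] by blast
    have "\<phi> \<in> C_C_per \<Omega>" using \<phi>(1) E(2) by blast
    then have "dist (\<psi> x) (\<phi> x) \<le> e" if "x \<in> closure \<Omega>" for x
      using that \<psi> \<phi>(2)[of "(x, _)"] by (intro dist_C_per_le) (auto simp: C_C_per_def)
    then show ?thesis using \<phi>(1) by blast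
  qed
  then show ?thesis using that E by blast
qed

lemma C_C_per_linear:
  assumes \<psi>: "\<psi> \<in> C_C_per \<Omega>" and \<phi>: "\<phi> \<in> C_C_per \<Omega>"
  shows "(\<lambda>x. \<psi> x + c *\<^sub>R \<phi> x) \<in> C_C_per \<Omega>"
  using assms by (auto simp: C_C_per_def C_per_def intro!: continuous_intros)


section \<open>Cells and cubes\<close>

lemma unit_cell_eq_box: "unit_cell = box (0 :: real ^ 'n) 1"
  by (auto simp: unit_cell_def mem_box_cart)

lemma open_unit_cell: "open (unit_cell :: (real ^ 'n) set)"
  by (simp only: unit_cell_eq_box open_box)

lemma bounded_unit_cell: "bounded (unit_cell :: (real ^ 'n) set)"
  by (simp add: unit_cell_eq_box)

lemma open_invertible_image:
  fixes A :: "real ^ 'n ^ 'n"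
  assumes "invertible A" "open S"
  shows "open ((*v) A ` S)"
proof (rule open_surjective_linear_image[OF assms(2) matrix_vector_mul_linear])
  show "surj ((*v) A)" using matrix_inv_cancel(4)[OF assms(1)] by (metis surjI)
qed

lemma bounded_matrix_image: "bounded S \<Longrightarrow> bounded ((*v) (A :: real ^ 'n ^ 'm) ` S)"
  by (rule bounded_linear_image[OF _ matrix_vector_mul_bounded_linear])

lemma lmeasurable_cell:
  fixes A :: "real ^ 'n ^ 'n"
  shows "invertible A \<Longrightarrow> (*v) A ` unit_cell \<in> lmeasurable"
  by (intro lmeasurable_open open_invertible_image bounded_matrix_image bounded_unit_cell open_unit_cell)

definition cell_volume :: "real ^ 'n ^ 'n \<Rightarrow> real" where
  "cell_volume A = measure lebesgue ((*v) A ` unit_cell)"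

lemma scaled_cell_unit_cell:
  fixes A :: "real ^ 'n ^ 'n"
  assumes "0 < \<epsilon>" "invertible A"
  shows "scaled_cell \<epsilon> A \<xi> unit_cell \<in> lmeasurable"
    "measure lebesgue (scaled_cell \<epsilon> A \<xi> unit_cell) = \<epsilon> ^ CARD('n) * cell_volume A"
proof -
  have eq: "scaled_cell \<epsilon> A \<xi> unit_cell = (\<lambda>x. \<epsilon> *\<^sub>R x + \<epsilon> *\<^sub>R (A *v \<xi>)) ` ((*v) A ` unit_cell)"
    unfolding scaled_cell_def image_image by (simp add: matrix_vector_right_distrib scaleR_add_right)
  have eq': "scaled_cell \<epsilon> A \<xi> unit_cell = (+) (\<epsilon> *\<^sub>R (A *v \<xi>)) ` ((*\<^sub>R) \<epsilon> ` ((*v) A ` unit_cell))"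
    unfolding eq image_image by (simp add: add.commute)
  have "open (scaled_cell \<epsilon> A \<xi> unit_cell)" "bounded (scaled_cell \<epsilon> A \<xi> unit_cell)"
    unfolding eq' using assms
    by (auto intro!: open_translation open_scaling open_invertible_image bounded_translation bounded_scaling
        bounded_matrix_image bounded_unit_cell open_unit_cell)
  then show "scaled_cell \<epsilon> A \<xi> unit_cell \<in> lmeasurable" by (simp add: lmeasurable_open)
  show "measure lebesgue (scaled_cell \<epsilon> A \<xi> unit_cell) = \<epsilon> ^ CARD('n) * cell_volume A"
    unfolding eq cell_volume_def using measure_lebesgue_affine[of \<epsilon> "\<epsilon> *\<^sub>R (A *v \<xi>)" "(*v) A ` unit_cell"] assms(1)
    by (simp add: add.commute)
qed

text \<open>The inverse matrix sends the ball of radius \<open>1 / (2 * a)\<close> about the image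
  of the centre \<open>c\<close> to points within 1/2 of \<open>c\<close>, that is, into the unit
  cell. A bound on the inverses thus bounds the volumes from below uniformly in
  \<open>x\<close>.\<close>

lemma cell_volume_ge:
  fixes A :: "real ^ 'n ^ 'n"
  assumes A: "invertible A" and a: "norm (matrix_inv A) \<le> a" "0 < a"
  shows "measure lebesgue (ball (0 :: real ^ 'n) (1 / (2 * a))) \<le> cell_volume A"
proof -
  define c where "c = (\<chi> i. 1/2 :: real ^ 'n)"
  have sub: "ball (A *v c) (1 / (2 * a)) \<subseteq> (*v) A ` unit_cell"
  proof
    fix z assume z: "z \<in> ball (A *v c) (1 / (2 * a))"
    define y where "y = matrix_inv A *v z"
    have "y - c = matrix_inv A *v (z - A *v c)"
      by (simp add: y_def matrix_vector_mult_diff_distrib matrix_inv_cancel[OF A])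
    then have "norm (y - c) \<le> a * norm (z - A *v c)"
      using norm_matrix_vector_mult_le[of "matrix_inv A" "z - A *v c"] a(1)
      by (metis (no_types, opaque_lifting) mult_right_mono norm_ge_zero order_trans)
    also have "\<dots> < 1/2" using z a(2) by (simp add: dist_norm norm_minus_commute field_simps)
    finally have "\<bar>(y - c) $ i\<bar> < 1/2" for i using component_le_norm_cart[of "y - c" i] by linarith
    then have "\<bar>y $ i - 1/2\<bar> < 1/2" for i by (simp add: c_def)
    then have "0 < y $ i \<and> y $ i < 1" for i using abs_less_iff[of "y $ i - 1/2" "1/2"] by (metis (no_types) add.commute
        diff_gt_0_iff_gt abs_diff_less_iff field_sum_of_halves diff_self)
    then have "y \<in> unit_cell" by (simp add: unit_cell_def)
    moreover have "z = A *v y" by (simp add: y_def matrix_inv_cancel[OF A])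
    ultimately show "z \<in> (*v) A ` unit_cell" by blast
  qed
  have "measure lebesgue (ball (0 :: real ^ 'n) (1 / (2 * a))) = measure lebesgue (ball (A *v c) (1 / (2 * a)))"
    using measure_translation[of "A *v c" "ball 0 (1 / (2 * a))"] by (simp add: ball_translation[symmetric])
  also have "\<dots> \<le> cell_volume A"
    unfolding cell_volume_def by (rule measure_mono_fmeasurable[OF sub _ lmeasurable_cell[OF A]]) simp
  finally show ?thesis .
qed

lemma scaled_cell_disjoint:
  fixes A :: "real ^ 'n ^ 'n"
  assumes "0 < \<epsilon>" "invertible A" "\<xi> \<in> int_lattice" "\<xi>' \<in> int_lattice" "\<xi> \<noteq> \<xi>'"
  shows "scaled_cell \<epsilon> A \<xi> unit_cell \<inter> scaled_cell \<epsilon> A \<xi>' unit_cell = {}"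
proof (rule ccontr)
  assume "\<not> ?thesis"
  then obtain y y' where y: "y \<in> unit_cell" "y' \<in> unit_cell" "\<epsilon> *\<^sub>R (A *v (y + \<xi>)) = \<epsilon> *\<^sub>R (A *v (y' + \<xi>'))"
    unfolding scaled_cell_def by blast
  then have "A *v (y + \<xi>) = A *v (y' + \<xi>')" using assms(1) by simp
  then have eq: "y + \<xi> = y' + \<xi>'" by (metis assms(2) matrix_inv_cancel(3))
  have "\<xi> $ i = \<xi>' $ i" for i
  proof -
    obtain a b where ab: "\<xi> $ i = of_int a" "\<xi>' $ i = of_int b"
      using assms(3,4) unfolding int_lattice_def mem_Collect_eq by (meson Ints_cases)
    have "y $ i + \<xi> $ i = y' $ i + \<xi>' $ i" using eq by (metis vector_add_component)
    moreover have "0 < y $ i" "y $ i < 1" "0 < y' $ i" "y' $ i < 1" using y by (auto simp: unit_cell_def)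
    ultimately have "\<bar>of_int a - of_int b :: real\<bar> < 1" using ab by linarith
    then have "\<bar>a - b\<bar> < 1" by linarith
    then show ?thesis using ab by simp
  qed
  then show False using assms(5) by (simp add: vec_eq_iff)
qed

text \<open>Volume comparison: the cells are disjoint, of equal volume and contained in
  \<open>Q\<close>. The estimate is proved for finite subsets first, since \<open>card\<close> of an
  infinite set is 0; finiteness then follows from it.\<close>

lemma card_Xi_star_le:
  fixes A :: "real ^ 'n ^ 'n"
  assumes \<epsilon>: "0 < \<epsilon>" and A: "invertible A" and Q: "Q \<in> lmeasurable"
  shows "finite (Xi_star \<epsilon> A Q)"
    "real (card (Xi_star \<epsilon> A Q)) * (\<epsilon> ^ CARD('n) * cell_volume A) \<le> measure lebesgue Q"
proof -
  have le: "real (card X) * (\<epsilon> ^ CARD('n) * cell_volume A) \<le> measure lebesgue Q"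
    if X: "X \<subseteq> Xi_star \<epsilon> A Q" "finite X" for X
  proof -
    have lat: "\<xi> \<in> int_lattice" "scaled_cell \<epsilon> A \<xi> unit_cell \<subseteq> Q" if "\<xi> \<in> X" for \<xi>
      using X(1) that by (auto simp: Xi_star_def Xi_def)
    have "real (card X) * (\<epsilon> ^ CARD('n) * cell_volume A) = (\<Sum>\<xi>\<in>X. measure lebesgue (scaled_cell \<epsilon> A \<xi> unit_cell))"
      by (simp add: scaled_cell_unit_cell[OF \<epsilon> A])
    also have "\<dots> = measure lebesgue (\<Union>\<xi>\<in>X. scaled_cell \<epsilon> A \<xi> unit_cell)"
    proof (rule measure_finite_Union[symmetric])
      show "disjoint_family_on (\<lambda>\<xi>. scaled_cell \<epsilon> A \<xi> unit_cell) X"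
        unfolding disjoint_family_on_def using scaled_cell_disjoint[OF \<epsilon> A] lat(1) by blast
      show "(\<lambda>\<xi>. scaled_cell \<epsilon> A \<xi> unit_cell) ` X \<subseteq> sets lebesgue"
        using scaled_cell_unit_cell(1)[OF \<epsilon> A] by (auto simp: fmeasurable_def)
      show "emeasure lebesgue (scaled_cell \<epsilon> A \<xi> unit_cell) \<noteq> \<infinity>" for \<xi>
        using scaled_cell_unit_cell(1)[OF \<epsilon> A, of \<xi>] by (auto simp: fmeasurable_def less_top)
    qed (use X in auto)
    also have "\<dots> \<le> measure lebesgue Q"
    proof (rule measure_mono_fmeasurable[OF _ _ Q])
      show "(\<Union>\<xi>\<in>X. scaled_cell \<epsilon> A \<xi> unit_cell) \<subseteq> Q" using lat(2) by auto
      show "(\<Union>\<xi>\<in>X. scaled_cell \<epsilon> A \<xi> unit_cell) \<in> sets lebesgue"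
        using scaled_cell_unit_cell(1)[OF \<epsilon> A] X(2) by (intro sets.finite_UN) (auto simp: fmeasurable_def)
    qed
    finally show ?thesis .
  qed
  have "0 < measure lebesgue (ball (0 :: real ^ 'n) (1 / (2 * (norm (matrix_inv A) + 1))))"
    by (simp add: content_ball_pos add_nonneg_pos)
  then have "0 < cell_volume A"
    using cell_volume_ge[OF A, of "norm (matrix_inv A) + 1"] by (smt (verit, best) norm_ge_zero)
  then have c: "0 < \<epsilon> ^ CARD('n) * cell_volume A" using \<epsilon> by simp
  show fin: "finite (Xi_star \<epsilon> A Q)"
  proof (rule ccontr)
    assume inf: "infinite (Xi_star \<epsilon> A Q)"
    obtain m :: nat where m: "measure lebesgue Q / (\<epsilon> ^ CARD('n) * cell_volume A) < real m" using reals_Archimedean2 by blast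
    obtain X where X: "X \<subseteq> Xi_star \<epsilon> A Q" "finite X" "card X = m" using infinite_arbitrarily_large[OF inf] by blast
    show False using le[OF X(1,2)] m X(3) c by (simp add: divide_less_eq)
  qed
  show "real (card (Xi_star \<epsilon> A Q)) * (\<epsilon> ^ CARD('n) * cell_volume A) \<le> measure lebesgue Q"
    by (rule le[OF order_refl fin])
qed

lemma open_cube_properties:
  fixes Q :: "(real ^ 'n) set"
  assumes "open_cube s Q"
  shows "open Q" "\<And>x y. x \<in> closure Q \<Longrightarrow> y \<in> Q \<Longrightarrow> dist x y \<le> real CARD('n) * s" "bounded Q"
proof -
  let ?C = "{y :: real ^ 'n. \<forall>i. 0 < y $ i \<and> y $ i < s}"
  obtain a T where T: "orthogonal_transformation T" "Q = (\<lambda>y. a + T y) ` ?C"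
    using assms unfolding open_cube_def by blast
  have C: "?C = box 0 (\<chi> i. s)" by (auto simp: mem_box_cart)
  have "open (T ` ?C)"
    unfolding C using T(1) orthogonal_transformation_surj orthogonal_transformation_linear
    by (intro open_surjective_linear_image) auto
  moreover have "Q = (+) a ` (T ` ?C)" unfolding T(2) by (simp add: image_image)
  ultimately show "open Q" by (simp only: open_translation)
  have d: "dist x y \<le> real CARD('n) * s" if "x \<in> Q" "y \<in> Q" for x y
  proof -
    obtain u v where uv: "u \<in> ?C" "v \<in> ?C" "x = a + T u" "y = a + T v" using \<open>x \<in> Q\<close> \<open>y \<in> Q\<close> T(2) by auto
    have "T u - T v = T (u - v)" using orthogonal_transformation_linear[OF T(1)] by (simp add: linear_diff)
    then have "dist x y = norm (u - v)" using orthogonal_transformation_norm[OF T(1), of "u - v"] by (simp add: uv dist_norm)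
    also have "\<dots> \<le> (\<Sum>i\<in>UNIV. \<bar>(u - v) $ i\<bar>)" by (rule norm_le_l1_cart)
    also have "\<dots> \<le> (\<Sum>i\<in>(UNIV::'n set). s)"
    proof (rule sum_mono)
      fix i
      have "0 < u $ i" "u $ i < s" "0 < v $ i" "v $ i < s" using uv by auto
      then show "\<bar>(u - v) $ i\<bar> \<le> s" by simp
    qed
    finally show ?thesis by simp
  qed
  then show "bounded Q" unfolding bounded_two_points by blast
  fix x y assume x: "x \<in> closure Q" and y: "y \<in> Q"
  have "Q \<subseteq> cball y (real CARD('n) * s)" using d[OF y] by auto
  then have "closure Q \<subseteq> cball y (real CARD('n) * s)" by (simp add: closure_minimal)
  then show "dist x y \<le> real CARD('n) * s" using x by (auto simp: dist_commute)
qed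

section \<open>Matrix-valued functions and a Borel set\<close>

lemma continuous_on_matrix_mult:
  fixes A :: "'a::topological_space \<Rightarrow> real ^ 'n ^ 'm" and B :: "'a \<Rightarrow> real ^ 'k ^ 'n"
  assumes "continuous_on S A" "continuous_on S B"
  shows "continuous_on S (\<lambda>x. A x ** B x)"
  unfolding matrix_matrix_mult_def using assms
  by (intro continuous_on_vec_lambda continuous_on_sum continuous_on_mult continuous_on_component)

lemma continuous_on_matrix_vector_mult:
  fixes A :: "'a::topological_space \<Rightarrow> real ^ 'n ^ 'm" and v :: "'a \<Rightarrow> real ^ 'n"
  assumes "continuous_on S A" "continuous_on S v"
  shows "continuous_on S (\<lambda>x. A x *v v x)"
  unfolding matrix_vector_mult_def using assms
  by (intro continuous_on_vec_lambda continuous_on_sum continuous_on_mult continuous_on_component)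

lemma matrix_inv_mult:
  fixes A B :: "real ^ 'n ^ 'n"
  assumes "invertible A" "invertible B"
  shows "matrix_inv (A ** B) = matrix_inv B ** matrix_inv A"
proof -
  have "invertible (A ** B)" using assms by (rule invertible_mult)
  then have "matrix_inv (A ** B) *v x = (matrix_inv B ** matrix_inv A) *v x" for x
  proof -
    have "x = (A ** B) *v ((matrix_inv B ** matrix_inv A) *v x)"
      by (simp add: matrix_vector_mul_assoc[symmetric] matrix_inv_cancel assms)
    then show ?thesis using matrix_inv_cancel(3)[OF \<open>invertible (A ** B)\<close>] by metis
  qed
  then show ?thesis by (simp add: matrix_eq)
qed

lemma borel_UN_compact_Int_open:
  fixes C :: "'i \<Rightarrow> 'j \<Rightarrow> 'a::t2_space set"
  assumes "finite I" "\<And>i. i \<in> I \<Longrightarrow> finite (J i)" "\<And>i j. i \<in> I \<Longrightarrow> j \<in> J i \<Longrightarrow> compact (C i j)" "open U"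
  shows "(\<Union>i\<in>I. \<Union>j\<in>J i. C i j \<inter> U) \<in> sets borel"
proof (rule sets.finite_UN[OF assms(1)])
  fix i assume i: "i \<in> I"
  show "(\<Union>j\<in>J i. C i j \<inter> U) \<in> sets borel"
  proof (rule sets.finite_UN[OF assms(2)[OF i]])
    fix j assume "j \<in> J i"
    then have "C i j \<in> sets borel" using assms(3)[OF i] by (simp add: borel_closed compact_imp_closed)
    then show "C i j \<inter> U \<in> sets borel" using borel_open[OF assms(4)] by (rule sets.Int)
  qed
qed


section \<open>The limit measure\<close>

locale perforated_domain =
  fixes \<Omega> Y0 :: "(real ^ 'n) set" and D K :: "real ^ 'n \<Rightarrow> real ^ 'n ^ 'n" and s :: nat
  assumes s_eq: "s = CARD('n) - 1"
    and domain: "bounded_lipschitz_domain \<Omega>"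
    and D_lip: "inverse_lipschitz_pair D" and K_lip: "inverse_lipschitz_pair K"
    and Y0_cell: "Y0 \<subseteq> unit_cell" and Y0_lip: "lipschitz_boundary Y0"
begin

abbreviation \<Gamma> :: "(real ^ 'n) set" where "\<Gamma> \<equiv> frontier Y0"
abbreviation A :: "real ^ 'n \<Rightarrow> real ^ 'n ^ 'n" where "A x \<equiv> D x ** K x"

lemma Omega_props: "\<Omega> \<noteq> {}" "open \<Omega>" "bounded \<Omega>" "compact (closure \<Omega>)" "\<Omega> \<subseteq> closure \<Omega>"
  using domain closure_subset by (auto simp: bounded_lipschitz_domain_def)

lemma negligible_frontier_Omega: "negligible (frontier \<Omega>)"
  using domain by (auto simp: bounded_lipschitz_domain_def intro: negligible_lipschitz_frontier)

lemma bounded_Y0: "bounded Y0"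
  using bounded_subset[OF bounded_unit_cell Y0_cell] .

lemma compact_Gamma: "compact \<Gamma>"
  using bounded_Y0 by (rule compact_frontier_bounded)

lemma Gamma_borel [measurable]: "\<Gamma> \<in> sets borel"
  by (simp add: borel_closed)

lemma hausdorff_Gamma_finite: "hausdorff_outer s \<Gamma> < top"
  unfolding s_eq by (rule hausdorff_outer_lipschitz_frontier[OF Y0_lip bounded_Y0])

lemma emeasure_hausdorff_on_s:
  fixes S :: "(real ^ 'n) set"
  shows "S \<in> sets borel \<Longrightarrow> B \<in> sets borel \<Longrightarrow> emeasure (hausdorff_on S) B = hausdorff_outer s (B \<inter> S)"
  using emeasure_hausdorff_on[of S B] by (simp add: s_eq)

lemma hausdorff_subset_finite: "X \<subseteq> \<Gamma> \<Longrightarrow> hausdorff_outer s X < top"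
  using hausdorff_Gamma_finite hausdorff_outer_mono order_le_less_trans by blast

lemma finite_measure_Gamma: "finite_measure (hausdorff_on \<Gamma>)"
  by (rule finite_measureI) (use hausdorff_Gamma_finite in \<open>simp add: emeasure_hausdorff_on_s less_top\<close>)

lemma invertible_DKA: "invertible (D x)" "invertible (K x)" "invertible (A x)"
  using D_lip K_lip by (auto simp: inverse_lipschitz_pair_def intro: invertible_mult)

lemma continuous_DKA:
  "continuous_on UNIV D" "continuous_on UNIV K" "continuous_on UNIV A"
  "continuous_on UNIV (\<lambda>x. matrix_inv (D x))" "continuous_on UNIV (\<lambda>x. matrix_inv (A x))"
proof -
  show D: "continuous_on UNIV D" "continuous_on UNIV (\<lambda>x. matrix_inv (D x))"
    using D_lip unfolding inverse_lipschitz_pair_def by (meson lipschitz_on_continuous_on)+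
  have K': "continuous_on UNIV (\<lambda>x. matrix_inv (K x))"
    using K_lip unfolding inverse_lipschitz_pair_def by (meson lipschitz_on_continuous_on)
  show K: "continuous_on UNIV K"
    using K_lip unfolding inverse_lipschitz_pair_def by (meson lipschitz_on_continuous_on)
  show "continuous_on UNIV A" by (rule continuous_on_matrix_mult[OF D(1) K])
  show "continuous_on UNIV (\<lambda>x. matrix_inv (A x))"
    unfolding matrix_inv_mult[OF invertible_DKA(1,2)] by (rule continuous_on_matrix_mult[OF K' D(2)])
qed

lemma bounded_on_closure:
  fixes B :: "real ^ 'n \<Rightarrow> real ^ 'n ^ 'n"
  assumes "continuous_on UNIV B"
  shows "\<exists>b. \<forall>x\<in>closure \<Omega>. norm (B x) \<le> b"
proof -
  have "compact (B ` closure \<Omega>)"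
    by (rule compact_continuous_image[OF continuous_on_subset[OF assms] Omega_props(4)]) simp
  then show ?thesis using compact_imp_bounded bounded_iff by (metis imageI)
qed

lemma matrix_bounds:
  obtains a where "0 < a" "\<And>x. x \<in> closure \<Omega> \<Longrightarrow> norm (A x) \<le> a"
    "\<And>x. x \<in> closure \<Omega> \<Longrightarrow> norm (matrix_inv (A x)) \<le> a"
    "\<And>x. x \<in> closure \<Omega> \<Longrightarrow> norm (D x) \<le> a" "\<And>x. x \<in> closure \<Omega> \<Longrightarrow> norm (matrix_inv (D x)) \<le> a"
proof -
  obtain b1 b2 b3 b4 where b: "\<forall>x\<in>closure \<Omega>. norm (A x) \<le> b1" "\<forall>x\<in>closure \<Omega>. norm (matrix_inv (A x)) \<le> b2"
    "\<forall>x\<in>closure \<Omega>. norm (D x) \<le> b3" "\<forall>x\<in>closure \<Omega>. norm (matrix_inv (D x)) \<le> b4"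
    using bounded_on_closure[OF continuous_DKA(3)] bounded_on_closure[OF continuous_DKA(5)]
      bounded_on_closure[OF continuous_DKA(1)] bounded_on_closure[OF continuous_DKA(4)] by blast
  define a where "a = 1 + \<bar>b1\<bar> + \<bar>b2\<bar> + \<bar>b3\<bar> + \<bar>b4\<bar>"
  have "0 < a" "b1 \<le> a" "b2 \<le> a" "b3 \<le> a" "b4 \<le> a" unfolding a_def by linarith+
  then show ?thesis using b by (intro that[of a]) (auto intro: order_trans)
qed

text \<open>\<open>\<kappa> x\<close> is the surface measure of \<open>\<Gamma>\<^sub>x\<close> pulled back to \<open>\<Gamma>\<close>. It depends continuously on \<open>x\<close> and is
  comparable with the surface measure of \<open>\<Gamma>\<close> because Hausdorff measure changes by at most \<open>L ^ s\<close>
  under \<open>L\<close>-Lipschitz maps; the area formula is not needed.\<close>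

definition \<kappa> :: "real ^ 'n \<Rightarrow> (real ^ 'n) measure" where
  "\<kappa> x = distr (hausdorff_on ((*v) (A x) ` \<Gamma>)) borel ((*v) (matrix_inv (A x)))"

lemma compact_image_Gamma: "compact ((*v) (B :: real ^ 'n ^ 'n) ` \<Gamma>)"
  by (intro compact_continuous_image compact_Gamma) (simp add: linear_continuous_on)

lemma measurable_matrix_hausdorff_on [measurable]:
  "(*v) (B :: real ^ 'n ^ 'n) \<in> hausdorff_on S \<rightarrow>\<^sub>M borel"
  using borel_measurable_matrix_vector_mult measurable_cong_sets[OF sets_hausdorff_on refl] by blast

lemma sets_kappa [simp, measurable_cong]: "sets (\<kappa> x) = sets borel"
  and space_kappa [simp]: "space (\<kappa> x) = UNIV"
  by (simp_all add: \<kappa>_def)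

lemma emeasure_kappa:
  assumes "B \<in> sets borel"
  shows "emeasure (\<kappa> x) B = hausdorff_outer s ((*v) (A x) ` (B \<inter> \<Gamma>))"
proof -
  have "(*v) (matrix_inv (A x)) -` B \<inter> (*v) (A x) ` \<Gamma> = (*v) (A x) ` (B \<inter> \<Gamma>)"
    using matrix_inv_cancel(3)[OF invertible_DKA(3)] by auto
  moreover have "(*v) (matrix_inv (A x)) -` B \<in> sets borel"
    using measurable_sets[OF borel_measurable_matrix_vector_mult assms] by simp
  moreover have "(*v) (A x) ` \<Gamma> \<in> sets borel"
    using compact_image_Gamma by (simp add: borel_closed compact_imp_closed)
  ultimately show ?thesis
    unfolding \<kappa>_def using assms by (simp add: emeasure_distr emeasure_hausdorff_on_s)
qed

lemma integral_kappa:
  fixes f :: "real ^ 'n \<Rightarrow> real"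
  assumes [measurable]: "f \<in> borel_measurable borel"
  shows "(\<integral>y. f y \<partial>\<kappa> x) = (\<integral>z. f (matrix_inv (A x) *v z) \<partial>surface_measure ((*v) (A x) ` \<Gamma>))"
proof -
  have "(\<integral>y. f y \<partial>\<kappa> x) = (\<integral>z. f (matrix_inv (A x) *v z) \<partial>hausdorff_on ((*v) (A x) ` \<Gamma>))"
    unfolding \<kappa>_def by (rule integral_distr) auto
  then show ?thesis by (simp add: integral_hausdorff_on)
qed

section \<open>Comparison of the kernel with the surface measure of \<open>\<Gamma>\<close>, and its
  dependence on \<open>x\<close>\<close>

lemma hausdorff_matrix_image_le:
  fixes B :: "real ^ 'n ^ 'n"
  assumes "norm B \<le> b" "0 < b"
  shows "hausdorff_outer m ((*v) B ` X) \<le> ennreal (b ^ m) * hausdorff_outer m X"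
proof (rule hausdorff_outer_lipschitz_image[OF assms(2)])
  fix x y :: "real ^ 'n"
  have "dist (B *v x) (B *v y) = norm (B *v (x - y))" by (simp add: dist_norm matrix_vector_mult_diff_distrib)
  also have "\<dots> \<le> norm B * norm (x - y)" by (rule norm_matrix_vector_mult_le)
  also have "\<dots> \<le> b * dist x y" unfolding dist_norm using assms by (intro mult_right_mono) auto
  finally show "dist (B *v x) (B *v y) \<le> b * dist x y" .
qed

lemma emeasure_kappa_le:
  assumes "norm (A x) \<le> a" "0 < a" "B \<in> sets borel"
  shows "emeasure (\<kappa> x) B \<le> ennreal (a ^ s) * emeasure (hausdorff_on \<Gamma>) B"
  using hausdorff_matrix_image_le[OF assms(1,2), of s "B \<inter> \<Gamma>"] assms(3)
  by (simp add: emeasure_kappa emeasure_hausdorff_on_s)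

lemma emeasure_kappa_ge:
  assumes "norm (matrix_inv (A x)) \<le> a" "0 < a" "B \<in> sets borel"
  shows "emeasure (hausdorff_on \<Gamma>) B \<le> ennreal (a ^ s) * emeasure (\<kappa> x) B"
proof -
  have "(*v) (matrix_inv (A x)) ` ((*v) (A x) ` (B \<inter> \<Gamma>)) = B \<inter> \<Gamma>"
    using matrix_inv_cancel(3)[OF invertible_DKA(3)[of x]] by (auto simp: image_image)
  then show ?thesis
    using hausdorff_matrix_image_le[OF assms(1,2), of s "(*v) (A x) ` (B \<inter> \<Gamma>)"] assms(3)
    by (simp add: emeasure_kappa emeasure_hausdorff_on_s)
qed

text \<open>The Lipschitz estimate in both directions gives
  \<open>f x / \<theta> x x' \<le> f x' \<le> \<theta> x' x * f x\<close>, and both factors tend to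
  1 as \<open>x'\<close> tends to \<open>x\<close>.\<close>

lemma continuous_hausdorff_image:
  assumes X: "X \<subseteq> \<Gamma>"
  shows "continuous_on UNIV (\<lambda>x. enn2real (hausdorff_outer s ((*v) (A x) ` X)))"
proof -
  define f where "f = (\<lambda>x. enn2real (hausdorff_outer s ((*v) (A x) ` X)))"
  have fin: "hausdorff_outer s ((*v) (A x) ` X) < top" for x
  proof -
    have "hausdorff_outer s ((*v) (A x) ` X) \<le> ennreal ((norm (A x) + 1) ^ s) * hausdorff_outer s X"
      by (rule hausdorff_matrix_image_le) (auto simp: add_nonneg_pos)
    then show ?thesis using hausdorff_subset_finite[OF X] by (simp add: ennreal_mult_less_top order_le_less_trans)
  qed
  define \<theta> where "\<theta> = (\<lambda>x' x. (1 + norm (A x' - A x) * norm (matrix_inv (A x))) ^ s)"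
  have \<theta>: "1 \<le> \<theta> x' x" for x' x by (auto simp: \<theta>_def intro!: one_le_power)
  have le: "f x' \<le> \<theta> x' x * f x" for x x'
  proof -
    have "hausdorff_outer s ((*v) (A x') ` X) \<le> ennreal (\<theta> x' x) * hausdorff_outer s ((*v) (A x) ` X)"
      unfolding \<theta>_def by (rule hausdorff_outer_linear_image_le[OF invertible_DKA(3)])
    then have "f x' \<le> enn2real (ennreal (\<theta> x' x) * hausdorff_outer s ((*v) (A x) ` X))"
      unfolding f_def using fin[of x] by (intro enn2real_mono) (auto simp: ennreal_mult_less_top)
    also have "\<dots> = \<theta> x' x * f x" using \<theta>[of x' x] by (simp add: f_def enn2real_mult)
    finally show ?thesis .
  qed
  have "(f \<longlongrightarrow> f x) (at x)" for x
  proof -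
    have A: "(A \<longlongrightarrow> A x) (at x)" and Ai: "((\<lambda>x. matrix_inv (A x)) \<longlongrightarrow> matrix_inv (A x)) (at x)"
      using continuous_DKA(3,5) by (auto simp: continuous_on_eq_continuous_at isCont_def)
    have "((\<lambda>x'. \<theta> x' x) \<longlongrightarrow> (1 + norm (A x - A x) * norm (matrix_inv (A x))) ^ s) (at x)"
      unfolding \<theta>_def by (intro tendsto_intros A)
    then have t1: "((\<lambda>x'. \<theta> x' x * f x) \<longlongrightarrow> f x) (at x)" by (auto intro: tendsto_eq_intros)
    have "((\<lambda>x'. \<theta> x x') \<longlongrightarrow> (1 + norm (A x - A x) * norm (matrix_inv (A x))) ^ s) (at x)"
      unfolding \<theta>_def by (intro tendsto_intros A Ai)
    then have "((\<lambda>x'. f x / \<theta> x x') \<longlongrightarrow> f x / 1) (at x)" by (intro tendsto_intros) auto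
    then have t2: "((\<lambda>x'. f x / \<theta> x x') \<longlongrightarrow> f x) (at x)" by simp
    show ?thesis
    proof (rule tendsto_sandwich[OF _ _ t2 t1])
      have "f x / \<theta> x x' \<le> f x'" for x'
        using le[of x x'] \<theta>[of x x'] by (simp add: divide_le_eq mult.commute)
      then show "\<forall>\<^sub>F x' in at x. f x / \<theta> x x' \<le> f x'" by simp
    qed (use le in simp)
  qed
  then show ?thesis unfolding f_def[symmetric] by (simp add: continuous_on_eq_continuous_at isCont_def)
qed

lemma measurable_emeasure_kappa:
  assumes "B \<in> sets borel"
  shows "(\<lambda>x. emeasure (\<kappa> x) B) \<in> borel_measurable borel"
proof -
  have "emeasure (\<kappa> x) B = ennreal (enn2real (hausdorff_outer s ((*v) (A x) ` (B \<inter> \<Gamma>))))" for x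
  proof -
    have "hausdorff_outer s ((*v) (A x) ` (B \<inter> \<Gamma>)) \<le> ennreal ((norm (A x) + 1) ^ s) * hausdorff_outer s (B \<inter> \<Gamma>)"
      by (rule hausdorff_matrix_image_le) (auto simp: add_nonneg_pos)
    then have "hausdorff_outer s ((*v) (A x) ` (B \<inter> \<Gamma>)) < top"
      using hausdorff_subset_finite[of "B \<inter> \<Gamma>"] by (simp add: ennreal_mult_less_top order_le_less_trans)
    then show ?thesis using assms by (simp add: emeasure_kappa)
  qed
  moreover have "(\<lambda>x. enn2real (hausdorff_outer s ((*v) (A x) ` (B \<inter> \<Gamma>)))) \<in> borel_measurable borel"
    by (intro borel_measurable_continuous_onI continuous_hausdorff_image) auto
  ultimately show ?thesis by simp
qed

text \<open>The volume is written as the integral over \<open>z\<close> of an indicator that is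
  jointly Borel in \<open>x\<close> and \<open>z\<close>, so that measurability of parameter
  integrals applies.\<close>

lemma measurable_cell_volume: "(\<lambda>x. cell_volume (D x)) \<in> borel_measurable borel"
proof -
  have "cell_volume (D x) = enn2real (\<integral>\<^sup>+z. indicator unit_cell (matrix_inv (D x) *v z) \<partial>lborel)" for x
  proof -
    have op: "open ((*v) (D x) ` unit_cell)" by (rule open_invertible_image[OF invertible_DKA(1) open_unit_cell])
    have "indicator unit_cell (matrix_inv (D x) *v z) = (indicator ((*v) (D x) ` unit_cell) z :: ennreal)" for z
      using matrix_inv_cancel(3,4)[OF invertible_DKA(1)[of x]]
      by (auto simp: indicator_def image_iff)
    then have "(\<integral>\<^sup>+z. indicator unit_cell (matrix_inv (D x) *v z) \<partial>lborel) = emeasure lborel ((*v) (D x) ` unit_cell)"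
      using op by simp
    then show ?thesis using op by (simp add: cell_volume_def measure_def)
  qed
  moreover have "(\<lambda>x. \<integral>\<^sup>+z. indicator unit_cell (matrix_inv (D x) *v z) \<partial>lborel) \<in> borel_measurable borel"
  proof (rule lborel.borel_measurable_nn_integral)
    have c: "continuous_on UNIV (\<lambda>z :: (real ^ 'n) \<times> (real ^ 'n). matrix_inv (D (fst z)) *v snd z)"
      by (intro continuous_on_matrix_vector_mult continuous_on_compose2[OF continuous_DKA(4)] continuous_intros) auto
    have "(\<lambda>z :: (real ^ 'n) \<times> (real ^ 'n). indicator unit_cell (matrix_inv (D (fst z)) *v snd z) :: ennreal) \<in> borel_measurable borel"
      by (rule measurable_compose[OF borel_measurable_continuous_onI[OF c]])
         (simp add: open_unit_cell)
    then show "(\<lambda>(x, z). indicator unit_cell (matrix_inv (D x) *v z) :: ennreal) \<in> borel_measurable (borel \<Otimes>\<^sub>M lborel)"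
      by (simp add: split_def borel_prod measurable_cong_sets[OF sets_pair_measure_cong[OF refl sets_lborel] refl])
  qed
  ultimately show ?thesis by simp
qed

lemma cell_volume_bounds:
  obtains v V where "0 < v" "\<And>x. x \<in> closure \<Omega> \<Longrightarrow> v \<le> cell_volume (D x)" "\<And>x. x \<in> closure \<Omega> \<Longrightarrow> cell_volume (D x) \<le> V"
proof -
  obtain a where a: "0 < a" "\<And>x. x \<in> closure \<Omega> \<Longrightarrow> norm (D x) \<le> a" "\<And>x. x \<in> closure \<Omega> \<Longrightarrow> norm (matrix_inv (D x)) \<le> a"
    by (rule matrix_bounds) blast
  obtain b where b: "0 < b" "\<And>y. y \<in> unit_cell \<Longrightarrow> norm (y :: real ^ 'n) \<le> b"
    using bounded_unit_cell bounded_pos by metis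
  show ?thesis
  proof (rule that)
    show "0 < measure lebesgue (ball (0 :: real ^ 'n) (1 / (2 * a)))" using a(1) by (simp add: content_ball_pos)
    fix x assume x: "x \<in> closure \<Omega>"
    show "measure lebesgue (ball (0 :: real ^ 'n) (1 / (2 * a))) \<le> cell_volume (D x)"
      by (rule cell_volume_ge[OF invertible_DKA(1) a(3)[OF x] a(1)])
    have "(*v) (D x) ` unit_cell \<subseteq> cball 0 (a * b)"
    proof
      fix z assume "z \<in> (*v) (D x) ` unit_cell"
      then obtain y where y: "y \<in> unit_cell" "z = D x *v y" by auto
      have "norm z \<le> norm (D x) * norm y" unfolding y(2) by (rule norm_matrix_vector_mult_le)
      also have "\<dots> \<le> a * b" using a b y x by (intro mult_mono) auto
      finally show "z \<in> cball 0 (a * b)" by simp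
    qed
    then show "cell_volume (D x) \<le> measure lebesgue (cball (0 :: real ^ 'n) (a * b))"
      unfolding cell_volume_def using lmeasurable_cell[OF invertible_DKA(1)]
      by (intro measure_mono_fmeasurable[OF _ _ lmeasurable_cball]) (auto simp: fmeasurable_def)
  qed
qed

definition mass :: real where
  "mass = (SOME T. 0 < T \<and> (\<forall>x\<in>closure \<Omega>. emeasure (\<kappa> x) UNIV \<le> ennreal T))"

lemma mass: "0 < mass" "\<And>x. x \<in> closure \<Omega> \<Longrightarrow> emeasure (\<kappa> x) UNIV \<le> ennreal mass"
proof -
  obtain a where a: "0 < a" "\<And>x. x \<in> closure \<Omega> \<Longrightarrow> norm (A x) \<le> a" by (rule matrix_bounds) blast
  define H where "H = enn2real (hausdorff_outer s \<Gamma>)"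
  have H: "hausdorff_outer s \<Gamma> = ennreal H" "0 \<le> H" using hausdorff_Gamma_finite by (auto simp: H_def)
  have "emeasure (\<kappa> x) UNIV \<le> ennreal (a ^ s * H + 1)" if "x \<in> closure \<Omega>" for x
  proof -
    have "emeasure (\<kappa> x) UNIV \<le> ennreal (a ^ s) * emeasure (hausdorff_on \<Gamma>) UNIV"
      by (rule emeasure_kappa_le[OF a(2)[OF that] a(1)]) simp
    also have "\<dots> = ennreal (a ^ s * H)"
      using a(1) H by (simp add: emeasure_hausdorff_on_s ennreal_mult)
    also have "\<dots> \<le> ennreal (a ^ s * H + 1)" by (rule ennreal_leI) simp
    finally show ?thesis .
  qed
  then have ex: "0 < a ^ s * H + 1 \<and> (\<forall>x\<in>closure \<Omega>. emeasure (\<kappa> x) UNIV \<le> ennreal (a ^ s * H + 1))"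
    using a(1) H by (simp add: add_nonneg_pos)
  show "0 < mass" "\<And>x. x \<in> closure \<Omega> \<Longrightarrow> emeasure (\<kappa> x) UNIV \<le> ennreal mass"
    unfolding mass_def using someI[of "\<lambda>T. 0 < T \<and> (\<forall>x\<in>closure \<Omega>. emeasure (\<kappa> x) UNIV \<le> ennreal T)", OF ex] by auto
qed

text \<open>The factor \<open>mass\<close> makes the kernel a subprobability kernel.\<close>

definition base :: "(real ^ 'n) measure" where
  "base = density (lebesgue_on \<Omega>) (\<lambda>x. ennreal (mass / cell_volume (D x)))"

definition \<kappa>1 :: "real ^ 'n \<Rightarrow> (real ^ 'n) measure" where
  "\<kappa>1 x = density (\<kappa> x) (\<lambda>_. ennreal (1 / mass))"

text \<open>The factors \<open>mass\<close> and \<open>1 / mass\<close> cancel between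
  \<open>base\<close> and \<open>\<kappa>1\<close>. Integration against \<open>\<nu>\<close> is
  therefore the iterated integral in the definition of the l-t-s limit, in coordinates on
  \<open>\<Gamma>\<close>; see \<open>integral_nu\<close>.\<close>

definition \<nu> :: "((real ^ 'n) \<times> (real ^ 'n)) measure" where
  "\<nu> = kernel_product base borel \<kappa>1"

lemma measurable_lebesgue_on: "f \<in> borel_measurable borel \<Longrightarrow> f \<in> borel_measurable (lebesgue_on \<Omega>)"
  by (intro measurable_restrict_space1 measurable_completion) simp

lemma Omega_lmeasurable: "\<Omega> \<in> lmeasurable"
  using Omega_props by (simp add: lmeasurable_open)

lemma finite_lebesgue_on: "finite_measure (lebesgue_on \<Omega>)"
  by (rule finite_measure_lebesgue_on[OF Omega_lmeasurable])

lemma measurable_base_density [measurable]: "(\<lambda>x. mass / cell_volume (D x)) \<in> borel_measurable (lebesgue_on \<Omega>)"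
  using measurable_lebesgue_on[OF measurable_cell_volume] by simp

lemma space_base: "space base = \<Omega>"
  by (simp add: base_def space_restrict_space)

lemma sets_base [measurable_cong]: "sets base = sets (lebesgue_on \<Omega>)"
  by (simp add: base_def)

lemma finite_base: "finite_measure base"
proof (rule finite_measureI)
  interpret finite_measure "lebesgue_on \<Omega>" by (rule finite_lebesgue_on)
  obtain v where v: "0 < v" "\<And>x. x \<in> closure \<Omega> \<Longrightarrow> v \<le> cell_volume (D x)" by (rule cell_volume_bounds) blast
  have "emeasure base (space base) = (\<integral>\<^sup>+x. ennreal (mass / cell_volume (D x)) * indicator \<Omega> x \<partial>lebesgue_on \<Omega>)"
    unfolding space_base unfolding base_def by (rule emeasure_density) (auto intro: sets.top simp: sets_restrict_space)
  also have "\<dots> \<le> (\<integral>\<^sup>+x. ennreal (mass / v) \<partial>lebesgue_on \<Omega>)"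
  proof (rule nn_integral_mono)
    fix x assume "x \<in> space (lebesgue_on \<Omega>)"
    then have "x \<in> closure \<Omega>" using Omega_props(5) by auto
    then have "mass / cell_volume (D x) \<le> mass / v"
      using v mass(1) by (intro divide_left_mono) (auto intro: mult_pos_pos order_less_le_trans)
    then show "ennreal (mass / cell_volume (D x)) * indicator \<Omega> x \<le> ennreal (mass / v)"
      by (auto simp: indicator_def intro: ennreal_leI)
  qed
  also have "\<dots> < \<infinity>"
  proof -
    have "emeasure (lebesgue_on \<Omega>) \<Omega> < top"
      using emeasure_finite[of \<Omega>] by (metis less_top infinity_ennreal_def)
    then show ?thesis by (simp add: ennreal_mult_less_top)
  qed
  finally show "emeasure base (space base) \<noteq> \<infinity>" by simp
qed

lemma kernel_kappa1: "\<kappa>1 \<in> base \<rightarrow>\<^sub>M subprob_algebra borel"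
proof (rule measurable_subprob_algebra)
  have em: "emeasure (\<kappa>1 x) B = ennreal (1 / mass) * emeasure (\<kappa> x) B" if "B \<in> sets borel" for x B
    unfolding \<kappa>1_def using that by (simp add: emeasure_density_const)
  fix x assume "x \<in> space base"
  then have x: "x \<in> closure \<Omega>" using space_base Omega_props(5) by auto
  show "subprob_space (\<kappa>1 x)"
  proof (rule subprob_spaceI)
    have "emeasure (\<kappa>1 x) UNIV \<le> ennreal (1 / mass) * ennreal mass"
      using mass(2)[OF x] by (simp add: em mult_left_mono)
    also have "\<dots> = 1" using mass(1) by (simp add: ennreal_mult'[symmetric])
    finally show "emeasure (\<kappa>1 x) (space (\<kappa>1 x)) \<le> 1" by (simp add: \<kappa>1_def)
    show "space (\<kappa>1 x) \<noteq> {}" by (simp add: \<kappa>1_def)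
  qed
next
  fix B :: "(real ^ 'n) set" assume B: "B \<in> sets borel"
  have "(\<lambda>x. ennreal (1 / mass) * emeasure (\<kappa> x) B) \<in> borel_measurable base"
    using measurable_lebesgue_on[OF measurable_emeasure_kappa[OF B]] by measurable
  then show "(\<lambda>x. emeasure (\<kappa>1 x) B) \<in> borel_measurable base"
    unfolding \<kappa>1_def using B by (simp add: emeasure_density_const)
qed (simp add: \<kappa>1_def)

lemma base_nonempty: "space base \<noteq> {}"
  using space_base Omega_props(1) by simp

lemma sets_nu: "sets \<nu> = sets (lebesgue_on \<Omega> \<Otimes>\<^sub>M borel)"
  unfolding \<nu>_def sets_kernel_product[OF finite_base base_nonempty kernel_kappa1]
  by (rule sets_pair_measure_cong[OF sets_base refl])

lemma measurable_nu: "f \<in> borel_measurable \<nu> \<longleftrightarrow> f \<in> borel_measurable (lebesgue_on \<Omega> \<Otimes>\<^sub>M borel)"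
  using measurable_cong_sets[OF sets_nu refl] by blast

lemma measurable_nu': "f \<in> borel_measurable \<nu> \<longleftrightarrow> f \<in> borel_measurable (base \<Otimes>\<^sub>M borel)"
  unfolding measurable_nu using measurable_cong_sets[OF sets_pair_measure_cong[OF sets_base refl] refl] by blast

lemma measurable_section:
  assumes "f \<in> borel_measurable \<nu>" "x \<in> \<Omega>"
  shows "(\<lambda>y. f (x, y)) \<in> borel_measurable borel"
  using measurable_Pair2[of f "lebesgue_on \<Omega>" borel borel x] assms by (simp add: measurable_nu)

lemma finite_nu: "finite_measure \<nu>"
  unfolding \<nu>_def by (rule finite_measure_kernel_product[OF finite_base base_nonempty kernel_kappa1])

text \<open>The constant is the product of the Lipschitz factor of the inverse matrices and the
  upper bound for the cell volumes. The comparison is used twice: to bound the integral of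
  \<open>F\<close> by a \<open>q\<close>-integral against \<open>\<nu>\<close>, and to get
  \<open>p\<close>-integrability of the density over \<open>\<Omega> \<times> \<Gamma>\<close> with
  the fixed surface measure.\<close>

lemma product_le_nu:
  obtains c where "0 \<le> c" "\<And>f. f \<in> borel_measurable \<nu> \<Longrightarrow>
    (\<integral>\<^sup>+x. \<integral>\<^sup>+y. f (x, y) \<partial>hausdorff_on \<Gamma> \<partial>lebesgue_on \<Omega>) \<le> ennreal c * (\<integral>\<^sup>+z. f z \<partial>\<nu>)"
proof -
  obtain a where a: "0 < a" "\<And>x. x \<in> closure \<Omega> \<Longrightarrow> norm (matrix_inv (A x)) \<le> a" by (rule matrix_bounds) blast
  obtain v V where v: "0 < v" "\<And>x. x \<in> closure \<Omega> \<Longrightarrow> v \<le> cell_volume (D x)"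
     "\<And>x. x \<in> closure \<Omega> \<Longrightarrow> cell_volume (D x) \<le> V" by (rule cell_volume_bounds) blast
  have "(\<integral>\<^sup>+x. \<integral>\<^sup>+y. f (x, y) \<partial>hausdorff_on \<Gamma> \<partial>lebesgue_on \<Omega>) \<le> ennreal (a ^ s * V) * (\<integral>\<^sup>+z. f z \<partial>\<nu>)"
    if f: "f \<in> borel_measurable \<nu>" for f
  proof -
    have fb: "f \<in> borel_measurable (base \<Otimes>\<^sub>M borel)" using f by (simp add: measurable_nu')
    have g: "(\<lambda>x. \<integral>\<^sup>+y. f (x, y) \<partial>\<kappa>1 x) \<in> borel_measurable base"
      using nn_integral_measurable_subprob_algebra2[OF _ kernel_kappa1, of "\<lambda>x y. f (x, y)"] fb by simp
    have "(\<integral>\<^sup>+x. \<integral>\<^sup>+y. f (x, y) \<partial>hausdorff_on \<Gamma> \<partial>lebesgue_on \<Omega>)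
       \<le> (\<integral>\<^sup>+x. ennreal (a ^ s * V) * (ennreal (mass / cell_volume (D x)) * (\<integral>\<^sup>+y. f (x, y) \<partial>\<kappa>1 x)) \<partial>lebesgue_on \<Omega>)"
    proof (rule nn_integral_mono)
      fix x assume "x \<in> space (lebesgue_on \<Omega>)"
      then have x: "x \<in> \<Omega>" "x \<in> closure \<Omega>" using Omega_props(5) by auto
      have fx: "(\<lambda>y. f (x, y)) \<in> borel_measurable borel" by (rule measurable_section[OF f x(1)])
      have vx: "0 < cell_volume (D x)" using v(1) v(2)[OF x(2)] by linarith
      have "(\<integral>\<^sup>+y. f (x, y) \<partial>hausdorff_on \<Gamma>) \<le> ennreal (a ^ s) * (\<integral>\<^sup>+y. f (x, y) \<partial>\<kappa> x)"
        by (rule nn_integral_mono_measures)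
           (use emeasure_kappa_ge[OF a(2)[OF x(2)] a(1)] fx in \<open>auto simp: measurable_cong_sets[OF sets_hausdorff_on refl]\<close>)
      also have "\<dots> \<le> ennreal (a ^ s * V) * (ennreal (1 / cell_volume (D x)) * (\<integral>\<^sup>+y. f (x, y) \<partial>\<kappa> x))"
      proof -
        have "a ^ s * 1 \<le> a ^ s * (V * (1 / cell_volume (D x)))"
          using a(1) vx v(3)[OF x(2)] by (intro mult_left_mono) auto
        then have "ennreal (a ^ s) \<le> ennreal (a ^ s * V) * ennreal (1 / cell_volume (D x))"
          using vx by (simp add: ennreal_mult'[symmetric] ennreal_mult''[symmetric] ennreal_leI mult.assoc del: times_divide_eq_right)
        then show ?thesis by (simp add: mult.assoc[symmetric] mult_right_mono)
      qed
      also have "ennreal (1 / cell_volume (D x)) * (\<integral>\<^sup>+y. f (x, y) \<partial>\<kappa> x)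
          = ennreal (mass / cell_volume (D x)) * (\<integral>\<^sup>+y. f (x, y) \<partial>\<kappa>1 x)"
      proof -
        have "(\<integral>\<^sup>+y. f (x, y) \<partial>\<kappa>1 x) = ennreal (1 / mass) * (\<integral>\<^sup>+y. f (x, y) \<partial>\<kappa> x)"
          unfolding \<kappa>1_def using fx
          by (subst nn_integral_density) (auto simp: nn_integral_cmult measurable_cong_sets[OF sets_kappa refl])
        moreover have "ennreal (mass / cell_volume (D x)) * ennreal (1 / mass) = ennreal (1 / cell_volume (D x))"
          using mass(1) vx by (simp add: ennreal_mult'[symmetric] ennreal_mult''[symmetric])
        ultimately show ?thesis by (simp add: mult.assoc[symmetric])
      qed
      finally show "(\<integral>\<^sup>+y. f (x, y) \<partial>hausdorff_on \<Gamma>)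
        \<le> ennreal (a ^ s * V) * (ennreal (mass / cell_volume (D x)) * (\<integral>\<^sup>+y. f (x, y) \<partial>\<kappa>1 x))" .
    qed
    also have "\<dots> = ennreal (a ^ s * V) * (\<integral>\<^sup>+x. ennreal (mass / cell_volume (D x)) * (\<integral>\<^sup>+y. f (x, y) \<partial>\<kappa>1 x) \<partial>lebesgue_on \<Omega>)"
      using g measurable_cong_sets[OF sets_base refl] by (intro nn_integral_cmult borel_measurable_times) (auto)
    also have "(\<integral>\<^sup>+x. ennreal (mass / cell_volume (D x)) * (\<integral>\<^sup>+y. f (x, y) \<partial>\<kappa>1 x) \<partial>lebesgue_on \<Omega>) = (\<integral>\<^sup>+x. \<integral>\<^sup>+y. f (x, y) \<partial>\<kappa>1 x \<partial>base)"
      unfolding base_def using g measurable_cong_sets[OF sets_base refl] by (intro nn_integral_density[symmetric]) auto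
    also have "\<dots> = (\<integral>\<^sup>+z. f z \<partial>\<nu>)"
      unfolding \<nu>_def by (rule nn_integral_kernel_product[OF finite_base base_nonempty kernel_kappa1 fb, symmetric])
    finally show ?thesis .
  qed
  moreover have "0 \<le> a ^ s * V"
  proof -
    obtain x where "x \<in> closure \<Omega>" using Omega_props by auto
    then have "0 < V" using v order_trans by (meson order_less_le_trans)
    then show ?thesis using a(1) by simp
  qed
  ultimately show ?thesis using that by blast
qed

lemma integral_nu:
  fixes f :: "(real ^ 'n) \<times> (real ^ 'n) \<Rightarrow> real"
  assumes f: "integrable \<nu> f"
  shows "(\<integral>z. f z \<partial>\<nu>) = (\<integral>x. 1 / cell_volume (D x) * (\<integral>y. f (x, y) \<partial>\<kappa> x) \<partial>lebesgue_on \<Omega>)"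
proof -
  have fm: "f \<in> borel_measurable \<nu>" using f by simp
  have "(\<integral>z. f z \<partial>\<nu>) = (\<integral>x. \<integral>y. f (x, y) \<partial>\<kappa>1 x \<partial>base)"
    using integral_kernel_product[OF finite_base base_nonempty kernel_kappa1] f unfolding \<nu>_def by blast
  also have "\<dots> = (\<integral>x. (mass / cell_volume (D x)) *\<^sub>R (\<integral>y. f (x, y) \<partial>\<kappa>1 x) \<partial>lebesgue_on \<Omega>)"
  \<comment> \<open>If the inner integral is not measurable, neither is its product with the
    density, which can be divided out because it is measurable and positive. Both outer integrals
    then have the default value 0.\<close>
  proof (cases "(\<lambda>x. \<integral>y. f (x, y) \<partial>\<kappa>1 x) \<in> borel_measurable (lebesgue_on \<Omega>)")
    case True
    show ?thesis
      unfolding base_def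
    proof (rule integral_density[OF True measurable_base_density])
      show "AE x in lebesgue_on \<Omega>. 0 \<le> mass / cell_volume (D x)"
        using mass(1) by (intro AE_I2) (simp add: cell_volume_def)
    qed
  next
    case False
    obtain v where v: "0 < v" "\<And>x. x \<in> closure \<Omega> \<Longrightarrow> v \<le> cell_volume (D x)" by (rule cell_volume_bounds) blast
    have "\<not> integrable base (\<lambda>x. \<integral>y. f (x, y) \<partial>\<kappa>1 x)"
      using False measurable_cong_sets[OF sets_base refl] by auto
    moreover have "\<not> integrable (lebesgue_on \<Omega>) (\<lambda>x. (mass / cell_volume (D x)) *\<^sub>R (\<integral>y. f (x, y) \<partial>\<kappa>1 x))"
    proof
      assume "integrable (lebesgue_on \<Omega>) (\<lambda>x. (mass / cell_volume (D x)) *\<^sub>R (\<integral>y. f (x, y) \<partial>\<kappa>1 x))"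
      from borel_measurable_integrable[OF this]
      have m: "(\<lambda>x. (mass / cell_volume (D x)) * (\<integral>y. f (x, y) \<partial>\<kappa>1 x)) \<in> borel_measurable (lebesgue_on \<Omega>)"
        by (simp only: real_scaleR_def)
      have m2: "(\<lambda>x. inverse (mass / cell_volume (D x)) * ((mass / cell_volume (D x)) * (\<integral>y. f (x, y) \<partial>\<kappa>1 x))) \<in> borel_measurable (lebesgue_on \<Omega>)"
        by (rule borel_measurable_times[OF borel_measurable_inverse[OF measurable_base_density] m])
      have eqv: "inverse (mass / cell_volume (D x)) * ((mass / cell_volume (D x)) * (\<integral>y. f (x, y) \<partial>\<kappa>1 x)) = (\<integral>y. f (x, y) \<partial>\<kappa>1 x)"
        if "x \<in> space (lebesgue_on \<Omega>)" for x
      proof -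
        have "x \<in> closure \<Omega>" using that Omega_props(5) by auto
        then have "0 < cell_volume (D x)" using v by (meson order_less_le_trans)
        then show ?thesis using mass(1) by simp
      qed
      show False using measurable_cong[THEN iffD1, OF eqv m2] False by blast
    qed
    ultimately show ?thesis by (simp add: not_integrable_integral_eq)
  qed
  also have "\<dots> = (\<integral>x. 1 / cell_volume (D x) * (\<integral>y. f (x, y) \<partial>\<kappa> x) \<partial>lebesgue_on \<Omega>)"
  proof (rule Bochner_Integration.integral_cong[OF refl])
    fix x assume "x \<in> space (lebesgue_on \<Omega>)"
    then have fx: "(\<lambda>y. f (x, y)) \<in> borel_measurable (\<kappa> x)"
      using measurable_section[OF fm, of x] by (simp add: measurable_cong_sets[OF sets_kappa refl])
    have "(\<integral>y. f (x, y) \<partial>\<kappa>1 x) = (\<integral>y. (1 / mass) *\<^sub>R f (x, y) \<partial>\<kappa> x)"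
      unfolding \<kappa>1_def using mass(1) by (intro integral_density fx) auto
    then show "(mass / cell_volume (D x)) *\<^sub>R (\<integral>y. f (x, y) \<partial>\<kappa>1 x) = 1 / cell_volume (D x) * (\<integral>y. f (x, y) \<partial>\<kappa> x)"
      using mass(1) by simp
  qed
  finally show ?thesis .
qed

end


section \<open>Upper bound for the oscillating surface integrals\<close>

lemma uniformly_continuous_abs_powr:
  fixes q M \<eta> :: real
  assumes "1 < q" "0 < \<eta>"
  obtains d where "0 < d" "\<And>s t. \<bar>s\<bar> \<le> M \<Longrightarrow> \<bar>t\<bar> \<le> M \<Longrightarrow> \<bar>s - t\<bar> < d \<Longrightarrow> \<bar>\<bar>s\<bar> powr q - \<bar>t\<bar> powr q\<bar> < \<eta>"
proof -
  have "continuous_on {-M..M} (\<lambda>t. \<bar>t\<bar> powr q)"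
    using assms(1) by (intro continuous_on_powr' continuous_intros) auto
  then have "uniformly_continuous_on {-M..M} (\<lambda>t. \<bar>t\<bar> powr q)"
    by (rule compact_uniformly_continuous) simp
  then obtain d where d: "0 < d" "\<And>s t. s \<in> {-M..M} \<Longrightarrow> t \<in> {-M..M} \<Longrightarrow> dist t s < d \<Longrightarrow> dist (\<bar>t\<bar> powr q) (\<bar>s\<bar> powr q) < \<eta>"
    using assms(2) unfolding uniformly_continuous_on_def by meson
  show ?thesis
    by (rule that[OF d(1)]) (use d(2) in \<open>auto simp: dist_real_def abs_le_iff\<close>)
qed

text \<open>Passing from \<open>C \<inter> S\<close> to all of \<open>C\<close> allows every cell to
  be integrated over in full, although \<open>G \<epsilon>\<close> may contain only the part of it
  inside \<open>\<Omega>\<close>.\<close>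

lemma nn_integral_hausdorff_on_indicator_le:
  assumes S: "S \<in> sets borel" and C: "C \<in> sets borel" and h [measurable]: "h \<in> borel_measurable borel"
  shows "(\<integral>\<^sup>+z. indicator C z * h z \<partial>hausdorff_on S) \<le> (\<integral>\<^sup>+z. h z \<partial>hausdorff_on (C :: 'a::euclidean_space set))"
proof -
  note [measurable] = C
  have ms: "measurable (hausdorff_on S) borel = measurable borel borel" for S :: "'a set"
    by (rule measurable_cong_sets) auto
  have "(\<integral>\<^sup>+z. indicator C z * h z \<partial>hausdorff_on S) = (\<integral>\<^sup>+z. h z \<partial>density (hausdorff_on S) (indicator C))"
    by (subst nn_integral_density) (simp_all add: ms)
  also have "\<dots> \<le> 1 * (\<integral>\<^sup>+z. h z \<partial>hausdorff_on C)"
  proof (rule nn_integral_mono_measures)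
    fix B assume "B \<in> sets (density (hausdorff_on S) (indicator C))"
    then have B [measurable]: "B \<in> sets borel" by simp
    have "emeasure (density (hausdorff_on S) (indicator C)) B = emeasure (hausdorff_on S) (C \<inter> B)"
      by (subst emeasure_density) (simp_all add: ms indicator_inter_arith[symmetric])
    also have "\<dots> \<le> emeasure (hausdorff_on C) B"
      using S C by (auto simp: emeasure_hausdorff_on intro!: hausdorff_outer_mono)
    finally show "emeasure (density (hausdorff_on S) (indicator C)) B \<le> 1 * emeasure (hausdorff_on C) B" by simp
  qed (simp_all add: ms measurable_density_eq1)
  finally show ?thesis by simp
qed

locale perforated_partition = perforated_domain \<Omega> Y0 D K s
  for \<Omega> Y0 :: "(real ^ 'n) set" and D K s +
  fixes r :: real and N :: "real \<Rightarrow> nat" and Q :: "real \<Rightarrow> nat \<Rightarrow> (real ^ 'n) set"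
    and xs :: "real \<Rightarrow> nat \<Rightarrow> real ^ 'n"
  assumes r_pos: "0 < r" and partition: "cube_partition \<Omega> r N Q xs"
    and KY0: "\<And>x. x \<in> closure \<Omega> \<Longrightarrow> (*v) (K x) ` Y0 \<subseteq> unit_cell"
begin

abbreviation G :: "real \<Rightarrow> (real ^ 'n) set" where "G \<epsilon> \<equiv> Gamma_eps \<Omega> D K \<Gamma> N Q xs \<epsilon>"
abbreviation L :: "real \<Rightarrow> (real ^ 'n \<Rightarrow> ((real ^ 'n) \<Rightarrow>\<^sub>C real)) \<Rightarrow> real ^ 'n \<Rightarrow> real" where
  "L \<epsilon> \<psi> \<equiv> lp_approx D N Q xs \<epsilon> \<psi>"
abbreviation \<Xi> :: "real \<Rightarrow> nat \<Rightarrow> (real ^ 'n) set" where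
  "\<Xi> \<epsilon> n \<equiv> Xi_star \<epsilon> (D (xs \<epsilon> n)) (Q \<epsilon> n)"
abbreviation cell :: "real \<Rightarrow> nat \<Rightarrow> real ^ 'n \<Rightarrow> (real ^ 'n) set" where
  "cell \<epsilon> n \<xi> \<equiv> scaled_cell \<epsilon> (D (xs \<epsilon> n)) \<xi> ((*v) (K (xs \<epsilon> n)) ` \<Gamma>)"

section \<open>Geometry of the cubes and of the oscillating surface\<close>

lemma cube_facts:
  assumes "0 < \<epsilon>" "n \<in> {1..N \<epsilon>}"
  shows "open (Q \<epsilon> n)" "bounded (Q \<epsilon> n)" "xs \<epsilon> n \<in> Q \<epsilon> n" "xs \<epsilon> n \<in> \<Omega>" "xs \<epsilon> n \<in> closure \<Omega>"
    "\<And>x. x \<in> closure (Q \<epsilon> n) \<Longrightarrow> dist x (xs \<epsilon> n) \<le> real CARD('n) * \<epsilon> powr r"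
    "Q \<epsilon> n \<in> lmeasurable" "finite (\<Xi> \<epsilon> n)"
proof -
  have c: "open_cube (\<epsilon> powr r) (Q \<epsilon> n)" and x: "xs \<epsilon> n \<in> Q \<epsilon> n \<inter> \<Omega>"
    using partition assms unfolding cube_partition_def by blast+
  show "open (Q \<epsilon> n)" "bounded (Q \<epsilon> n)" "xs \<epsilon> n \<in> Q \<epsilon> n" "xs \<epsilon> n \<in> \<Omega>" "xs \<epsilon> n \<in> closure \<Omega>"
    using open_cube_properties[OF c] x Omega_props(5) by auto
  then show "Q \<epsilon> n \<in> lmeasurable" by (simp add: lmeasurable_open)
  then show "finite (\<Xi> \<epsilon> n)" by (rule card_Xi_star_le(1)[OF assms(1) invertible_DKA(1)])
  show "dist x (xs \<epsilon> n) \<le> real CARD('n) * \<epsilon> powr r" if "x \<in> closure (Q \<epsilon> n)" for x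
    using open_cube_properties(2)[OF c that] x by blast
qed

lemma Q_disjoint: "0 < \<epsilon> \<Longrightarrow> disjoint_family_on (Q \<epsilon>) {1..N \<epsilon>}"
  using partition unfolding cube_partition_def by blast

lemma cell_eq: "cell \<epsilon> n \<xi> = (\<lambda>y. \<epsilon> *\<^sub>R (D (xs \<epsilon> n) *v (K (xs \<epsilon> n) *v y + \<xi>))) ` \<Gamma>"
  by (simp add: scaled_cell_def image_image)

lemma continuous_cell_map: "continuous_on UNIV (\<lambda>y. \<epsilon> *\<^sub>R (D x *v (K x *v y + \<xi>)))"
  by (intro continuous_intros continuous_on_matrix_vector_mult)

lemma compact_cell: "compact (cell \<epsilon> n \<xi>)"
  unfolding cell_eq
  by (intro compact_continuous_image continuous_on_subset[OF continuous_cell_map] compact_Gamma) auto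

lemma cell_borel: "cell \<epsilon> n \<xi> \<in> sets borel"
  using compact_cell by (simp add: borel_closed compact_imp_closed)

lemma G_eq: "G \<epsilon> = (\<Union>n\<in>{1..N \<epsilon>}. \<Union>\<xi>\<in>\<Xi> \<epsilon> n. cell \<epsilon> n \<xi> \<inter> \<Omega>)"
  by (simp add: Gamma_eps_def)

lemma G_borel: "0 < \<epsilon> \<Longrightarrow> G \<epsilon> \<in> sets borel"
  unfolding G_eq using cube_facts(8) compact_cell Omega_props(2) by (intro borel_UN_compact_Int_open) auto

lemma G_subset: "G \<epsilon> \<subseteq> \<Omega>"
  unfolding G_eq by auto

text \<open>\<open>Y0\<close> is mapped into an open cell contained in the cube, but
  \<open>\<Gamma>\<close> lies only in the closure of \<open>Y0\<close> and may touch the boundary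
  of the unit cell; continuity then gives the closed cube.\<close>

lemma cell_subset_closure_Q:
  assumes \<epsilon>: "0 < \<epsilon>" "n \<in> {1..N \<epsilon>}" and \<xi>: "\<xi> \<in> \<Xi> \<epsilon> n"
  shows "cell \<epsilon> n \<xi> \<subseteq> closure (Q \<epsilon> n)"
proof -
  let ?x = "xs \<epsilon> n"
  let ?f = "\<lambda>y. \<epsilon> *\<^sub>R (D ?x *v (K ?x *v y + \<xi>))"
  have "\<Gamma> \<subseteq> closure Y0" by (simp add: frontier_def)
  then have "?f ` \<Gamma> \<subseteq> ?f ` closure Y0" by blast
  also have "\<dots> \<subseteq> closure (?f ` Y0)"
    by (rule image_closure_subset[OF continuous_on_subset[OF continuous_cell_map]]) (auto simp: closure_subset)
  also have "\<dots> \<subseteq> closure (Q \<epsilon> n)"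
  proof (rule closure_mono)
    have "?f ` Y0 \<subseteq> scaled_cell \<epsilon> (D ?x) \<xi> unit_cell"
      using KY0[OF cube_facts(5)[OF \<epsilon>]] by (auto simp: scaled_cell_def)
    then show "?f ` Y0 \<subseteq> Q \<epsilon> n" using \<xi> by (auto simp: Xi_star_def)
  qed
  finally show ?thesis unfolding cell_eq .
qed

text \<open>An open cube disjoint from \<open>Q \<epsilon> n\<close> is also disjoint from its
  closure, so at most the term with index \<open>n\<close> survives. On the boundary of
  \<open>Q \<epsilon> n\<close> this term vanishes too, which is why only an inequality
  holds.\<close>

lemma L_bound_on_cell:
  assumes \<epsilon>: "0 < \<epsilon>" "n \<in> {1..N \<epsilon>}" and z: "z \<in> closure (Q \<epsilon> n)"
  shows "\<bar>L \<epsilon> \<psi> z\<bar> \<le> \<bar>apply_bcontfun (\<psi> z) (matrix_inv (D (xs \<epsilon> n)) *v (z /\<^sub>R \<epsilon>))\<bar>"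
proof -
  have "z \<notin> Q \<epsilon> m" if m: "m \<in> {1..N \<epsilon>}" "m \<noteq> n" for m
  proof
    assume "z \<in> Q \<epsilon> m"
    moreover have "Q \<epsilon> m \<inter> Q \<epsilon> n = {}" using Q_disjoint[OF \<epsilon>(1)] m \<epsilon>(2) by (auto simp: disjoint_family_on_def)
    ultimately show False
      using z open_Int_closure_eq_empty[OF cube_facts(1)[OF \<epsilon>(1) m(1)], of "Q \<epsilon> n"] by auto
  qed
  then have "L \<epsilon> \<psi> z = (\<Sum>m\<in>{n}. apply_bcontfun (\<psi> z) (matrix_inv (D (xs \<epsilon> m)) *v (z /\<^sub>R \<epsilon>)) * indicator (Q \<epsilon> m) z)"
    unfolding lp_approx_def using \<epsilon>(2) by (intro sum.mono_neutral_right) (auto simp: indicator_def)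
  then show ?thesis by (cases "z \<in> Q \<epsilon> n") simp_all
qed

text \<open>The majorant is the approximation of the constant 1, whose \<open>q\<close>-integrals
  are bounded for all small \<open>\<epsilon>\<close>; one bound for the constant function thereby
  controls all test functions at once.\<close>

lemma L_le_sup:
  assumes z: "z \<in> \<Omega>" and b: "\<And>x. x \<in> closure \<Omega> \<Longrightarrow> norm (\<psi> x) \<le> b"
  shows "\<bar>L \<epsilon> \<psi> z\<bar> \<le> b * L \<epsilon> (\<lambda>x. const_bcontfun 1) z"
proof -
  have "\<bar>apply_bcontfun (\<psi> z) u\<bar> \<le> b" for u
    using norm_bounded[of "\<psi> z" u] b[of z] z Omega_props(5) by auto
  then have "\<bar>L \<epsilon> \<psi> z\<bar> \<le> (\<Sum>n\<in>{1..N \<epsilon>}. b * indicator (Q \<epsilon> n) z)"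
    unfolding lp_approx_def by (intro order_trans[OF sum_abs] sum_mono) (auto simp: abs_mult indicator_def)
  then show ?thesis by (simp add: lp_approx_def sum_distrib_left const_bcontfun.rep_eq)
qed

text \<open>The map from \<open>\<Gamma>\<close> to a cell has Lipschitz constant
  \<open>\<epsilon> * a\<close>, the same for all \<open>\<xi>\<close> because the lattice shift
  drops out of distances.\<close>

lemma nn_integral_cell_le:
  assumes \<epsilon>: "0 < \<epsilon>" "n \<in> {1..N \<epsilon>}" and a: "0 < a" "norm (A (xs \<epsilon> n)) \<le> a"
    and h: "h \<in> borel_measurable borel"
  shows "(\<integral>\<^sup>+z. h z \<partial>hausdorff_on (cell \<epsilon> n \<xi>)) \<le> ennreal ((\<epsilon> * a) ^ s) *
     (\<integral>\<^sup>+y. h (\<epsilon> *\<^sub>R (D (xs \<epsilon> n) *v (K (xs \<epsilon> n) *v y + \<xi>))) \<partial>hausdorff_on \<Gamma>)"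
proof -
  let ?x = "xs \<epsilon> n"
  let ?f = "\<lambda>y. \<epsilon> *\<^sub>R (D ?x *v (K ?x *v y + \<xi>))"
  have "(\<integral>\<^sup>+z. h z \<partial>hausdorff_on (?f ` \<Gamma>)) \<le> ennreal ((\<epsilon> * a) ^ (DIM(real ^ 'n) - 1)) * (\<integral>\<^sup>+y. h (?f y) \<partial>hausdorff_on \<Gamma>)"
  proof (rule hausdorff_on_lipschitz_image[OF _ _ _ _ _ h])
    show "?f ` \<Gamma> \<in> sets borel" using cell_borel[of \<epsilon> n \<xi>] unfolding cell_eq .
    show "?f \<in> borel_measurable borel" by (rule borel_measurable_continuous_onI[OF continuous_cell_map])
    show "0 < \<epsilon> * a" using \<epsilon> a by simp
    fix u v :: "real ^ 'n"
    have "?f u - ?f v = \<epsilon> *\<^sub>R (A ?x *v (u - v))"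
      by (simp add: matrix_vector_mul_assoc[symmetric] matrix_vector_right_distrib matrix_vector_mult_diff_distrib scaleR_diff_right scaleR_add_right)
    then have "dist (?f u) (?f v) = \<epsilon> * norm (A ?x *v (u - v))" using \<epsilon>(1) by (simp add: dist_norm)
    also have "\<dots> \<le> \<epsilon> * (norm (A ?x) * norm (u - v))"
      using \<epsilon>(1) norm_matrix_vector_mult_le[of "A ?x" "u - v"] by (intro mult_left_mono) auto
    also have "\<dots> \<le> \<epsilon> * (a * norm (u - v))"
      using \<epsilon>(1) a(2) by (intro mult_left_mono mult_right_mono) auto
    finally show "dist (?f u) (?f v) \<le> \<epsilon> * a * dist u v" by (simp add: dist_norm mult.assoc)
  qed auto
  then show ?thesis unfolding cell_eq by (simp add: s_eq)
qed

lemma surface_G_finite: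
  assumes \<epsilon>: "0 < \<epsilon>"
  shows "finite_measure (surface_measure (G \<epsilon>))"
proof (rule finite_measureI)
  obtain a where a: "0 < a" "\<And>x. x \<in> closure \<Omega> \<Longrightarrow> norm (A x) \<le> a" by (rule matrix_bounds) blast
  have cell: "hausdorff_outer s (cell \<epsilon> n \<xi>) < top" if n: "n \<in> {1..N \<epsilon>}" for n \<xi>
  proof -
    have "(\<integral>\<^sup>+z. 1 \<partial>hausdorff_on (cell \<epsilon> n \<xi>)) \<le> ennreal ((\<epsilon> * a) ^ s) * (\<integral>\<^sup>+y. 1 \<partial>hausdorff_on \<Gamma>)"
      using nn_integral_cell_le[OF \<epsilon> n a(1) a(2)[OF cube_facts(5)[OF \<epsilon> n]], of "\<lambda>_. 1" \<xi>] by simp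
    then have "hausdorff_outer s (cell \<epsilon> n \<xi>) \<le> ennreal ((\<epsilon> * a) ^ s) * hausdorff_outer s \<Gamma>"
      using emeasure_hausdorff_on_s[of _ UNIV] cell_borel by simp
    then show ?thesis using hausdorff_Gamma_finite by (simp add: ennreal_mult_less_top order_le_less_trans)
  qed
  have "hausdorff_outer s (G \<epsilon>) \<le> (\<Sum>n\<in>{1..N \<epsilon>}. \<Sum>\<xi>\<in>\<Xi> \<epsilon> n. hausdorff_outer s (cell \<epsilon> n \<xi> \<inter> \<Omega>))"
    unfolding G_eq using cube_facts(8)[OF \<epsilon>]
    by (intro order_trans[OF hausdorff_outer_Union_finite] sum_mono hausdorff_outer_Union_finite) auto
  also have "\<dots> \<le> (\<Sum>n\<in>{1..N \<epsilon>}. \<Sum>\<xi>\<in>\<Xi> \<epsilon> n. hausdorff_outer s (cell \<epsilon> n \<xi>))"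
    by (intro sum_mono hausdorff_outer_mono) auto
  also have "\<dots> < top" using cell cube_facts(8)[OF \<epsilon>] by simp
  finally show "emeasure (surface_measure (G \<epsilon>)) (space (surface_measure (G \<epsilon>))) \<noteq> \<infinity>"
    using emeasure_surface_measure[OF G_borel[OF \<epsilon>], of UNIV] by (simp add: s_eq less_top)
qed

lemma small_cubes:
  assumes "0 < \<rho>"
  obtains e where "0 < e" "\<And>\<epsilon>. 0 < \<epsilon> \<Longrightarrow> \<epsilon> < e \<Longrightarrow> real CARD('n) * \<epsilon> powr r < \<rho>"
proof -
  define c where "c = \<rho> / real CARD('n)"
  have c: "0 < c" using assms by (simp add: c_def)
  show ?thesis
  proof (rule that[of "c powr (1 / r)"])
    fix \<epsilon> :: real assume "0 < \<epsilon>" "\<epsilon> < c powr (1 / r)"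
    then have "\<epsilon> powr r < (c powr (1 / r)) powr r" using r_pos by (intro powr_less_mono2) auto
    also have "\<dots> = c" using c r_pos by (simp add: powr_powr)
    finally show "real CARD('n) * \<epsilon> powr r < \<rho>" by (simp add: c_def field_simps)
  qed (use c in simp)
qed

text \<open>The limit integrand over the reference surface, taken with the fixed measure of
  \<open>\<Gamma>\<close> instead of \<open>\<kappa> x\<close>. The two are comparable, and the
  fixed measure makes continuity in \<open>x\<close> a matter of the integrand alone.\<close>

definition F :: "real \<Rightarrow> (real ^ 'n \<Rightarrow> ((real ^ 'n) \<Rightarrow>\<^sub>C real)) \<Rightarrow> real ^ 'n \<Rightarrow> real" where
  "F q \<psi> x = (\<integral>y. \<bar>apply_bcontfun (\<psi> x) (K x *v y)\<bar> powr q \<partial>hausdorff_on \<Gamma>)"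

lemma C_C_per_bound:
  assumes "\<psi> \<in> C_C_per \<Omega>"
  obtains b where "0 \<le> b" "\<And>x. x \<in> closure \<Omega> \<Longrightarrow> norm (\<psi> x) \<le> b"
    "\<And>x u. x \<in> closure \<Omega> \<Longrightarrow> \<bar>apply_bcontfun (\<psi> x) u\<bar> \<le> b"
proof -
  have "compact (\<psi> ` closure \<Omega>)"
    using assms Omega_props(4) by (intro compact_continuous_image) (auto simp: C_C_per_def)
  then obtain b where b: "\<And>x. x \<in> closure \<Omega> \<Longrightarrow> norm (\<psi> x) \<le> b"
    using compact_imp_bounded bounded_iff by (metis imageI)
  obtain x where "x \<in> closure \<Omega>" using Omega_props by auto
  then have "0 \<le> b" using b norm_ge_zero order_trans by blast
  moreover have "\<bar>apply_bcontfun (\<psi> x) u\<bar> \<le> b" if "x \<in> closure \<Omega>" for x u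
    using norm_bounded[of "\<psi> x" u] b[OF that] by simp
  ultimately show ?thesis using that b by blast
qed

lemma continuous_bcontfun_K:
  "continuous_on UNIV (\<lambda>y. apply_bcontfun g (K x *v y))"
proof -
  have "continuous_on UNIV (apply_bcontfun g)" using apply_bcontfun[of g] by (simp add: bcontfun_def)
  then show ?thesis
    by (rule continuous_on_compose2) (auto intro!: continuous_on_matrix_vector_mult continuous_intros)
qed

lemma borel_bcontfun: "apply_bcontfun (g :: (real ^ 'n) \<Rightarrow>\<^sub>C real) \<in> borel_measurable borel"
  using apply_bcontfun[of g] by (intro borel_measurable_continuous_onI) (simp add: bcontfun_def)

lemma measurable_hausdorff_on_eq: "measurable (hausdorff_on S) borel = measurable borel borel"
  by (rule measurable_cong_sets) auto

lemma integrable_F: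
  assumes \<psi>: "\<psi> \<in> C_C_per \<Omega>" and q: "1 < q" and x: "x \<in> closure \<Omega>"
  shows "integrable (hausdorff_on \<Gamma>) (\<lambda>y. \<bar>apply_bcontfun (\<psi> x) (K x *v y)\<bar> powr q)"
proof -
  interpret finite_measure "hausdorff_on \<Gamma>" by (rule finite_measure_Gamma)
  obtain b where b: "\<And>x u. x \<in> closure \<Omega> \<Longrightarrow> \<bar>apply_bcontfun (\<psi> x) u\<bar> \<le> b" by (rule C_C_per_bound[OF \<psi>]) blast
  have m: "(\<lambda>y. apply_bcontfun (\<psi> x) (K x *v y)) \<in> borel_measurable borel"
    by (rule borel_measurable_continuous_onI[OF continuous_bcontfun_K])
  show ?thesis
  proof (rule integrable_const_bound[where B="b powr q"])
    show "AE y in hausdorff_on \<Gamma>. norm (\<bar>apply_bcontfun (\<psi> x) (K x *v y)\<bar> powr q) \<le> b powr q"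
      using b[OF x] q by (intro AE_I2) (simp add: powr_mono2)
    show "(\<lambda>y. \<bar>apply_bcontfun (\<psi> x) (K x *v y)\<bar> powr q) \<in> borel_measurable (hausdorff_on \<Gamma>)"
      unfolding measurable_hausdorff_on_eq using m by measurable
  qed
qed

lemma F_nonneg: "0 \<le> F q \<psi> x"
  unfolding F_def by (rule integral_nonneg_AE) simp

text \<open>The integrand is uniformly continuous on the compact set
  \<open>closure \<Omega> \<times> \<Gamma>\<close>, and \<open>hausdorff_on \<Gamma>\<close>,
  though defined on the whole space, is concentrated on \<open>\<Gamma>\<close>.\<close>

lemma F_uniformly_continuous:
  assumes \<psi>: "\<psi> \<in> C_C_per \<Omega>" and q: "1 < q"
  shows "uniformly_continuous_on (closure \<Omega>) (F q \<psi>)"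
  unfolding uniformly_continuous_on_def
proof (intro allI impI)
  fix \<eta> :: real assume \<eta>: "0 < \<eta>"
  interpret finite_measure "hausdorff_on \<Gamma>" by (rule finite_measure_Gamma)
  define H where "H = measure (hausdorff_on \<Gamma>) UNIV"
  have H: "0 < H + 1" by (simp add: H_def add_nonneg_pos)
  let ?g = "\<lambda>z. \<bar>apply_bcontfun (\<psi> (fst z)) (K (fst z) *v snd z)\<bar> powr q"
  have "continuous_on (closure \<Omega> \<times> \<Gamma>) (\<lambda>z. apply_bcontfun (\<psi> (fst z)) (K (fst z) *v snd z))"
    using \<psi> by (intro continuous_on_apply_bcontfun_compose[of "closure \<Omega>"] continuous_on_matrix_vector_mult
       continuous_on_compose2[OF continuous_DKA(2)] continuous_intros) (auto simp: C_C_per_def)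
  then have "continuous_on (closure \<Omega> \<times> \<Gamma>) ?g"
    using q by (intro continuous_on_powr' continuous_intros) auto
  then have "uniformly_continuous_on (closure \<Omega> \<times> \<Gamma>) ?g"
    by (rule compact_uniformly_continuous) (intro compact_Times Omega_props(4) compact_Gamma)
  moreover have "0 < \<eta> / (H + 1)" using \<eta> H by simp
  ultimately obtain d where d: "0 < d" "\<And>z z'. z \<in> closure \<Omega> \<times> \<Gamma> \<Longrightarrow> z' \<in> closure \<Omega> \<times> \<Gamma> \<Longrightarrow> dist z' z < d \<Longrightarrow> dist (?g z') (?g z) < \<eta> / (H + 1)"
    unfolding uniformly_continuous_on_def by meson
  show "\<exists>d>0. \<forall>x\<in>closure \<Omega>. \<forall>x'\<in>closure \<Omega>. dist x' x < d \<longrightarrow> dist (F q \<psi> x') (F q \<psi> x) < \<eta>"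
  proof (intro exI[of _ d] conjI ballI impI d(1))
    fix x x' assume x: "x \<in> closure \<Omega>" "x' \<in> closure \<Omega>" "dist x' x < d"
    note i = integrable_F[OF \<psi> q x(1)] integrable_F[OF \<psi> q x(2)]
    have "dist (F q \<psi> x') (F q \<psi> x) = \<bar>\<integral>y. ?g (x', y) - ?g (x, y) \<partial>hausdorff_on \<Gamma>\<bar>"
      using i by (simp add: F_def dist_real_def)
    also have "\<dots> \<le> (\<integral>y. \<bar>?g (x', y) - ?g (x, y)\<bar> \<partial>hausdorff_on \<Gamma>)" by (rule integral_abs_bound)
    also have "\<dots> \<le> (\<integral>y. \<eta> / (H + 1) \<partial>hausdorff_on \<Gamma>)"
    proof (rule integral_mono_AE)
      show "AE y in hausdorff_on \<Gamma>. \<bar>?g (x', y) - ?g (x, y)\<bar> \<le> \<eta> / (H + 1)"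
        using AE_hausdorff_on[OF Gamma_borel]
      proof eventually_elim
        case (elim y)
        then show ?case using d(2)[of "(x, y)" "(x', y)"] x by (simp add: dist_Pair_Pair dist_real_def)
      qed
    qed (use i in auto)
    also have "\<dots> = \<eta> / (H + 1) * H" by (simp add: H_def)
    also have "\<dots> < \<eta>" using \<eta> H by (simp add: field_simps)
    finally show "dist (F q \<psi> x') (F q \<psi> x) < \<eta>" .
  qed
qed

text \<open>Cubes that meet \<open>\<Omega>\<close> may stick out of it, but only into a thin
  neighbourhood. The parts of these neighbourhoods outside \<open>\<Omega>\<close> decrease to a
  subset of the frontier, which is a null set by the Lipschitz property.\<close>

lemma measure_neighbourhood_small:
  assumes "0 < \<eta>"
  obtains \<rho> where "0 < \<rho>" "\<rho> \<le> 1" "{x. infdist x \<Omega> \<le> \<rho>} \<in> lmeasurable" "measure lebesgue ({x. infdist x \<Omega> \<le> \<rho>} - \<Omega>) < \<eta>"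
proof -
  define S where "S = (\<lambda>m::nat. {x. infdist x \<Omega> \<le> 1 / real (Suc m)})"
  have clos: "closed {x. infdist x \<Omega> \<le> t}" for t by (intro closed_Collect_le continuous_intros)
  have bdd: "bounded {x. infdist x \<Omega> \<le> 1}"
  proof -
    obtain b where b: "\<And>x. x \<in> \<Omega> \<Longrightarrow> norm x \<le> b" using Omega_props(3) bounded_iff by metis
    have "norm x \<le> b + 2" if "infdist x \<Omega> \<le> 1" for x
    proof -
      have "infdist x \<Omega> < 2" using that by simp
      then obtain y where "y \<in> \<Omega>" "dist x y < 2"
        using Omega_props(1) cInf_lessD[of "dist x ` \<Omega>" 2] by (auto simp: infdist_notempty)
      then show ?thesis using b[of y] norm_triangle_ineq2[of x y] by (simp add: dist_norm)
    qed
    then show ?thesis unfolding bounded_iff by blast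
  qed
  have lm: "{x. infdist x \<Omega> \<le> \<rho>} \<in> lmeasurable" if "\<rho> \<le> 1" for \<rho>
  proof -
    have "bounded {x. infdist x \<Omega> \<le> \<rho>}" by (rule bounded_subset[OF bdd]) (use that in auto)
    then show ?thesis using clos by (simp add: lmeasurable_compact compact_eq_bounded_closed)
  qed
  have Sm: "S m - \<Omega> \<in> lmeasurable" for m
    unfolding S_def by (intro fmeasurable_Diff lm) (use Omega_lmeasurable in \<open>auto simp: fmeasurable_def\<close>)
  have "(\<lambda>m. measure lebesgue (S m - \<Omega>)) \<longlonglongrightarrow> measure lebesgue (\<Inter>m. S m - \<Omega>)"
  proof (rule Lim_measure_decseq)
    show "range (\<lambda>m. S m - \<Omega>) \<subseteq> sets lebesgue" using Sm by (auto simp: fmeasurable_def)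
    have "1 / real (Suc (Suc m)) \<le> 1 / real (Suc m)" for m by (intro divide_left_mono) auto
    then show "decseq (\<lambda>m. S m - \<Omega>)" unfolding S_def by (intro decseq_SucI) (auto intro: order_trans)
    show "emeasure lebesgue (S m - \<Omega>) \<noteq> \<infinity>" for m using Sm[of m] by (auto simp: fmeasurable_def)
  qed
  also have "(\<Inter>m. S m - \<Omega>) \<subseteq> frontier \<Omega>"
  proof
    fix x assume x: "x \<in> (\<Inter>m. S m - \<Omega>)"
    have "infdist x \<Omega> \<le> 0"
    proof (rule ccontr)
      assume "\<not> infdist x \<Omega> \<le> 0"
      then obtain m where "1 / real (Suc m) < infdist x \<Omega>" using nat_approx_posE[of "infdist x \<Omega>"] by auto
      then show False using x by (auto simp: S_def dest!: spec[of _ m])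
    qed
    then have "infdist x \<Omega> = 0" using infdist_nonneg[of x \<Omega>] by simp
    then have "x \<in> closure \<Omega>" using in_closure_iff_infdist_zero[OF Omega_props(1)] by blast
    then show "x \<in> frontier \<Omega>" using x Omega_props(2) by (auto simp: frontier_def interior_open)
  qed
  then have "measure lebesgue (\<Inter>m. S m - \<Omega>) = 0"
    using negligible_frontier_Omega negligible_subset negligible_imp_measure0 by blast
  finally have "(\<lambda>m. measure lebesgue (S m - \<Omega>)) \<longlonglongrightarrow> 0" .
  then have "\<forall>\<^sub>F m in sequentially. measure lebesgue (S m - \<Omega>) < \<eta>" using assms by (rule order_tendstoD)
  then obtain m where "measure lebesgue (S m - \<Omega>) < \<eta>" using eventually_happens' sequentially_bot by blast
  moreover have "1 / real (Suc m) \<le> 1" by simp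
  ultimately show ?thesis
    using that[of "1 / real (Suc m)"] lm[of "1 / real (Suc m)"] by (simp add: S_def)
qed

end


context perforated_partition
begin

text \<open>A Riemann sum with sample points \<open>xs \<epsilon> n\<close>. The parts of the cubes
  inside \<open>\<Omega>\<close> are compared with the integral through the oscillation
  \<open>\<eta>\<close>; the parts outside have total measure at most \<open>\<eta>\<close> and are
  weighted by \<open>M\<close>. The summand \<open>t\<close> transports the error from freezing the
  test function.\<close>

lemma sum_cubes_le:
  assumes \<epsilon>: "0 < \<epsilon>" and f: "continuous_on (closure \<Omega>) f"
    and fb: "\<And>x. x \<in> closure \<Omega> \<Longrightarrow> 0 \<le> f x" "\<And>x. x \<in> closure \<Omega> \<Longrightarrow> f x \<le> M"
    and osc: "\<And>n x. n \<in> {1..N \<epsilon>} \<Longrightarrow> x \<in> Q \<epsilon> n \<inter> \<Omega> \<Longrightarrow> f (xs \<epsilon> n) \<le> f x + \<eta>"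
    and U: "U \<in> lmeasurable" "\<And>n. n \<in> {1..N \<epsilon>} \<Longrightarrow> Q \<epsilon> n \<subseteq> U" "measure lebesgue (U - \<Omega>) \<le> \<eta>"
    and t: "0 \<le> t" and \<eta>: "0 \<le> \<eta>"
  shows "(\<Sum>n\<in>{1..N \<epsilon>}. measure lebesgue (Q \<epsilon> n) * (f (xs \<epsilon> n) + t))
     \<le> (\<integral>x. f x \<partial>lebesgue_on \<Omega>) + \<eta> * measure lebesgue \<Omega> + M * \<eta> + t * (measure lebesgue \<Omega> + \<eta>)"
proof -
  interpret \<Omega>: finite_measure "lebesgue_on \<Omega>" by (rule finite_lebesgue_on)
  let ?I = "{1..N \<epsilon>}"
  define i where "i = (\<lambda>n. measure lebesgue (Q \<epsilon> n \<inter> \<Omega>))"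
  define o' where "o' = (\<lambda>n. measure lebesgue (Q \<epsilon> n - \<Omega>))"
  have \<Omega>s: "\<Omega> \<in> sets lebesgue" using Omega_lmeasurable by (simp add: fmeasurable_def)
  have Ql: "Q \<epsilon> n \<in> lmeasurable" if "n \<in> ?I" for n using cube_facts(7)[OF \<epsilon> that] .
  have Qi: "Q \<epsilon> n \<inter> \<Omega> \<in> lmeasurable" "Q \<epsilon> n - \<Omega> \<in> lmeasurable" if "n \<in> ?I" for n
    using Ql[OF that] Omega_lmeasurable by (auto intro: fmeasurable_Int_fmeasurable fmeasurable_Diff \<Omega>s)
  have i0: "0 \<le> i n" "0 \<le> o' n" for n by (simp_all add: i_def o'_def)
  have dj: "disjoint_family_on (\<lambda>n. Q \<epsilon> n \<inter> \<Omega>) ?I" "disjoint_family_on (\<lambda>n. Q \<epsilon> n - \<Omega>) ?I"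
    using Q_disjoint[OF \<epsilon>] by (auto simp: disjoint_family_on_def)
  have fin: "emeasure lebesgue (Q \<epsilon> n \<inter> \<Omega>) \<noteq> \<infinity>" "emeasure lebesgue (Q \<epsilon> n - \<Omega>) \<noteq> \<infinity>" if "n \<in> ?I" for n
    using Qi[OF that] by (auto simp: fmeasurable_def)
  have split: "measure lebesgue (Q \<epsilon> n) = i n + o' n" if "n \<in> ?I" for n
  proof -
    have "measure lebesgue (Q \<epsilon> n \<inter> \<Omega> \<union> (Q \<epsilon> n - \<Omega>)) = i n + o' n"
      unfolding i_def o'_def using Qi[OF that] fin[OF that] by (intro measure_Union) (auto simp: fmeasurable_def)
    then show ?thesis by (simp add: Int_Diff_Un)
  qed
  have sum_i: "(\<Sum>n\<in>?I. i n) \<le> measure lebesgue \<Omega>"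
  proof -
    have "(\<Sum>n\<in>?I. i n) = measure lebesgue (\<Union>n\<in>?I. Q \<epsilon> n \<inter> \<Omega>)"
      unfolding i_def using dj(1) fin(1) Qi(1) by (intro measure_finite_Union[symmetric]) (auto simp: fmeasurable_def)
    also have "\<dots> \<le> measure lebesgue \<Omega>"
      using Qi(1) by (intro measure_mono_fmeasurable[OF _ _ Omega_lmeasurable] sets.finite_UN) (auto simp: fmeasurable_def)
    finally show ?thesis .
  qed
  have sum_o: "(\<Sum>n\<in>?I. o' n) \<le> \<eta>"
  proof -
    have "(\<Sum>n\<in>?I. o' n) = measure lebesgue (\<Union>n\<in>?I. Q \<epsilon> n - \<Omega>)"
      unfolding o'_def using dj(2) fin(2) Qi(2) by (intro measure_finite_Union[symmetric]) (auto simp: fmeasurable_def)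
    also have "\<dots> \<le> measure lebesgue (U - \<Omega>)"
    proof (rule measure_mono_fmeasurable[OF _ _ fmeasurable_Diff[OF U(1) \<Omega>s]])
      show "(\<Union>n\<in>?I. Q \<epsilon> n - \<Omega>) \<subseteq> U - \<Omega>" using U(2) by blast
      show "(\<Union>n\<in>?I. Q \<epsilon> n - \<Omega>) \<in> sets lebesgue"
        using Qi(2) by (intro sets.finite_UN) (auto simp: fmeasurable_def)
    qed
    finally show ?thesis using U(3) by simp
  qed
  have fm: "f \<in> borel_measurable (lebesgue_on \<Omega>)"
    by (rule continuous_imp_measurable_on_sets_lebesgue[OF continuous_on_subset[OF f Omega_props(5)] \<Omega>s])
  have fi: "integrable (lebesgue_on \<Omega>) f"
    using fb fm Omega_props(5) by (intro \<Omega>.integrable_const_bound[where B=M] AE_I2) (auto simp: subset_eq)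
  have ind: "(indicator (Q \<epsilon> n) :: _ \<Rightarrow> real) \<in> borel_measurable (lebesgue_on \<Omega>)" if "n \<in> ?I" for n
    using cube_facts(1)[OF \<epsilon> that] by (intro measurable_lebesgue_on) simp
  have intQ: "(\<integral>x. c * indicator (Q \<epsilon> n) x \<partial>lebesgue_on \<Omega>) = c * i n" if "n \<in> ?I" for c :: real and n
  proof -
    have "(\<integral>x. indicator (Q \<epsilon> n) x \<partial>lebesgue_on \<Omega>) = measure (lebesgue_on \<Omega>) (Q \<epsilon> n \<inter> \<Omega>)"
      by simp
    also have "\<dots> = i n" unfolding i_def using \<Omega>s by (subst measure_restrict_space) auto
    finally show ?thesis by simp
  qed
  have "(\<Sum>n\<in>?I. i n * f (xs \<epsilon> n)) = (\<Sum>n\<in>?I. \<integral>x. f (xs \<epsilon> n) * indicator (Q \<epsilon> n) x \<partial>lebesgue_on \<Omega>)"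
  proof (rule sum.cong[OF refl])
    fix n assume "n \<in> ?I"
    from intQ[OF this, of "f (xs \<epsilon> n)"]
    show "i n * f (xs \<epsilon> n) = (\<integral>x. f (xs \<epsilon> n) * indicator (Q \<epsilon> n) x \<partial>lebesgue_on \<Omega>)"
      by (simp only: mult.commute)
  qed
  also have "\<dots> = (\<integral>x. (\<Sum>n\<in>?I. f (xs \<epsilon> n) * indicator (Q \<epsilon> n) x) \<partial>lebesgue_on \<Omega>)"
  proof (rule Bochner_Integration.integral_sum[symmetric])
    fix n assume n: "n \<in> ?I"
    show "integrable (lebesgue_on \<Omega>) (\<lambda>x. f (xs \<epsilon> n) * indicator (Q \<epsilon> n) x)"
      using ind[OF n] by (intro integrable_mult_right \<Omega>.integrable_const_bound[where B=1] AE_I2) auto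
  qed
  also have "\<dots> \<le> (\<integral>x. f x + \<eta> \<partial>lebesgue_on \<Omega>)"
  proof (rule integral_mono)
    show "integrable (lebesgue_on \<Omega>) (\<lambda>x. \<Sum>n\<in>?I. f (xs \<epsilon> n) * indicator (Q \<epsilon> n) x)"
      using ind by (intro Bochner_Integration.integrable_sum integrable_mult_right \<Omega>.integrable_const_bound[where B=1] AE_I2) auto
    show "integrable (lebesgue_on \<Omega>) (\<lambda>x. f x + \<eta>)" using fi by simp
    fix x assume "x \<in> space (lebesgue_on \<Omega>)"
    then have x: "x \<in> \<Omega>" "x \<in> closure \<Omega>" using Omega_props(5) by auto
    show "(\<Sum>n\<in>?I. f (xs \<epsilon> n) * indicator (Q \<epsilon> n) x) \<le> f x + \<eta>"
    proof (cases "\<exists>m\<in>?I. x \<in> Q \<epsilon> m")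
      case True
      then obtain m where m: "m \<in> ?I" "x \<in> Q \<epsilon> m" by blast
      have "(\<Sum>n\<in>?I. f (xs \<epsilon> n) * indicator (Q \<epsilon> n) x) = (\<Sum>n\<in>{m}. f (xs \<epsilon> n) * indicator (Q \<epsilon> n) x)"
      proof (rule sum.mono_neutral_right)
        show "\<forall>n\<in>?I - {m}. f (xs \<epsilon> n) * indicator (Q \<epsilon> n) x = 0"
        proof
          fix n assume n: "n \<in> ?I - {m}"
          then have "Q \<epsilon> n \<inter> Q \<epsilon> m = {}"
            using Q_disjoint[OF \<epsilon>] m(1) unfolding disjoint_family_on_def by blast
          then show "f (xs \<epsilon> n) * indicator (Q \<epsilon> n) x = 0" using m(2) by (auto simp: indicator_def)
        qed
      qed (use m in auto)
      also have "\<dots> = f (xs \<epsilon> m)" using m by simp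
      also have "\<dots> \<le> f x + \<eta>" using osc[OF m(1)] m(2) x(1) by blast
      finally show ?thesis .
    next
      \<comment> \<open>Only the closed cubes cover \<open>\<Omega>\<close>, so a point may lie in
        no open cube; there the sum is 0 and nonnegativity of \<open>f\<close> suffices.\<close>
      case False
      then have "(\<Sum>n\<in>?I. f (xs \<epsilon> n) * indicator (Q \<epsilon> n) x) = 0" by (intro sum.neutral) auto
      then show ?thesis using fb(1)[OF x(2)] \<eta> by simp
    qed
  qed
  also have "\<dots> = (\<integral>x. f x \<partial>lebesgue_on \<Omega>) + \<eta> * measure lebesgue \<Omega>"
    using fi \<Omega>s by (simp add: measure_restrict_space)
  finally have S1: "(\<Sum>n\<in>?I. i n * f (xs \<epsilon> n)) \<le> (\<integral>x. f x \<partial>lebesgue_on \<Omega>) + \<eta> * measure lebesgue \<Omega>" .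
  have M0: "0 \<le> M"
  proof -
    obtain x where "x \<in> closure \<Omega>" using Omega_props by auto
    then show ?thesis using fb order_trans by blast
  qed
  have "(\<Sum>n\<in>?I. o' n * f (xs \<epsilon> n)) \<le> (\<Sum>n\<in>?I. o' n * M)"
    using fb(2) cube_facts(5)[OF \<epsilon>] i0 by (intro sum_mono mult_left_mono) auto
  also have "\<dots> = M * (\<Sum>n\<in>?I. o' n)" by (simp add: sum_distrib_left mult.commute)
  also have "\<dots> \<le> M * \<eta>" using sum_o M0 by (rule mult_left_mono)
  finally have S2: "(\<Sum>n\<in>?I. o' n * f (xs \<epsilon> n)) \<le> M * \<eta>" .
  have S3: "t * ((\<Sum>n\<in>?I. i n) + (\<Sum>n\<in>?I. o' n)) \<le> t * (measure lebesgue \<Omega> + \<eta>)"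
    using sum_i sum_o t by (intro mult_left_mono add_mono)
  have "(\<Sum>n\<in>?I. measure lebesgue (Q \<epsilon> n) * (f (xs \<epsilon> n) + t))
     = (\<Sum>n\<in>?I. i n * f (xs \<epsilon> n) + o' n * f (xs \<epsilon> n) + (t * i n + t * o' n))"
    by (rule sum.cong) (simp_all add: split algebra_simps)
  also have "\<dots> = (\<Sum>n\<in>?I. i n * f (xs \<epsilon> n)) + (\<Sum>n\<in>?I. o' n * f (xs \<epsilon> n)) + t * ((\<Sum>n\<in>?I. i n) + (\<Sum>n\<in>?I. o' n))"
    by (simp add: sum.distrib sum_distrib_left distrib_left)
  finally show ?thesis using S1 S2 S3 by linarith
qed

text \<open>On each cell the slow variable is frozen at \<open>xs \<epsilon> n\<close>, at the cost
  \<open>\<eta>\<close>. After rescaling to \<open>\<Gamma>\<close>, periodicity removes the shift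
  \<open>\<xi>\<close>, so all cells of one cube contribute the same integral. A point lying in
  several cells is counted several times, which is harmless for an upper bound.\<close>

lemma nn_integral_L_le:
  assumes q: "1 < q" and \<psi>: "\<psi> \<in> C_C_per \<Omega>" and \<epsilon>: "0 < \<epsilon>" and \<eta>: "0 < \<eta>"
    and a: "0 < a" "\<And>x. x \<in> closure \<Omega> \<Longrightarrow> norm (A x) \<le> a"
    and osc: "\<And>n z u. n \<in> {1..N \<epsilon>} \<Longrightarrow> z \<in> \<Omega> \<Longrightarrow> z \<in> closure (Q \<epsilon> n) \<Longrightarrow>
       \<bar>apply_bcontfun (\<psi> z) u\<bar> powr q \<le> \<bar>apply_bcontfun (\<psi> (xs \<epsilon> n)) u\<bar> powr q + \<eta>"
  shows "(\<integral>\<^sup>+z. ennreal (\<bar>L \<epsilon> \<psi> z\<bar> powr q) \<partial>surface_measure (G \<epsilon>)) \<le>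
    ennreal (\<Sum>n\<in>{1..N \<epsilon>}. real (card (\<Xi> \<epsilon> n)) * ((\<epsilon> * a) ^ s * (F q \<psi> (xs \<epsilon> n) + \<eta> * measure (hausdorff_on \<Gamma>) UNIV)))"
proof -
  interpret \<sigma>: finite_measure "hausdorff_on \<Gamma>" by (rule finite_measure_Gamma)
  let ?I = "{1..N \<epsilon>}"
  let ?H = "measure (hausdorff_on \<Gamma>) UNIV"
  define h where "h = (\<lambda>n z. ennreal (\<bar>apply_bcontfun (\<psi> (xs \<epsilon> n)) (matrix_inv (D (xs \<epsilon> n)) *v (z /\<^sub>R \<epsilon>))\<bar> powr q + \<eta>))"
  have hm [measurable]: "h n \<in> borel_measurable borel" for n
  proof -
    have "(\<lambda>z. matrix_inv (D (xs \<epsilon> n)) *v (z /\<^sub>R \<epsilon>)) \<in> borel_measurable borel"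
      by (intro borel_measurable_continuous_onI continuous_on_matrix_vector_mult continuous_intros)
    from measurable_compose[OF this borel_bcontfun[of "\<psi> (xs \<epsilon> n)"]] show ?thesis
      unfolding h_def by measurable
  qed
  note [measurable] = cell_borel
  have "(\<integral>\<^sup>+z. ennreal (\<bar>L \<epsilon> \<psi> z\<bar> powr q) \<partial>surface_measure (G \<epsilon>))
     \<le> (\<integral>\<^sup>+z. (\<Sum>n\<in>?I. \<Sum>\<xi>\<in>\<Xi> \<epsilon> n. indicator (cell \<epsilon> n \<xi>) z * h n z) \<partial>surface_measure (G \<epsilon>))"
  proof (rule nn_integral_mono)
    fix z assume "z \<in> space (surface_measure (G \<epsilon>))"
    then obtain n \<xi> where n: "n \<in> ?I" "\<xi> \<in> \<Xi> \<epsilon> n" "z \<in> cell \<epsilon> n \<xi>" "z \<in> \<Omega>"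
      by (auto simp: G_eq)
    have zQ: "z \<in> closure (Q \<epsilon> n)" using cell_subset_closure_Q[OF \<epsilon> n(1,2)] n(3) by blast
    have "\<bar>L \<epsilon> \<psi> z\<bar> powr q \<le> \<bar>apply_bcontfun (\<psi> z) (matrix_inv (D (xs \<epsilon> n)) *v (z /\<^sub>R \<epsilon>))\<bar> powr q"
      using L_bound_on_cell[OF \<epsilon> n(1) zQ, of \<psi>] q by (intro powr_mono2) auto
    also have "\<dots> \<le> \<bar>apply_bcontfun (\<psi> (xs \<epsilon> n)) (matrix_inv (D (xs \<epsilon> n)) *v (z /\<^sub>R \<epsilon>))\<bar> powr q + \<eta>"
      by (rule osc[OF n(1,4) zQ])
    finally have "ennreal (\<bar>L \<epsilon> \<psi> z\<bar> powr q) \<le> h n z" unfolding h_def by (rule ennreal_leI)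
    also have "h n z = indicator (cell \<epsilon> n \<xi>) z * h n z" using n by simp
    also have "\<dots> \<le> (\<Sum>\<xi>\<in>\<Xi> \<epsilon> n. indicator (cell \<epsilon> n \<xi>) z * h n z)"
      using n(2) cube_facts(8)[OF \<epsilon> n(1)] by (intro member_le_sum) auto
    also have "\<dots> \<le> (\<Sum>n\<in>?I. \<Sum>\<xi>\<in>\<Xi> \<epsilon> n. indicator (cell \<epsilon> n \<xi>) z * h n z)"
      using n(1) by (intro member_le_sum[where f="\<lambda>n. \<Sum>\<xi>\<in>\<Xi> \<epsilon> n. indicator (cell \<epsilon> n \<xi>) z * h n z"]) auto
    finally show "ennreal (\<bar>L \<epsilon> \<psi> z\<bar> powr q) \<le> (\<Sum>n\<in>?I. \<Sum>\<xi>\<in>\<Xi> \<epsilon> n. indicator (cell \<epsilon> n \<xi>) z * h n z)" .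
  qed
  also have "\<dots> = (\<integral>\<^sup>+z. (\<Sum>n\<in>?I. \<Sum>\<xi>\<in>\<Xi> \<epsilon> n. indicator (cell \<epsilon> n \<xi>) z * h n z) \<partial>hausdorff_on (G \<epsilon>))"
    by (rule nn_integral_hausdorff_on[symmetric]) measurable
  also have "\<dots> = (\<Sum>n\<in>?I. \<Sum>\<xi>\<in>\<Xi> \<epsilon> n. \<integral>\<^sup>+z. indicator (cell \<epsilon> n \<xi>) z * h n z \<partial>hausdorff_on (G \<epsilon>))"
    by (simp add: nn_integral_sum measurable_hausdorff_on_eq)
  also have "\<dots> \<le> (\<Sum>n\<in>?I. \<Sum>\<xi>\<in>\<Xi> \<epsilon> n. ennreal ((\<epsilon> * a) ^ s * (F q \<psi> (xs \<epsilon> n) + \<eta> * ?H)))"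
  proof (intro sum_mono)
    fix n \<xi> assume n: "n \<in> ?I" and \<xi>: "\<xi> \<in> \<Xi> \<epsilon> n"
    let ?x = "xs \<epsilon> n"
    have x: "?x \<in> closure \<Omega>" by (rule cube_facts(5)[OF \<epsilon> n])
    have "(\<integral>\<^sup>+z. indicator (cell \<epsilon> n \<xi>) z * h n z \<partial>hausdorff_on (G \<epsilon>)) \<le> (\<integral>\<^sup>+z. h n z \<partial>hausdorff_on (cell \<epsilon> n \<xi>))"
      by (rule nn_integral_hausdorff_on_indicator_le[OF G_borel[OF \<epsilon>] cell_borel hm])
    also have "\<dots> \<le> ennreal ((\<epsilon> * a) ^ s) * (\<integral>\<^sup>+y. h n (\<epsilon> *\<^sub>R (D ?x *v (K ?x *v y + \<xi>))) \<partial>hausdorff_on \<Gamma>)"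
      by (rule nn_integral_cell_le[OF \<epsilon> n a(1) a(2)[OF x] hm])
    also have "(\<integral>\<^sup>+y. h n (\<epsilon> *\<^sub>R (D ?x *v (K ?x *v y + \<xi>))) \<partial>hausdorff_on \<Gamma>)
       = (\<integral>\<^sup>+y. ennreal (\<bar>apply_bcontfun (\<psi> ?x) (K ?x *v y)\<bar> powr q + \<eta>) \<partial>hausdorff_on \<Gamma>)"
    proof (rule nn_integral_cong)
      fix y
      have lat: "\<xi> \<in> int_lattice" using \<xi> by (simp add: Xi_star_def Xi_def)
      have "\<psi> ?x \<in> C_per" using \<psi> x by (auto simp: C_C_per_def)
      then have "apply_bcontfun (\<psi> ?x) (K ?x *v y + \<xi>) = apply_bcontfun (\<psi> ?x) (K ?x *v y)"
        using lat by (auto simp: C_per_def)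
      moreover have "matrix_inv (D ?x) *v ((\<epsilon> *\<^sub>R (D ?x *v (K ?x *v y + \<xi>))) /\<^sub>R \<epsilon>) = K ?x *v y + \<xi>"
        using \<epsilon> matrix_inv_cancel(3)[OF invertible_DKA(1)] by simp
      ultimately show "h n (\<epsilon> *\<^sub>R (D ?x *v (K ?x *v y + \<xi>))) = ennreal (\<bar>apply_bcontfun (\<psi> ?x) (K ?x *v y)\<bar> powr q + \<eta>)"
        by (simp only: h_def)
    qed
    also have "\<dots> = ennreal (F q \<psi> ?x + \<eta> * ?H)"
    proof -
      have i: "integrable (hausdorff_on \<Gamma>) (\<lambda>y. \<bar>apply_bcontfun (\<psi> ?x) (K ?x *v y)\<bar> powr q + \<eta>)"
        using integrable_F[OF \<psi> q x] by simp
      have "(\<integral>\<^sup>+y. ennreal (\<bar>apply_bcontfun (\<psi> ?x) (K ?x *v y)\<bar> powr q + \<eta>) \<partial>hausdorff_on \<Gamma>)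
         = ennreal (\<integral>y. \<bar>apply_bcontfun (\<psi> ?x) (K ?x *v y)\<bar> powr q + \<eta> \<partial>hausdorff_on \<Gamma>)"
        by (rule nn_integral_eq_integral[OF i]) (use \<eta> in simp)
      then show ?thesis using integrable_F[OF \<psi> q x] by (simp add: F_def mult.commute)
    qed
    also have "ennreal ((\<epsilon> * a) ^ s) * ennreal (F q \<psi> ?x + \<eta> * ?H) = ennreal ((\<epsilon> * a) ^ s * (F q \<psi> ?x + \<eta> * ?H))"
      using \<epsilon> a by (intro ennreal_mult'[symmetric]) simp
    finally show "(\<integral>\<^sup>+z. indicator (cell \<epsilon> n \<xi>) z * h n z \<partial>hausdorff_on (G \<epsilon>)) \<le> ennreal ((\<epsilon> * a) ^ s * (F q \<psi> ?x + \<eta> * ?H))" .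
  qed
  also have "\<dots> = (\<Sum>n\<in>?I. ennreal (real (card (\<Xi> \<epsilon> n)) * ((\<epsilon> * a) ^ s * (F q \<psi> (xs \<epsilon> n) + \<eta> * ?H))))"
    by (simp add: ennreal_of_nat_eq_real_of_nat ennreal_mult'[symmetric])
  also have "\<dots> = ennreal (\<Sum>n\<in>?I. real (card (\<Xi> \<epsilon> n)) * ((\<epsilon> * a) ^ s * (F q \<psi> (xs \<epsilon> n) + \<eta> * ?H)))"
    using \<epsilon> a \<eta> F_nonneg by (intro sum_ennreal mult_nonneg_nonneg add_nonneg_nonneg zero_le_power) auto
  finally show ?thesis .
qed

text \<open>Only the inequality holds in general: neighbouring cells may share parts of their
  boundaries (\<open>\<Gamma>\<close> may meet the boundary of the unit cell), and \<open>\<Gamma>\<^sup>\<epsilon>\<close> contains a shared part once.\<close>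

lemma L_upper_bound:
  assumes q: "1 < q"
  obtains B where "0 \<le> B" "\<And>\<psi> \<delta>. \<psi> \<in> C_C_per \<Omega> \<Longrightarrow> 0 < \<delta> \<Longrightarrow> \<exists>e>0. \<forall>\<epsilon>. 0 < \<epsilon> \<and> \<epsilon> < e \<longrightarrow>
     ennreal \<epsilon> * (\<integral>\<^sup>+z. ennreal (\<bar>L \<epsilon> \<psi> z\<bar> powr q) \<partial>surface_measure (G \<epsilon>)) \<le> ennreal (B * (\<integral>x. F q \<psi> x \<partial>lebesgue_on \<Omega>) + \<delta>)"
proof -
  obtain a where a: "0 < a" "\<And>x. x \<in> closure \<Omega> \<Longrightarrow> norm (A x) \<le> a" by (rule matrix_bounds) blast
  obtain v where v: "0 < v" "\<And>x. x \<in> closure \<Omega> \<Longrightarrow> v \<le> cell_volume (D x)" by (rule cell_volume_bounds) blast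
  \<comment> \<open>Surface per cell is at most of order \<open>a ^ s\<close>, volume per cell at
    least \<open>v\<close>, after the powers of \<open>\<epsilon>\<close> have been removed.\<close>
  define B where "B = a ^ s / v"
  have B: "0 < B" using a v by (simp add: B_def)
  have main: "\<exists>e>0. \<forall>\<epsilon>. 0 < \<epsilon> \<and> \<epsilon> < e \<longrightarrow>
     ennreal \<epsilon> * (\<integral>\<^sup>+z. ennreal (\<bar>L \<epsilon> \<psi> z\<bar> powr q) \<partial>surface_measure (G \<epsilon>)) \<le> ennreal (B * (\<integral>x. F q \<psi> x \<partial>lebesgue_on \<Omega>) + \<delta>)"
    if \<psi>: "\<psi> \<in> C_C_per \<Omega>" and \<delta>: "0 < \<delta>" for \<psi> \<delta>
  proof -
    define H where "H = measure (hausdorff_on \<Gamma>) UNIV"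
    define l where "l = measure lebesgue \<Omega>"
    have H0: "0 \<le> H" "0 \<le> l" by (simp_all add: H_def l_def)
    have Fcont: "continuous_on (closure \<Omega>) (F q \<psi>)"
      by (rule uniformly_continuous_imp_continuous[OF F_uniformly_continuous[OF \<psi> q]])
    obtain M where M: "0 \<le> M" "\<And>x. x \<in> closure \<Omega> \<Longrightarrow> F q \<psi> x \<le> M"
    proof -
      have "compact (F q \<psi> ` closure \<Omega>)" by (rule compact_continuous_image[OF Fcont Omega_props(4)])
      then obtain M where "\<And>x. x \<in> closure \<Omega> \<Longrightarrow> norm (F q \<psi> x) \<le> M"
        using compact_imp_bounded bounded_iff by (metis imageI)
      then show ?thesis by (intro that[of "\<bar>M\<bar>"]) (auto intro: order_trans[OF abs_ge_self] order_trans[OF _ abs_ge_self])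
    qed
    obtain b where b: "\<And>x u. x \<in> closure \<Omega> \<Longrightarrow> \<bar>apply_bcontfun (\<psi> x) u\<bar> \<le> b" by (rule C_C_per_bound[OF \<psi>]) blast
    \<comment> \<open>The three error terms of \<open>sum_cubes_le\<close> for
      \<open>t = \<eta> * H\<close>, each divided by \<open>\<eta>\<close> and estimated with
      \<open>\<eta> \<le> 1\<close>.\<close>
    define c where "c = l + M + H * (l + 1)"
    have c: "0 \<le> c" using H0 M(1) by (simp add: c_def)
    \<comment> \<open>Small enough for the total error \<open>B * (\<eta> * c)\<close> to be at most
      \<open>\<delta>\<close>; the added 1 excludes division by 0.\<close>
    define \<eta> where "\<eta> = min 1 (\<delta> / (B * c + 1))"
    have Bc: "0 < B * c + 1" using B c by (simp add: add_nonneg_pos)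
    have \<eta>: "0 < \<eta>" "\<eta> \<le> 1" using \<delta> Bc by (auto simp: \<eta>_def)
    have \<eta>\<delta>: "B * (\<eta> * c) \<le> \<delta>"
    proof -
      have "\<eta> * (B * c + 1) \<le> \<delta>" using Bc by (simp add: \<eta>_def min_le_iff_disj pos_le_divide_eq[symmetric])
      then show ?thesis using \<eta>(1) by (simp add: algebra_simps)
    qed
    obtain \<rho>1 where \<rho>1: "0 < \<rho>1" "{x. infdist x \<Omega> \<le> \<rho>1} \<in> lmeasurable" "measure lebesgue ({x. infdist x \<Omega> \<le> \<rho>1} - \<Omega>) < \<eta>"
      by (rule measure_neighbourhood_small[OF \<eta>(1)]) blast
    obtain d where d: "0 < d" "\<And>s t. \<bar>s\<bar> \<le> b \<Longrightarrow> \<bar>t\<bar> \<le> b \<Longrightarrow> \<bar>s - t\<bar> < d \<Longrightarrow> \<bar>\<bar>s\<bar> powr q - \<bar>t\<bar> powr q\<bar> < \<eta>"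
      by (rule uniformly_continuous_abs_powr[OF q \<eta>(1)]) blast
    have "uniformly_continuous_on (closure \<Omega>) \<psi>"
      using \<psi> by (intro compact_uniformly_continuous Omega_props(4)) (auto simp: C_C_per_def)
    then obtain \<rho>2 where \<rho>2: "0 < \<rho>2" "\<And>x x'. x \<in> closure \<Omega> \<Longrightarrow> x' \<in> closure \<Omega> \<Longrightarrow> dist x' x < \<rho>2 \<Longrightarrow> dist (\<psi> x') (\<psi> x) < d"
      using d(1) unfolding uniformly_continuous_on_def by meson
    obtain \<rho>3 where \<rho>3: "0 < \<rho>3" "\<And>x x'. x \<in> closure \<Omega> \<Longrightarrow> x' \<in> closure \<Omega> \<Longrightarrow> dist x' x < \<rho>3 \<Longrightarrow> dist (F q \<psi> x') (F q \<psi> x) < \<eta>"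
      using F_uniformly_continuous[OF \<psi> q] \<eta>(1) unfolding uniformly_continuous_on_def by meson
    \<comment> \<open>The cubes must be small for three reasons: the overhang beyond
      \<open>\<Omega>\<close> (\<open>\<rho>1\<close>), the oscillation of \<open>\<psi>\<close> on
      a cube (\<open>\<rho>2\<close>) and the oscillation of \<open>F q \<psi>\<close>
      (\<open>\<rho>3\<close>).\<close>
    define \<rho> where "\<rho> = min \<rho>1 (min \<rho>2 \<rho>3)"
    have \<rho>: "0 < \<rho>" "\<rho> \<le> \<rho>1" "\<rho> \<le> \<rho>2" "\<rho> \<le> \<rho>3" using \<rho>1 \<rho>2 \<rho>3 by (auto simp: \<rho>_def)
    obtain e where e: "0 < e" "\<And>\<epsilon>. 0 < \<epsilon> \<Longrightarrow> \<epsilon> < e \<Longrightarrow> real CARD('n) * \<epsilon> powr r < \<rho>" by (rule small_cubes[OF \<rho>(1)]) blast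
    have "ennreal \<epsilon> * (\<integral>\<^sup>+z. ennreal (\<bar>L \<epsilon> \<psi> z\<bar> powr q) \<partial>surface_measure (G \<epsilon>)) \<le> ennreal (B * (\<integral>x. F q \<psi> x \<partial>lebesgue_on \<Omega>) + \<delta>)"
      if \<epsilon>: "0 < \<epsilon>" "\<epsilon> < e" for \<epsilon>
    proof -
      let ?I = "{1..N \<epsilon>}"
      have near: "dist z (xs \<epsilon> n) < \<rho>" if "n \<in> ?I" "z \<in> closure (Q \<epsilon> n)" for n z
        using cube_facts(6)[OF \<epsilon>(1) that] e(2)[OF \<epsilon>] by linarith
      have "(\<integral>\<^sup>+z. ennreal (\<bar>L \<epsilon> \<psi> z\<bar> powr q) \<partial>surface_measure (G \<epsilon>)) \<le>
        ennreal (\<Sum>n\<in>?I. real (card (\<Xi> \<epsilon> n)) * ((\<epsilon> * a) ^ s * (F q \<psi> (xs \<epsilon> n) + \<eta> * H)))"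
        unfolding H_def
      proof (rule nn_integral_L_le[OF q \<psi> \<epsilon>(1) \<eta>(1) a])
        fix n z u assume n: "n \<in> ?I" "z \<in> \<Omega>" "z \<in> closure (Q \<epsilon> n)"
        have z: "z \<in> closure \<Omega>" using n(2) Omega_props(5) by blast
        have x: "xs \<epsilon> n \<in> closure \<Omega>" by (rule cube_facts(5)[OF \<epsilon>(1) n(1)])
        have "dist (\<psi> z) (\<psi> (xs \<epsilon> n)) < d" using \<rho>2(2)[OF x z] near[OF n(1,3)] \<rho>(3) by linarith
        then have "\<bar>apply_bcontfun (\<psi> z) u - apply_bcontfun (\<psi> (xs \<epsilon> n)) u\<bar> < d"
          using dist_bounded[of "\<psi> z" u "\<psi> (xs \<epsilon> n)"] by (simp add: dist_real_def)
        from d(2)[OF b[OF z] b[OF x] this]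
        show "\<bar>apply_bcontfun (\<psi> z) u\<bar> powr q \<le> \<bar>apply_bcontfun (\<psi> (xs \<epsilon> n)) u\<bar> powr q + \<eta>" by linarith
      qed
      then have "ennreal \<epsilon> * (\<integral>\<^sup>+z. ennreal (\<bar>L \<epsilon> \<psi> z\<bar> powr q) \<partial>surface_measure (G \<epsilon>)) \<le>
        ennreal (\<epsilon> * (\<Sum>n\<in>?I. real (card (\<Xi> \<epsilon> n)) * ((\<epsilon> * a) ^ s * (F q \<psi> (xs \<epsilon> n) + \<eta> * H))))"
        using \<epsilon>(1) by (simp add: ennreal_mult' mult_left_mono)
      also have "\<dots> \<le> ennreal (B * (\<Sum>n\<in>?I. measure lebesgue (Q \<epsilon> n) * (F q \<psi> (xs \<epsilon> n) + \<eta> * H)))"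
      proof (rule ennreal_leI)
        have "\<epsilon> * (real (card (\<Xi> \<epsilon> n)) * ((\<epsilon> * a) ^ s * (F q \<psi> (xs \<epsilon> n) + \<eta> * H)))
          \<le> B * (measure lebesgue (Q \<epsilon> n) * (F q \<psi> (xs \<epsilon> n) + \<eta> * H))" if n: "n \<in> ?I" for n
        proof -
          let ?c = "real (card (\<Xi> \<epsilon> n))"
          have "CARD('n) = Suc s" using s_eq by simp
          \<comment> \<open>Here the prefactor \<open>\<epsilon>\<close> meets the surface scaling
            \<open>\<epsilon> ^ s\<close>: together they give the volume scaling by which the cells
            in a cube are counted.\<close>
          then have pw: "\<epsilon> ^ CARD('n) = \<epsilon> * \<epsilon> ^ s" by simp
          have "?c * (\<epsilon> * \<epsilon> ^ s * v) \<le> ?c * (\<epsilon> ^ CARD('n) * cell_volume (D (xs \<epsilon> n)))"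
            unfolding pw using v(2)[OF cube_facts(5)[OF \<epsilon>(1) n]] \<epsilon>(1) by (intro mult_left_mono) auto
          also have "\<dots> \<le> measure lebesgue (Q \<epsilon> n)"
            by (rule card_Xi_star_le(2)[OF \<epsilon>(1) invertible_DKA(1) cube_facts(7)[OF \<epsilon>(1) n]])
          finally have "?c * (\<epsilon> * \<epsilon> ^ s) \<le> measure lebesgue (Q \<epsilon> n) / v" using v(1) by (simp add: pos_le_divide_eq mult.assoc)
          then have "a ^ s * (?c * (\<epsilon> * \<epsilon> ^ s)) \<le> a ^ s * (measure lebesgue (Q \<epsilon> n) / v)"
            using a(1) by (intro mult_left_mono) auto
          then have "(a ^ s * (?c * (\<epsilon> * \<epsilon> ^ s))) * (F q \<psi> (xs \<epsilon> n) + \<eta> * H) \<le> (a ^ s * (measure lebesgue (Q \<epsilon> n) / v)) * (F q \<psi> (xs \<epsilon> n) + \<eta> * H)"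
            using F_nonneg[of q \<psi> "xs \<epsilon> n"] \<eta>(1) H0(1) by (intro mult_right_mono) auto
          then show ?thesis by (simp add: B_def power_mult_distrib mult_ac)
        qed
        then show "\<epsilon> * (\<Sum>n\<in>?I. real (card (\<Xi> \<epsilon> n)) * ((\<epsilon> * a) ^ s * (F q \<psi> (xs \<epsilon> n) + \<eta> * H)))
           \<le> B * (\<Sum>n\<in>?I. measure lebesgue (Q \<epsilon> n) * (F q \<psi> (xs \<epsilon> n) + \<eta> * H))"
          unfolding sum_distrib_left by (rule sum_mono)
      qed
      also have "\<dots> \<le> ennreal (B * (\<integral>x. F q \<psi> x \<partial>lebesgue_on \<Omega>) + \<delta>)"
      proof (rule ennreal_leI)
        have "(\<Sum>n\<in>?I. measure lebesgue (Q \<epsilon> n) * (F q \<psi> (xs \<epsilon> n) + \<eta> * H))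
          \<le> (\<integral>x. F q \<psi> x \<partial>lebesgue_on \<Omega>) + \<eta> * measure lebesgue \<Omega> + M * \<eta> + \<eta> * H * (measure lebesgue \<Omega> + \<eta>)"
        proof (rule sum_cubes_le[OF \<epsilon>(1) Fcont _ M(2) _ \<rho>1(2)])
          show "0 \<le> F q \<psi> x" for x by (rule F_nonneg)
          show "measure lebesgue ({x. infdist x \<Omega> \<le> \<rho>1} - \<Omega>) \<le> \<eta>" using \<rho>1(3) by simp
          show "0 \<le> \<eta> * H" "0 \<le> \<eta>" using \<eta>(1) H0 by auto
          fix n assume n: "n \<in> ?I"
          have x: "xs \<epsilon> n \<in> closure \<Omega>" by (rule cube_facts(5)[OF \<epsilon>(1) n])
          show "Q \<epsilon> n \<subseteq> {x. infdist x \<Omega> \<le> \<rho>1}"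
          proof
            fix z assume "z \<in> Q \<epsilon> n"
            then have "dist z (xs \<epsilon> n) < \<rho>1" using near[OF n] closure_subset \<rho>(2) by fastforce
            then show "z \<in> {x. infdist x \<Omega> \<le> \<rho>1}" using infdist_le[OF cube_facts(4)[OF \<epsilon>(1) n], of z] by simp
          qed
          fix z assume z: "z \<in> Q \<epsilon> n \<inter> \<Omega>"
          then have z': "z \<in> closure \<Omega>" "z \<in> closure (Q \<epsilon> n)" using Omega_props(5) closure_subset by auto
          have "dist (F q \<psi> z) (F q \<psi> (xs \<epsilon> n)) < \<eta>" using \<rho>3(2)[OF x z'(1)] near[OF n z'(2)] \<rho>(4) by linarith
          then show "F q \<psi> (xs \<epsilon> n) \<le> F q \<psi> z + \<eta>" by (simp add: dist_real_def abs_less_iff)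
        qed
        also have "\<dots> \<le> (\<integral>x. F q \<psi> x \<partial>lebesgue_on \<Omega>) + \<eta> * c"
        proof -
          have "\<eta> * H * (l + \<eta>) \<le> \<eta> * H * (l + 1)" using \<eta> H0 by (intro mult_left_mono) auto
          then show ?thesis by (simp add: c_def l_def[symmetric] algebra_simps)
        qed
        finally have "B * (\<Sum>n\<in>?I. measure lebesgue (Q \<epsilon> n) * (F q \<psi> (xs \<epsilon> n) + \<eta> * H)) \<le> B * ((\<integral>x. F q \<psi> x \<partial>lebesgue_on \<Omega>) + \<eta> * c)"
          using B by (intro mult_left_mono) auto
        then show "B * (\<Sum>n\<in>?I. measure lebesgue (Q \<epsilon> n) * (F q \<psi> (xs \<epsilon> n) + \<eta> * H)) \<le> B * (\<integral>x. F q \<psi> x \<partial>lebesgue_on \<Omega>) + \<delta>"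
          using \<eta>\<delta> by (simp add: distrib_left)
      qed
      finally show ?thesis .
    qed
    then show ?thesis using e(1) by blast
  qed
  show ?thesis by (rule that[of B]) (use B main in auto)
qed

end


section \<open>Compactness\<close>

text \<open>The test function in coordinates on \<open>\<Gamma>\<close>: at the point
  \<open>D x *v (K x *v y)\<close> of \<open>\<Gamma>_x\<close> the inverse of \<open>D x\<close> in
  \<open>locally_periodic\<close> cancels \<open>D x\<close>, and \<open>K x *v y\<close> is left as
  the fast variable.\<close>

definition eval_K :: "(real ^ 'n \<Rightarrow> real ^ 'n ^ 'n) \<Rightarrow> (real ^ 'n \<Rightarrow> ((real ^ 'n) \<Rightarrow>\<^sub>C real)) \<Rightarrow> (real ^ 'n) \<times> (real ^ 'n) \<Rightarrow> real" where
  "eval_K K \<psi> z = apply_bcontfun (\<psi> (fst z)) (K (fst z) *v snd z)"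

context perforated_domain
begin

text \<open>A test function is continuous on \<open>closure \<Omega>\<close> and arbitrary
  elsewhere, so measurability is first obtained on the subspace
  \<open>closure \<Omega> \<times> UNIV\<close> and then pulled back to
  \<open>\<Omega>\<close>.\<close>

lemma measurable_eval_K:
  assumes "\<psi> \<in> C_C_per \<Omega>"
  shows "eval_K K \<psi> \<in> borel_measurable \<nu>"
proof -
  have c: "continuous_on (closure \<Omega> \<times> UNIV) (eval_K K \<psi>)"
    unfolding eval_K_def[abs_def] using assms
    by (intro continuous_on_apply_bcontfun_compose[of "closure \<Omega>"] continuous_on_matrix_vector_mult
       continuous_on_compose2[OF continuous_DKA(2)] continuous_intros) (auto simp: C_C_per_def)
  have m: "eval_K K \<psi> \<in> borel_measurable (restrict_space borel (closure \<Omega> \<times> UNIV))"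
    by (rule borel_measurable_continuous_on_restrict[OF c])
  have "(\<lambda>z. z) \<in> lebesgue_on \<Omega> \<Otimes>\<^sub>M borel \<rightarrow>\<^sub>M restrict_space borel (closure \<Omega> \<times> (UNIV :: (real ^ 'n) set))"
  proof (rule measurable_restrict_space2)
    show "(\<lambda>z. z) \<in> space (lebesgue_on \<Omega> \<Otimes>\<^sub>M borel) \<rightarrow> closure \<Omega> \<times> (UNIV :: (real ^ 'n) set)"
      using Omega_props(5) by (auto simp: space_pair_measure)
    have id: "(\<lambda>x. x) \<in> lebesgue_on \<Omega> \<rightarrow>\<^sub>M borel"
      by (intro measurable_restrict_space1 measurable_completion) simp
    have "(\<lambda>z. (fst z, snd z)) \<in> lebesgue_on \<Omega> \<Otimes>\<^sub>M borel \<rightarrow>\<^sub>M (borel :: (real ^ 'n) measure) \<Otimes>\<^sub>M (borel :: (real ^ 'n) measure)"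
      by (intro measurable_Pair measurable_compose[OF measurable_fst id] measurable_snd)
    then show "(\<lambda>z. z) \<in> lebesgue_on \<Omega> \<Otimes>\<^sub>M (borel :: (real ^ 'n) measure) \<rightarrow>\<^sub>M borel" by (simp add: borel_prod)
  qed
  from measurable_compose[OF this m] show ?thesis by (simp add: measurable_nu)
qed

lemma eval_K_linear: "eval_K K (\<lambda>x. \<psi> x + c *\<^sub>R \<phi> x) = (\<lambda>z. eval_K K \<psi> z + c * eval_K K \<phi> z)"
  by (simp add: eval_K_def[abs_def])

text \<open>The density becomes a member of \<open>Lp_Gamma_x\<close> by a correction on a null set
  of \<open>x\<close>, and a function on the varying surfaces by the inverse of
  \<open>D x ** K x\<close>. Integrals against test functions are unchanged by the first and
  transform by the definition of \<open>\<kappa>\<close> under the second.\<close>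

lemma limit_function:
  assumes p: "1 < p" and v: "v \<in> borel_measurable \<nu>" "integrable \<nu> (\<lambda>z. \<bar>v z\<bar> powr p)"
  obtains w0 where "w0 \<in> Lp_Gamma_x p \<Omega> D K \<Gamma>"
    "\<And>\<psi>. \<psi> \<in> C_C_per \<Omega> \<Longrightarrow> integrable \<nu> (\<lambda>z. v z * eval_K K \<psi> z) \<Longrightarrow>
      (\<integral>z. v z * eval_K K \<psi> z \<partial>\<nu>) = (\<integral>x. 1 / measure lebesgue ((*v) (D x) ` unit_cell) *
               (\<integral>y. w0 x y * locally_periodic D \<psi> x y \<partial>surface_measure (Gamma_at D K \<Gamma> x))
           \<partial>lebesgue_on \<Omega>)"
proof -
  interpret \<sigma>: finite_measure "hausdorff_on \<Gamma>" by (rule finite_measure_Gamma)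
  have vm: "v \<in> borel_measurable (lebesgue_on \<Omega> \<Otimes>\<^sub>M borel)" using v(1) by (simp add: measurable_nu)
  have sets_pair: "sets (lebesgue_on \<Omega> \<Otimes>\<^sub>M hausdorff_on \<Gamma>) = sets (lebesgue_on \<Omega> \<Otimes>\<^sub>M borel)"
    by (rule sets_pair_measure_cong) auto
  define \<phi> where "\<phi> = (\<lambda>x. \<integral>\<^sup>+y. ennreal (\<bar>v (x, y)\<bar> powr p) \<partial>hausdorff_on \<Gamma>)"
  have \<phi>m [measurable]: "\<phi> \<in> borel_measurable (lebesgue_on \<Omega>)"
  proof -
    have [measurable]: "v \<in> borel_measurable (lebesgue_on \<Omega> \<Otimes>\<^sub>M hausdorff_on \<Gamma>)"
      using vm measurable_cong_sets[OF sets_pair refl] by blast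
    have "(\<lambda>z. ennreal (\<bar>v z\<bar> powr p)) \<in> borel_measurable (lebesgue_on \<Omega> \<Otimes>\<^sub>M hausdorff_on \<Gamma>)"
      by measurable
    then show ?thesis unfolding \<phi>_def by (intro \<sigma>.borel_measurable_nn_integral) (simp add: split_def)
  qed
  have \<phi>fin: "(\<integral>\<^sup>+x. \<phi> x \<partial>lebesgue_on \<Omega>) < \<infinity>"
  proof -
    obtain c where c: "0 \<le> c" "\<And>f. f \<in> borel_measurable \<nu> \<Longrightarrow>
       (\<integral>\<^sup>+x. \<integral>\<^sup>+y. f (x, y) \<partial>hausdorff_on \<Gamma> \<partial>lebesgue_on \<Omega>) \<le> ennreal c * (\<integral>\<^sup>+z. f z \<partial>\<nu>)"
      by (rule product_le_nu) blast
    note [measurable] = v(1)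
    have "(\<integral>\<^sup>+x. \<phi> x \<partial>lebesgue_on \<Omega>) \<le> ennreal c * (\<integral>\<^sup>+z. ennreal (\<bar>v z\<bar> powr p) \<partial>\<nu>)"
      unfolding \<phi>_def by (rule c(2)) measurable
    also have "\<dots> < \<infinity>"
      using nn_integral_eq_integral[OF v(2)] by (simp add: ennreal_mult_less_top)
    finally show ?thesis .
  qed
  have \<phi>AE: "AE x in lebesgue_on \<Omega>. \<phi> x \<noteq> \<infinity>"
    by (rule nn_integral_PInf_AE) (use \<phi>fin in auto)
  \<comment> \<open>\<open>Bochner_Lp\<close> requires every section to be
    \<open>p\<close>-integrable, so the sections with infinite integral \<open>\<phi>\<close> are
    set to 0. They form a null set because \<open>\<phi>\<close> has a finite integral.\<close>
  define v' where "v' = (\<lambda>z. if \<phi> (fst z) = \<infinity> then 0 else v z)"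
  have v'm: "v' \<in> borel_measurable (lebesgue_on \<Omega> \<Otimes>\<^sub>M borel)"
  proof -
    have [measurable]: "(\<lambda>z. \<phi> (fst z)) \<in> borel_measurable (lebesgue_on \<Omega> \<Otimes>\<^sub>M borel)"
      by (rule measurable_compose[OF measurable_fst \<phi>m])
    note [measurable] = vm
    show ?thesis unfolding v'_def by measurable
  qed
  have v'nu: "v' \<in> borel_measurable \<nu>" using v'm by (simp add: measurable_nu)
  have v'AE: "AE z in \<nu>. v' z = v z"
  proof -
    have "(\<lambda>z. if \<phi> (fst z) = \<infinity> then 1 else 0 :: ennreal) \<in> borel_measurable (lebesgue_on \<Omega> \<Otimes>\<^sub>M borel)"
    proof -
      have [measurable]: "(\<lambda>z. \<phi> (fst z)) \<in> borel_measurable (lebesgue_on \<Omega> \<Otimes>\<^sub>M borel)"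
        by (rule measurable_compose[OF measurable_fst \<phi>m])
      show ?thesis by measurable
    qed
    then have gm: "(\<lambda>z. if \<phi> (fst z) = \<infinity> then 1 else 0 :: ennreal) \<in> borel_measurable \<nu>" by (simp add: measurable_nu)
    have "(\<integral>\<^sup>+z. (if \<phi> (fst z) = \<infinity> then 1 else 0 :: ennreal) \<partial>\<nu>)
       = (\<integral>\<^sup>+x. \<integral>\<^sup>+y. (if \<phi> (fst (x, y)) = \<infinity> then 1 else 0 :: ennreal) \<partial>\<kappa>1 x \<partial>base)"
      unfolding \<nu>_def
      by (rule nn_integral_kernel_product[OF finite_base base_nonempty kernel_kappa1]) (use gm in \<open>simp add: measurable_nu'\<close>)
    also have "\<dots> = (\<integral>\<^sup>+x. 0 \<partial>base)"
    proof (rule nn_integral_cong_AE)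
      have "AE x in base. \<phi> x \<noteq> \<infinity>"
        unfolding base_def using \<phi>AE by (subst AE_density) auto
      then show "AE x in base. (\<integral>\<^sup>+y. (if \<phi> (fst (x, y)) = \<infinity> then 1 else 0 :: ennreal) \<partial>\<kappa>1 x) = 0"
        by eventually_elim simp
    qed
    finally have "AE z in \<nu>. (if \<phi> (fst z) = \<infinity> then 1 else 0 :: ennreal) = 0"
      using gm by (simp add: nn_integral_0_iff_AE)
    then show ?thesis by eventually_elim (auto simp: v'_def split: if_splits)
  qed
  \<comment> \<open>The value 0 outside \<open>\<Omega>\<close> is arbitrary: both the Bochner space
    and the limit integral look at points of \<open>\<Omega>\<close> only.\<close>
  define w0 where "w0 = (\<lambda>x z. if x \<in> \<Omega> then v' (x, matrix_inv (A x) *v z) else 0)"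
  have sec: "(\<lambda>y. v' (x, y)) \<in> borel_measurable borel" if "x \<in> \<Omega>" for x
    by (rule measurable_section[OF v'nu that])
  have w0_image: "w0 x (D x *v (K x *v y)) = (if x \<in> \<Omega> then v' (x, y) else 0)" for x y
    unfolding w0_def matrix_vector_mul_assoc using matrix_inv_cancel(3)[OF invertible_DKA(3)]
    by (simp add: matrix_vector_mul_assoc[symmetric])
  have "(\<lambda>x y. w0 x (D x *v (K x *v y))) \<in> Bochner_Lp p (lebesgue_on \<Omega>) (surface_measure \<Gamma>)"
  proof (rule Bochner_Lp_surface_measure)
    show "(\<lambda>y. w0 x (D x *v (K x *v y))) \<in> borel_measurable borel" if "x \<in> space (lebesgue_on \<Omega>)" for x
      unfolding w0_image using sec[of x] by (cases "x \<in> \<Omega>") auto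
    have fin: "(\<integral>\<^sup>+y. ennreal (\<bar>v' (x, y)\<bar> powr p) \<partial>hausdorff_on \<Gamma>) \<le> \<phi> x \<and>
        (\<integral>\<^sup>+y. ennreal (\<bar>v' (x, y)\<bar> powr p) \<partial>hausdorff_on \<Gamma>) < \<infinity>" for x
    proof (cases "\<phi> x = \<infinity>")
      case True
      then have "v' (x, y) = 0" for y by (simp add: v'_def)
      then show ?thesis using p by simp
    next
      case False
      then have "v' (x, y) = v (x, y)" for y by (simp add: v'_def)
      then have "(\<integral>\<^sup>+y. ennreal (\<bar>v' (x, y)\<bar> powr p) \<partial>hausdorff_on \<Gamma>) = \<phi> x" by (simp add: \<phi>_def)
      then show ?thesis using False by (simp add: less_top)
    qed
    show "(\<lambda>x y. w0 x (D x *v (K x *v y))) \<in> Bochner_Lp p (lebesgue_on \<Omega>) (hausdorff_on \<Gamma>)"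
    proof (rule Bochner_Lp_jointly_measurable[OF finite_lebesgue_on finite_measure_Gamma p])
      have "(\<lambda>z. w0 (fst z) (D (fst z) *v (K (fst z) *v snd z))) \<in> borel_measurable (lebesgue_on \<Omega> \<Otimes>\<^sub>M hausdorff_on \<Gamma>)
         \<longleftrightarrow> v' \<in> borel_measurable (lebesgue_on \<Omega> \<Otimes>\<^sub>M hausdorff_on \<Gamma>)"
        by (rule measurable_cong) (auto simp: w0_image space_pair_measure)
      then show "(\<lambda>z. w0 (fst z) (D (fst z) *v (K (fst z) *v snd z))) \<in> borel_measurable (lebesgue_on \<Omega> \<Otimes>\<^sub>M hausdorff_on \<Gamma>)"
        using v'm measurable_cong_sets[OF sets_pair refl] by blast
    next
      fix x assume x: "x \<in> space (lebesgue_on \<Omega>)"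
      have "integrable (hausdorff_on \<Gamma>) (\<lambda>y. \<bar>v' (x, y)\<bar> powr p)"
      proof (rule integrableI_nonneg)
        have [measurable]: "(\<lambda>y. v' (x, y)) \<in> borel_measurable (hausdorff_on \<Gamma>)"
          using sec[of x] x measurable_cong_sets[OF sets_hausdorff_on refl] by auto
        show "(\<lambda>y. \<bar>v' (x, y)\<bar> powr p) \<in> borel_measurable (hausdorff_on \<Gamma>)"
          by measurable
      qed (use fin in auto)
      then show "integrable (hausdorff_on \<Gamma>) (\<lambda>y. \<bar>w0 x (D x *v (K x *v y))\<bar> powr p)"
        using x by (simp add: w0_image)
    next
      have "(\<integral>\<^sup>+x. \<integral>\<^sup>+y. ennreal (\<bar>w0 x (D x *v (K x *v y))\<bar> powr p) \<partial>hausdorff_on \<Gamma> \<partial>lebesgue_on \<Omega>) \<le> (\<integral>\<^sup>+x. \<phi> x \<partial>lebesgue_on \<Omega>)"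
        by (rule nn_integral_mono) (use fin in \<open>simp add: w0_image\<close>)
      then show "(\<integral>\<^sup>+x. \<integral>\<^sup>+y. ennreal (\<bar>w0 x (D x *v (K x *v y))\<bar> powr p) \<partial>hausdorff_on \<Gamma> \<partial>lebesgue_on \<Omega>) < \<infinity>"
        using \<phi>fin by (rule order_le_less_trans)
    qed
  qed
  then have w0: "w0 \<in> Lp_Gamma_x p \<Omega> D K \<Gamma>" by (simp add: Lp_Gamma_x_def)
  have "(\<integral>z. v z * eval_K K \<psi> z \<partial>\<nu>) = (\<integral>x. 1 / measure lebesgue ((*v) (D x) ` unit_cell) *
               (\<integral>y. w0 x y * locally_periodic D \<psi> x y \<partial>surface_measure (Gamma_at D K \<Gamma> x))
           \<partial>lebesgue_on \<Omega>)" if \<psi>: "\<psi> \<in> C_C_per \<Omega>" and int: "integrable \<nu> (\<lambda>z. v z * eval_K K \<psi> z)" for \<psi>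
  proof -
    note em = measurable_eval_K[OF \<psi>]
    have AE: "AE z in \<nu>. v' z * eval_K K \<psi> z = v z * eval_K K \<psi> z" using v'AE by eventually_elim simp
    have m: "(\<lambda>z. v' z * eval_K K \<psi> z) \<in> borel_measurable \<nu>" using v'nu em by (rule borel_measurable_times)
    have m': "(\<lambda>z. v z * eval_K K \<psi> z) \<in> borel_measurable \<nu>" using v(1) em by (rule borel_measurable_times)
    have int': "integrable \<nu> (\<lambda>z. v' z * eval_K K \<psi> z)"
      using integrable_cong_AE[OF m m' AE] int by blast
    have "(\<integral>z. v z * eval_K K \<psi> z \<partial>\<nu>) = (\<integral>z. v' z * eval_K K \<psi> z \<partial>\<nu>)"
      by (rule integral_cong_AE[OF m m' AE, symmetric])
    also have "\<dots> = (\<integral>x. 1 / cell_volume (D x) * (\<integral>y. v' (x, y) * eval_K K \<psi> (x, y) \<partial>\<kappa> x) \<partial>lebesgue_on \<Omega>)"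
      by (rule integral_nu[OF int'])
    also have "\<dots> = (\<integral>x. 1 / measure lebesgue ((*v) (D x) ` unit_cell) *
               (\<integral>y. w0 x y * locally_periodic D \<psi> x y \<partial>surface_measure (Gamma_at D K \<Gamma> x)) \<partial>lebesgue_on \<Omega>)"
    proof (rule Bochner_Integration.integral_cong[OF refl])
      fix x assume "x \<in> space (lebesgue_on \<Omega>)"
      then have x: "x \<in> \<Omega>" by simp
      have "(\<integral>y. v' (x, y) * eval_K K \<psi> (x, y) \<partial>\<kappa> x)
         = (\<integral>z. v' (x, matrix_inv (A x) *v z) * eval_K K \<psi> (x, matrix_inv (A x) *v z) \<partial>surface_measure ((*v) (A x) ` \<Gamma>))"
        by (rule integral_kappa[OF measurable_section[OF m x]])
      also have "(*v) (A x) ` \<Gamma> = Gamma_at D K \<Gamma> x"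
        by (simp add: Gamma_at_def matrix_vector_mul_assoc)
      also have "(\<integral>z. v' (x, matrix_inv (A x) *v z) * eval_K K \<psi> (x, matrix_inv (A x) *v z) \<partial>surface_measure (Gamma_at D K \<Gamma> x))
         = (\<integral>z. w0 x z * locally_periodic D \<psi> x z \<partial>surface_measure (Gamma_at D K \<Gamma> x))"
      proof (rule Bochner_Integration.integral_cong[OF refl])
        fix z
        have "K x *v (matrix_inv (A x) *v z) = matrix_inv (D x) *v z"
          unfolding matrix_inv_mult[OF invertible_DKA(1,2)]
          by (simp add: matrix_vector_mul_assoc[symmetric] matrix_inv_cancel(4)[OF invertible_DKA(2)])
        then show "v' (x, matrix_inv (A x) *v z) * eval_K K \<psi> (x, matrix_inv (A x) *v z) = w0 x z * locally_periodic D \<psi> x z"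
          using x by (simp add: w0_def eval_K_def locally_periodic_def)
      qed
      finally show "1 / cell_volume (D x) * (\<integral>y. v' (x, y) * eval_K K \<psi> (x, y) \<partial>\<kappa> x) = 1 / measure lebesgue ((*v) (D x) ` unit_cell) *
               (\<integral>y. w0 x y * locally_periodic D \<psi> x y \<partial>surface_measure (Gamma_at D K \<Gamma> x))"
        by (simp add: cell_volume_def)
    qed
    finally show ?thesis .
  qed
  then show ?thesis using that w0 by blast
qed

end

context perforated_partition
begin

section \<open>Approximated test functions as integrands, and extraction of the limit\<close>

lemma L_measurable:
  assumes \<psi>: "\<psi> \<in> C_C_per \<Omega>" and \<epsilon>: "0 < \<epsilon>"
  shows "L \<epsilon> \<psi> \<in> borel_measurable (surface_measure (G \<epsilon>))"
  unfolding lp_approx_def[abs_def]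
proof (intro borel_measurable_sum borel_measurable_times)
  fix n assume n: "n \<in> {1..N \<epsilon>}"
  have c: "continuous_on (closure \<Omega>) (\<lambda>z. apply_bcontfun (\<psi> z) (matrix_inv (D (xs \<epsilon> n)) *v (z /\<^sub>R \<epsilon>)))"
    using \<psi> by (intro continuous_on_apply_bcontfun_compose[of "closure \<Omega>"] continuous_on_matrix_vector_mult continuous_intros)
       (auto simp: C_C_per_def)
  have "(\<lambda>z. z) \<in> surface_measure (G \<epsilon>) \<rightarrow>\<^sub>M restrict_space borel (closure \<Omega>)"
    by (rule measurable_restrict_space2[OF _ measurable_id_surface]) (use G_subset Omega_props(5) in auto)
  from measurable_compose[OF this borel_measurable_continuous_on_restrict[OF c]]
  show "(\<lambda>z. apply_bcontfun (\<psi> z) (matrix_inv (D (xs \<epsilon> n)) *v (z /\<^sub>R \<epsilon>))) \<in> borel_measurable (surface_measure (G \<epsilon>))" .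
  show "(indicator (Q \<epsilon> n) :: _ \<Rightarrow> real) \<in> borel_measurable (surface_measure (G \<epsilon>))"
    using cube_facts(1)[OF \<epsilon> n] by (intro borel_measurable_surface) simp
qed

text \<open>For fixed \<open>\<epsilon>\<close> the crude bound by \<open>N \<epsilon>\<close> is
  enough; uniformity in \<open>\<epsilon>\<close> is supplied by
  \<open>L_upper_bound\<close>.\<close>

lemma L_integrable:
  assumes \<psi>: "\<psi> \<in> C_C_per \<Omega>" and \<epsilon>: "0 < \<epsilon>" and q: "1 < q"
  shows "integrable (surface_measure (G \<epsilon>)) (\<lambda>z. \<bar>L \<epsilon> \<psi> z\<bar> powr q)"
proof -
  interpret finite_measure "surface_measure (G \<epsilon>)" by (rule surface_G_finite[OF \<epsilon>])
  note [measurable] = L_measurable[OF \<psi> \<epsilon>]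
  obtain b where b: "0 \<le> b" "\<And>x. x \<in> closure \<Omega> \<Longrightarrow> norm (\<psi> x) \<le> b" by (rule C_C_per_bound[OF \<psi>]) blast
  have "\<bar>L \<epsilon> \<psi> z\<bar> \<le> b * real (N \<epsilon>)" if z: "z \<in> \<Omega>" for z
  proof -
    have "L \<epsilon> (\<lambda>x. const_bcontfun 1) z \<le> (\<Sum>n\<in>{1..N \<epsilon>}. 1)"
      unfolding lp_approx_def by (rule sum_mono) (simp add: const_bcontfun.rep_eq indicator_def)
    then have "b * L \<epsilon> (\<lambda>x. const_bcontfun 1) z \<le> b * real (N \<epsilon>)" using b(1) by (intro mult_left_mono) auto
    with L_le_sup[where \<psi>=\<psi> and \<epsilon>=\<epsilon>, OF z b(2)] show ?thesis by linarith
  qed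
  then show ?thesis
    using G_subset q by (intro integrable_const_bound[where B="(b * real (N \<epsilon>)) powr q"] AE_I2) (auto intro!: powr_mono2)
qed

lemma L_linear: "L \<epsilon> (\<lambda>x. \<psi> x + c *\<^sub>R \<phi> x) z = L \<epsilon> \<psi> z + c * L \<epsilon> \<phi> z"
  unfolding lp_approx_def sum_distrib_left sum.distrib[symmetric]
  by (rule sum.cong[OF refl]) (simp add: distrib_right)

lemma const_C_C_per: "(\<lambda>x. const_bcontfun 1) \<in> C_C_per \<Omega>"
  by (auto simp: C_C_per_def C_per_def const_bcontfun.rep_eq)

lemma lts_compactness:
  fixes p C :: real and \<epsilon> :: "nat \<Rightarrow> real" and w :: "nat \<Rightarrow> real ^ 'n \<Rightarrow> real"
  assumes p: "1 < p" and \<epsilon>: "\<And>k. 0 < \<epsilon> k" "\<epsilon> \<longlonglongrightarrow> 0"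
    and w: "\<And>k. w k \<in> Lp_space p (surface_measure (G (\<epsilon> k)))"
    and bound: "\<And>k. \<epsilon> k * Lp_norm p (surface_measure (G (\<epsilon> k))) (w k) powr p \<le> C"
  shows "\<exists>t :: nat \<Rightarrow> nat. strict_mono t \<and> (\<exists>w0. w0 \<in> Lp_Gamma_x p \<Omega> D K \<Gamma> \<and>
      lts_converges p \<Omega> D K \<Gamma> N Q xs (\<epsilon> \<circ> t) (w \<circ> t) w0)"
proof -
  define q where "q = p / (p - 1)"
  have q: "1 < q" using p by (simp add: q_def)
  have pq: "1 / p + 1 / q = 1" using p by (simp add: q_def field_simps)
  have qp: "q / (q - 1) = p" using p by (simp add: q_def field_simps)
  define S where "S = (\<lambda>k. surface_measure (G (\<epsilon> k)))"
  have wm: "w k \<in> borel_measurable (S k)" and wi: "integrable (S k) (\<lambda>z. \<bar>w k z\<bar> powr p)" for k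
    using w[of k] by (auto simp: Lp_space_def S_def)
  have wC: "\<epsilon> k * (\<integral>z. \<bar>w k z\<bar> powr p \<partial>S k) \<le> C" for k
  proof -
    have "0 \<le> (\<integral>z. \<bar>w k z\<bar> powr p \<partial>S k)" by (rule integral_nonneg_AE) simp
    then have "Lp_norm p (S k) (w k) powr p = (\<integral>z. \<bar>w k z\<bar> powr p \<partial>S k)"
      using p by (simp add: Lp_norm_def powr_powr)
    then show ?thesis using bound[of k] by (simp add: S_def)
  qed
  have Lm: "L (\<epsilon> k) \<psi> \<in> borel_measurable (S k)" and Li: "integrable (S k) (\<lambda>z. \<bar>L (\<epsilon> k) \<psi> z\<bar> powr q)"
    if "\<psi> \<in> C_C_per \<Omega>" for \<psi> k
    using L_measurable[OF that \<epsilon>(1)] L_integrable[OF that \<epsilon>(1) q] by (simp_all add: S_def)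
  have young: "\<bar>w k z * L (\<epsilon> k) \<psi> z\<bar> \<le> \<bar>w k z\<bar> powr p / p + \<bar>L (\<epsilon> k) \<psi> z\<bar> powr q / q" for k z \<psi>
    using Youngs_inequality[OF p q pq, of "\<bar>w k z\<bar>" "\<bar>L (\<epsilon> k) \<psi> z\<bar>"] by (simp add: abs_mult)
  have wLi: "integrable (S k) (\<lambda>z. w k z * L (\<epsilon> k) \<psi> z)" if "\<psi> \<in> C_C_per \<Omega>" for \<psi> k
  proof (rule Bochner_Integration.integrable_bound)
    show "integrable (S k) (\<lambda>z. \<bar>w k z\<bar> powr p / p + \<bar>L (\<epsilon> k) \<psi> z\<bar> powr q / q)"
      using wi[of k] Li[OF that, of k] by simp
    show "(\<lambda>z. w k z * L (\<epsilon> k) \<psi> z) \<in> borel_measurable (S k)" using wm Lm[OF that] by (rule borel_measurable_times)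
    show "AE z in S k. norm (w k z * L (\<epsilon> k) \<psi> z) \<le> norm (\<bar>w k z\<bar> powr p / p + \<bar>L (\<epsilon> k) \<psi> z\<bar> powr q / q)"
      using young[of k _ \<psi>] by (intro AE_I2) (metis abs_ge_self order_trans real_norm_def)
  qed
  define \<mu> where "\<mu> = (\<lambda>k \<psi>. \<epsilon> k * (\<integral>z. w k z * L (\<epsilon> k) \<psi> z \<partial>S k))"
  define I where "I = (\<lambda>k \<psi>. \<epsilon> k * (\<integral>z. \<bar>L (\<epsilon> k) \<psi> z\<bar> powr q \<partial>S k))"
  \<comment> \<open>Young's inequality is applied under the integral and multiplied by
    \<open>\<epsilon> k\<close> afterwards, so the same factor falls on the
    \<open>p\<close>-integral and on the \<open>q\<close>-integral; this is the scaling of the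
    hypothesis \<open>bound\<close>.\<close>
  have \<mu>I: "\<bar>\<mu> k \<psi>\<bar> \<le> C / p + I k \<psi> / q" if \<psi>: "\<psi> \<in> C_C_per \<Omega>" for k \<psi>
  proof -
    have "\<bar>\<integral>z. w k z * L (\<epsilon> k) \<psi> z \<partial>S k\<bar> \<le> (\<integral>z. \<bar>w k z * L (\<epsilon> k) \<psi> z\<bar> \<partial>S k)" by (rule integral_abs_bound)
    also have "\<dots> \<le> (\<integral>z. \<bar>w k z\<bar> powr p / p + \<bar>L (\<epsilon> k) \<psi> z\<bar> powr q / q \<partial>S k)"
      using wLi[OF \<psi>, of k] wi[of k] Li[OF \<psi>, of k] by (intro integral_mono young) auto
    also have "\<dots> = (\<integral>z. \<bar>w k z\<bar> powr p \<partial>S k) / p + (\<integral>z. \<bar>L (\<epsilon> k) \<psi> z\<bar> powr q \<partial>S k) / q"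
      using wi[of k] Li[OF \<psi>, of k] by simp
    finally have "\<epsilon> k * \<bar>\<integral>z. w k z * L (\<epsilon> k) \<psi> z \<partial>S k\<bar> \<le> \<epsilon> k * ((\<integral>z. \<bar>w k z\<bar> powr p \<partial>S k) / p + (\<integral>z. \<bar>L (\<epsilon> k) \<psi> z\<bar> powr q \<partial>S k) / q)"
      using \<epsilon>(1)[of k] by (intro mult_left_mono) auto
    also have "\<dots> = \<epsilon> k * (\<integral>z. \<bar>w k z\<bar> powr p \<partial>S k) / p + I k \<psi> / q" by (simp add: I_def distrib_left)
    also have "\<dots> \<le> C / p + I k \<psi> / q" using wC[of k] p by (simp add: divide_right_mono)
    finally show ?thesis using \<epsilon>(1)[of k] by (simp add: \<mu>_def abs_mult)
  qed
  have \<mu>lin: "\<mu> k (\<lambda>x. \<psi> x + c *\<^sub>R \<phi> x) = \<mu> k \<psi> + c * \<mu> k \<phi>" if "\<psi> \<in> C_C_per \<Omega>" "\<phi> \<in> C_C_per \<Omega>" for k \<psi> \<phi> c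
  proof -
    have "(\<integral>z. w k z * L (\<epsilon> k) (\<lambda>x. \<psi> x + c *\<^sub>R \<phi> x) z \<partial>S k) = (\<integral>z. w k z * L (\<epsilon> k) \<psi> z + c * (w k z * L (\<epsilon> k) \<phi> z) \<partial>S k)"
      by (rule Bochner_Integration.integral_cong) (simp_all add: L_linear algebra_simps)
    also have "\<dots> = (\<integral>z. w k z * L (\<epsilon> k) \<psi> z \<partial>S k) + c * (\<integral>z. w k z * L (\<epsilon> k) \<phi> z \<partial>S k)"
      using wLi[OF that(1), of k] wLi[OF that(2), of k] by simp
    finally show ?thesis by (simp add: \<mu>_def algebra_simps)
  qed
  obtain B where B: "0 \<le> B" "\<And>\<psi> \<delta>. \<psi> \<in> C_C_per \<Omega> \<Longrightarrow> 0 < \<delta> \<Longrightarrow> \<exists>e>0. \<forall>\<epsilon>. 0 < \<epsilon> \<and> \<epsilon> < e \<longrightarrow>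
     ennreal \<epsilon> * (\<integral>\<^sup>+z. ennreal (\<bar>L \<epsilon> \<psi> z\<bar> powr q) \<partial>surface_measure (G \<epsilon>)) \<le> ennreal (B * (\<integral>x. F q \<psi> x \<partial>lebesgue_on \<Omega>) + \<delta>)"
    by (rule L_upper_bound[OF q]) blast
  have Fint: "0 \<le> (\<integral>x. F q \<psi> x \<partial>lebesgue_on \<Omega>)" for \<psi> by (rule integral_nonneg_AE) (simp add: F_nonneg)
  \<comment> \<open>The error \<open>\<delta> = 1\<close> is an arbitrary choice: an additive
    constant is allowed in the affine bound. It reappears below in \<open>C1\<close> and in the
    constant \<open>C / p + 1 / q\<close>.\<close>
  have Iev: "\<forall>\<^sub>F k in sequentially. I k \<psi> \<le> B * (\<integral>x. F q \<psi> x \<partial>lebesgue_on \<Omega>) + 1" if \<psi>: "\<psi> \<in> C_C_per \<Omega>" for \<psi>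
  proof -
    obtain e where e: "0 < e" "\<And>\<epsilon>. 0 < \<epsilon> \<Longrightarrow> \<epsilon> < e \<Longrightarrow>
       ennreal \<epsilon> * (\<integral>\<^sup>+z. ennreal (\<bar>L \<epsilon> \<psi> z\<bar> powr q) \<partial>surface_measure (G \<epsilon>)) \<le> ennreal (B * (\<integral>x. F q \<psi> x \<partial>lebesgue_on \<Omega>) + 1)"
      using B(2)[OF \<psi>, of 1] by auto
    have "\<forall>\<^sub>F k in sequentially. \<epsilon> k < e" using \<epsilon>(2) e(1) by (rule order_tendstoD)
    then show ?thesis
    proof eventually_elim
      case (elim k)
      have "ennreal (I k \<psi>) = ennreal (\<epsilon> k) * (\<integral>\<^sup>+z. ennreal (\<bar>L (\<epsilon> k) \<psi> z\<bar> powr q) \<partial>surface_measure (G (\<epsilon> k)))"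
        using nn_integral_eq_integral[OF Li[OF \<psi>, of k]] \<epsilon>(1)[of k] by (simp add: I_def S_def ennreal_mult')
      also have "\<dots> \<le> ennreal (B * (\<integral>x. F q \<psi> x \<partial>lebesgue_on \<Omega>) + 1)" by (rule e(2)[OF \<epsilon>(1) elim])
      finally show ?case using B(1) Fint[of \<psi>] by (subst (asm) ennreal_le_iff) auto
    qed
  qed
  let ?one = "\<lambda>x::real^'n. const_bcontfun 1 :: (real^'n) \<Rightarrow>\<^sub>C real"
  define C1 where "C1 = B * (\<integral>x. F q ?one x \<partial>lebesgue_on \<Omega>) + 1"
  have C1: "0 \<le> C1" using B(1) Fint[of ?one] by (simp add: C1_def)
  \<comment> \<open>The absolute value of \<open>C\<close> and the added 1 make this constant
    positive, since \<open>e / C2\<close> is formed later.\<close>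
  define C2 where "C2 = \<bar>C\<bar> / p + C1 / q + 1"
  have C2: "0 < C2" using p q C1 by (simp add: C2_def add_nonneg_pos)
  \<comment> \<open>One threshold in \<open>k\<close> serves all test functions: after division by
    \<open>b\<close> the approximation is dominated by that of the constant 1, so only the bound for
    the constant function has to hold at \<open>k\<close>.\<close>
  have equi: "\<forall>\<^sub>F k in sequentially. \<forall>\<psi>\<in>C_C_per \<Omega>. \<forall>b>0. (\<forall>x\<in>closure \<Omega>. norm (\<psi> x) \<le> b) \<longrightarrow> \<bar>\<mu> k \<psi>\<bar> \<le> b * C2"
    using Iev[OF const_C_C_per]
  proof eventually_elim
    case (elim k)
    show ?case
    proof (intro ballI allI impI)
      fix \<psi> b assume \<psi>: "\<psi> \<in> C_C_per \<Omega>" and b: "0 < (b::real)" "\<forall>x\<in>closure \<Omega>. norm (\<psi> x) \<le> b"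
      \<comment> \<open>This is \<open>\<psi>\<close> divided by \<open>b\<close>, in the form to
        which the linearity facts apply.\<close>
      define \<phi> where "\<phi> = (\<lambda>x. \<psi> x + (1 / b - 1) *\<^sub>R \<psi> x)"
      have \<phi>: "\<phi> \<in> C_C_per \<Omega>" unfolding \<phi>_def by (rule C_C_per_linear[OF \<psi> \<psi>])
      have "norm (\<phi> x) \<le> 1" if "x \<in> closure \<Omega>" for x
      proof -
        have "\<phi> x = (1 / b) *\<^sub>R \<psi> x" by (simp add: \<phi>_def scaleR_left_diff_distrib)
        then show ?thesis using b that by (simp add: field_simps)
      qed
      then have "\<bar>L (\<epsilon> k) \<phi> z\<bar> \<le> L (\<epsilon> k) ?one z" if "z \<in> \<Omega>" for z
        using L_le_sup[where \<psi>=\<phi> and b=1 and \<epsilon>="\<epsilon> k", OF that] by simp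
      then have le: "\<bar>L (\<epsilon> k) \<phi> z\<bar> powr q \<le> \<bar>L (\<epsilon> k) ?one z\<bar> powr q" if "z \<in> \<Omega>" for z
        using that q abs_ge_self order_trans by (intro powr_mono2) (auto, blast)
      have "(\<integral>z. \<bar>L (\<epsilon> k) \<phi> z\<bar> powr q \<partial>S k) \<le> (\<integral>z. \<bar>L (\<epsilon> k) ?one z\<bar> powr q \<partial>S k)"
        using le G_subset by (intro integral_mono Li \<phi> const_C_C_per) (auto simp: S_def)
      then have "I k \<phi> \<le> C1" using elim \<epsilon>(1)[of k] mult_left_mono[of _ _ "\<epsilon> k"] unfolding I_def C1_def
        by (meson less_imp_le order_trans)
      then have "\<bar>\<mu> k \<phi>\<bar> \<le> C / p + C1 / q" using \<mu>I[OF \<phi>, of k] q by (smt (verit) divide_right_mono)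
      also have "\<dots> \<le> C2" unfolding C2_def using p by (smt (verit) divide_right_mono)
      finally have "\<bar>\<mu> k \<phi>\<bar> \<le> C2" .
      moreover have "\<mu> k \<phi> = \<mu> k \<psi> / b" unfolding \<phi>_def \<mu>lin[OF \<psi> \<psi>] by (simp add: algebra_simps)
      ultimately have "\<bar>\<mu> k \<psi>\<bar> / b \<le> C2" using b(1) by (simp add: abs_divide)
      then show "\<bar>\<mu> k \<psi>\<bar> \<le> b * C2" using b(1) by (simp add: pos_divide_le_eq mult.commute)
    qed
  qed
  obtain E where E: "countable E" "E \<subseteq> C_C_per \<Omega>"
    "\<And>\<psi> e. \<psi> \<in> C_C_per \<Omega> \<Longrightarrow> 0 < e \<Longrightarrow> \<exists>\<phi>\<in>E. \<forall>x\<in>closure \<Omega>. dist (\<psi> x) (\<phi> x) \<le> e"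
    by (rule C_C_per_separable[OF Omega_props(3)]) blast
  obtain t :: "nat \<Rightarrow> nat" where t: "strict_mono t" "\<And>\<psi>. \<psi> \<in> C_C_per \<Omega> \<Longrightarrow> convergent (\<lambda>k. \<mu> (t k) \<psi>)"
  proof (rule convergent_subsequence_functionals[OF E(1), of \<mu> "C_C_per \<Omega>"])
    fix d assume d: "d \<in> E"
    then have dC: "d \<in> C_C_per \<Omega>" using E(2) by blast
    obtain b where b: "0 \<le> b" "\<And>x. x \<in> closure \<Omega> \<Longrightarrow> norm (d x) \<le> b" by (rule C_C_per_bound[OF dC]) blast
    have "\<forall>\<^sub>F k in sequentially. \<bar>\<mu> k d\<bar> \<le> (b + 1) * C2"
      using equi
    proof eventually_elim
      case (elim k)
      have "norm (d x) \<le> b + 1" if "x \<in> closure \<Omega>" for x using b(2)[OF that] by simp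
      then show ?case using elim dC b(1) by auto
    qed
    then obtain m where m: "\<And>k. m \<le> k \<Longrightarrow> \<bar>\<mu> k d\<bar> \<le> (b + 1) * C2" by (auto simp: eventually_sequentially)
    \<comment> \<open>The bound \<open>(b + 1) * C2\<close> holds only from \<open>m\<close> on; the
      sum takes care of the finitely many earlier indices.\<close>
    have "\<bar>\<mu> k d\<bar> \<le> (b + 1) * C2 + (\<Sum>j<m. \<bar>\<mu> j d\<bar>)" for k
    proof (cases "m \<le> k")
      case True
      have "0 \<le> (\<Sum>j<m. \<bar>\<mu> j d\<bar>)" by (rule sum_nonneg) simp
      then show ?thesis using m[OF True] by linarith
    next
      case False
      then have "\<bar>\<mu> k d\<bar> \<le> (\<Sum>j<m. \<bar>\<mu> j d\<bar>)" by (intro member_le_sum) auto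
      moreover have "0 \<le> (b + 1) * C2" using b(1) C2 by simp
      ultimately show ?thesis by linarith
    qed
    then show "\<exists>b. \<forall>k. \<bar>\<mu> k d\<bar> \<le> b" by blast
  next
    fix \<psi> and e :: real assume \<psi>: "\<psi> \<in> C_C_per \<Omega>" and e: "0 < e"
    then have eC: "0 < e / C2" using C2 by simp
    obtain \<phi> where \<phi>: "\<phi> \<in> E" "\<And>x. x \<in> closure \<Omega> \<Longrightarrow> dist (\<psi> x) (\<phi> x) \<le> e / C2" using E(3)[OF \<psi> eC] by blast
    have \<phi>C: "\<phi> \<in> C_C_per \<Omega>" using \<phi>(1) E(2) by blast
    have "\<forall>\<^sub>F k in sequentially. \<bar>\<mu> k \<psi> - \<mu> k \<phi>\<bar> \<le> e"
      using equi
    proof eventually_elim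
      case (elim k)
      have dC: "(\<lambda>x. \<psi> x + (-1) *\<^sub>R \<phi> x) \<in> C_C_per \<Omega>" by (rule C_C_per_linear[OF \<psi> \<phi>C])
      have "norm (\<psi> x + (-1) *\<^sub>R \<phi> x) \<le> e / C2" if "x \<in> closure \<Omega>" for x
        using \<phi>(2)[OF that] by (simp add: dist_norm)
      then have "\<bar>\<mu> k (\<lambda>x. \<psi> x + (-1) *\<^sub>R \<phi> x)\<bar> \<le> e / C2 * C2"
        by (intro elim[rule_format, OF dC eC])
      then show ?case unfolding \<mu>lin[OF \<psi> \<phi>C] using C2 by simp
    qed
    then show "\<exists>d\<in>E. \<forall>\<^sub>F k in sequentially. \<bar>\<mu> k \<psi> - \<mu> k d\<bar> \<le> e" using \<phi>(1) by blast
  qed blast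
  define l where "l = (\<lambda>\<psi>. lim (\<lambda>k. \<mu> (t k) \<psi>))"
  have lim: "(\<lambda>k. \<mu> (t k) \<psi>) \<longlonglongrightarrow> l \<psi>" if "\<psi> \<in> C_C_per \<Omega>" for \<psi>
    using t(2)[OF that] unfolding l_def by (rule convergent_LIMSEQ_iff[THEN iffD1])
  obtain c where c: "0 \<le> c" "\<And>f. f \<in> borel_measurable \<nu> \<Longrightarrow>
       (\<integral>\<^sup>+x. \<integral>\<^sup>+y. f (x, y) \<partial>hausdorff_on \<Gamma> \<partial>lebesgue_on \<Omega>) \<le> ennreal c * (\<integral>\<^sup>+z. f z \<partial>\<nu>)"
    by (rule product_le_nu) blast
  interpret nu: finite_measure \<nu> by (rule finite_nu)
  have space_nu: "space \<nu> = \<Omega> \<times> UNIV"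
    using sets_eq_imp_space_eq[OF sets_nu] by (simp add: space_pair_measure)
  have Eint: "integrable \<nu> (\<lambda>z. \<bar>eval_K K \<psi> z\<bar> powr q)" if \<psi>: "\<psi> \<in> C_C_per \<Omega>" for \<psi>
  proof -
    note [measurable] = measurable_eval_K[OF \<psi>]
    obtain b where b: "\<And>x u. x \<in> closure \<Omega> \<Longrightarrow> \<bar>apply_bcontfun (\<psi> x) u\<bar> \<le> b" by (rule C_C_per_bound[OF \<psi>]) blast
    show ?thesis
    proof (rule nu.integrable_const_bound[where B="b powr q"])
      show "AE z in \<nu>. norm (\<bar>eval_K K \<psi> z\<bar> powr q) \<le> b powr q"
        using b Omega_props(5) q by (intro AE_I2) (auto simp: space_nu eval_K_def intro!: powr_mono2)
    qed measurable
  qed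
  have FE: "(\<integral>x. F q \<psi> x \<partial>lebesgue_on \<Omega>) \<le> c * (\<integral>z. \<bar>eval_K K \<psi> z\<bar> powr q \<partial>\<nu>)" if \<psi>: "\<psi> \<in> C_C_per \<Omega>" for \<psi>
  proof -
    have Fcont: "continuous_on (closure \<Omega>) (F q \<psi>)"
      by (rule uniformly_continuous_imp_continuous[OF F_uniformly_continuous[OF \<psi> q]])
    have "compact (F q \<psi> ` closure \<Omega>)" by (rule compact_continuous_image[OF Fcont Omega_props(4)])
    then obtain M where M: "\<And>x. x \<in> closure \<Omega> \<Longrightarrow> norm (F q \<psi> x) \<le> M"
      using compact_imp_bounded bounded_iff by (metis imageI)
    have \<Omega>s: "\<Omega> \<in> sets lebesgue" using Omega_lmeasurable by (simp add: fmeasurable_def)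
    have Fi: "integrable (lebesgue_on \<Omega>) (F q \<psi>)"
    proof (rule finite_measure.integrable_const_bound[OF finite_lebesgue_on, where B=M])
      show "AE x in lebesgue_on \<Omega>. norm (F q \<psi> x) \<le> M" using M Omega_props(5) by (intro AE_I2) auto
      show "F q \<psi> \<in> borel_measurable (lebesgue_on \<Omega>)"
        by (rule continuous_imp_measurable_on_sets_lebesgue[OF continuous_on_subset[OF Fcont Omega_props(5)] \<Omega>s])
    qed
    have "ennreal (\<integral>x. F q \<psi> x \<partial>lebesgue_on \<Omega>) = (\<integral>\<^sup>+x. ennreal (F q \<psi> x) \<partial>lebesgue_on \<Omega>)"
      by (rule nn_integral_eq_integral[OF Fi, symmetric]) (simp add: F_nonneg)
    also have "\<dots> = (\<integral>\<^sup>+x. \<integral>\<^sup>+y. ennreal (\<bar>eval_K K \<psi> (x, y)\<bar> powr q) \<partial>hausdorff_on \<Gamma> \<partial>lebesgue_on \<Omega>)"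
    proof (rule nn_integral_cong)
      fix x assume "x \<in> space (lebesgue_on \<Omega>)"
      then have "x \<in> closure \<Omega>" using Omega_props(5) by auto
      from nn_integral_eq_integral[OF integrable_F[OF \<psi> q this]]
      show "ennreal (F q \<psi> x) = (\<integral>\<^sup>+y. ennreal (\<bar>eval_K K \<psi> (x, y)\<bar> powr q) \<partial>hausdorff_on \<Gamma>)"
        by (simp add: F_def eval_K_def)
    qed
    also have "\<dots> \<le> ennreal c * (\<integral>\<^sup>+z. ennreal (\<bar>eval_K K \<psi> z\<bar> powr q) \<partial>\<nu>)"
    proof (rule c(2)[of "\<lambda>z. ennreal (\<bar>eval_K K \<psi> z\<bar> powr q)"])
      note [measurable] = measurable_eval_K[OF \<psi>]
      show "(\<lambda>z. ennreal (\<bar>eval_K K \<psi> z\<bar> powr q)) \<in> borel_measurable \<nu>" by measurable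
    qed
    also have "\<dots> = ennreal (c * (\<integral>z. \<bar>eval_K K \<psi> z\<bar> powr q \<partial>\<nu>))"
      using nn_integral_eq_integral[OF Eint[OF \<psi>]] c(1) by (simp add: ennreal_mult')
    finally show ?thesis
      using c(1) integral_nonneg_AE[OF AE_I2, of \<nu> "\<lambda>z. \<bar>eval_K K \<psi> z\<bar> powr q"] by (subst (asm) ennreal_le_iff) auto
  qed
  \<comment> \<open>The limit functional is passed on as a graph, because test functions that agree
    \<open>\<nu>\<close>-almost everywhere may be distinct. That their limits coincide is a
    consequence of the representation, hence of the affine bound.\<close>
  define Gr where "Gr = (\<lambda>\<psi>. (eval_K K \<psi>, l \<psi>)) ` C_C_per \<Omega>"
  obtain v where v: "v \<in> borel_measurable \<nu>" "integrable \<nu> (\<lambda>z. \<bar>v z\<bar> powr (q / (q - 1)))"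
    "\<And>f a. (f, a) \<in> Gr \<Longrightarrow> integrable \<nu> (\<lambda>z. v z * f z) \<and> a = (\<integral>z. v z * f z \<partial>\<nu>)"
  \<comment> \<open>The constants come from \<open>\<mu>I\<close> with \<open>I k \<psi>\<close>
    estimated by \<open>Iev\<close> and \<open>FE\<close>, that is, by \<open>B * c\<close> times
    the \<open>q\<close>-integral against \<open>\<nu>\<close>, plus 1.\<close>
  proof (rule Lq_functional_representation[OF finite_nu q, of Gr "C / p + 1 / q" "B * c / q"])
    show "Gr \<noteq> {}" using const_C_C_per by (auto simp: Gr_def)
    show "f \<in> borel_measurable \<nu>" "integrable \<nu> (\<lambda>z. \<bar>f z\<bar> powr q)" if "(f, a) \<in> Gr" for f a
      using that measurable_eval_K Eint by (auto simp: Gr_def)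
    show "(\<lambda>z. f z + d * g z, a + d * b) \<in> Gr" if fg: "(f, a) \<in> Gr" "(g, b) \<in> Gr" for f a g b d
    proof -
      obtain \<psi> \<phi> where \<psi>: "\<psi> \<in> C_C_per \<Omega>" "f = eval_K K \<psi>" "a = l \<psi>" and \<phi>: "\<phi> \<in> C_C_per \<Omega>" "g = eval_K K \<phi>" "b = l \<phi>"
        using fg by (auto simp: Gr_def)
      have \<theta>: "(\<lambda>x. \<psi> x + d *\<^sub>R \<phi> x) \<in> C_C_per \<Omega>" by (rule C_C_per_linear[OF \<psi>(1) \<phi>(1)])
      have "(\<lambda>k. \<mu> (t k) \<psi> + d * \<mu> (t k) \<phi>) \<longlonglongrightarrow> l \<psi> + d * l \<phi>"
        by (intro tendsto_intros lim \<psi> \<phi>)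
      then have "l (\<lambda>x. \<psi> x + d *\<^sub>R \<phi> x) = l \<psi> + d * l \<phi>"
        by (rule LIMSEQ_unique[OF lim[OF \<theta>, unfolded \<mu>lin[OF \<psi>(1) \<phi>(1)]]])
      then show ?thesis
        unfolding Gr_def using \<theta> \<psi> \<phi> by (intro image_eqI[of _ _ "\<lambda>x. \<psi> x + d *\<^sub>R \<phi> x"]) (simp_all add: eval_K_linear)
    qed
    show "a \<le> (C / p + 1 / q) + B * c / q * (\<integral>z. \<bar>f z\<bar> powr q \<partial>\<nu>)" if fa: "(f, a) \<in> Gr" for f a
    proof -
      obtain \<psi> where \<psi>: "\<psi> \<in> C_C_per \<Omega>" "f = eval_K K \<psi>" "a = l \<psi>" using fa by (auto simp: Gr_def)
      let ?J = "\<integral>z. \<bar>eval_K K \<psi> z\<bar> powr q \<partial>\<nu>"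
      have Bc: "B * (\<integral>x. F q \<psi> x \<partial>lebesgue_on \<Omega>) \<le> B * (c * ?J)" by (rule mult_left_mono[OF FE[OF \<psi>(1)] B(1)])
      have ev: "\<forall>\<^sub>F k in sequentially. \<mu> k \<psi> \<le> C / p + (B * (c * ?J) + 1) / q"
        using Iev[OF \<psi>(1)]
      proof eventually_elim
        case (elim k)
        then have "I k \<psi> \<le> B * (c * ?J) + 1" using Bc by linarith
        then have "I k \<psi> / q \<le> (B * (c * ?J) + 1) / q" using q by (intro divide_right_mono) auto
        then show ?case using \<mu>I[OF \<psi>(1), of k] by linarith
      qed
      have "\<forall>\<^sub>F k in sequentially. \<mu> (t k) \<psi> \<le> C / p + (B * (c * ?J) + 1) / q"
        using eventually_subseq[OF t(1) ev] .
      then have "l \<psi> \<le> C / p + (B * (c * ?J) + 1) / q"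
        using lim[OF \<psi>(1)] by (intro tendsto_upperbound) auto
      then show ?thesis using \<psi> by (simp add: add_divide_distrib mult.assoc)
    qed
  qed blast
  have vp: "integrable \<nu> (\<lambda>z. \<bar>v z\<bar> powr p)" using v(2) unfolding qp .
  obtain w0 where w0: "w0 \<in> Lp_Gamma_x p \<Omega> D K \<Gamma>"
    "\<And>\<psi>. \<psi> \<in> C_C_per \<Omega> \<Longrightarrow> integrable \<nu> (\<lambda>z. v z * eval_K K \<psi> z) \<Longrightarrow>
      (\<integral>z. v z * eval_K K \<psi> z \<partial>\<nu>) = (\<integral>x. 1 / measure lebesgue ((*v) (D x) ` unit_cell) *
               (\<integral>y. w0 x y * locally_periodic D \<psi> x y \<partial>surface_measure (Gamma_at D K \<Gamma> x))
           \<partial>lebesgue_on \<Omega>)"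
    by (rule limit_function[OF p v(1) vp]) blast
  have "lts_converges p \<Omega> D K \<Gamma> N Q xs (\<epsilon> \<circ> t) (w \<circ> t) w0"
    unfolding lts_converges_def
  proof (intro conjI allI ballI)
    show "(w \<circ> t) k \<in> Lp_space p (surface_measure (G ((\<epsilon> \<circ> t) k)))" for k using w by simp
    show "w0 \<in> Lp_Gamma_x p \<Omega> D K \<Gamma>" by (rule w0(1))
    show "\<exists>C. \<forall>k. (\<epsilon> \<circ> t) k * Lp_norm p (surface_measure (G ((\<epsilon> \<circ> t) k))) ((w \<circ> t) k) powr p \<le> C"
      using bound by (intro exI[of _ C]) simp
    fix \<psi> assume \<psi>: "\<psi> \<in> C_C_per \<Omega>"
    have "(eval_K K \<psi>, l \<psi>) \<in> Gr" using \<psi> by (auto simp: Gr_def)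
    from v(3)[OF this] have "integrable \<nu> (\<lambda>z. v z * eval_K K \<psi> z)" "l \<psi> = (\<integral>z. v z * eval_K K \<psi> z \<partial>\<nu>)" by auto
    with w0(2)[OF \<psi>] lim[OF \<psi>]
    show "(\<lambda>k. (\<epsilon> \<circ> t) k * (\<integral>x. (w \<circ> t) k x * L ((\<epsilon> \<circ> t) k) \<psi> x \<partial>surface_measure (G ((\<epsilon> \<circ> t) k)))) \<longlonglongrightarrow>
        (\<integral>x. 1 / measure lebesgue ((*v) (D x) ` unit_cell) *
               (\<integral>y. w0 x y * locally_periodic D \<psi> x y \<partial>surface_measure (Gamma_at D K \<Gamma> x)) \<partial>lebesgue_on \<Omega>)"
      by (simp add: \<mu>_def S_def)
  qed
  then show ?thesis using t(1) w0(1) by blast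
qed

end

theorem theorem4p5:
  fixes \<Omega> Y0 :: "(real ^ 'n) set"
    and D K :: "real ^ 'n \<Rightarrow> real ^ 'n ^ 'n"
    and D1 D2 K1 K2 r p C :: real
    and N :: "real \<Rightarrow> nat"
    and Q :: "real \<Rightarrow> nat \<Rightarrow> (real ^ 'n) set"
    and xs :: "real \<Rightarrow> nat \<Rightarrow> real ^ 'n"
    and \<epsilon> :: "nat \<Rightarrow> real"
    and w :: "nat \<Rightarrow> real ^ 'n \<Rightarrow> real"
  assumes "bounded_lipschitz_domain \<Omega>"
    and "inverse_lipschitz_pair D"
    and "0 < D1" and "\<And>x. x \<in> closure \<Omega> \<Longrightarrow> D1 \<le> \<bar>det (D x)\<bar> \<and> \<bar>det (D x)\<bar> \<le> D2"
    and "0 < r" and "r < 1"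
    and "cube_partition \<Omega> r N Q xs"
    and "Y0 \<subseteq> unit_cell" and "lipschitz_boundary Y0"
    and "inverse_lipschitz_pair K"
    and "0 < K1" and "\<And>x. x \<in> closure \<Omega> \<Longrightarrow> K1 \<le> \<bar>det (K x)\<bar> \<and> \<bar>det (K x)\<bar> \<le> K2"
    and "\<And>x. x \<in> closure \<Omega> \<Longrightarrow> (*v) (K x) ` Y0 \<subseteq> unit_cell"
    and "connected (unit_cell - closure Y0)"
    and "\<And>x. x \<in> closure \<Omega> \<Longrightarrow> connected (unit_cell - (*v) (K x) ` closure Y0)"
    and "1 < p"
    and "\<And>k. 0 < \<epsilon> k" and "\<epsilon> \<longlonglongrightarrow> 0"
    and "\<And>k. w k \<in> Lp_space p (surface_measure (Gamma_eps \<Omega> D K (frontier Y0) N Q xs (\<epsilon> k)))"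
    and "\<And>k. \<epsilon> k * Lp_norm p (surface_measure (Gamma_eps \<Omega> D K (frontier Y0) N Q xs (\<epsilon> k))) (w k) powr p \<le> C"
  shows "\<exists>s :: nat \<Rightarrow> nat. strict_mono s \<and>
    (\<exists>w0. w0 \<in> Lp_Gamma_x p \<Omega> D K (frontier Y0) \<and>
      lts_converges p \<Omega> D K (frontier Y0) N Q xs (\<epsilon> \<circ> s) (w \<circ> s) w0)"
proof -
  interpret perforated_partition \<Omega> Y0 D K "CARD('n) - 1" r N Q xs
    by unfold_locales (use assms in auto)
  show ?thesis
    by (rule lts_compactness[OF \<open>1 < p\<close>]) (use assms in auto)
qed

end
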